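(* Let $P\subset\mathbb{R}^2$ be a reflexive polygon. For every $k\in\mathbb{N}$, $$\mathrm{mldrop}(\mathcal{B}^k(P)) = \#\,\mathrm{sing}(f_{2+k}),$$ where $f_{2+k}\in\mathbb{Z}[\theta_1^{\pm1},\dots,\theta_{2+k}^{\pm1}]$ is the Laurent polynomial $f_{2+k}=\sum_{a}\theta^a$, the sum being over all lattice points $a$ of $\mathcal{B}^k(P)$, and $\#\,\mathrm{sing}(f_{2+k})$ is the number of singularities of $f_{2+k}$, i.e. of points $\theta\in(\mathbb{C}^* )^{2+k}$ with $f_{2+k}(\theta)=\frac{\partial f_{2+k}}{\partial\theta_i}(\theta)=0$ for all $i\in\{1,\dots,2+k\}$.
   Context: A lattice polytope is reflexive if it contains the origin in its interior and its dual (polar) polytope is also a lattice polytope. For a reflexive polytope $P$, $\mathcal{B}(P):=\mathrm{conv}(P\times\{0\},(0,\dots,0,1),(0,\dots,0,-1))$, and $\mathcal{B}^k(P)$ is obtained by applying $\mathcal{B}$ exactly $k$ times, $\mathcal{B}^0(P)=P$. For a lattice polytope $Q \subset \mathbb{R}^m$ with lattice points $Q\cap\mathbb{Z}^m = \{a_1,\dots,a_n\}$, the design matrix is $A = [a_1\ \cdots\ a_n]$, and $A'$ is $A$ with an additional first row of ones. The toric variety $V = V_A\subseteq \mathbb{C}^n$ (standard scaling) is the Zariski closure of the image of $(\mathbb{C}^* )^{m+1}\to(\mathbb{C}^* )^n$, $(s,\theta)\mapsto (s\theta^{a_1},\dots,s\theta^{a_n})$; it is the affine cone over a projective toric variety,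 and $\deg(V)$ is its degree. For data $u\in\mathbb{N}^n$ with $u_+ = \sum_i u_i$, the score equations are $A'p = \frac{1}{u_+}A'u$ with $p\in V\cap(\mathbb{C}^* )^n$, and $\mathrm{mldeg}(V)$ is the number of complex solutions $p$ for generic $u$. The ML degree drop is $\mathrm{mldrop}(Q):=\deg(V)-\mathrm{mldeg}(V)$. *)

theory Defs
  imports
    "HOL-Analysis.Analysis"
    "HOL-Computational_Algebra.Polynomial"
    "HOL-Analysis.Finite_Function_Topology"
    "HOL-Library.Function_Algebras"
begin

text \<open>
  Since the dimension varies, \<open>\<real>\<^sup>m\<close> is represented as the subspace of the normed space
  \<^typ>\<open>nat \<Rightarrow>\<^sub>0 real\<close> of finitely supported sequences that is spanned by the coordinates
  \<open>0, \<dots>, m - 1\<close>, and \<open>\<int>\<^sup>m\<close> likewise inside \<^typ>\<open>nat \<Rightarrow>\<^sub>0 int\<close>. In particular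
  \<open>\<real>\<^sup>m \<times> {0}\<close>, as a subset of \<open>\<real>\<^bsup>m+1\<^esup>\<close>, is literally \<open>\<real>\<^sup>m\<close>.
\<close>

definition euclid :: "nat \<Rightarrow> (nat \<Rightarrow>\<^sub>0 real) set" where
  "euclid m = {x. Poly_Mapping.keys x \<subseteq> {..<m}}"

definition int_lattice :: "nat \<Rightarrow> (nat \<Rightarrow>\<^sub>0 int) set" where
  "int_lattice m = {a. Poly_Mapping.keys a \<subseteq> {..<m}}"

definition real_vec :: "(nat \<Rightarrow>\<^sub>0 int) \<Rightarrow> (nat \<Rightarrow>\<^sub>0 real)" where
  "real_vec a = Poly_Mapping.map real_of_int a"

definition lattice_polytope :: "nat \<Rightarrow> (nat \<Rightarrow>\<^sub>0 real) set \<Rightarrow> bool" where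
  "lattice_polytope m Q \<longleftrightarrow>
     (\<exists>S. finite S \<and> S \<subseteq> int_lattice m \<and> Q = convex hull (real_vec ` S))"

definition polar_dual :: "nat \<Rightarrow> (nat \<Rightarrow>\<^sub>0 real) set \<Rightarrow> (nat \<Rightarrow>\<^sub>0 real) set" where
  "polar_dual m Q = {y \<in> euclid m.
     \<forall>x\<in>Q. (\<Sum>i<m. Poly_Mapping.lookup x i * Poly_Mapping.lookup y i) \<le> 1}"

definition reflexive_polytope :: "nat \<Rightarrow> (nat \<Rightarrow>\<^sub>0 real) set \<Rightarrow> bool" where
  "reflexive_polytope m Q \<longleftrightarrow>
     lattice_polytope m Q \<and>
     0 \<in> (top_of_set (euclid m)) interior_of Q \<and>
     lattice_polytope m (polar_dual m Q)"

text \<open>The operator \<open>\<B>\<close>, taking polytopes in \<open>\<real>\<^sup>m\<close> to polytopes in \<open>\<real>\<^bsup>m+1\<^esup>\<close>.\<close>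

definition bipyramid :: "nat \<Rightarrow> (nat \<Rightarrow>\<^sub>0 real) set \<Rightarrow> (nat \<Rightarrow>\<^sub>0 real) set" where
  "bipyramid m Q =
     convex hull (Q \<union> {Poly_Mapping.single m 1, Poly_Mapping.single m (- 1)})"

primrec iter_bipyramid :: "nat \<Rightarrow> nat \<Rightarrow> (nat \<Rightarrow>\<^sub>0 real) set \<Rightarrow> (nat \<Rightarrow>\<^sub>0 real) set" where
  "iter_bipyramid m 0 Q = Q"
| "iter_bipyramid m (Suc k) Q = bipyramid (m + k) (iter_bipyramid m k Q)"

definition lattice_points :: "nat \<Rightarrow> (nat \<Rightarrow>\<^sub>0 real) set \<Rightarrow> (nat \<Rightarrow>\<^sub>0 int) set" where
  "lattice_points m Q = {a \<in> int_lattice m. real_vec a \<in> Q}"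


text \<open>
  Multivariate polynomials over \<open>\<complex>\<close> with variables indexed by \<open>A\<close>, in the usual representation
  as finitely supported functions from exponent vectors to coefficients. The affine space
  \<open>\<complex>\<^bsup>A\<^esup>\<close> consists of the functions that are extensional on \<open>A\<close>.
\<close>

definition polys :: "'i set \<Rightarrow> (('i \<Rightarrow>\<^sub>0 nat) \<Rightarrow>\<^sub>0 complex) set" where
  "polys A = {g. \<forall>e\<in>Poly_Mapping.keys g. Poly_Mapping.keys e \<subseteq> A}"

definition poly_eval :: "(('i \<Rightarrow>\<^sub>0 nat) \<Rightarrow>\<^sub>0 complex) \<Rightarrow> ('i \<Rightarrow> complex) \<Rightarrow> complex" where
  "poly_eval g x = (\<Sum>e\<in>Poly_Mapping.keys g. Poly_Mapping.lookup g e *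
     (\<Prod>i\<in>Poly_Mapping.keys e. x i ^ Poly_Mapping.lookup e i))"

definition forms :: "'i set \<Rightarrow> nat \<Rightarrow> (('i \<Rightarrow>\<^sub>0 nat) \<Rightarrow>\<^sub>0 complex) set" where
  "forms A t = {g \<in> polys A. \<forall>e\<in>Poly_Mapping.keys g.
     (\<Sum>i\<in>Poly_Mapping.keys e. Poly_Mapping.lookup e i) = t}"

definition affine_space :: "'i set \<Rightarrow> ('i \<Rightarrow> complex) set" where
  "affine_space A = A \<rightarrow>\<^sub>E UNIV"

definition zariski_closure :: "'i set \<Rightarrow> ('i \<Rightarrow> complex) set \<Rightarrow> ('i \<Rightarrow> complex) set" where
  "zariski_closure A X = {x \<in> affine_space A.
     \<forall>g\<in>polys A. (\<forall>y\<in>X. poly_eval g y = 0) \<longrightarrow> poly_eval g x = 0}"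

text \<open>
  The degree-\<open>t\<close> part of the homogeneous coordinate ring of a cone \<open>V \<subseteq> \<complex>\<^bsup>A\<^esup>\<close>, that is,
  forms of degree \<open>t\<close> modulo those vanishing on \<open>V\<close>, realised as the space of their
  restrictions to \<open>V\<close>. Restrictions are extended by zero, so that they form a linear subspace of
  the space of all functions.
\<close>

definition coord_ring_part ::
    "'i set \<Rightarrow> ('i \<Rightarrow> complex) set \<Rightarrow> nat \<Rightarrow> (('i \<Rightarrow> complex) \<Rightarrow> complex) set" where
  "coord_ring_part A V t = (\<lambda>g x. if x \<in> V then poly_eval g x else 0) ` forms A t"

lemma vector_space_complex_fun:
  "vector_space (\<lambda>(c::complex) (f::'a \<Rightarrow> complex) x. c * f x)"
  by unfold_locales (auto simp: fun_eq_iff algebra_simps)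

definition hilbert_function :: "'i set \<Rightarrow> ('i \<Rightarrow> complex) set \<Rightarrow> nat \<Rightarrow> nat" where
  "hilbert_function A V t =
     vector_space.dim (\<lambda>c f x. c * f x) (coord_ring_part A V t)"

text \<open>
  The degree of the projective variety with affine cone \<open>V\<close>: if \<open>r\<close> is the degree of its
  Hilbert polynomial, the leading coefficient times \<open>r!\<close>.
\<close>

definition cone_degree :: "'i set \<Rightarrow> ('i \<Rightarrow> complex) set \<Rightarrow> nat" where
  "cone_degree A V = (THE d. \<exists>H :: rat poly.
     (\<forall>\<^sub>F t in sequentially. poly H (of_nat t) = of_nat (hilbert_function A V t)) \<and>
     of_nat d = fact (degree H) * lead_coeff H)"


text \<open>
  Instead of enumerating the columns of the design matrix, coordinates of \<open>\<complex>\<^sup>n\<close> are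
  indexed by the columns themselves, i.e. by the finite set \<open>A\<close> of lattice points.
\<close>

definition torus :: "nat \<Rightarrow> (nat \<Rightarrow> complex) set" where
  "torus m = {..<m} \<rightarrow>\<^sub>E (UNIV - {0})"

definition laurent_monomial :: "(nat \<Rightarrow> complex) \<Rightarrow> (nat \<Rightarrow>\<^sub>0 int) \<Rightarrow> complex" where
  "laurent_monomial \<theta> a = (\<Prod>i\<in>Poly_Mapping.keys a. \<theta> i powi Poly_Mapping.lookup a i)"

definition toric_variety ::
    "nat \<Rightarrow> (nat \<Rightarrow>\<^sub>0 int) set \<Rightarrow> ((nat \<Rightarrow>\<^sub>0 int) \<Rightarrow> complex) set" where
  "toric_variety m A = zariski_closure A
     {(\<lambda>a\<in>A. s * laurent_monomial \<theta> a) | s \<theta>. s \<noteq> 0 \<and> \<theta> \<in> torus m}"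

text \<open>Entry in row \<open>j \<le> m\<close> and column \<open>a\<close> of the matrix \<open>A'\<close>, whose row \<open>0\<close> is all ones.\<close>

definition ext_design :: "nat \<Rightarrow> (nat \<Rightarrow>\<^sub>0 int) \<Rightarrow> int" where
  "ext_design j a = (case j of 0 \<Rightarrow> 1 | Suc i \<Rightarrow> Poly_Mapping.lookup a i)"

definition score_solutions ::
    "nat \<Rightarrow> (nat \<Rightarrow>\<^sub>0 int) set \<Rightarrow> ((nat \<Rightarrow>\<^sub>0 int) \<Rightarrow> nat) \<Rightarrow> ((nat \<Rightarrow>\<^sub>0 int) \<Rightarrow> complex) set" where
  "score_solutions m A u = {p \<in> toric_variety m A.
     (\<forall>a\<in>A. p a \<noteq> 0) \<and>
     (\<forall>j\<le>m. (\<Sum>a\<in>A. of_int (ext_design j a) * p a) =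
        1 / of_nat (\<Sum>a\<in>A. u a) * (\<Sum>a\<in>A. of_int (ext_design j a) * of_nat (u a)))}"

text \<open>
  Genericity of the data means: outside the zero set of some nonzero polynomial. As \<open>\<nat>\<^bsup>A\<^esup>\<close> is
  Zariski dense in \<open>\<complex>\<^bsup>A\<^esup>\<close>, there is at most one such number.
\<close>

definition ml_degree :: "nat \<Rightarrow> (nat \<Rightarrow>\<^sub>0 int) set \<Rightarrow> nat" where
  "ml_degree m A = (THE d. \<exists>g\<in>polys A. g \<noteq> 0 \<and>
     (\<forall>u. poly_eval g (\<lambda>a. of_nat (u a)) \<noteq> 0 \<longrightarrow>
        finite (score_solutions m A u) \<and> card (score_solutions m A u) = d))"

definition ml_drop :: "nat \<Rightarrow> (nat \<Rightarrow>\<^sub>0 real) set \<Rightarrow> int" where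
  "ml_drop m Q = (let A = lattice_points m Q in
     int (cone_degree A (toric_variety m A)) - int (ml_degree m A))"


text \<open>Laurent polynomials over \<open>\<int>\<close> as finitely supported functions on exponent vectors.\<close>

definition lattice_laurent :: "nat \<Rightarrow> (nat \<Rightarrow>\<^sub>0 real) set \<Rightarrow> ((nat \<Rightarrow>\<^sub>0 int) \<Rightarrow>\<^sub>0 int)" where
  "lattice_laurent m Q = (\<Sum>a\<in>lattice_points m Q. Poly_Mapping.single a 1)"

definition laurent_eval :: "((nat \<Rightarrow>\<^sub>0 int) \<Rightarrow>\<^sub>0 int) \<Rightarrow> (nat \<Rightarrow> complex) \<Rightarrow> complex" where
  "laurent_eval f \<theta> = (\<Sum>a\<in>Poly_Mapping.keys f.
     of_int (Poly_Mapping.lookup f a) * laurent_monomial \<theta> a)"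

definition laurent_pderiv ::
    "nat \<Rightarrow> ((nat \<Rightarrow>\<^sub>0 int) \<Rightarrow>\<^sub>0 int) \<Rightarrow> ((nat \<Rightarrow>\<^sub>0 int) \<Rightarrow>\<^sub>0 int)" where
  "laurent_pderiv i f = (\<Sum>a\<in>Poly_Mapping.keys f.
     Poly_Mapping.single (a - Poly_Mapping.single i 1)
       (Poly_Mapping.lookup f a * Poly_Mapping.lookup a i))"

definition singularities ::
    "nat \<Rightarrow> ((nat \<Rightarrow>\<^sub>0 int) \<Rightarrow>\<^sub>0 int) \<Rightarrow> (nat \<Rightarrow> complex) set" where
  "singularities m f = {\<theta> \<in> torus m.
     laurent_eval f \<theta> = 0 \<and> (\<forall>i<m. laurent_eval (laurent_pderiv i f) \<theta> = 0)}"

end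

theory Submission
  imports Defs "HOL-Computational_Algebra.Fundamental_Theorem_Algebra"
begin

text \<open>
  Let \<open>B\<close> be the set of lattice points of the iterated bipyramid, \<open>f\<close> the sum of its monomials, and
  \<open>b\<close> the normalised area of \<open>P\<close>. Both the degree and the ML degree are compared with \<open>b 2\<^sup>k\<close>.

  \<^item> The degree is \<open>b 2\<^sup>k\<close>. The Hilbert function of the toric variety at \<open>t\<close> is the number of
    sums of \<open>t\<close> elements of \<open>B\<close>. For a reflexive polygon this number is \<open>1 + b t (t + 1) / 2\<close>, and a
    bipyramid raises the degree of this polynomial by one and doubles its normalised leading coefficient.

  \<^item> On the torus the score equations say \<open>\<theta>\<^sub>i \<partial>\<^sub>i f = c\<^sub>i f\<close> and \<open>f \<noteq> 0\<close>, where \<open>c = A u / u\<^sub>+\<close>. If the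
    condition \<open>f \<noteq> 0\<close> is dropped, the additional solutions are the points where \<open>f\<close> and all its logarithmic
    derivatives vanish. These are the singularities of \<open>f\<close>, and they do not depend on \<open>u\<close>. So it
    remains to count the solutions without this condition.

  \<^item> The number of solutions is generically constant, because the data with exactly \<open>N\<close>
    solutions form a constructible set (Chevalley), and a constructible set that contains a ball
    contains the complement of a hypersurface. So it suffices to count for complex data in a ball, and
    the ball is taken around the indicator of the origin, which is a lattice point of \<open>B\<close>. There
    \<open>c = 0\<close>, and the solutions are the critical points of \<open>f\<close> on the torus.

  \<^item> The variables of \<open>f\<close> separate: \<open>f\<close> is the sum of a Laurent polynomial in the plane and of
    \<open>\<theta>\<^sub>i + 1 / \<theta>\<^sub>i\<close> for the other coordinates. The latter have two critical points each. The polynomial of the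
    polygon has exactly \<open>b\<close> critical points, all nondegenerate. Hence there are \<open>b 2\<^sup>k\<close> of
    them. For small \<open>c\<close> each moves a little by the contraction principle. No others appear, since
    on the torus the monomials are bounded by the logarithmic gradient (\<open>coercive\<close>).

  Neither a general theorem of Bernstein--Kushnirenko type nor one on normality is invoked for the polygon. Instead
  the reflexive polygons are classified up to unimodular maps (\<open>fano_tame\<close>): each contains two
  opposite lattice points, or is the triangle of the projective plane. In the first case
  it is either of lattice width two, with three parameters, or one of two exceptional
  triangles. The number of sums and the critical points are computed for these normal forms. The
  facts about polygons that the rest of the proof needs are collected in the predicate \<open>tame\<close>.\<close>

abbreviation (input) lookup :: "('a \<Rightarrow>\<^sub>0 'b :: zero) \<Rightarrow> 'a \<Rightarrow> 'b" where "lookup \<equiv> Poly_Mapping.lookup"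

abbreviation (input) single :: "'a \<Rightarrow> 'b \<Rightarrow> ('a \<Rightarrow>\<^sub>0 'b :: zero)" where "single \<equiv> Poly_Mapping.single"

abbreviation (input) keys :: "('a \<Rightarrow>\<^sub>0 'b :: zero) \<Rightarrow> 'a set" where "keys \<equiv> Poly_Mapping.keys"

section \<open>Polynomial functions and projections of constructible sets\<close>

inductive polyfun :: "(('i \<Rightarrow> complex) \<Rightarrow> complex) \<Rightarrow> bool" where
 polyfun_const: "polyfun (\<lambda>_. c)"
| polyfun_var: "polyfun (\<lambda>v. v i)"
| polyfun_add: "polyfun p \<Longrightarrow> polyfun q \<Longrightarrow> polyfun (\<lambda>v. p v + q v)"
| polyfun_mult: "polyfun p \<Longrightarrow> polyfun q \<Longrightarrow> polyfun (\<lambda>v. p v * q v)"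

named_theorems polyfun_intros
declare polyfun.intros [polyfun_intros]

lemma polyfun_diff [polyfun_intros]:
 assumes "polyfun p" "polyfun q" shows "polyfun (\<lambda>v. p v - q v)"
proof -
 have "polyfun (\<lambda>v. p v + (-1) * q v)" using assms by (intro polyfun_intros)
 then show ?thesis by simp
qed

lemma polyfun_power [polyfun_intros]: "polyfun p \<Longrightarrow> polyfun (\<lambda>v. p v ^ n)"
 by (induction n) (auto intro: polyfun_intros)

lemma polyfun_sum [polyfun_intros]:
 "(\<And>i. i \<in> I \<Longrightarrow> polyfun (p i)) \<Longrightarrow> polyfun (\<lambda>v. \<Sum>i\<in>I. p i v)"
 by (induction I rule: infinite_finite_induct) (auto intro: polyfun_intros)

lemma polyfun_prod [polyfun_intros]:
 "(\<And>i. i \<in> I \<Longrightarrow> polyfun (p i)) \<Longrightarrow> polyfun (\<lambda>v. \<Prod>i\<in>I. p i v)"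
 by (induction I rule: infinite_finite_induct) (auto intro: polyfun_intros)

lemma polyfun_on_line:
 assumes "polyfun p"
 shows "\<exists>P. \<forall>t. p (\<lambda>i. a i + t * b i) = poly P t"
 using assms
proof induction
 case (polyfun_const c) then show ?case by (intro exI[of _ "[:c:]"]) auto
next
 case (polyfun_var i) then show ?case by (intro exI[of _ "[:a i, b i:]"]) auto
next
 case (polyfun_add p q)
 then obtain P Q where "\<forall>t. p (\<lambda>i. a i + t * b i) = poly P t" "\<forall>t. q (\<lambda>i. a i + t * b i) = poly Q t" by auto
 then show ?case by (intro exI[of _ "P + Q"]) auto
next
 case (polyfun_mult p q)
 then obtain P Q where "\<forall>t. p (\<lambda>i. a i + t * b i) = poly P t" "\<forall>t. q (\<lambda>i. a i + t * b i) = poly Q t" by auto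
 then show ?case by (intro exI[of _ "P * Q"]) auto
qed

lemma polyfun_mult_nonzero:
 fixes p q :: "('i \<Rightarrow> complex) \<Rightarrow> complex"
 assumes "polyfun p" "polyfun q" "p a ~= 0" "q b ~= 0"
 shows "\<exists>v. p v * q v ~= 0"
proof -
 obtain P Q where P: "\<And>t. p (\<lambda>i. a i + t * (b i - a i)) = poly P t"
  and Q: "\<And>t. q (\<lambda>i. a i + t * (b i - a i)) = poly Q t"
  using polyfun_on_line[OF assms(1)] polyfun_on_line[OF assms(2)] by meson
 have "poly P 0 ~= 0" "poly Q 1 ~= 0" using P[of 0] Q[of 1] assms by simp_all
 then have "P * Q ~= 0" by auto
 then obtain t where "poly (P * Q) t ~= 0" using poly_all_0_iff_0 by blast
 then have "poly P t * poly Q t ~= 0" by simp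
 then show ?thesis unfolding P[of t, symmetric] Q[of t, symmetric]
  by (rule exI[of "\<lambda>v. p v * q v ~= 0"])
qed

text \<open>A family of univariate polynomials whose coefficients are polynomial functions; the number
  \<open>n\<close> is a strict bound on the exponents.\<close>

definition polyfam :: "(('i \<Rightarrow> complex) \<Rightarrow> complex poly) \<Rightarrow> nat \<Rightarrow> bool" where
 "polyfam P n \<longleftrightarrow> (\<forall>i. polyfun (\<lambda>v. coeff (P v) i)) & (\<forall>v. \<forall>i\<ge>n. coeff (P v) i = 0)"

lemma polyfam_mono: "polyfam P n \<Longrightarrow> n \<le> m \<Longrightarrow> polyfam P m"
 by (auto simp: polyfam_def)

lemma polyfam_add: "polyfam P n \<Longrightarrow> polyfam Q m \<Longrightarrow> polyfam (\<lambda>v. P v + Q v) (max n m)"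
 by (auto simp: polyfam_def intro!: polyfun_intros)

lemma polyfam_mult:
 assumes "polyfam P n" "polyfam Q m" shows "polyfam (\<lambda>v. P v * Q v) (n + m)"
proof -
 have "coeff (P v * Q v) i = 0" if "n + m \<le> i" for v i
 proof -
  have "coeff (P v) k * coeff (Q v) (i - k) = 0" if "k \<le> i" for k
   using assms that \<open>n + m \<le> i\<close> by (cases "n \<le> k") (auto simp: polyfam_def)
  then show ?thesis unfolding coeff_mult by (intro sum.neutral) auto
 qed
 moreover have "polyfun (\<lambda>v. coeff (P v * Q v) i)" for i
  unfolding coeff_mult using assms by (auto simp: polyfam_def intro!: polyfun_intros)
 ultimately show ?thesis by (auto simp: polyfam_def)
qed

lemma polyfam_const: "polyfun p \<Longrightarrow> polyfam (\<lambda>v. [:p v:]) 1"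
proof -
 assume p: "polyfun p"
 have "polyfun (\<lambda>v. coeff [:p v:] i)" for i
  using p by (cases i) (auto intro: polyfun_intros)
 then show ?thesis by (auto simp: polyfam_def coeff_pCons split: nat.splits)
qed

lemma polyfam_power: "polyfam P n \<Longrightarrow> \<exists>m. polyfam (\<lambda>v. P v ^ k) m"
proof (induction k)
 case 0
 show ?case using polyfam_const[OF polyfun_const[of 1]] by (auto simp: one_pCons intro!: exI[of _ 1])
next
 case (Suc k)
 then show ?case using polyfam_mult[of P n] by auto
qed

lemma polyfun_as_polyfam:
 assumes "polyfun p"
 shows "\<exists>P n. polyfam P n & (\<forall>v x. p (v(j := x)) = poly (P v) x)"
 using assms
proof induction
 case (polyfun_const c)
 then show ?case
  by (intro exI[of _ "\<lambda>_. [:c:]"] exI[of _ 1] conjI polyfam_const[OF polyfun.polyfun_const]) simp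
next
 case (polyfun_var i)
 show ?case
 proof (cases "i = j")
  case True
  have "polyfam (\<lambda>_. [:0, 1:]) 2"
   by (auto simp: polyfam_def intro: polyfun_intros) (auto simp: coeff_pCons split: nat.splits)
  with True show ?thesis by (intro exI[of _ "\<lambda>_. [:0, 1:]"] exI[of _ 2]) simp
 next
  case False
  then show ?thesis
   by (intro exI[of _ "\<lambda>v. [:v i:]"] exI[of _ 1] conjI polyfam_const[OF polyfun.polyfun_var]) simp
 qed
next
 case (polyfun_add p q)
 then obtain P n Q m where "polyfam P n" "\<forall>v x. p (v(j := x)) = poly (P v) x"
  "polyfam Q m" "\<forall>v x. q (v(j := x)) = poly (Q v) x" by meson
 then show ?case by (intro exI[of _ "\<lambda>v. P v + Q v"] exI[of _ "max n m"] conjI polyfam_add) (simp_all del: fun_upd_apply)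
next
 case (polyfun_mult p q)
 then obtain P n Q m where "polyfam P n" "\<forall>v x. p (v(j := x)) = poly (P v) x"
  "polyfam Q m" "\<forall>v x. q (v(j := x)) = poly (Q v) x" by meson
 then show ?case by (intro exI[of _ "\<lambda>v. P v * Q v"] exI[of _ "n + m"] conjI polyfam_mult) (simp_all del: fun_upd_apply)
qed

inductive constructible :: "('i \<Rightarrow> complex) set \<Rightarrow> bool" where
 constr_zero: "polyfun p \<Longrightarrow> constructible {v. p v = 0}"
| constr_compl: "constructible S \<Longrightarrow> constructible (- S)"
| constr_Un: "constructible S \<Longrightarrow> constructible T \<Longrightarrow> constructible (S \<union> T)"

lemma constr_Int: "constructible S \<Longrightarrow> constructible T \<Longrightarrow> constructible (S \<inter> T)"
 using constr_compl[OF constr_Un[OF constr_compl constr_compl]] by fastforce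

lemma constr_Diff: "constructible S \<Longrightarrow> constructible T \<Longrightarrow> constructible (S - T)"
 by (simp add: Diff_eq constr_Int constr_compl)

lemma constr_empty: "constructible {}"
 using constr_zero[OF polyfun_const[of 1]] by simp

lemma constr_UNIV: "constructible UNIV"
 using constr_compl[OF constr_empty] by simp

lemma constr_nonzero: "polyfun p \<Longrightarrow> constructible {v. p v ~= 0}"
 using constr_compl[OF constr_zero, of p] by (simp add: Collect_neg_eq)

lemma constr_UN: "finite I \<Longrightarrow> (\<And>i. i \<in> I \<Longrightarrow> constructible (S i)) \<Longrightarrow> constructible (\<Union>i\<in>I. S i)"
 by (induction I rule: finite_induct) (auto intro: constr_empty constr_Un)

lemma constr_INT: "finite I \<Longrightarrow> (\<And>i. i \<in> I \<Longrightarrow> constructible (S i)) \<Longrightarrow> constructible (\<Inter>i\<in>I. S i)"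
 by (induction I rule: finite_induct) (auto intro: constr_UNIV constr_Int)

lemma constr_Collect_conj:
 "constructible {v. P v} \<Longrightarrow> constructible {v. Q v} \<Longrightarrow> constructible {v. P v & Q v}"
 using constr_Int[of "{v. P v}" "{v. Q v}"] by (simp add: Collect_conj_eq)

lemma constr_Collect_ball:
 "finite I \<Longrightarrow> (\<And>i. i \<in> I \<Longrightarrow> constructible {v. P i v}) \<Longrightarrow> constructible {v. \<forall>i\<in>I. P i v}"
 using constr_INT[of I "\<lambda>i. {v. P i v}"] by (simp add: Collect_ball_eq)

lemma constr_Collect_bex:
 "finite I \<Longrightarrow> (\<And>i. i \<in> I \<Longrightarrow> constructible {v. P i v}) \<Longrightarrow> constructible {v. \<exists>i\<in>I. P i v}"
 using constr_UN[of I "\<lambda>i. {v. P i v}"] by (simp add: Collect_bex_eq)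

lemma constr_eq: "polyfun p \<Longrightarrow> polyfun q \<Longrightarrow> constructible {v. p v = q v}"
 using constr_zero[OF polyfun_diff, of p q] by simp

lemma constr_polyfam_eq_0: 
 assumes "polyfam P n" shows "constructible {v. P v = 0}"
proof -
 have eq: "{v. P v = 0} = {v. \<forall>i\<in>{..<n}. coeff (P v) i = 0}"
  using assms unfolding polyfam_def poly_eq_iff by (auto; metis lessThan_iff not_less)
 show ?thesis unfolding eq
  by (intro constr_Collect_ball constr_zero) (use assms in \<open>auto simp: polyfam_def\<close>)
qed

text \<open>Multiplying the dividend by the leading coefficient, which may vanish at some points, avoids
  divisions, so that the remainder again depends polynomially on the point.\<close>

lemma polyfam_pseudo_step:
 assumes P: "polyfam P (Suc n)" and R: "polyfam R (Suc e)" and "n \<le> e"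
 defines "a \<equiv> \<lambda>v. coeff (P v) n"
 defines "R' \<equiv> \<lambda>v. smult (a v) (R v) - monom (coeff (R v) e) (e - n) * P v"
 shows "polyfam R' e"
proof -
 have "polyfun (\<lambda>v. coeff (R' v) i)" for i
  using P R unfolding R'_def a_def polyfam_def coeff_diff coeff_smult coeff_monom_mult
  by (cases "i < e - n"; simp only: if_True if_False simp_thms; intro polyfun_intros; blast)
 moreover have "coeff (R' v) i = 0" if "e \<le> i" for v i
 proof (cases "i = e")
  case True then show ?thesis using \<open>n \<le> e\<close> by (simp add: R'_def a_def coeff_monom_mult)
 next
  case False
  with that have "Suc e \<le> i" "Suc n \<le> i - (e - n)" using \<open>n \<le> e\<close> by auto
  then have "coeff (R v) i = 0" "coeff (P v) (i - (e - n)) = 0" using P R unfolding polyfam_def by blast+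
  then show ?thesis by (simp add: R'_def coeff_monom_mult)
 qed
 ultimately show ?thesis by (auto simp: polyfam_def)
qed

lemma polyfam_pseudo_rem:
 assumes P: "polyfam P (Suc n)" and R: "polyfam R e"
 shows "\<exists>T. polyfam T n & (\<forall>v. coeff (P v) n ~= 0 \<longrightarrow> (P v dvd R v \<longleftrightarrow> P v dvd T v))"
 using R
proof (induction e arbitrary: R)
 case 0
 then show ?case using polyfam_mono[of R 0 n] by (intro exI[of _ R]) simp
next
 case (Suc e)
 show ?case
 proof (cases "n \<le> e")
  case False
  then show ?thesis using Suc.prems polyfam_mono[of R "Suc e" n] by (intro exI[of _ R]) simp
 next
  case True
  define R' where "R' = (\<lambda>v. smult (coeff (P v) n) (R v) - monom (coeff (R v) e) (e - n) * P v)"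
  have "polyfam R' e" using polyfam_pseudo_step[OF P Suc.prems True] by (simp add: R'_def)
  then obtain T where T: "polyfam T n" "\<And>v. coeff (P v) n ~= 0 \<Longrightarrow> (P v dvd R' v \<longleftrightarrow> P v dvd T v)"
   using Suc.IH by blast
  have "P v dvd R v \<longleftrightarrow> P v dvd R' v" if "coeff (P v) n ~= 0" for v
  proof -
   have "P v dvd R' v \<longleftrightarrow> P v dvd smult (coeff (P v) n) (R v)"
    unfolding R'_def diff_conv_add_uminus by (rule dvd_add_left_iff) simp
   then show ?thesis using that by (simp add: dvd_smult_iff)
  qed
  then show ?thesis using T by (intro exI[of _ T]) simp
 qed
qed

lemma constr_root_single:
 assumes P: "polyfam P (Suc n)" and Q: "polyfam Q m"
 shows "constructible {v. coeff (P v) n ~= 0 & (\<exists>x. poly (P v) x = 0 & poly (Q v) x ~= 0)}"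
proof -
 obtain m' where "polyfam (\<lambda>v. Q v ^ n) m'" using polyfam_power[OF Q] by blast
 then obtain T where T: "polyfam T n" "\<And>v. coeff (P v) n ~= 0 \<Longrightarrow> (P v dvd Q v ^ n \<longleftrightarrow> P v dvd T v)"
  using polyfam_pseudo_rem[OF P] by blast
 have eq: "{v. coeff (P v) n ~= 0 & (\<exists>x. poly (P v) x = 0 & poly (Q v) x ~= 0)}
   = {v. coeff (P v) n ~= 0 & T v ~= 0}"
 proof (intro Collect_cong conj_cong refl)
  fix v assume a: "coeff (P v) n ~= 0"
  have deg: "degree (P v) = n"
   using P a by (intro antisym le_degree degree_le) (auto simp: polyfam_def)
  have "(\<forall>x. poly (P v) x = 0 \<longrightarrow> poly (Q v) x = 0) \<longleftrightarrow> P v dvd Q v ^ n"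
   using nullstellensatz_univariate[of "P v" "Q v"] deg a by auto
  also have "\<dots> \<longleftrightarrow> P v dvd T v" using T a by blast
  also have "\<dots> \<longleftrightarrow> T v = 0"
  proof
   assume "P v dvd T v"
   show "T v = 0"
   proof (rule ccontr)
    assume "T v ~= 0"
    with \<open>P v dvd T v\<close> have "n \<le> degree (T v)" using dvd_imp_degree_le deg by blast
    then have "coeff (T v) (degree (T v)) = 0" using T(1) unfolding polyfam_def by blast
    with \<open>T v ~= 0\<close> show False by simp
   qed
  qed simp
  finally show "(\<exists>x. poly (P v) x = 0 & poly (Q v) x ~= 0) = (T v ~= 0)" by blast
 qed
 show ?thesis unfolding eq
  by (intro constr_Collect_conj constr_nonzero)
   (use P constr_compl[OF constr_polyfam_eq_0[OF T(1)]] in \<open>auto simp: polyfam_def Collect_neg_eq\<close>)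
qed

lemma constr_exists_common_root:
 assumes "\<forall>(P, n) \<in> set L. polyfam P n" "polyfam Q m"
 shows "constructible {v. \<exists>x. (\<forall>(P, n) \<in> set L. poly (P v) x = 0) & poly (Q v) x ~= 0}"
 using assms(1)
proof (induction "\<Sum>(P, n)\<leftarrow>L. Suc n" arbitrary: L rule: less_induct)
 case less
 let ?S = "\<lambda>L. {v. \<exists>x. (\<forall>(P, n) \<in> set L. poly (P v) x = 0) & poly (Q v) x ~= 0}"
 let ?m = "\<lambda>L::((('a \<Rightarrow> complex) \<Rightarrow> complex poly) \<times> nat) list. (\<Sum>(P, n)\<leftarrow>L. Suc n)"
 show ?case
 proof (cases "L = []")
  case True
  have "?S L = {v. Q v ~= 0}" using True by simp (metis poly_all_0_iff_0)
  then show ?thesis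
   using constr_compl[OF constr_polyfam_eq_0[OF assms(2)]] by (simp add: Collect_neg_eq)
 next
  case False
  then obtain P n where Pn: "(P, n) \<in> set L" "\<And>R e. (R, e) \<in> set L \<Longrightarrow> n \<le> e"
  proof -
   have "\<exists>x\<in>set L. \<forall>y\<in>set L. snd x \<le> snd y"
    using False ex_min_if_finite[of "snd ` set L"] by (auto simp: not_less)
   then obtain x where "x \<in> set L" "\<forall>y\<in>set L. snd x \<le> snd y" by blast
   then show ?thesis using that[of "fst x" "snd x"] by (metis prod.collapse snd_conv)
  qed
  then obtain L1 L2 where L: "L = L1 @ (P, n) # L2" by (meson split_list)
  have P: "polyfam P n" and fam: "\<forall>(P, n) \<in> set (L1 @ L2). polyfam P n" using less.prems L by auto
  show ?thesis
  proof (cases n)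
   case 0
   then have "P v = 0" for v using P by (auto simp: polyfam_def poly_eq_iff)
   then have "?S L = ?S (L1 @ L2)" by (auto simp: L)
   then show ?thesis using less.hyps[of "L1 @ L2"] fam by (simp add: L)
  next
   case (Suc n')
   define a where "a = (\<lambda>v. coeff (P v) n')"
   have pa: "polyfun a" using P by (auto simp: a_def polyfam_def)
   define P' where "P' = (\<lambda>v. P v - monom (a v) n')"
   have "polyfun (\<lambda>v. coeff (P' v) i)" for i
    using P unfolding polyfam_def P'_def a_def
    by (cases "i = n'") (auto intro!: polyfun_intros)
   moreover have "coeff (P' v) i = 0" if "n' \<le> i" for v i
    using P that unfolding Suc polyfam_def P'_def a_def by (cases "i = n'") auto
   ultimately have P': "polyfam P' n'" by (simp add: polyfam_def)
   have "P' v = P v" if "a v = 0" for v using that by (simp add: P'_def)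
   then have "{v. a v = 0} \<inter> ?S L = {v. a v = 0} \<inter> ?S (L1 @ (P', n') # L2)"
    by (intro set_eqI) (simp add: L ball_Un conj_commute cong: conj_cong)
   then have "?S L = ({v. a v = 0} \<inter> ?S (L1 @ (P', n') # L2)) \<union> ({v. a v ~= 0} \<inter> ?S L)"
    by blast
   moreover have "constructible ({v. a v = 0} \<inter> ?S (L1 @ (P', n') # L2))"
    by (intro constr_Int constr_zero pa less.hyps) (use fam P' Suc in \<open>auto simp: L\<close>)
   moreover have "constructible ({v. a v ~= 0} \<inter> ?S L)"
   proof (cases "L1 @ L2 = []")
    case True
    then have "{v. a v ~= 0} \<inter> ?S L
      = {v. coeff (P v) n' ~= 0 & (\<exists>x. poly (P v) x = 0 & poly (Q v) x ~= 0)}"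
     by (auto simp: L a_def)
    then show ?thesis using constr_root_single[OF P[unfolded Suc] assms(2)] by simp
   next
    case False
    then obtain R e where "(R, e) \<in> set (L1 @ L2)" by (metis list.set_intros(1) neq_Nil_conv surj_pair)
    then obtain M1 M2 where M: "L1 @ L2 = M1 @ (R, e) # M2" by (meson split_list)
    have R: "polyfam R e" using fam M by auto
    have "(R, e) \<in> set L" using \<open>(R, e) \<in> set (L1 @ L2)\<close> L by auto
    then have "n \<le> e" using Pn by blast
    then obtain e' where e': "e = Suc e'" "n' \<le> e'" using Suc by (cases e) auto
    define R' where "R' = (\<lambda>v. smult (a v) (R v) - monom (coeff (R v) e') (e' - n') * P v)"
    have R': "polyfam R' e'" using polyfam_pseudo_step[OF P[unfolded Suc] R[unfolded e'(1)] e'(2)]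
     by (simp add: R'_def a_def)
    define L' where "L' = (P, n) # M1 @ (R', e') # M2"
    have setL: "set L = set ((P, n) # M1 @ (R, e) # M2)"
     using arg_cong[OF M, of set] by (auto simp: L)
    have "{v. a v ~= 0} \<inter> ?S L = {v. a v ~= 0} \<inter> ?S L'"
    proof -
     have "(poly (P v) x = 0 & poly (R v) x = 0) \<longleftrightarrow> (poly (P v) x = 0 & poly (R' v) x = 0)"
      if "a v ~= 0" for v x using that by (auto simp: R'_def)
     then have "a v ~= 0 \<Longrightarrow> (\<forall>(P, n) \<in> set ((P, n) # M1 @ (R, e) # M2). poly (P v) x = 0)
       \<longleftrightarrow> (\<forall>(P, n) \<in> set L'. poly (P v) x = 0)" for v x
      unfolding L'_def by (simp add: ball_Un) blast
     then show ?thesis unfolding setL by blast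
    qed
    moreover have "?m L = ?m ((P, n) # M1 @ (R, e) # M2)"
     using arg_cong[OF M, of ?m] by (simp add: L)
    then have "?m L' < ?m L" using e' by (simp add: L'_def)
    moreover have "\<forall>(P, n) \<in> set L'. polyfam P n"
     using R' P fam unfolding M by (auto simp: L'_def)
    ultimately show ?thesis using less.hyps[of L'] by (simp add: constr_Int constr_nonzero pa)
   qed
   ultimately show ?thesis using constr_Un
    [of "{v. a v = 0} \<inter> ?S (L1 @ (P', n') # L2)" "{v. a v ~= 0} \<inter> ?S L"] by (simp only:)
  qed
 qed
qed

inductive dnf :: "('i \<Rightarrow> complex) set \<Rightarrow> bool" where
 dnf_empty: "dnf {}"
| dnf_step: "list_all polyfun ps \<Longrightarrow> polyfun q \<Longrightarrow> dnf S \<Longrightarrow>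
  dnf ({v. (\<forall>p\<in>set ps. p v = 0) & q v ~= 0} \<union> S)"

lemma dnf_Un: "dnf S \<Longrightarrow> dnf T \<Longrightarrow> dnf (S \<union> T)"
proof (induction rule: dnf.induct)
 case (dnf_step ps q S)
 then show ?case unfolding Un_assoc by (intro dnf.dnf_step)
qed simp

lemma dnf_basic: 
 "list_all polyfun ps \<Longrightarrow> polyfun q \<Longrightarrow> dnf {v. (\<forall>p\<in>set ps. p v = 0) & q v ~= 0}"
 using dnf_step[OF _ _ dnf_empty] by simp

lemma dnf_Int_basic:
 assumes "dnf S" "list_all polyfun ps" "polyfun q"
 shows "dnf ({v. (\<forall>p\<in>set ps. p v = 0) & q v ~= 0} \<inter> S)"
 using assms(1)
proof induction
 case (dnf_step ps' q' S)
 have "dnf ({v. (\<forall>p\<in>set (ps @ ps'). p v = 0) & q v * q' v ~= 0})"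
  using dnf_step assms by (intro dnf_basic polyfun_mult) simp_all
 moreover have "{v. (\<forall>p\<in>set ps. p v = 0) & q v ~= 0} \<inter> ({v. (\<forall>p\<in>set ps'. p v = 0) & q' v ~= 0} \<union> S)
  = {v. (\<forall>p\<in>set (ps @ ps'). p v = 0) & q v * q' v ~= 0} \<union> ({v. (\<forall>p\<in>set ps. p v = 0) & q v ~= 0} \<inter> S)"
  by auto
 ultimately show ?case using dnf_Un[OF _ dnf_step.IH] by (simp only:)
qed (simp add: dnf_empty)

lemma dnf_Int: "dnf S \<Longrightarrow> dnf T \<Longrightarrow> dnf (S \<inter> T)"
proof (induction rule: dnf.induct)
 case (dnf_step ps q S)
 then show ?case unfolding Int_Un_distrib2 by (intro dnf_Un dnf_Int_basic)
qed (simp add: dnf_empty)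

lemma dnf_zero: "polyfun p \<Longrightarrow> dnf {v. p v = 0}"
 using dnf_basic[of "[p]" "\<lambda>_. 1"] polyfun_const[of 1] by simp

lemma dnf_nonzero: "polyfun p \<Longrightarrow> dnf {v. p v ~= 0}"
 using dnf_basic[of "[]" p] by simp

lemma dnf_UNIV: "dnf UNIV"
 using dnf_nonzero[OF polyfun_const[of 1]] by simp

lemma dnf_compl: "dnf S \<Longrightarrow> dnf (- S)"
proof (induction rule: dnf.induct)
 case (dnf_step ps q S)
 have "dnf {v. \<exists>p\<in>set ps. p v ~= 0}" using dnf_step(1)
 proof (induction ps)
  case (Cons p ps)
  then have "dnf ({v. p v ~= 0} \<union> {v. \<exists>p\<in>set ps. p v ~= 0})" by (intro dnf_Un dnf_nonzero) auto
  moreover have "{v. \<exists>p\<in>set (p # ps). p v ~= 0} = {v. p v ~= 0} \<union> {v. \<exists>p\<in>set ps. p v ~= 0}" by auto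
  ultimately show ?case by (simp only:)
 qed (simp add: dnf_empty)
 then have "dnf (({v. \<exists>p\<in>set ps. p v ~= 0} \<union> {v. q v = 0}) \<inter> - S)"
  using dnf_step by (intro dnf_Int dnf_Un dnf_zero)
 moreover have "- ({v. (\<forall>p\<in>set ps. p v = 0) & q v ~= 0} \<union> S)
   = ({v. \<exists>p\<in>set ps. p v ~= 0} \<union> {v. q v = 0}) \<inter> - S" by auto
 ultimately show ?case by simp
qed (simp add: dnf_UNIV)

lemma constructible_dnf: "constructible S \<Longrightarrow> dnf S"
 by (induction rule: constructible.induct) (simp_all add: dnf_zero dnf_compl dnf_Un)

text \<open>Eliminating one variable from finitely many equations and one inequation. Pseudo-division reduces
  the equations to a single polynomial \<open>P\<close> in this variable. It has a root outside the zeros of \<open>Q\<close> iff \<open>P\<close>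
  does not divide a power of \<open>Q\<close>, and divisibility is again a condition on remainders.\<close>

theorem constructible_projection:
 assumes "constructible S"
 shows "constructible {v. \<exists>x. v(j := x) \<in> S}"
 using constructible_dnf[OF assms]
proof induction
 case (dnf_step ps q S)
 obtain Q m where Q: "polyfam Q m" "\<And>v x. q (v(j := x)) = poly (Q v) x"
  using polyfun_as_polyfam[OF dnf_step(2)] by blast
 have "\<forall>p\<in>set ps. \<exists>Pn. polyfam (fst Pn) (snd Pn) & (\<forall>v x. p (v(j := x)) = poly (fst Pn v) x)"
  using dnf_step(1) polyfun_as_polyfam by (fastforce simp: list_all_iff)
 then obtain F where F: "\<And>p. p \<in> set ps \<Longrightarrow> polyfam (fst (F p)) (snd (F p))"
  "\<And>p v x. p \<in> set ps \<Longrightarrow> p (v(j := x)) = poly (fst (F p) v) x" by metis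
 have "constructible {v. \<exists>x. (\<forall>(P, n) \<in> set (map F ps). poly (P v) x = 0) & poly (Q v) x ~= 0}"
  using F by (intro constr_exists_common_root[OF _ Q(1)]) (auto simp: case_prod_beta)
 moreover have "(\<forall>(P, n) \<in> set (map F ps). poly (P v) x = 0) \<longleftrightarrow> (\<forall>p\<in>set ps. p (v(j := x)) = 0)" for v x
  using F by (auto simp: case_prod_beta)
 ultimately have "constructible {v. \<exists>x. (\<forall>p\<in>set ps. p (v(j := x)) = 0) & q (v(j := x)) ~= 0}"
  using Q by simp
 moreover have "{v. \<exists>x. v(j := x) \<in> {v. (\<forall>p\<in>set ps. p v = 0) & q v ~= 0} \<union> S}
  = {v. \<exists>x. (\<forall>p\<in>set ps. p (v(j := x)) = 0) & q (v(j := x)) ~= 0} \<union> {v. \<exists>x. v(j := x) \<in> S}" by auto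
 ultimately show ?case using constr_Un[OF _ dnf_step.IH] by (simp only:)
qed (simp add: constr_empty)

corollary constructible_projection_finite:
 assumes "constructible S" "finite J"
 shows "constructible {v. \<exists>w\<in>S. \<forall>i. i \<notin> J \<longrightarrow> w i = v i}"
 using assms(2)
proof induction
 case empty
 have "{v. \<exists>w\<in>S. \<forall>i. i \<notin> {} \<longrightarrow> w i = v i} = S" by (auto simp flip: fun_eq_iff)
 then show ?case using assms by simp
next
 case (insert j J)
 have "{v. \<exists>w\<in>S. \<forall>i. i \<notin> insert j J \<longrightarrow> w i = v i}
   = {v. \<exists>x. v(j := x) \<in> {v. \<exists>w\<in>S. \<forall>i. i \<notin> J \<longrightarrow> w i = v i}}" (is "?L = ?R")
 proof (intro set_eqI iffI)
  fix v assume "v \<in> ?L"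
  then obtain w where "w \<in> S" "\<forall>i. i \<notin> insert j J \<longrightarrow> w i = v i" by auto
  then show "v \<in> ?R" by (intro CollectI exI[of _ "w j"] bexI[of _ w]) auto
 next
  fix v assume "v \<in> ?R"
  then obtain x w where "w \<in> S" "\<forall>i. i \<notin> J \<longrightarrow> w i = (v(j := x)) i" by auto
  then show "v \<in> ?L" by (intro CollectI bexI[of _ w]) auto
 qed
 then show ?case using constructible_projection[OF insert.IH] by simp
qed

definition nonzeros :: "(('i \<Rightarrow> complex) \<Rightarrow> complex) \<Rightarrow> ('i \<Rightarrow> complex) set" where
 "nonzeros g = {v. g v ~= 0}"

lemma nonzeros_mult_nonempty:
 "polyfun g \<Longrightarrow> polyfun h \<Longrightarrow> nonzeros g ~= {} \<Longrightarrow> nonzeros h ~= {} \<Longrightarrow>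
  nonzeros (\<lambda>v. g v * h v) ~= {}"
 using polyfun_mult_nonzero[of g h] unfolding nonzeros_def by auto

lemma constructible_generic:
 assumes "constructible S"
 shows "\<exists>g. polyfun g & nonzeros g ~= {} & (nonzeros g \<subseteq> S \<or> nonzeros g \<inter> S = {})"
 using assms
proof induction
 case (constr_zero p)
 have "nonzeros p \<inter> {v. p v = 0} = {}" by (auto simp: nonzeros_def)
 moreover have "{v. p v = 0} = UNIV" if "nonzeros p = {}" using that by (auto simp: nonzeros_def)
 moreover have "nonzeros (\<lambda>_. 1) = UNIV" by (simp add: nonzeros_def)
 ultimately show ?case using constr_zero polyfun_const[of 1] by (metis UNIV_not_empty subset_UNIV)
next
 case (constr_compl S)
 then show ?case by blast
next
 case (constr_Un S T)
 obtain g where g: "polyfun g" "nonzeros g ~= {}" "nonzeros g \<subseteq> S \<or> nonzeros g \<inter> S = {}"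
  using constr_Un.IH(1) by blast
 obtain h where h: "polyfun h" "nonzeros h ~= {}" "nonzeros h \<subseteq> T \<or> nonzeros h \<inter> T = {}"
  using constr_Un.IH(2) by blast
 have "nonzeros (\<lambda>v. g v * h v) = nonzeros g \<inter> nonzeros h" by (auto simp: nonzeros_def)
 then have "nonzeros (\<lambda>v. g v * h v) \<subseteq> S \<union> T \<or> nonzeros (\<lambda>v. g v * h v) \<inter> (S \<union> T) = {}"
  using g(3) h(3) by blast
 then show ?case using nonzeros_mult_nonempty[OF g(1) h(1) g(2) h(2)] polyfun_mult[OF g(1) h(1)] by blast
qed

text \<open>A constructible set that contains a neighbourhood of a point, in the finitely many coordinates
  on which it depends, contains the complement of a hypersurface.\<close>

lemma constructible_box_generic:
 fixes v0 :: "'i \<Rightarrow> complex"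
 assumes "constructible S" "finite J" "\<eta> > 0"
  and box: "\<And>v. \<forall>i\<in>J. norm (v i - v0 i) < \<eta> \<Longrightarrow> v \<in> S"
 shows "\<exists>g. polyfun g & nonzeros g ~= {} & nonzeros g \<subseteq> S"
proof -
 obtain g where g: "polyfun g" "nonzeros g ~= {}" "nonzeros g \<subseteq> S \<or> nonzeros g \<inter> S = {}"
  using constructible_generic[OF assms(1)] by blast
 then obtain v1 where v1: "v1 \<in> nonzeros g" by blast
 obtain P where P: "\<And>t. g (\<lambda>i. v0 i + t * (v1 i - v0 i)) = poly P t"
  using polyfun_on_line[OF g(1), of v0 "\<lambda>i. v1 i - v0 i"] by blast
 have "poly P 1 ~= 0" using P[of 1] v1 by (simp add: nonzeros_def)
 then have "P ~= 0" by auto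
 then have fin: "finite {t. poly P t = 0}" by (rule poly_roots_finite)
 define B where "B = (\<Sum>i\<in>J. norm (v1 i - v0 i)) + 1"
 have B0: "B > 0" unfolding B_def by (intro add_nonneg_pos sum_nonneg) auto
 have B: "norm (v1 i - v0 i) < B" if "i \<in> J" for i
  using assms(2) that member_le_sum[of i J "\<lambda>i. norm (v1 i - v0 i)"] unfolding B_def by simp
 have "infinite (of_real ` {0<..<\<eta> / B} :: complex set)"
  using assms(3) B0 by (subst finite_image_iff) (auto intro!: inj_onI simp: infinite_Ioo)
 then have "\<not> of_real ` {0<..<\<eta> / B} \<subseteq> {t. poly P t = 0}"
  using fin finite_subset[of "of_real ` {0<..<\<eta> / B}" "{t. poly P t = 0}"] by blast
 then have "\<exists>t\<in>{0<..<\<eta> / B}. poly P (of_real t) ~= 0" by blast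
 then obtain t where t: "0 < t" "t < \<eta> / B" "poly P (of_real t) ~= 0" by auto
 have "\<forall>i\<in>J. norm ((v0 i + of_real t * (v1 i - v0 i)) - v0 i) < \<eta>"
 proof
  fix i assume "i \<in> J"
  have "t * norm (v1 i - v0 i) \<le> t * B" using B[OF \<open>i \<in> J\<close>] t by (intro mult_left_mono) auto
  also have "\<dots> < \<eta>" using t B0 by (simp add: field_simps)
  finally show "norm ((v0 i + of_real t * (v1 i - v0 i)) - v0 i) < \<eta>" using t by (simp add: norm_mult)
 qed
 then have "(\<lambda>i. v0 i + of_real t * (v1 i - v0 i)) \<in> S" by (rule box)
 moreover have "(\<lambda>i. v0 i + of_real t * (v1 i - v0 i)) \<in> nonzeros g"
  unfolding nonzeros_def mem_Collect_eq P using t(3) .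
 ultimately have "nonzeros g \<inter> S ~= {}" by blast
 then show ?thesis using g by blast
qed

section \<open>Polynomials as polynomial functions\<close>

lemma poly_eval_superset:
 assumes "finite S" "keys g \<subseteq> S"
 shows "poly_eval g x = (\<Sum>e\<in>S. lookup g e *
   (\<Prod>i\<in>keys e. x i ^ lookup e i))"
 unfolding poly_eval_def using assms by (intro sum.mono_neutral_left) (auto simp: in_keys_iff)

lemma poly_eval_add: "poly_eval (g + h) x = poly_eval g x + poly_eval h x"
proof -
 let ?S = "keys g \<union> keys h"
 have "keys (g + h) \<subseteq> ?S" by (rule Poly_Mapping.keys_add)
 then show ?thesis
  by (simp add: poly_eval_superset[of ?S] lookup_add distrib_right sum.distrib)
qed

lemma poly_eval_sum: "poly_eval (\<Sum>i\<in>I. g i) x = (\<Sum>i\<in>I. poly_eval (g i) x)"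
 by (induction I rule: infinite_finite_induct) (simp_all add: poly_eval_add, simp_all add: poly_eval_def)

lemma poly_eval_single:
 "poly_eval (single e c) x = c * (\<Prod>i\<in>keys e. x i ^ lookup e i)"
 by (cases "c = 0") (simp_all add: poly_eval_def)

lemma monomial_superset:
 assumes "finite S" "keys e \<subseteq> S"
 shows "(\<Prod>i\<in>keys e. (x i :: complex) ^ lookup e i)
  = (\<Prod>i\<in>S. x i ^ lookup e i)"
 using assms by (intro prod.mono_neutral_left) (auto simp: in_keys_iff)

lemma monomial_add:
 "(\<Prod>i\<in>keys (e + e'). (x i :: complex) ^ lookup (e + e') i)
  = (\<Prod>i\<in>keys e. x i ^ lookup e i)
   * (\<Prod>i\<in>keys e'. x i ^ lookup e' i)"
proof -
 let ?S = "keys e \<union> keys e'"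
 have "keys (e + e') \<subseteq> ?S" by (rule Poly_Mapping.keys_add)
 then have "(\<Prod>i\<in>keys (e + e'). x i ^ lookup (e + e') i)
   = (\<Prod>i\<in>?S. x i ^ lookup (e + e') i)" by (intro monomial_superset) auto
 moreover have "(\<Prod>i\<in>keys e. x i ^ lookup e i)
   = (\<Prod>i\<in>?S. x i ^ lookup e i)" by (intro monomial_superset) auto
 moreover have "(\<Prod>i\<in>keys e'. x i ^ lookup e' i)
   = (\<Prod>i\<in>?S. x i ^ lookup e' i)" by (intro monomial_superset) auto
 ultimately show ?thesis by (simp only: lookup_add power_add prod.distrib)
qed

lemma poly_mapping_as_sum:
 "g = (\<Sum>e\<in>keys g. single e (lookup g e))"
 by (intro poly_mapping_eqI)
   (auto simp: lookup_sum lookup_single when_def in_keys_iff if_distrib cong: if_cong)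

lemma poly_eval_mult: "poly_eval (g * h) x = poly_eval g x * poly_eval h x"
proof -
 have "poly_eval (g * h) x = poly_eval ((\<Sum>e\<in>keys g. single e (lookup g e))
   * (\<Sum>e\<in>keys h. single e (lookup h e))) x"
  using poly_mapping_as_sum[of g] poly_mapping_as_sum[of h] by simp
 also have "\<dots> = poly_eval g x * poly_eval h x"
  unfolding sum_product poly_eval_sum mult_single poly_eval_single monomial_add
  by (simp add: poly_eval_def sum_product mult_ac)
 finally show ?thesis .
qed

lemma keys_add_nat: "keys (e + e' :: 'a \<Rightarrow>\<^sub>0 nat) = keys e \<union> keys e'"
 by (auto simp: in_keys_iff lookup_add)

lemma polys_add: "g \<in> polys A \<Longrightarrow> h \<in> polys A \<Longrightarrow> g + h \<in> polys A"
 unfolding polys_def using Poly_Mapping.keys_add[of g h] by blast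

lemma polys_mult: "g \<in> polys A \<Longrightarrow> h \<in> polys A \<Longrightarrow> g * h \<in> polys A"
 unfolding polys_def using keys_mult[of g h] by (fastforce simp: keys_add_nat)

lemma polys_single: "keys e \<subseteq> A \<Longrightarrow> single e c \<in> polys A"
 by (auto simp: polys_def)

text \<open>Setting some variables to zero and renaming the others turns a polynomial function into
  the evaluation of a polynomial.\<close>

lemma polyfun_imp_polys:
 assumes "polyfun p" "\<And>j a. \<tau> j = Some a \<Longrightarrow> a \<in> A"
 shows "\<exists>g\<in>polys A. \<forall>u. poly_eval g u = p (\<lambda>j. case \<tau> j of Some a \<Rightarrow> u a | None \<Rightarrow> 0)"
 using assms(1)
proof induction
 case (polyfun_const c)
 show ?case by (intro bexI[of _ "single 0 c"] polys_single) (auto simp: poly_eval_single)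
next
 case (polyfun_var j)
 show ?case
 proof (cases "\<tau> j")
  case None
  then show ?thesis by (intro bexI[of _ 0]) (auto simp: poly_eval_def polys_def)
 next
  case (Some a)
  then show ?thesis using assms(2)[OF Some]
   by (intro bexI[of _ "single (single a 1) 1"] polys_single)
    (auto simp: poly_eval_single)
 qed
next
 case (polyfun_add p q)
 then obtain g h where "g \<in> polys A" "\<forall>u. poly_eval g u = p (\<lambda>j. case \<tau> j of Some a \<Rightarrow> u a | None \<Rightarrow> 0)"
  "h \<in> polys A" "\<forall>u. poly_eval h u = q (\<lambda>j. case \<tau> j of Some a \<Rightarrow> u a | None \<Rightarrow> 0)" by blast
 then show ?case by (intro bexI[of _ "g + h"] polys_add) (simp_all add: poly_eval_add)
next
 case (polyfun_mult p q)
 then obtain g h where "g \<in> polys A" "\<forall>u. poly_eval g u = p (\<lambda>j. case \<tau> j of Some a \<Rightarrow> u a | None \<Rightarrow> 0)"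
  "h \<in> polys A" "\<forall>u. poly_eval h u = q (\<lambda>j. case \<tau> j of Some a \<Rightarrow> u a | None \<Rightarrow> 0)" by blast
 then show ?case by (intro bexI[of _ "g * h"] polys_mult) (simp_all add: poly_eval_mult)
qed

lemma polyfun_poly_eval: "polyfun (poly_eval g)"
 unfolding poly_eval_def by (intro polyfun_intros)

lemma polyfun_zero_of_nat:
 assumes "polyfun p" "finite A" "\<And>u :: 'i \<Rightarrow> nat. p (\<lambda>i. of_nat (u i)) = 0"
  "\<And>v w. (\<And>i. i \<in> A \<Longrightarrow> v i = w i) \<Longrightarrow> p v = p w"
 shows "p v = 0"
proof -
 have "p v = 0" if "B \<subseteq> A" "\<forall>i\<in>A - B. v i \<in> \<nat>" for B v
  using finite_subset[OF that(1) assms(2)] that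
 proof (induction B arbitrary: v rule: finite_induct)
  case empty
  then have "\<forall>i\<in>A. \<exists>n. v i = of_nat n" by (auto elim: Nats_cases)
  then obtain u where "\<forall>i\<in>A. v i = of_nat (u i)" by metis
  then have "p v = p (\<lambda>i. of_nat (u i))" by (intro assms(4)) simp
  then show ?case using assms(3) by simp
 next
  case (insert j B)
  obtain P n where P: "\<And>v x. p (v(j := x)) = poly (P v) x"
   using polyfun_as_polyfam[OF assms(1)] by blast
  have "poly (P v) (of_nat n) = 0" for n
   unfolding P[symmetric] using insert by (intro insert.IH) auto
  then have "range of_nat \<subseteq> {x. poly (P v) x = 0}" by auto
  moreover have "infinite (range (of_nat :: nat \<Rightarrow> complex))"
   by (simp add: finite_image_iff inj_of_nat infinite_UNIV_nat)
  ultimately have "P v = 0" using poly_roots_finite finite_subset by blast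
  then show ?case using P[of v "v j"] by simp
 qed
 from this[of A] show ?thesis by simp
qed

text \<open>Dedekind's lemma on the independence of characters.\<close>

lemma characters_independent:
 fixes ch :: "'b \<Rightarrow> 'm \<Rightarrow> complex" and mul :: "'m \<Rightarrow> 'm \<Rightarrow> 'm"
 assumes "finite B"
  and closed: "\<And>x y. x \<in> M \<Longrightarrow> y \<in> M \<Longrightarrow> mul x y \<in> M"
  and mult: "\<And>b x y. b \<in> B \<Longrightarrow> x \<in> M \<Longrightarrow> y \<in> M \<Longrightarrow> ch b (mul x y) = ch b x * ch b y"
  and nonzero: "\<And>b. b \<in> B \<Longrightarrow> \<exists>x\<in>M. ch b x ~= 0"
  and distinct: "\<And>b b'. b \<in> B \<Longrightarrow> b' \<in> B \<Longrightarrow> b ~= b' \<Longrightarrow> \<exists>x\<in>M. ch b x ~= ch b' x"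
  and zero: "\<And>x. x \<in> M \<Longrightarrow> (\<Sum>b\<in>B. c b * ch b x) = 0"
  and "b \<in> B"
 shows "c b = 0"
 using assms(1,3-7)
proof (induction B arbitrary: c b rule: finite_induct)
 case (insert b1 B)
 have others: "c b = 0" if bB: "b \<in> B" for b
 proof -
  obtain y where y: "y \<in> M" "ch b y ~= ch b1 y"       using insert.prems(3)[of b b1] bB insert.hyps by blast
  have "c b * (ch b y - ch b1 y) = 0"
  proof (rule insert.IH[where c = "\<lambda>b. c b * (ch b y - ch b1 y)"])
   fix x assume x: "x \<in> M"
   have "(\<Sum>b\<in>insert b1 B. c b * ch b (mul y x)) = 0" using insert.prems(4) closed x y by blast
   moreover have "(\<Sum>b\<in>insert b1 B. c b * ch b (mul y x)) = (\<Sum>b\<in>insert b1 B. c b * (ch b y * ch b x))"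
    using insert.prems(1) x y by (intro sum.cong) auto
   moreover have "(\<Sum>b\<in>insert b1 B. c b * ch b x) = 0" using insert.prems(4) x by blast
   ultimately have "(\<Sum>b\<in>insert b1 B. c b * (ch b y * ch b x)) - ch b1 y * (\<Sum>b\<in>insert b1 B. c b * ch b x) = 0"
    by simp
   then show "(\<Sum>b\<in>B. c b * (ch b y - ch b1 y) * ch b x) = 0"
    using insert.hyps by (simp add: sum_distrib_left algebra_simps sum_subtractf)
  qed (use insert.prems(1-3) bB in simp_all)
  then show ?thesis using y by simp
 qed
 then have "c b1 * ch b1 x = 0" if "x \<in> M" for x
  using insert.prems(4)[OF that] insert.hyps by simp
 then have "c b1 = 0" using insert.prems(2)[of b1] by auto
 then show ?case using others insert.prems(5) by auto
qed simp

lemma poly_eval_zero_imp: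
 fixes g :: "('i \<Rightarrow>\<^sub>0 nat) \<Rightarrow>\<^sub>0 complex"
 assumes "\<And>x. poly_eval g x = 0"
 shows "g = 0"
proof (rule poly_mapping_eqI)
 fix e
 have "lookup g e = 0" if "e \<in> keys g"
 proof (rule characters_independent[where M = UNIV and mul = "\<lambda>x y i. x i * y i" and B = "keys g"
    and ch = "\<lambda>e x. \<Prod>i\<in>keys e. x i ^ lookup e i"])
  fix e e' :: "'i \<Rightarrow>\<^sub>0 nat" assume "e ~= e'"
  then obtain j where j: "lookup e j ~= lookup e' j" by (metis poly_mapping_eqI)
  define x where "x = (\<lambda>i. if i = j then 2 else 1 :: complex)"
  have "(\<Prod>i\<in>keys e. x i ^ lookup e i) = 2 ^ lookup e j" for e :: "'i \<Rightarrow>\<^sub>0 nat"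
  proof -
   have "(\<Prod>i\<in>keys e. x i ^ lookup e i)
     = (\<Prod>i\<in>insert j (keys e). x i ^ lookup e i)"
    by (rule monomial_superset) auto
   also have "\<dots> = (\<Prod>i\<in>insert j (keys e). if i = j then 2 ^ lookup e j else 1)"
    by (intro prod.cong) (auto simp: x_def)
   finally show ?thesis by simp
  qed
  moreover have "(2 :: complex) ^ lookup e j ~= 2 ^ lookup e' j"
  proof
   assume "(2 :: complex) ^ lookup e j = 2 ^ lookup e' j"
   then have "norm ((2 :: complex) ^ lookup e j) = norm ((2::complex) ^ lookup e' j)" by simp
   then show False using j by (simp add: norm_power)
  qed
  ultimately show "\<exists>x\<in>UNIV. (\<Prod>i\<in>keys e. (x i :: complex) ^ lookup e i)
    ~= (\<Prod>i\<in>keys e'. x i ^ lookup e' i)" by (intro bexI[of _ x]) simp_all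
 next
  fix e :: "'i \<Rightarrow>\<^sub>0 nat"
  show "\<exists>x\<in>UNIV. (\<Prod>i\<in>keys e. (x i :: complex) ^ lookup e i) ~= 0"
   by (intro bexI[of _ "\<lambda>_. 1"]) auto
 next
  fix x
  show "(\<Sum>b\<in>keys g. lookup g b * (\<Prod>i\<in>keys b. x i ^ lookup b i)) = 0"
   using assms[of x] by (simp add: poly_eval_def)
 qed (use that in \<open>auto simp: power_mult_distrib prod.distrib\<close>)
 then show "lookup g e = lookup 0 e" by (auto simp: in_keys_iff)
qed

lemma poly_eval_cong:
 assumes "g \<in> polys A" "\<And>i. i \<in> A \<Longrightarrow> x i = y i" shows "poly_eval g x = poly_eval g y"
 unfolding poly_eval_def using assms
 by (intro sum.cong arg_cong2[of _ _ _ _ "(*)"] arg_cong2[of _ _ _ _ power] prod.cong refl)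
  (simp add: polys_def subset_iff)

text \<open>Two conditions that hold generically are met simultaneously by a vector of natural numbers.\<close>

lemma polys_common_nonzero_nat:
 assumes "finite A" "g \<in> polys A" "h \<in> polys A" "g ~= 0" "h ~= 0"
 shows "\<exists>u :: 'i \<Rightarrow> nat. poly_eval g (\<lambda>i. of_nat (u i)) ~= 0 & poly_eval h (\<lambda>i. of_nat (u i)) ~= 0"
proof (rule ccontr)
 assume "\<not> ?thesis"
 then have fail: "poly_eval g (\<lambda>i. of_nat (u i)) = 0 \<or> poly_eval h (\<lambda>i. of_nat (u i)) = 0" for u :: "'i \<Rightarrow> nat"
  by blast
 have *: "poly_eval (g * h) (\<lambda>i. of_nat (u i)) = 0" for u :: "'i \<Rightarrow> nat"
  unfolding poly_eval_mult mult_eq_0_iff by (rule fail)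
 have zero: "poly_eval (g * h) v = 0" for v
 proof (rule polyfun_zero_of_nat[where p = "poly_eval (g * h)"])
  show "polyfun (poly_eval (g * h))" by (rule polyfun_poly_eval)
  show "poly_eval (g * h) v = poly_eval (g * h) w" if "\<And>i. i \<in> A \<Longrightarrow> v i = w i" for v w
   using poly_eval_cong[OF polys_mult[OF assms(2,3)], of v w] that by blast
 qed (use assms(1) * in simp_all)
 obtain v where v: "poly_eval g v ~= 0"
  using poly_eval_zero_imp[of g] assms(4) by auto
 obtain w where w: "poly_eval h w ~= 0"
  using poly_eval_zero_imp[of h] assms(5) by auto
 have "\<exists>v. poly_eval g v * poly_eval h v ~= 0"
  by (rule polyfun_mult_nonzero[of "poly_eval g" "poly_eval h" v w, OF polyfun_poly_eval[of g] polyfun_poly_eval[of h] v w])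
 then obtain x where "poly_eval g x * poly_eval h x ~= 0" by blast
 then show False using zero[of x] unfolding poly_eval_mult by simp
qed

section \<open>Sumsets, Hilbert function and degree\<close>

primrec sumset :: "nat \<Rightarrow> 'a::comm_monoid_add set \<Rightarrow> 'a set" where
 "sumset 0 A = {0}"
| "sumset (Suc t) A = {a + b | a b. a \<in> A & b \<in> sumset t A}"

lemma sumset_SucI: "a \<in> A \<Longrightarrow> b \<in> sumset t A \<Longrightarrow> a + b \<in> sumset (Suc t) A"
 by auto

lemma sumset_mono: "0 \<in> A \<Longrightarrow> s \<le> t \<Longrightarrow> sumset s A \<subseteq> sumset t A"
proof (induction t)
 case (Suc t)
 have "sumset t A \<subseteq> sumset (Suc t) A"
 proof
  fix x assume "x \<in> sumset t A"
  then have "0 + x \<in> sumset (Suc t) A" using Suc.prems(1) by (intro sumset_SucI)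
  then show "x \<in> sumset (Suc t) A" by (simp only: add_0_left)
 qed
 then show ?case using Suc by (cases "s = Suc t") auto
qed simp

lemma sumset_mono_set: "A \<subseteq> B \<Longrightarrow> sumset t A \<subseteq> sumset t B"
 by (induction t) (simp_all, blast)

lemma finite_sumset: "finite A \<Longrightarrow> finite (sumset t A)"
proof (induction t)
 case (Suc t)
 have "sumset (Suc t) A = (\<lambda>(a, b). a + b) ` (A \<times> sumset t A)" by auto
 then show ?case using Suc by simp
qed simp

lemma sumset_1: "sumset 1 A = A"
 by (auto simp: One_nat_def)

definition wsum :: "('i \<Rightarrow> 'b::comm_monoid_add) \<Rightarrow> ('i \<Rightarrow>\<^sub>0 nat) \<Rightarrow> 'b" where
 "wsum h e = (\<Sum>i\<in>keys e. \<Sum>j<lookup e i. h i)"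

abbreviation exp_degree :: "('i \<Rightarrow>\<^sub>0 nat) \<Rightarrow> nat" where
 "exp_degree \<equiv> wsum (\<lambda>_. Suc 0)"

abbreviation monomial :: "('i \<Rightarrow>\<^sub>0 nat) \<Rightarrow> ('i \<Rightarrow> complex) \<Rightarrow> complex" where
 "monomial e x \<equiv> (\<Prod>i\<in>keys e. x i ^ lookup e i)"

lemma wsum_superset:
 assumes "finite S" "keys e \<subseteq> S"
 shows "wsum h e = (\<Sum>i\<in>S. \<Sum>j<lookup e i. h i)"
 unfolding wsum_def using assms by (intro sum.mono_neutral_left) (auto simp: in_keys_iff)

lemma wsum_zero [simp]: "wsum h 0 = 0"
 by (simp add: wsum_def)

lemma wsum_single [simp]: "wsum h (single i n) = (\<Sum>j<n. h i)"
 by (cases "n = 0") (simp_all add: wsum_def)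

lemma sum_lessThan_add_const: "(\<Sum>j<m + n :: nat. c) = (\<Sum>j<m. c) + (\<Sum>j<n. c :: 'b::comm_monoid_add)"
 by (induct n) (simp_all add: add.assoc)

lemma wsum_add: "wsum h (e + e') = wsum h e + wsum h e'"
proof -
 let ?S = "keys e \<union> keys e'"
 have "wsum h (e + e') = (\<Sum>i\<in>?S. \<Sum>j<lookup (e + e') i. h i)"
  by (intro wsum_superset) (auto simp: keys_add_nat)
 moreover have "wsum h e = (\<Sum>i\<in>?S. \<Sum>j<lookup e i. h i)" by (intro wsum_superset) auto
 moreover have "wsum h e' = (\<Sum>i\<in>?S. \<Sum>j<lookup e' i. h i)" by (intro wsum_superset) auto
 ultimately show ?thesis by (simp only: lookup_add sum_lessThan_add_const sum.distrib)
qed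

lemma wsum_sum: "wsum h (\<Sum>j\<in>J. e j) = (\<Sum>j\<in>J. wsum h (e j))"
 by (induction J rule: infinite_finite_induct) (simp_all add: wsum_add)

lemma monomial_sum: "finite J \<Longrightarrow> monomial (\<Sum>j\<in>J. e j) x = (\<Prod>j\<in>J. monomial (e j) x)"
 by (induction J rule: finite_induct) (simp_all add: monomial_add)

lemma keys_sum_nat: "finite J \<Longrightarrow> keys (\<Sum>j\<in>J. e j :: 'a \<Rightarrow>\<^sub>0 nat) = (\<Union>j\<in>J. keys (e j))"
 by (induction J rule: finite_induct) (simp_all add: keys_add_nat)

lemma exp_degree_eq: "exp_degree e = (\<Sum>i\<in>keys e. lookup e i)"
 by (simp add: wsum_def)

lemma sumset_iff_wsum:
 "x \<in> sumset t A \<longleftrightarrow> (\<exists>e. keys e \<subseteq> A & exp_degree e = t & wsum (\<lambda>a. a) e = x)"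
proof
 assume "x \<in> sumset t A"
 then show "\<exists>e. keys e \<subseteq> A & exp_degree e = t & wsum (\<lambda>a. a) e = x"
 proof (induction t arbitrary: x)
  case 0 then show ?case by (intro exI[of _ 0]) auto
 next
  case (Suc t)
  then obtain a b where x: "x = a + b" "a \<in> A" "b \<in> sumset t A" by auto
  then obtain e where "keys e \<subseteq> A" "exp_degree e = t" "wsum (\<lambda>a. a) e = b" using Suc.IH by blast
  then show ?case using x
   by (intro exI[of _ "single a 1 + e"]) (simp add: wsum_add keys_add_nat)
 qed
next
 assume "\<exists>e. keys e \<subseteq> A & exp_degree e = t & wsum (\<lambda>a. a) e = x"
 then obtain e where "keys e \<subseteq> A" "exp_degree e = t" "wsum (\<lambda>a. a) e = x" by blast
 then show "x \<in> sumset t A"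
 proof (induction t arbitrary: x e)
  case 0
  then have "e = 0" by (intro poly_mapping_eqI) (auto simp: exp_degree_eq in_keys_iff)
  then show ?case using 0 by simp
 next
  case (Suc t)
  then have "keys e ~= {}" by (auto simp: exp_degree_eq)
  then obtain a where a: "a \<in> keys e" by blast
  define e' where "e' = e - single a 1"
  have e: "e = single a 1 + e'"
  proof (rule poly_mapping_eqI)
   fix k show "lookup e k = lookup (single a 1 + e') k"
    using a unfolding e'_def by (cases "k = a") (auto simp: lookup_add lookup_minus lookup_single in_keys_iff)
  qed
  have "keys e' \<subseteq> A" "exp_degree e' = t" "x = a + wsum (\<lambda>a. a) e'" "a \<in> A"
   using Suc.prems e a by (auto simp: keys_add_nat wsum_add)
  then show ?case using Suc.IH[of e' "wsum (\<lambda>a. a) e'"] sumset_SucI[of a A "wsum (\<lambda>a. a) e'" t]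
   by (simp del: sumset.simps)
 qed
qed

subsection \<open>Laurent monomials\<close>

lemma laurent_monomial_eq:
 "a \<in> int_lattice m \<Longrightarrow> laurent_monomial \<theta> a = (\<Prod>i<m. \<theta> i powi lookup a i)"
 unfolding laurent_monomial_def
 by (intro prod.mono_neutral_left) (auto simp: int_lattice_def in_keys_iff)

lemma torus_nonzero: "\<theta> \<in> torus m \<Longrightarrow> i < m \<Longrightarrow> \<theta> i ~= 0"
 by (auto simp: torus_def)

lemma int_lattice_add: "a \<in> int_lattice m \<Longrightarrow> b \<in> int_lattice m \<Longrightarrow> a + b \<in> int_lattice m"
 using Poly_Mapping.keys_add[of a b] by (auto simp: int_lattice_def)

lemma int_lattice_zero [simp]: "0 \<in> int_lattice m"
 by (simp add: int_lattice_def)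

lemma int_lattice_single [simp]: "i < m \<Longrightarrow> single i c \<in> int_lattice m"
 by (simp add: int_lattice_def)

lemma laurent_monomial_add:
 assumes "a \<in> int_lattice m" "b \<in> int_lattice m" "\<theta> \<in> torus m"
 shows "laurent_monomial \<theta> (a + b) = laurent_monomial \<theta> a * laurent_monomial \<theta> b"
 using assms
 by (simp add: laurent_monomial_eq[of _ m] int_lattice_add lookup_add prod.distrib[symmetric] power_int_add torus_nonzero)

lemma laurent_monomial_nonzero:
 "a \<in> int_lattice m \<Longrightarrow> \<theta> \<in> torus m \<Longrightarrow> laurent_monomial \<theta> a ~= 0"
 by (simp add: laurent_monomial_eq torus_nonzero)

lemma laurent_monomial_0 [simp]: "laurent_monomial \<theta> 0 = 1"
 by (simp add: laurent_monomial_def)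

lemma laurent_monomial_single [simp]: "laurent_monomial \<theta> (single i c) = \<theta> i powi c"
 by (cases "c = 0") (simp_all add: laurent_monomial_def)

lemma sumset_int_lattice: "A \<subseteq> int_lattice m \<Longrightarrow> sumset t A \<subseteq> int_lattice m"
 by (induction t) (auto intro: int_lattice_add)

lemma laurent_monomial_sum:
 assumes "\<And>j. j \<in> J \<Longrightarrow> a j \<in> int_lattice m" "\<theta> \<in> torus m" "finite J"
 shows "laurent_monomial \<theta> (\<Sum>j\<in>J. a j) = (\<Prod>j\<in>J. laurent_monomial \<theta> (a j)) & (\<Sum>j\<in>J. a j) \<in> int_lattice m"
 using assms(3,1)
 by (induction J rule: finite_induct) (simp_all add: laurent_monomial_add[OF _ _ assms(2)] int_lattice_add)

lemma monomial_on_torus: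
 assumes "A \<subseteq> int_lattice m" "\<theta> \<in> torus m" "keys e \<subseteq> A"
 shows "monomial e (\<lambda>a\<in>A. s * laurent_monomial \<theta> a) = s ^ exp_degree e * laurent_monomial \<theta> (wsum (\<lambda>a. a) e)"
proof -
 have pw: "laurent_monomial \<theta> (\<Sum>j<n. a) = laurent_monomial \<theta> a ^ n & (\<Sum>j<n. a) \<in> int_lattice m"
  if "a \<in> keys e" for a and n :: nat
  using laurent_monomial_sum[of "{..<n}" "\<lambda>_. a" m \<theta>] that assms by auto
 have "laurent_monomial \<theta> (wsum (\<lambda>a. a) e)
   = (\<Prod>a\<in>keys e. laurent_monomial \<theta> (\<Sum>j<lookup e a. a))"
  unfolding wsum_def
  using laurent_monomial_sum[of "keys e" "\<lambda>i. \<Sum>j<lookup e i. i" m \<theta>] pw assms(2) by simp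
 also have "\<dots> = (\<Prod>a\<in>keys e. laurent_monomial \<theta> a ^ lookup e a)"
  using pw by (intro prod.cong) auto
 moreover have "monomial e (\<lambda>a\<in>A. s * laurent_monomial \<theta> a)
   = (\<Prod>a\<in>keys e. s ^ lookup e a * laurent_monomial \<theta> a ^ lookup e a)"
  using assms(3) by (intro prod.cong) (auto simp: power_mult_distrib)
 ultimately show ?thesis by (simp add: prod.distrib exp_degree_eq power_sum)
qed

subsection \<open>The toric variety\<close>

lemma toric_point:
 assumes "s ~= 0" "\<theta> \<in> torus m"
 shows "(\<lambda>a\<in>A. s * laurent_monomial \<theta> a) \<in> toric_variety m A"
 using assms unfolding toric_variety_def zariski_closure_def affine_space_def by auto

lemma poly_eval_diff_single:
 "poly_eval (single e 1 + single e' (- 1)) x = monomial e x - monomial e' x"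
 by (simp add: poly_eval_add poly_eval_single)

lemma toric_binomial:
 assumes "A \<subseteq> int_lattice m" "x \<in> toric_variety m A" "keys e \<subseteq> A" "keys e' \<subseteq> A"
  "exp_degree e = exp_degree e'" "wsum (\<lambda>a. a) e = wsum (\<lambda>a. a) e'"
 shows "monomial e x = monomial e' x"
proof -
 let ?g = "single e 1 + single e' (- 1) :: (_ \<Rightarrow>\<^sub>0 nat) \<Rightarrow>\<^sub>0 complex"
 have "?g \<in> polys A" by (intro polys_add polys_single assms)
 moreover have "poly_eval ?g y = 0"
  if "y \<in> {(\<lambda>a\<in>A. s * laurent_monomial \<theta> a) | s \<theta>. s ~= 0 & \<theta> \<in> torus m}" for y
 proof -
  from that obtain s \<theta> where y: "y = (\<lambda>a\<in>A. s * laurent_monomial \<theta> a)" "\<theta> \<in> torus m" by auto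
  show ?thesis unfolding poly_eval_diff_single y(1)
   using monomial_on_torus[OF assms(1) y(2) assms(3), of s] monomial_on_torus[OF assms(1) y(2) assms(4), of s] assms(5,6)
   by simp
 qed
 ultimately have "poly_eval ?g x = 0"
  using assms(2) unfolding toric_variety_def zariski_closure_def by blast
 then show ?thesis unfolding poly_eval_diff_single by simp
qed

lemma sum_fun_apply: "(\<Sum>i\<in>I. F i) x = (\<Sum>i\<in>I. F i x)"
 by (induction I rule: infinite_finite_induct) (simp_all add: zero_fun_def plus_fun_def)

lemma torus_characters_independent:
 assumes "finite B" "B \<subseteq> int_lattice m"
  and "\<And>\<theta>. \<theta> \<in> torus m \<Longrightarrow> (\<Sum>b\<in>B. c b * laurent_monomial \<theta> b) = 0" and "b \<in> B"
 shows "c b = 0"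
proof (rule characters_independent[where M = "torus m" and mul = "\<lambda>x y. \<lambda>i\<in>{..<m}. x i * y i" and B = B
   and ch = "\<lambda>b \<theta>. laurent_monomial \<theta> b"])
 show "(\<lambda>i\<in>{..<m}. x i * y i) \<in> torus m" if "x \<in> torus m" "y \<in> torus m" for x y
  using that by (auto simp: torus_def PiE_iff)
 show "laurent_monomial (\<lambda>i\<in>{..<m}. x i * y i) b = laurent_monomial x b * laurent_monomial y b"
  if "b \<in> B" for b x y
 proof -
  have "b \<in> int_lattice m" using that assms(2) by blast
  then show ?thesis by (simp add: laurent_monomial_eq prod.distrib[symmetric] power_int_mult_distrib)
 qed
 show "\<exists>x\<in>torus m. laurent_monomial x b ~= 0" if "b \<in> B" for b
  using that assms(2) by (intro bexI[of _ "\<lambda>i\<in>{..<m}. 1"]) (auto simp: torus_def laurent_monomial_eq)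
 show "\<exists>x\<in>torus m. laurent_monomial x b ~= laurent_monomial x b'" if "b \<in> B" "b' \<in> B" "b ~= b'" for b b'
 proof -
  have bb: "b \<in> int_lattice m" "b' \<in> int_lattice m" using that assms(2) by auto
  obtain j where j: "lookup b j ~= lookup b' j" using \<open>b ~= b'\<close> by (metis poly_mapping_eqI)
  then have "j \<in> keys b \<union> keys b'" by (auto simp: in_keys_iff)
  then have "j < m" using bb by (auto simp: int_lattice_def)
  define x where "x = (\<lambda>i\<in>{..<m}. if i = j then 2 else 1 :: complex)"
  have "laurent_monomial x b = 2 powi lookup b j" if "b \<in> int_lattice m" for b
  proof -
   have "laurent_monomial x b = (\<Prod>i<m. if i = j then 2 powi lookup b j else 1)"
    unfolding laurent_monomial_eq[OF that] by (intro prod.cong) (auto simp: x_def)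
   then show ?thesis using \<open>j < m\<close> by simp
  qed
  moreover have "(2 :: complex) powi lookup b j ~= 2 powi lookup b' j"
  proof
   assume "(2 :: complex) powi lookup b j = 2 powi lookup b' j"
   then have "norm ((2 :: complex) powi lookup b j) = norm ((2::complex) powi lookup b' j)" by simp
   then have "(2 :: real) powi lookup b j = 2 powi lookup b' j"
    by (simp add: norm_power_int)
   then show False
    using j power_int_strict_increasing[of "lookup b j" "lookup b' j" "2 :: real"]
     power_int_strict_increasing[of "lookup b' j" "lookup b j" "2 :: real"]
    by linarith
  qed
  moreover have "x \<in> torus m" by (auto simp: torus_def x_def)
  ultimately show ?thesis using bb by (intro bexI[of _ x]) simp_all
 qed
qed (use assms in auto)

theorem hilbert_function_toric:
 assumes A: "A \<subseteq> int_lattice m" "finite A"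
 shows "hilbert_function A (toric_variety m A) t = card (sumset t A)"
proof -
 interpret vs: vector_space "\<lambda>(c::complex) (f::((nat \<Rightarrow>\<^sub>0 int) \<Rightarrow> complex) \<Rightarrow> complex) x. c * f x"
  by (rule vector_space_complex_fun)
 let ?V = "toric_variety m A"
 have "\<forall>b\<in>sumset t A. \<exists>e. keys e \<subseteq> A & exp_degree e = t & wsum (\<lambda>a. a) e = b"
  using sumset_iff_wsum by blast
 then obtain E where E: "\<And>b. b \<in> sumset t A \<Longrightarrow> keys (E b) \<subseteq> A"
  "\<And>b. b \<in> sumset t A \<Longrightarrow> exp_degree (E b) = t"
  "\<And>b. b \<in> sumset t A \<Longrightarrow> wsum (\<lambda>a. a) (E b) = b" by metis
 define F where "F = (\<lambda>b x. if x \<in> ?V then monomial (E b) x else 0)"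
 let ?B = "sumset t A"
 have finB: "finite ?B" by (rule finite_sumset[OF A(2)])
 have Blat: "?B \<subseteq> int_lattice m" by (rule sumset_int_lattice[OF A(1)])
 have F_torus: "F b (\<lambda>a\<in>A. 1 * laurent_monomial \<theta> a) = laurent_monomial \<theta> b"
  if "b \<in> ?B" "\<theta> \<in> torus m" for b \<theta>
  using that toric_point[of 1 \<theta> m A] monomial_on_torus[OF A(1) that(2) E(1)[OF that(1)], of 1] E(3)[OF that(1)]
  by (simp add: F_def)
 have zero: "c b = 0" if "(\<Sum>b\<in>?B. (\<lambda>x. c b * F b x)) = 0" "b \<in> ?B" for c b
 proof (rule torus_characters_independent[OF finB Blat _ that(2)])
  fix \<theta> assume \<theta>: "\<theta> \<in> torus m"
  have "(\<Sum>b\<in>?B. c b * F b (\<lambda>a\<in>A. 1 * laurent_monomial \<theta> a)) = 0"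
   using fun_cong[OF that(1), of "\<lambda>a\<in>A. 1 * laurent_monomial \<theta> a"] unfolding sum_fun_apply by (simp only: zero_fun_def)
  then show "(\<Sum>b\<in>?B. c b * laurent_monomial \<theta> b) = 0" using F_torus \<theta> by simp
 qed
 have inj: "inj_on F ?B"
 proof (rule inj_onI, rule ccontr)
  fix b b' assume b: "b \<in> ?B" "b' \<in> ?B" "F b = F b'" "b ~= b'"
  define c where "c = (\<lambda>x. if x = b then 1 else if x = b' then - 1 else 0 :: complex)"
  have "(\<Sum>x\<in>?B. (\<lambda>y. c x * F x y)) = 0"
  proof
   fix y
   have "(\<Sum>x\<in>?B. c x * F x y) = (\<Sum>x\<in>{b, b'}. c x * F x y)"
    using b finB by (intro sum.mono_neutral_right) (auto simp: c_def)
   also have "\<dots> = 0" using b by (simp add: c_def)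
   finally show "(\<Sum>x\<in>?B. (\<lambda>y. c x * F x y)) y = 0 y" by (simp add: sum_fun_apply zero_fun_def)
  qed
  then have "c b = 0" using zero b by blast
  then show False by (simp add: c_def)
 qed
 have indep: "vs.independent (F ` ?B)"
 proof
  assume "vs.dependent (F ` ?B)"
  then obtain u where u: "\<exists>v\<in>F ` ?B. u v ~= 0" "(\<Sum>v\<in>F ` ?B. (\<lambda>x. u v * v x)) = 0"
   using vs.dependent_finite finB by auto
  have "(\<Sum>b\<in>?B. (\<lambda>x. u (F b) * F b x)) = 0" using u(2) by (simp add: sum.reindex[OF inj] o_def)
  then have "u (F b) = 0" if "b \<in> ?B" for b using zero[of "\<lambda>b. u (F b)"] that by blast
  then show False using u(1) by blast
 qed
 have sub: "F b \<in> coord_ring_part A ?V t" if "b \<in> ?B" for b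
 proof -
  have "single (E b) 1 \<in> forms A t"
   using E[OF that] by (auto simp: forms_def polys_def exp_degree_eq)
  moreover have "F b = (\<lambda>x. if x \<in> ?V then poly_eval (single (E b) 1) x else 0)"
   unfolding F_def poly_eval_single by (simp only: mult_1_left)
  ultimately show ?thesis unfolding coord_ring_part_def by blast
 qed
 have sup: "coord_ring_part A ?V t \<subseteq> vs.span (F ` ?B)"
 proof
  fix h assume "h \<in> coord_ring_part A ?V t"
  then obtain g where g: "g \<in> forms A t" "h = (\<lambda>x. if x \<in> ?V then poly_eval g x else 0)"
   by (auto simp: coord_ring_part_def)
  have *: "wsum (\<lambda>a. a) e \<in> ?B & keys e \<subseteq> A & exp_degree e = t" if "e \<in> keys g" for e
   using g(1) that sumset_iff_wsum[of "wsum (\<lambda>a. a) e" t A] by (auto simp: forms_def polys_def exp_degree_eq)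
  have "h = (\<Sum>e\<in>keys g. (\<lambda>x. lookup g e * F (wsum (\<lambda>a. a) e) x))"
  proof
   fix x
   have "monomial e x = monomial (E (wsum (\<lambda>a. a) e)) x" if "x \<in> ?V" "e \<in> keys g" for e
    using *[OF that(2)] E by (intro toric_binomial[OF A(1) that(1)]) auto
   then show "h x = (\<Sum>e\<in>keys g. (\<lambda>x. lookup g e * F (wsum (\<lambda>a. a) e) x)) x"
    unfolding sum_fun_apply g(2) poly_eval_def F_def by (auto intro!: sum.cong)
  qed
  moreover have "(\<Sum>e\<in>keys g. (\<lambda>x. lookup g e * F (wsum (\<lambda>a. a) e) x)) \<in> vs.span (F ` ?B)"
   using * by (intro vs.span_sum vs.span_scale vs.span_base) auto
  ultimately show "h \<in> vs.span (F ` ?B)" by simp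
 qed
 have "vs.span (F ` ?B) = vs.span (coord_ring_part A ?V t)"
  unfolding vs.span_eq using sup sub vs.span_superset[of "coord_ring_part A ?V t"] by blast
 then have "vs.dim (coord_ring_part A ?V t) = card (F ` ?B)" by (rule vs.dim_eq_card[OF _ indep])
 then show ?thesis by (simp add: hilbert_function_def card_image[OF inj])
qed

lemma poly_antidifference:
 fixes H :: "rat poly"
 shows "\<exists>S. (\<forall>n. poly S (of_nat n) = (\<Sum>i<n. poly H (of_nat i))) &
  (H ~= 0 \<longrightarrow> degree S = Suc (degree H) & lead_coeff S * of_nat (Suc (degree H)) = lead_coeff H)"
proof (induction "degree H" arbitrary: H rule: less_induct)
 case less
 show ?case
 proof (cases "H = 0")
  case True then show ?thesis by (intro exI[of _ 0]) simp
 next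
  case False
  define d c where "d = degree H" and "c = lead_coeff H"
  define S0 where "S0 = monom (c / of_nat (Suc d)) (Suc d)"
  define \<Delta> where "\<Delta> = smult (c / of_nat (Suc d)) ([:1, 1:] ^ Suc d) - S0"
  have c: "c ~= 0" using False by (simp add: c_def)
  have evalD: "poly \<Delta> x = poly S0 (x + 1) - poly S0 x" for x
   by (simp add: \<Delta>_def S0_def poly_monom add.commute distrib_right)
  have coeffD: "coeff \<Delta> i = (if i \<le> d then c / of_nat (Suc d) * of_nat (Suc d choose i) else 0)" for i
  proof (cases "i \<le> Suc d")
   case True
   then show ?thesis unfolding \<Delta>_def S0_def
    by (auto simp: coeff_linear_poly_power le_Suc_eq simp del: power_Suc)
  next
   case False
   then have "coeff ([:1, 1:] ^ Suc d :: rat poly) i = 0"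
    by (intro coeff_eq_0) (simp add: degree_linear_power del: power_Suc)
   then show ?thesis using False unfolding \<Delta>_def S0_def by (simp del: power_Suc)
  qed
  define H1 where "H1 = H - \<Delta>"
  have "coeff \<Delta> d = c" by (simp add: coeffD)
  then have coeffH1: "coeff H1 i = 0" if "d \<le> i" for i
   using that by (cases "i = d") (auto simp: H1_def c_def d_def[symmetric] coeffD coeff_eq_0)
  have degH1: "H1 = 0 \<or> degree H1 < d"
   using coeffH1[of "degree H1"] by (cases "degree H1 < d") (auto simp: not_less)
  have "\<exists>S1. (\<forall>n. poly S1 (of_nat n) = (\<Sum>i<n. poly H1 (of_nat i))) & degree S1 \<le> d"
  proof (cases "H1 = 0")
   case True then show ?thesis by (intro exI[of _ 0]) simp
  next
   case F: False
   then have "degree H1 < degree H" using degH1 d_def by blast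
   from less[OF this] F show ?thesis using degH1 by auto
  qed
  then obtain S1 where S1: "\<And>n. poly S1 (of_nat n) = (\<Sum>i<n. poly H1 (of_nat i))" "degree S1 \<le> d" by blast
  have tel: "poly S0 (of_nat n) = (\<Sum>i<n. poly \<Delta> (of_nat i))" for n
   by (induction n) (simp_all add: evalD, simp_all add: S0_def poly_monom add.commute)
  have "poly (S0 + S1) (of_nat n) = (\<Sum>i<n. poly H (of_nat i))" for n
   by (simp add: tel S1 sum.distrib[symmetric] H1_def)
  moreover have degS0: "degree S0 = Suc d" using c by (simp add: S0_def degree_monom_eq)
  then have deg: "degree (S0 + S1) = Suc d" using S1(2) by (simp add: degree_add_eq_left)
  moreover have "coeff S1 (Suc d) = 0" using S1(2) by (simp add: coeff_eq_0)
  then have "lead_coeff (S0 + S1) * of_nat (Suc d) = c" unfolding deg using c by (simp add: S0_def)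
  ultimately show ?thesis unfolding d_def c_def by blast
 qed
qed

text \<open>The Hilbert polynomial, which here agrees with the Hilbert function everywhere, with degree
  \<open>d\<close> and normalised leading coefficient \<open>N\<close>.\<close>

definition hilbert_poly :: "'a::comm_monoid_add set \<Rightarrow> nat \<Rightarrow> nat \<Rightarrow> bool" where
 "hilbert_poly A d N \<longleftrightarrow> (\<exists>H :: rat poly. (\<forall>t. poly H (of_nat t) = of_nat (card (sumset t A))) &
   degree H = d & H ~= 0 & fact d * lead_coeff H = of_nat N)"

lemma cone_degree_toric:
 assumes "A \<subseteq> int_lattice m" "finite A" "hilbert_poly A d N"
 shows "cone_degree A (toric_variety m A) = N"
proof -
 obtain H :: "rat poly" where H: "\<And>t. poly H (of_nat t) = of_nat (card (sumset t A))"
  "degree H = d" "fact d * lead_coeff H = of_nat N" using assms(3) unfolding hilbert_poly_def by blast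
 show ?thesis unfolding cone_degree_def hilbert_function_toric[OF assms(1,2)]
 proof (rule the_equality)
  show "\<exists>H::rat poly. (\<forall>\<^sub>F t in sequentially. poly H (of_nat t) = of_nat (card (sumset t A))) &
    of_nat N = fact (degree H) * lead_coeff H" using H by (intro exI[of _ H]) simp
 next
  fix n assume "\<exists>H::rat poly. (\<forall>\<^sub>F t in sequentially. poly H (of_nat t) = of_nat (card (sumset t A))) &
    of_nat n = fact (degree H) * lead_coeff H"
  then obtain G :: "rat poly" where G: "\<forall>\<^sub>F t in sequentially. poly G (of_nat t) = of_nat (card (sumset t A))"
   "of_nat n = fact (degree G) * lead_coeff G" by blast
  obtain T where T: "\<And>t. t \<ge> T \<Longrightarrow> poly G (of_nat t) = of_nat (card (sumset t A))"
   using G(1) unfolding eventually_sequentially by blast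
  have "of_nat ` {T..} \<subseteq> {x. poly (G - H) x = 0}" using T H(1) by auto
  moreover have "infinite (of_nat ` {T..} :: rat set)"
   by (subst finite_image_iff) (auto simp: inj_on_def infinite_Ici)
  ultimately have "G = H" using poly_roots_finite[of "G - H"] finite_subset by auto
  then have "of_nat n = (of_nat N :: rat)" using G(2) H by simp
  then show "n = N" by simp
 qed
qed

lemma sumset_bipyramid:
 assumes "0 \<in> A"
 shows "sumset t (A \<union> {single m 1, single m (- 1)})
  = (\<Union>j\<in>{- int t..int t}. (\<lambda>x. x + single m j) ` sumset (t - nat \<bar>j\<bar>) A)"
proof (induction t)
 case (Suc t)
 let ?A = "A \<union> {single m 1, single m (- 1)}"
 let ?U = "\<lambda>t. \<Union>j\<in>{- int t..int t}. (\<lambda>x. x + single m j) ` sumset (t - nat \<bar>j\<bar>) A"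
 have UI: "x + single m j \<in> ?U s" if "\<bar>j\<bar> \<le> int s" "x \<in> sumset (s - nat \<bar>j\<bar>) A" for x j s
  using that by (intro UN_I[of j]) auto
 show ?case
 proof (intro set_eqI iffI)
  fix y assume "y \<in> sumset (Suc t) ?A"
  then obtain a z where "y = a + z" "a \<in> ?A" "z \<in> ?U t" using Suc.IH by auto
  then obtain x j where y: "y = a + (x + single m j)" and a: "a \<in> ?A"
   and j: "\<bar>j\<bar> \<le> int t" and x: "x \<in> sumset (t - nat \<bar>j\<bar>) A" by auto
  have pm: "x + single m j' \<in> ?U (Suc t)" if "\<bar>j' - j\<bar> = 1" for j'
  proof (rule UI)
   show "\<bar>j'\<bar> \<le> int (Suc t)" using that j by linarith
   have "t - nat \<bar>j\<bar> \<le> Suc t - nat \<bar>j'\<bar>" using that j by linarith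
   then show "x \<in> sumset (Suc t - nat \<bar>j'\<bar>) A" using sumset_mono[OF assms] x by blast
  qed
  consider "a \<in> A" | "a = single m 1" | "a = single m (- 1)" using a by blast
  then show "y \<in> ?U (Suc t)"
  proof cases
   case 1
   have "a + x \<in> sumset (Suc (t - nat \<bar>j\<bar>)) A" using 1 x by (rule sumset_SucI)
   moreover have "Suc (t - nat \<bar>j\<bar>) = Suc t - nat \<bar>j\<bar>" using j by linarith
   ultimately show ?thesis using UI[of j "Suc t" "a + x"] j y by (simp add: add.assoc)
  next
   case 2
   then have "y = x + single m (j + 1)" by (simp add: y single_add ac_simps)
   then show ?thesis using pm[of "j + 1"] by simp
  next
   case 3
   then have "y = x + single m (j - 1)" using y single_add[of m j "-1"] by (simp add: ac_simps)
   then show ?thesis using pm[of "j - 1"] by simp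
  qed
 next
  fix y assume "y \<in> ?U (Suc t)"
  then obtain x j where y: "y = x + single m j" and j: "\<bar>j\<bar> \<le> int (Suc t)"
   and x: "x \<in> sumset (Suc t - nat \<bar>j\<bar>) A" by auto
  consider "j = 0" | "j > 0" | "j < 0" by linarith
  then show "y \<in> sumset (Suc t) ?A"
  proof cases
   case 1
   then show ?thesis using x y sumset_mono_set[of A ?A "Suc t"] by (auto simp del: sumset.simps)
  next
   case 2
   then have "Suc t - nat \<bar>j\<bar> = t - nat \<bar>j - 1\<bar>" by linarith
   then have "x + single m (j - 1) \<in> sumset t ?A"
    unfolding Suc.IH using 2 j x by (intro UI) auto
   then have "single m 1 + (x + single m (j - 1)) \<in> sumset (Suc t) ?A"
    by (intro sumset_SucI) auto
   moreover have "single m 1 + (x + single m (j - 1)) = y"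
    using y single_add[of m 1 "j - 1"] by (simp add: ac_simps)
   ultimately show ?thesis by simp
  next
   case 3
   then have "Suc t - nat \<bar>j\<bar> = t - nat \<bar>j + 1\<bar>" by linarith
   then have "x + single m (j + 1) \<in> sumset t ?A"
    unfolding Suc.IH using 3 j x by (intro UI) auto
   then have "single m (- 1) + (x + single m (j + 1)) \<in> sumset (Suc t) ?A"
    by (intro sumset_SucI) auto
   moreover have "single m (- 1) + (x + single m (j + 1)) = y"
    using y single_add[of m "- 1" "j + 1"] by (simp add: ac_simps)
   ultimately show ?thesis by simp
  qed
 qed
qed simp

lemma sum_symmetric_interval:
 "(\<Sum>j\<in>{- int t..int t}. f (nat \<bar>j\<bar>)) = f 0 + 2 * (\<Sum>j<t. f (Suc j) :: nat)"
proof (induction t)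
 case (Suc t)
 have "{- int (Suc t)..int (Suc t)} = insert (int (Suc t)) (insert (- int (Suc t)) {- int t..int t})" by auto
 moreover have "nat (1 + int t) = Suc t" "nat (int t + 1) = Suc t" by auto
 ultimately show ?case using Suc by simp
qed simp

lemma card_sumset_bipyramid:
 assumes "0 \<in> A" "A \<subseteq> int_lattice m" "finite A"
 shows "card (sumset t (A \<union> {single m 1, single m (- 1)}))
  = card (sumset t A) + 2 * (\<Sum>i<t. card (sumset i A))"
proof -
 have m: "lookup x m = 0" if "x \<in> sumset s A" for x s
 proof -
  have "keys x \<subseteq> {..<m}"
   using sumset_int_lattice[OF assms(2), of s] that unfolding int_lattice_def by blast
  then show ?thesis by (auto simp: in_keys_iff subset_iff)
 qed
 have "card (sumset t (A \<union> {single m 1, single m (- 1)}))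
  = (\<Sum>j\<in>{- int t..int t}. card ((\<lambda>x. x + single m j) ` sumset (t - nat \<bar>j\<bar>) A))"
  unfolding sumset_bipyramid[OF assms(1)]
 proof (rule card_UN_disjoint)
  show "\<forall>i\<in>{- int t..int t}. \<forall>j\<in>{- int t..int t}. i ~= j \<longrightarrow>
    (\<lambda>x. x + single m i) ` sumset (t - nat \<bar>i\<bar>) A \<inter>
    (\<lambda>x. x + single m j) ` sumset (t - nat \<bar>j\<bar>) A = {}"
  proof (intro ballI impI, rule ccontr)
   fix i j :: int assume "i ~= j" and "(\<lambda>x. x + single m i) ` sumset (t - nat \<bar>i\<bar>) A \<inter>
    (\<lambda>x. x + single m j) ` sumset (t - nat \<bar>j\<bar>) A ~= {}"
   then obtain x y where xy: "x \<in> sumset (t - nat \<bar>i\<bar>) A" "y \<in> sumset (t - nat \<bar>j\<bar>) A"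
    and eq: "x + single m i = y + single m j" by auto
   have "lookup x m + i = lookup y m + j"
    using arg_cong[OF eq, of "\<lambda>z. lookup z m"] by (simp add: lookup_add)
   then show False using m[OF xy(1)] m[OF xy(2)] \<open>i ~= j\<close> by simp
  qed
 qed (use finite_sumset[OF assms(3)] in auto)
 also have "\<dots> = (\<Sum>j\<in>{- int t..int t}. card (sumset (t - nat \<bar>j\<bar>) A))"
  by (intro sum.cong refl card_image inj_onI) simp
 also have "\<dots> = card (sumset t A) + 2 * (\<Sum>j<t. card (sumset (t - Suc j) A))"
  using sum_symmetric_interval[of "\<lambda>j. card (sumset (t - j) A)" t] by simp
 finally show ?thesis by (simp add: sum.nat_diff_reindex[of "\<lambda>i. card (sumset i A)"])
qed

lemma hilbert_poly_bipyramid: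
 assumes "0 \<in> A" "A \<subseteq> int_lattice m" "finite A" "hilbert_poly A d N" "N > 0"
 shows "hilbert_poly (A \<union> {single m 1, single m (- 1)}) (Suc d) (2 * N)"
proof -
 obtain H :: "rat poly" where H: "\<And>t. poly H (of_nat t) = of_nat (card (sumset t A))"
  "degree H = d" "fact d * lead_coeff H = of_nat N" "H ~= 0" using assms(4) unfolding hilbert_poly_def by blast
 obtain S where S: "\<And>n. poly S (of_nat n) = (\<Sum>i<n. poly H (of_nat i))" "degree S = Suc d"
  "lead_coeff S * of_nat (Suc d) = lead_coeff H" using poly_antidifference[of H] H by blast
 have deg: "degree (H + smult 2 S) = Suc d" using S(2) H(2) by (subst degree_add_eq_right) auto
 have "coeff H (Suc d) = 0" using H(2) by (simp add: coeff_eq_0)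
 then have lc: "lead_coeff (H + smult 2 S) = 2 * lead_coeff S" unfolding deg using S(2) by simp
 have "fact (Suc d) * lead_coeff (H + smult 2 S) = 2 * (fact d * (lead_coeff S * of_nat (Suc d)))"
  unfolding lc by (simp add: algebra_simps)
 also have "\<dots> = of_nat (2 * N)" unfolding S(3) H(3) by simp
 finally have *: "fact (Suc d) * lead_coeff (H + smult 2 S) = of_nat (2 * N)" .
 show ?thesis unfolding hilbert_poly_def
 proof (intro exI[of _ "H + smult 2 S"] conjI allI)
  show "H + smult 2 S ~= 0" using deg by auto
  show "poly (H + smult 2 S) (of_nat t) = of_nat (card (sumset t (A \<union> {single m 1, single m (- 1)})))" for t
   unfolding card_sumset_bipyramid[OF assms(1-3)] by (simp add: H(1) S(1))
 qed (use deg * in simp_all)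
qed

section \<open>Score equations on the torus\<close>

definition laurent_sum :: "(nat \<Rightarrow>\<^sub>0 int) set \<Rightarrow> (nat \<Rightarrow> complex) \<Rightarrow> complex" where
 "laurent_sum A \<theta> = (\<Sum>a\<in>A. laurent_monomial \<theta> a)"

definition log_deriv :: "(nat \<Rightarrow>\<^sub>0 int) set \<Rightarrow> nat \<Rightarrow> (nat \<Rightarrow> complex) \<Rightarrow> complex" where
 "log_deriv A i \<theta> = (\<Sum>a\<in>A. of_int (lookup a i) * laurent_monomial \<theta> a)"

text \<open>The critical points of the likelihood function, for complex data.\<close>

definition critical_likelihood :: "nat \<Rightarrow> (nat \<Rightarrow>\<^sub>0 int) set \<Rightarrow> ((nat \<Rightarrow>\<^sub>0 int) \<Rightarrow> complex) \<Rightarrow> (nat \<Rightarrow> complex) set" where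
 "critical_likelihood m A u = {\<theta> \<in> torus m. laurent_sum A \<theta> ~= 0 &
   (\<forall>i<m. (\<Sum>a\<in>A. u a) * log_deriv A i \<theta> = (\<Sum>a\<in>A. of_int (lookup a i) * u a) * laurent_sum A \<theta>)}"

lemma laurent_eval_superset:
 assumes "finite S" "keys f \<subseteq> S"
 shows "laurent_eval f \<theta> = (\<Sum>a\<in>S. of_int (lookup f a) * laurent_monomial \<theta> a)"
 unfolding laurent_eval_def using assms by (intro sum.mono_neutral_left) (auto simp: in_keys_iff)

lemma laurent_eval_add: "laurent_eval (f + g) \<theta> = laurent_eval f \<theta> + laurent_eval g \<theta>"
proof -
 let ?S = "keys f \<union> keys g"
 have "keys (f + g) \<subseteq> ?S" by (rule Poly_Mapping.keys_add)
 then show ?thesis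
  by (simp add: laurent_eval_superset[of ?S] lookup_add distrib_right sum.distrib)
qed

lemma laurent_eval_sum: "laurent_eval (\<Sum>i\<in>I. f i) \<theta> = (\<Sum>i\<in>I. laurent_eval (f i) \<theta>)"
 by (induction I rule: infinite_finite_induct) (simp_all add: laurent_eval_add, simp_all add: laurent_eval_def)

lemma laurent_eval_single: "laurent_eval (single a c) \<theta> = of_int c * laurent_monomial \<theta> a"
 by (cases "c = 0") (simp_all add: laurent_eval_def)

lemma lookup_indicator_sum:
 "finite A \<Longrightarrow> lookup (\<Sum>a\<in>A. single a (1::int)) b = (if b \<in> A then 1 else 0)"
 by (simp add: lookup_sum lookup_single when_def if_distrib cong: if_cong)

lemma singularities_indicator:
 assumes "finite A" "A \<subseteq> int_lattice m"
 shows "singularities m (\<Sum>a\<in>A. single a 1)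
  = {\<theta> \<in> torus m. laurent_sum A \<theta> = 0 & (\<forall>i<m. log_deriv A i \<theta> = 0)}"
proof -
 let ?f = "\<Sum>a\<in>A. single a (1::int)"
 have keys: "keys ?f = A"
  by (auto simp: in_keys_iff lookup_indicator_sum[OF assms(1)] split: if_splits)
 have ev: "laurent_eval ?f \<theta> = laurent_sum A \<theta>" for \<theta>
  by (simp add: laurent_eval_sum laurent_eval_single laurent_sum_def)
 have "laurent_eval (laurent_pderiv i ?f) \<theta> = log_deriv A i \<theta> / \<theta> i" if "\<theta> \<in> torus m" "i < m" for \<theta> i
 proof -
  have mono: "laurent_monomial \<theta> (a - single i 1) = laurent_monomial \<theta> a / \<theta> i" if "a \<in> A" for a
  proof -
   have s: "a - single i 1 = a + single i (- 1)" by (simp add: single_uminus)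
   have "laurent_monomial \<theta> (a + single i (- 1)) = laurent_monomial \<theta> a * (1 / \<theta> i)"
    using laurent_monomial_add[of a m "single i (- 1)" \<theta>] assms(2) that \<open>i < m\<close> \<open>\<theta> \<in> torus m\<close>
    by (auto simp: power_int_minus inverse_eq_divide simp flip: single_uminus)
   then show ?thesis unfolding s by simp
  qed
  have "laurent_eval (laurent_pderiv i ?f) \<theta> = (\<Sum>a\<in>A. of_int (lookup a i) * (laurent_monomial \<theta> a / \<theta> i))"
   unfolding laurent_pderiv_def laurent_eval_sum keys laurent_eval_single
   by (intro sum.cong refl arg_cong2[of _ _ _ _ "(*)"] mono) (simp add: lookup_indicator_sum assms)
  then show ?thesis by (simp add: log_deriv_def sum_divide_distrib)
 qed
 then show ?thesis using torus_nonzero by (auto simp: singularities_def ev)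
qed

lemma powi_pos_neg_parts:
 "(x::complex) ~= 0 \<Longrightarrow> x powi b * x ^ nat (- b) = x ^ nat b"
 by (cases "b \<ge> 0") (simp_all add: power_int_def field_simps)

text \<open>The part of the toric variety in the torus is parametrised by the torus: with \<open>e\<^sub>i\<close> a sum of
  \<open>t\<^sub>i\<close> elements of \<open>A\<close>, the coordinate \<open>\<theta>\<^sub>i\<close> is a monomial of degree \<open>0\<close> in the coordinates of the point.\<close>

lemma toric_torus_point:
 assumes A: "A \<subseteq> int_lattice m" "0 \<in> A" "finite A"
  and gen: "\<And>i. i < m \<Longrightarrow> \<exists>t. single i 1 \<in> sumset t A"
  and p: "p \<in> toric_variety m A" "\<forall>a\<in>A. p a ~= 0"
 shows "\<exists>\<theta>\<in>torus m. \<forall>a\<in>A. p a = p 0 * laurent_monomial \<theta> a"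
proof -
 have "\<exists>e. i < m \<longrightarrow> keys e \<subseteq> A & wsum (\<lambda>a. a) e = single i 1" for i
  using gen sumset_iff_wsum by blast
 then obtain E where E: "\<And>i. i < m \<Longrightarrow> keys (E i) \<subseteq> A"
  "\<And>i. i < m \<Longrightarrow> wsum (\<lambda>a. a) (E i) = single i 1" by metis
 define \<theta> where "\<theta> = (\<lambda>i\<in>{..<m}. monomial (E i) p / p 0 ^ exp_degree (E i))"
 have p0: "p 0 ~= 0" using p A by blast
 have nz: "monomial (E i) p ~= 0" if "i < m" for i
  using E(1)[OF that] p(2) by auto
 have \<theta>: "\<theta> \<in> torus m" using nz p0 by (auto simp: \<theta>_def torus_def)
 have monE: "monomial (E i) p = \<theta> i * p 0 ^ exp_degree (E i)" if "i < m" for i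
  using that p0 by (simp add: \<theta>_def)
 have "p b = p 0 * laurent_monomial \<theta> b" if b: "b \<in> A" for b
 proof -
  have bm: "b \<in> int_lattice m" using b A by blast
  define ep en where "ep = (\<Sum>i<m. \<Sum>j<nat (lookup b i). E i)"
   and "en = (\<Sum>i<m. \<Sum>j<nat (- lookup b i). E i)"
  define e1 where "e1 = single b 1 + en + single 0 (exp_degree ep)"
  define e2 where "e2 = ep + single 0 (Suc (exp_degree en))"
  have wE: "wsum (\<lambda>a. a) (\<Sum>i<m. \<Sum>j<n i. E i) = (\<Sum>i<m. single i (int (n i)))" for n :: "nat \<Rightarrow> nat"
  proof -
   have "(\<Sum>j<k. single i (1::int)) = single i (int k)" for i :: nat and k :: nat
    by (induction k) (simp_all add: single_add[symmetric] add.commute del: sum_constant single_one)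
   then show ?thesis using E(2) by (simp add: wsum_sum del: sum_constant)
  qed
  have "b + (\<Sum>i<m. single i (int (nat (- lookup b i))))
    = (\<Sum>i<m. single i (int (nat (lookup b i))))"
  proof (rule poly_mapping_eqI)
   fix k
   have "lookup b k = 0" if "\<not> k < m"
    using bm that by (auto simp: int_lattice_def in_keys_iff)
   then show "lookup (b + (\<Sum>i<m. single i (int (nat (- lookup b i))))) k
     = lookup (\<Sum>i<m. single i (int (nat (lookup b i)))) k"
    by (cases "k < m") (auto simp: lookup_add lookup_sum lookup_single when_def)
  qed
  then have w: "wsum (\<lambda>a. a) e1 = wsum (\<lambda>a. a) e2"
   unfolding e1_def e2_def wsum_add ep_def en_def wE by simp
  have d: "exp_degree e1 = exp_degree e2"
   by (simp add: e1_def e2_def wsum_add)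
  have k: "keys ep \<subseteq> A" "keys en \<subseteq> A"
   using E(1) by (auto simp: ep_def en_def keys_sum_nat simp del: sum_constant)
  have keys: "keys e1 \<subseteq> A" "keys e2 \<subseteq> A"
   using k b A(2) by (auto simp: e1_def e2_def keys_add_nat split: if_splits)
  have "monomial e1 p = monomial e2 p" by (rule toric_binomial[OF A(1) p(1) keys d w])
  moreover have monn: "monomial (\<Sum>i<m. \<Sum>j<n i. E i) p
    = (\<Prod>i<m. \<theta> i ^ n i) * p 0 ^ exp_degree (\<Sum>i<m. \<Sum>j<n i. E i)" for n :: "nat \<Rightarrow> nat"
  proof -
   have "monomial (\<Sum>i<m. \<Sum>j<n i. E i) p = (\<Prod>i<m. (\<theta> i * p 0 ^ exp_degree (E i)) ^ n i)"
    using monE by (simp add: monomial_sum del: sum_constant)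
   also have "\<dots> = (\<Prod>i<m. \<theta> i ^ n i) * p 0 ^ (\<Sum>i<m. n i * exp_degree (E i))"
    by (simp add: power_mult_distrib prod.distrib power_sum power_mult[symmetric] mult.commute)
   also have "(\<Sum>i<m. n i * exp_degree (E i)) = exp_degree (\<Sum>i<m. \<Sum>j<n i. E i)"
    unfolding wsum_sum by simp
   finally show ?thesis .
  qed
  have zpow: "monomial (single 0 n) p = p 0 ^ n" for n by (cases "n = 0") auto
  have "monomial e1 p = p b * monomial en p * p 0 ^ exp_degree ep"
   unfolding e1_def monomial_add zpow by simp
  moreover have "monomial e2 p = monomial ep p * p 0 ^ Suc (exp_degree en)"
   unfolding e2_def monomial_add zpow by simp
  ultimately have "p b * ((\<Prod>i<m. \<theta> i ^ nat (- lookup b i)) * p 0 ^ exp_degree en) * p 0 ^ exp_degree ep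
    = ((\<Prod>i<m. \<theta> i ^ nat (lookup b i)) * p 0 ^ exp_degree ep) * p 0 ^ Suc (exp_degree en)"
   using monn[of "\<lambda>i. nat (- lookup b i)"] monn[of "\<lambda>i. nat (lookup b i)"]
   unfolding ep_def en_def by simp
  then have "p b * (\<Prod>i<m. \<theta> i ^ nat (- lookup b i))
    = p 0 * (\<Prod>i<m. \<theta> i ^ nat (lookup b i))"
   using p0 by simp
  also have "(\<Prod>i<m. \<theta> i ^ nat (lookup b i))
    = (\<Prod>i<m. \<theta> i powi lookup b i * \<theta> i ^ nat (- lookup b i))"
   using torus_nonzero[OF \<theta>] by (intro prod.cong refl powi_pos_neg_parts[symmetric]) auto
  also have "\<dots> = laurent_monomial \<theta> b * (\<Prod>i<m. \<theta> i ^ nat (- lookup b i))"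
   using bm by (simp add: laurent_monomial_eq prod.distrib)
  finally show ?thesis using torus_nonzero[OF \<theta>] by simp
 qed
 then show ?thesis using \<theta> by blast
qed

lemma critical_likelihood_score:
 assumes A: "A \<subseteq> int_lattice m" "0 \<in> A" "finite A"
  and gen: "\<And>i. i < m \<Longrightarrow> \<exists>t. single i 1 \<in> sumset t A"
  and u: "(\<Sum>a\<in>A. u a) ~= (0::nat)"
 shows "bij_betw (\<lambda>\<theta>. \<lambda>a\<in>A. 1 / laurent_sum A \<theta> * laurent_monomial \<theta> a)
  (critical_likelihood m A (\<lambda>a. of_nat (u a))) (score_solutions m A u)"
proof -
 let ?\<phi> = "\<lambda>\<theta>. \<lambda>a\<in>A. 1 / laurent_sum A \<theta> * laurent_monomial \<theta> a"
 have uc: "(\<Sum>a\<in>A. of_nat (u a)) = (of_nat (\<Sum>a\<in>A. u a) :: complex)" by simp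
 have u0: "(of_nat (\<Sum>a\<in>A. u a) :: complex) ~= 0" using u by (simp del: of_nat_sum)
 have sum0: "(\<Sum>a\<in>A. of_int (ext_design 0 a) * ?\<phi> \<theta> a) = laurent_sum A \<theta> / laurent_sum A \<theta>" for \<theta>
  by (simp add: ext_design_def laurent_sum_def sum_divide_distrib[symmetric])
 have sumS: "(\<Sum>a\<in>A. of_int (ext_design (Suc i) a) * ?\<phi> \<theta> a) = log_deriv A i \<theta> / laurent_sum A \<theta>" for \<theta> i
  by (simp add: ext_design_def log_deriv_def sum_divide_distrib[symmetric])
 have all_Suc: "(\<forall>j\<le>m. P j) \<longleftrightarrow> P 0 & (\<forall>i<m. P (Suc i))" for P :: "nat \<Rightarrow> bool"
  by (metis Suc_le_eq le0 not0_implies_Suc)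
 show ?thesis
 proof (rule bij_betw_imageI)
  show "inj_on ?\<phi> (critical_likelihood m A (\<lambda>a. of_nat (u a)))"
  proof (rule inj_onI)
   fix \<theta> \<theta>' assume 1: "\<theta> \<in> critical_likelihood m A (\<lambda>a. of_nat (u a))" "\<theta>' \<in> critical_likelihood m A (\<lambda>a. of_nat (u a))"
    and eq: "?\<phi> \<theta> = ?\<phi> \<theta>'"
   have t: "\<theta> \<in> torus m" "\<theta>' \<in> torus m" "laurent_sum A \<theta> ~= 0" "laurent_sum A \<theta>' ~= 0"
    using 1 by (auto simp: critical_likelihood_def)
   have eqa: "1 / laurent_sum A \<theta> * laurent_monomial \<theta> a = 1 / laurent_sum A \<theta>' * laurent_monomial \<theta>' a" if "a \<in> A" for a
    using fun_cong[OF eq, of a] that by simp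
   have "laurent_sum A \<theta> = laurent_sum A \<theta>'" using eqa[OF A(2)] t by simp
   then have mon: "laurent_monomial \<theta> a = laurent_monomial \<theta>' a" if "a \<in> A" for a
    using eqa[OF that] t by simp
   have "laurent_monomial \<theta> b = laurent_monomial \<theta>' b" if "b \<in> sumset t A" for b t
    using that
   proof (induction t arbitrary: b)
    case (Suc t)
    then obtain a c where "b = a + c" "a \<in> A" "c \<in> sumset t A" by auto
    moreover have "a \<in> int_lattice m" "c \<in> int_lattice m"
     using calculation sumset_int_lattice[OF A(1)] A(1) by auto
    ultimately show ?case using Suc.IH[of c] mon[of a] t by (simp add: laurent_monomial_add[of _ m])
   qed simp
   then have "\<theta> i = \<theta>' i" if "i < m" for i
    using gen[OF that] by (metis laurent_monomial_single power_int_1_right)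
   then show "\<theta> = \<theta>'" using t(1,2) PiE_ext[of \<theta> "{..<m}" _ \<theta>'] unfolding torus_def by blast
  qed
  show "?\<phi> ` critical_likelihood m A (\<lambda>a. of_nat (u a)) = score_solutions m A u"
  proof (intro set_eqI iffI)
   fix p assume "p \<in> ?\<phi> ` critical_likelihood m A (\<lambda>a. of_nat (u a))"
   then obtain \<theta> where p: "p = ?\<phi> \<theta>" and \<theta>: "\<theta> \<in> critical_likelihood m A (\<lambda>a. of_nat (u a))" by blast
   have t: "\<theta> \<in> torus m" "laurent_sum A \<theta> ~= 0" using \<theta> by (auto simp: critical_likelihood_def)
   have "p \<in> toric_variety m A" unfolding p using t by (intro toric_point) auto
   moreover have "\<forall>a\<in>A. p a ~= 0" using t laurent_monomial_nonzero A(1) by (auto simp: p)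
   moreover have "log_deriv A i \<theta> / laurent_sum A \<theta>
     = 1 / of_nat (\<Sum>a\<in>A. u a) * (\<Sum>a\<in>A. of_int (lookup a i) * of_nat (u a))" if "i < m" for i
    using \<theta> that u0 t(2) unfolding critical_likelihood_def uc by (simp add: field_simps del: of_nat_sum)
   moreover have "(\<Sum>a\<in>A. of_int (ext_design 0 a) * of_nat (u a)) = (of_nat (\<Sum>a\<in>A. u a) :: complex)"
    by (simp add: ext_design_def)
   then have "(\<Sum>a\<in>A. of_int (ext_design 0 a) * p a)
     = 1 / of_nat (\<Sum>a\<in>A. u a) * (\<Sum>a\<in>A. of_int (ext_design 0 a) * of_nat (u a))"
    unfolding p sum0 using t(2) u0 by (simp del: of_nat_sum)
   moreover have "(\<Sum>a\<in>A. of_int (ext_design (Suc i) a) * p a) = log_deriv A i \<theta> / laurent_sum A \<theta>" for i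
    unfolding p sumS ..
   moreover have "ext_design (Suc i) a = lookup a i" for i a by (simp add: ext_design_def)
   ultimately show "p \<in> score_solutions m A u"
    unfolding score_solutions_def all_Suc by simp
  next
   fix p assume "p \<in> score_solutions m A u"
   then have p: "p \<in> toric_variety m A" "\<forall>a\<in>A. p a ~= 0"
    and eq0: "(\<Sum>a\<in>A. of_int (ext_design 0 a) * p a) = 1 / of_nat (\<Sum>a\<in>A. u a) * (\<Sum>a\<in>A. of_int (ext_design 0 a) * of_nat (u a))"
    and eqS: "\<And>i. i < m \<Longrightarrow> (\<Sum>a\<in>A. of_int (ext_design (Suc i) a) * p a) =
     1 / of_nat (\<Sum>a\<in>A. u a) * (\<Sum>a\<in>A. of_int (ext_design (Suc i) a) * of_nat (u a))"
    unfolding score_solutions_def all_Suc by blast+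
   obtain \<theta> where \<theta>: "\<theta> \<in> torus m" "\<And>a. a \<in> A \<Longrightarrow> p a = p 0 * laurent_monomial \<theta> a"
    using toric_torus_point[OF A gen p] by blast
   have "p 0 * laurent_sum A \<theta> = (\<Sum>a\<in>A. p a)" using \<theta>(2) by (simp add: laurent_sum_def sum_distrib_left)
   also have "\<dots> = 1" using eq0 u0 by (simp add: ext_design_def del: of_nat_sum) (simp add: uc del: of_nat_sum)
   finally have F: "p 0 * laurent_sum A \<theta> = 1" .
   then have F0: "laurent_sum A \<theta> ~= 0" by auto
   with F have F1: "p 0 = 1 / laurent_sum A \<theta>" by (simp add: eq_divide_eq)
   have "p \<in> extensional A"
    using p(1) by (auto simp: toric_variety_def zariski_closure_def affine_space_def PiE_def)
   then have peq: "p = ?\<phi> \<theta>" using \<theta>(2) F1 by (intro ext) (auto simp: extensional_def)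
   have "\<theta> \<in> critical_likelihood m A (\<lambda>a. of_nat (u a))"
   proof -
    have "log_deriv A i \<theta> / laurent_sum A \<theta>
     = 1 / of_nat (\<Sum>a\<in>A. u a) * (\<Sum>a\<in>A. of_int (lookup a i) * of_nat (u a))" if "i < m" for i
     using eqS[OF that] unfolding peq sumS by (simp add: ext_design_def)
    then show ?thesis using \<theta>(1) F0 u0 unfolding critical_likelihood_def uc
     by (simp add: field_simps del: of_nat_sum)
   qed
   then show "p \<in> ?\<phi> ` critical_likelihood m A (\<lambda>a. of_nat (u a))" using peq by blast
  qed
 qed
qed

section \<open>Laurent polynomials in the plane\<close>

definition mono2 :: "complex \<times> complex \<Rightarrow> int \<times> int \<Rightarrow> complex" where
 "mono2 z a = fst z powi fst a * snd z powi snd a"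

definition torus2 :: "(complex \<times> complex) set" where
 "torus2 = {z. fst z ~= 0 & snd z ~= 0}"

definition plane_sum :: "(int \<times> int) set \<Rightarrow> complex \<times> complex \<Rightarrow> complex" where
 "plane_sum A z = (\<Sum>a\<in>A. mono2 z a)"

definition dlog1 :: "(int \<times> int) set \<Rightarrow> complex \<times> complex \<Rightarrow> complex" where
 "dlog1 A z = (\<Sum>a\<in>A. of_int (fst a) * mono2 z a)"

definition dlog2 :: "(int \<times> int) set \<Rightarrow> complex \<times> complex \<Rightarrow> complex" where
 "dlog2 A z = (\<Sum>a\<in>A. of_int (snd a) * mono2 z a)"

definition hess11 :: "(int \<times> int) set \<Rightarrow> complex \<times> complex \<Rightarrow> complex" where
 "hess11 A z = (\<Sum>a\<in>A. of_int (fst a * fst a) * mono2 z a)"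

definition hess12 :: "(int \<times> int) set \<Rightarrow> complex \<times> complex \<Rightarrow> complex" where
 "hess12 A z = (\<Sum>a\<in>A. of_int (fst a * snd a) * mono2 z a)"

definition hess22 :: "(int \<times> int) set \<Rightarrow> complex \<times> complex \<Rightarrow> complex" where
 "hess22 A z = (\<Sum>a\<in>A. of_int (snd a * snd a) * mono2 z a)"

definition hess :: "(int \<times> int) set \<Rightarrow> complex \<times> complex \<Rightarrow> complex" where
 "hess A z = hess11 A z * hess22 A z - hess12 A z ^ 2"

definition crit :: "(int \<times> int) set \<Rightarrow> (complex \<times> complex) set" where
 "crit A = {z \<in> torus2. dlog1 A z = 0 & dlog2 A z = 0}"

definition morse :: "(int \<times> int) set \<Rightarrow> nat \<Rightarrow> bool" where
 "morse A b \<longleftrightarrow> finite (crit A) & card (crit A) = b & (\<forall>z\<in>crit A. hess A z ~= 0)"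

text \<open>On the part of the torus where the logarithmic gradient is bounded, all monomials are bounded. As
  monomials with opposite exponents are inverse to each other, this confines a point to a compact part of the torus.\<close>

definition coercive :: "(int \<times> int) set \<Rightarrow> bool" where
 "coercive A \<longleftrightarrow> (\<exists>K. \<forall>z\<in>torus2. \<forall>a\<in>A. norm (mono2 z a) \<le> K * (1 + norm (dlog1 A z) + norm (dlog2 A z)))"

text \<open>Everything that the counting arguments use about the lattice points of a polygon of normalised area
  \<open>b\<close>: they generate the lattice, their sums are counted by the Ehrhart polynomial \<open>1 + b t (t + 1) / 2\<close>, and
  the sum of their monomials has \<open>b\<close> critical points, all nondegenerate. All parts are invariant
  under unimodular maps.\<close>

definition tame :: "(int \<times> int) set \<Rightarrow> nat \<Rightarrow> bool" where
 "tame A b \<longleftrightarrow> finite A & 0 \<in> A & (\<forall>v. \<exists>t. v \<in> sumset t A) &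
   (\<forall>t. 2 * card (sumset t A) = 2 + b * (t * (t + 1))) & 0 < b & morse A b & coercive A"

lemma mono2_nonzero: "z \<in> torus2 \<Longrightarrow> mono2 z a ~= 0"
 by (simp add: mono2_def torus2_def)

lemma mono2_add: "z \<in> torus2 \<Longrightarrow> mono2 z (a + b) = mono2 z a * mono2 z b"
 by (simp add: mono2_def torus2_def power_int_add)

lemma mono2_0 [simp]: "mono2 z 0 = 1" "mono2 z (0, 0) = 1"
 by (simp_all add: mono2_def)

subsection \<open>Change of lattice basis\<close>

definition lin :: "int \<Rightarrow> int \<Rightarrow> int \<Rightarrow> int \<Rightarrow> int \<times> int \<Rightarrow> int \<times> int" where
 "lin a b c d x = (a * fst x + b * snd x, c * fst x + d * snd x)"

lemma lin_add: "lin a b c d (x + y) = lin a b c d x + lin a b c d y"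
 by (simp add: lin_def algebra_simps)

lemma lin_inverse:
 assumes "\<bar>a * d - b * c\<bar> = 1"
 defines "\<delta> \<equiv> a * d - b * c"
 shows "lin (\<delta> * d) (- \<delta> * b) (- \<delta> * c) (\<delta> * a) (lin a b c d x) = x"
  "lin a b c d (lin (\<delta> * d) (- \<delta> * b) (- \<delta> * c) (\<delta> * a) x) = x"
proof -
 have "\<delta> = 1 \<or> \<delta> = - 1" using assms by linarith
 then have dd: "\<delta> * \<delta> = 1" by auto
 have "lin (\<delta> * d) (- \<delta> * b) (- \<delta> * c) (\<delta> * a) (lin a b c d x) = (\<delta> * (a * d - b * c) * fst x, \<delta> * (a * d - b * c) * snd x)"
  by (simp add: lin_def algebra_simps)
 then show "lin (\<delta> * d) (- \<delta> * b) (- \<delta> * c) (\<delta> * a) (lin a b c d x) = x"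
  unfolding \<delta>_def[symmetric] dd by simp
 have "lin a b c d (lin (\<delta> * d) (- \<delta> * b) (- \<delta> * c) (\<delta> * a) x) = (\<delta> * (a * d - b * c) * fst x, \<delta> * (a * d - b * c) * snd x)"
  by (simp add: lin_def algebra_simps)
 then show "lin a b c d (lin (\<delta> * d) (- \<delta> * b) (- \<delta> * c) (\<delta> * a) x) = x"
  unfolding \<delta>_def[symmetric] dd by simp
qed

lemma sumset_lin: "sumset t (lin a b c d ` A) = lin a b c d ` sumset t A"
proof (induction t)
 case 0 show ?case by (simp add: lin_def zero_prod_def)
next
 case (Suc t)
 show ?case
 proof (intro set_eqI iffI)
  fix x assume "x \<in> sumset (Suc t) (lin a b c d ` A)"
  then obtain u v where "x = lin a b c d u + lin a b c d v" "u \<in> A" "v \<in> sumset t A"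
   unfolding sumset.simps Suc by blast
  then show "x \<in> lin a b c d ` sumset (Suc t) A"
   using sumset_SucI[of u A v t] by (intro image_eqI[of _ _ "u + v"]) (simp_all only: lin_add)
 next
  fix x assume "x \<in> lin a b c d ` sumset (Suc t) A"
  then obtain u v where "x = lin a b c d (u + v)" "u \<in> A" "v \<in> sumset t A" by auto
  then show "x \<in> sumset (Suc t) (lin a b c d ` A)"
   unfolding lin_add using Suc by (auto intro!: sumset_SucI simp del: sumset.simps)
 qed
qed

definition torus_map :: "int \<Rightarrow> int \<Rightarrow> int \<Rightarrow> int \<Rightarrow> complex \<times> complex \<Rightarrow> complex \<times> complex" where
 "torus_map a b c d z = (mono2 z (a, c), mono2 z (b, d))"

lemma torus_map_torus: "z \<in> torus2 \<Longrightarrow> torus_map a b c d z \<in> torus2"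
 using mono2_nonzero[of z] by (simp add: torus_map_def torus2_def)

lemma mono2_lin:
 assumes "z \<in> torus2" shows "mono2 z (lin a b c d x) = mono2 (torus_map a b c d z) x"
 using assms
 by (simp add: mono2_def lin_def torus_map_def torus2_def power_int_add power_int_mult power_int_mult_distrib mult_ac)

lemma torus_map_inverse:
 assumes "z \<in> torus2" "\<And>x. lin a b c d (lin a' b' c' d' x) = x"
 shows "torus_map a' b' c' d' (torus_map a b c d z) = z"
proof -
 have "mono2 (torus_map a b c d z) x = mono2 z (lin a b c d x)" for x
  by (rule mono2_lin[OF assms(1), symmetric])
 moreover have "(a', c') = lin a' b' c' d' (1, 0)" "(b', d') = lin a' b' c' d' (0, 1)" by (simp_all add: lin_def)
 ultimately show ?thesis
  by (simp add: torus_map_def[of a' b' c' d'] assms(2)) (simp add: mono2_def prod_eq_iff)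
qed

theorem tame_lin:
 assumes "tame A n" "\<bar>a * d - b * c\<bar> = 1"
 shows "tame (lin a b c d ` A) n"
proof -
 define \<delta> where "\<delta> = a * d - b * c"
 define \<phi> where "\<phi> = lin a b c d"
 define \<psi> where "\<psi> = torus_map a b c d"
 have "\<delta> = 1 \<or> \<delta> = - 1" using assms(2) unfolding \<delta>_def by linarith
 then have dd: "\<delta> * \<delta> = 1" by auto
 have dc: "of_int \<delta> * of_int \<delta> = (1 :: complex)" using dd by (metis of_int_1 of_int_mult)
 have inv: "lin (\<delta> * d) (- \<delta> * b) (- \<delta> * c) (\<delta> * a) (\<phi> x) = x"
  "\<phi> (lin (\<delta> * d) (- \<delta> * b) (- \<delta> * c) (\<delta> * a) x) = x" for x
  using lin_inverse[OF assms(2)] by (simp_all add: \<delta>_def \<phi>_def)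
 have inj: "inj \<phi>" by (rule inj_on_inverseI[of _ "lin (\<delta> * d) (- \<delta> * b) (- \<delta> * c) (\<delta> * a)"]) (rule inv)
 have injS: "inj_on \<phi> S" for S using inj inj_on_subset by blast
 have A: "finite A" "0 \<in> A" "\<And>v. \<exists>t. v \<in> sumset t A" "\<And>t. 2 * card (sumset t A) = 2 + n * (t * (t + 1))"
  "0 < n" "morse A n" "coercive A" using assms(1) by (auto simp: tame_def)
 have sumset: "sumset t (\<phi> ` A) = \<phi> ` sumset t A" for t unfolding \<phi>_def by (rule sumset_lin)
 have torus: "\<psi> z \<in> torus2" if "z \<in> torus2" for z using that torus_map_torus by (simp add: \<psi>_def)
 have mono: "mono2 z (\<phi> x) = mono2 (\<psi> z) x" if "z \<in> torus2" for z x
  using mono2_lin[OF that] by (simp add: \<phi>_def \<psi>_def)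
 have fst\<phi>: "fst (\<phi> x) = a * fst x + b * snd x" and snd\<phi>: "snd (\<phi> x) = c * fst x + d * snd x" for x
  by (simp_all add: \<phi>_def lin_def)
 have d1: "dlog1 (\<phi> ` A) z = of_int a * dlog1 A (\<psi> z) + of_int b * dlog2 A (\<psi> z)" if "z \<in> torus2" for z
  by (simp add: dlog1_def dlog2_def sum.reindex[OF injS] mono[OF that] fst\<phi> sum_distrib_left sum.distrib[symmetric] algebra_simps)
 have d2: "dlog2 (\<phi> ` A) z = of_int c * dlog1 A (\<psi> z) + of_int d * dlog2 A (\<psi> z)" if "z \<in> torus2" for z
  by (simp add: dlog1_def dlog2_def sum.reindex[OF injS] mono[OF that] snd\<phi> sum_distrib_left sum.distrib[symmetric] algebra_simps)
 have D\<delta>: "of_int \<delta> = of_int a * of_int d - of_int b * (of_int c :: complex)" by (simp add: \<delta>_def)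
 have d1': "dlog1 A (\<psi> z) = of_int \<delta> * (of_int d * dlog1 (\<phi> ` A) z - of_int b * dlog2 (\<phi> ` A) z)" if "z \<in> torus2" for z
 proof -
  have "of_int d * dlog1 (\<phi> ` A) z - of_int b * dlog2 (\<phi> ` A) z = of_int \<delta> * dlog1 A (\<psi> z)"
   unfolding d1[OF that] d2[OF that] D\<delta> by (simp add: algebra_simps)
  then show ?thesis using dc by (simp add: mult.assoc[symmetric])
 qed
 have d2': "dlog2 A (\<psi> z) = of_int \<delta> * (of_int a * dlog2 (\<phi> ` A) z - of_int c * dlog1 (\<phi> ` A) z)" if "z \<in> torus2" for z
 proof -
  have "of_int a * dlog2 (\<phi> ` A) z - of_int c * dlog1 (\<phi> ` A) z = of_int \<delta> * dlog2 A (\<psi> z)"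
   unfolding d1[OF that] d2[OF that] D\<delta> by (simp add: algebra_simps)
  then show ?thesis using dc by (simp add: mult.assoc[symmetric])
 qed
 have h: "hess (\<phi> ` A) z = hess A (\<psi> z)" if "z \<in> torus2" for z
 proof -
  let ?p = "hess11 A (\<psi> z)" and ?q = "hess12 A (\<psi> z)" and ?r = "hess22 A (\<psi> z)"
  have 1: "hess11 (\<phi> ` A) z = of_int (a * a) * ?p + of_int (2 * a * b) * ?q + of_int (b * b) * ?r"
   by (simp add: hess11_def hess12_def hess22_def sum.reindex[OF injS] mono[OF that] fst\<phi> sum_distrib_left sum.distrib[symmetric] algebra_simps)
  have 2: "hess12 (\<phi> ` A) z = of_int (a * c) * ?p + of_int (a * d + b * c) * ?q + of_int (b * d) * ?r"
   by (simp add: hess11_def hess12_def hess22_def sum.reindex[OF injS] mono[OF that] fst\<phi> snd\<phi> sum_distrib_left sum.distrib[symmetric] algebra_simps)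
  have 3: "hess22 (\<phi> ` A) z = of_int (c * c) * ?p + of_int (2 * c * d) * ?q + of_int (d * d) * ?r"
   by (simp add: hess11_def hess12_def hess22_def sum.reindex[OF injS] mono[OF that] snd\<phi> sum_distrib_left sum.distrib[symmetric] algebra_simps)
  have "hess (\<phi> ` A) z = (of_int \<delta> * of_int \<delta>) * hess A (\<psi> z)"
   unfolding hess_def 1 2 3 D\<delta> by (simp add: algebra_simps power2_eq_square)
  then show ?thesis using dc by simp
 qed
 have crit: "z \<in> crit (\<phi> ` A) \<longleftrightarrow> z \<in> torus2 & \<psi> z \<in> crit A" for z
 proof (cases "z \<in> torus2")
  case True
  have "dlog1 (\<phi> ` A) z = 0 & dlog2 (\<phi> ` A) z = 0 \<longleftrightarrow> dlog1 A (\<psi> z) = 0 & dlog2 A (\<psi> z) = 0"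
  proof
   assume "dlog1 (\<phi> ` A) z = 0 & dlog2 (\<phi> ` A) z = 0"
   then show "dlog1 A (\<psi> z) = 0 & dlog2 A (\<psi> z) = 0" unfolding d1'[OF True] d2'[OF True] by simp
  next
   assume "dlog1 A (\<psi> z) = 0 & dlog2 A (\<psi> z) = 0"
   then show "dlog1 (\<phi> ` A) z = 0 & dlog2 (\<phi> ` A) z = 0" unfolding d1[OF True] d2[OF True] by simp
  qed
  then show ?thesis using True torus[OF True] unfolding crit_def by blast
 qed (simp add: crit_def)
 define \<psi>' where "\<psi>' = torus_map (\<delta> * d) (- \<delta> * b) (- \<delta> * c) (\<delta> * a)"
 have \<psi>1: "\<psi>' (\<psi> z) = z" if "z \<in> torus2" for z
  unfolding \<psi>_def \<psi>'_def by (rule torus_map_inverse[OF that]) (use inv in \<open>simp add: \<phi>_def\<close>)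
 have \<psi>2: "\<psi> (\<psi>' z) = z" if "z \<in> torus2" for z
  unfolding \<psi>_def \<psi>'_def by (rule torus_map_inverse[OF that]) (use inv in \<open>simp add: \<phi>_def\<close>)
 have torus': "\<psi>' z \<in> torus2" if "z \<in> torus2" for z using that torus_map_torus by (simp add: \<psi>'_def)
 have bij: "bij_betw \<psi> (crit (\<phi> ` A)) (crit A)"
 proof (rule bij_betw_byWitness[where f' = \<psi>'])
  show "\<forall>z\<in>crit (\<phi> ` A). \<psi>' (\<psi> z) = z" using crit \<psi>1 by blast
  show "\<forall>z\<in>crit A. \<psi> (\<psi>' z) = z" using \<psi>2 by (auto simp: crit_def)
  show "\<psi> ` crit (\<phi> ` A) \<subseteq> crit A" using crit by blast
  show "\<psi>' ` crit A \<subseteq> crit (\<phi> ` A)"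
  proof
   fix y assume "y \<in> \<psi>' ` crit A"
   then obtain z where z: "z \<in> crit A" "y = \<psi>' z" by blast
   then have "z \<in> torus2" by (simp add: crit_def)
   then show "y \<in> crit (\<phi> ` A)" unfolding crit using z torus' \<psi>2 by simp
  qed
 qed
 have "morse (\<phi> ` A) n"
 proof -
  have "hess (\<phi> ` A) z ~= 0" if "z \<in> crit (\<phi> ` A)" for z
  proof -
   have z: "z \<in> torus2" "\<psi> z \<in> crit A" using that crit by blast+
   then show ?thesis using A(6) h[OF z(1)] unfolding morse_def by simp
  qed
  then show ?thesis using A(6) bij_betw_finite[OF bij] bij_betw_same_card[OF bij]
   unfolding morse_def by simp
 qed
 moreover have "coercive (\<phi> ` A)"
 proof -
  obtain K where K: "\<And>z x. z \<in> torus2 \<Longrightarrow> x \<in> A \<Longrightarrow> norm (mono2 z x) \<le> K * (1 + norm (dlog1 A z) + norm (dlog2 A z))"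
   using A(7) unfolding coercive_def by blast
  define C where "C = real_of_int (1 + \<bar>a\<bar> + \<bar>b\<bar> + \<bar>c\<bar> + \<bar>d\<bar>)"
  have C: "C \<ge> 1" "\<bar>real_of_int a\<bar> + \<bar>real_of_int c\<bar> \<le> C" "\<bar>real_of_int b\<bar> + \<bar>real_of_int d\<bar> \<le> C"
   by (simp_all add: C_def)
  have \<delta>1: "\<bar>real_of_int \<delta>\<bar> = 1" using assms(2) unfolding \<delta>_def by linarith
  have "norm (mono2 z (\<phi> x)) \<le> (\<bar>K\<bar> * C) * (1 + norm (dlog1 (\<phi> ` A) z) + norm (dlog2 (\<phi> ` A) z))"
   if z: "z \<in> torus2" and x: "x \<in> A" for z x
  proof -
   let ?d1 = "norm (dlog1 (\<phi> ` A) z)" and ?d2 = "norm (dlog2 (\<phi> ` A) z)"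
   have n1: "norm (dlog1 A (\<psi> z)) \<le> \<bar>real_of_int d\<bar> * ?d1 + \<bar>real_of_int b\<bar> * ?d2"
    using norm_triangle_ineq4[of "of_int d * dlog1 (\<phi> ` A) z" "of_int b * dlog2 (\<phi> ` A) z"]
    unfolding d1'[OF z] by (simp only: norm_mult norm_of_int \<delta>1 mult_1_left)
   have n2: "norm (dlog2 A (\<psi> z)) \<le> \<bar>real_of_int a\<bar> * ?d2 + \<bar>real_of_int c\<bar> * ?d1"
    using norm_triangle_ineq4[of "of_int a * dlog2 (\<phi> ` A) z" "of_int c * dlog1 (\<phi> ` A) z"]
    unfolding d2'[OF z] by (simp only: norm_mult norm_of_int \<delta>1 mult_1_left)
   have "\<bar>real_of_int d\<bar> + \<bar>real_of_int c\<bar> \<le> C" "\<bar>real_of_int b\<bar> + \<bar>real_of_int a\<bar> \<le> C" by (simp_all add: C_def)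
   then have "(\<bar>real_of_int d\<bar> + \<bar>real_of_int c\<bar>) * ?d1 \<le> C * ?d1" "(\<bar>real_of_int b\<bar> + \<bar>real_of_int a\<bar>) * ?d2 \<le> C * ?d2"
    by (auto intro!: mult_right_mono)
   then have le: "1 + norm (dlog1 A (\<psi> z)) + norm (dlog2 A (\<psi> z)) \<le> C * (1 + ?d1 + ?d2)"
    using n1 n2 C(1) by (simp add: algebra_simps)
   have "norm (mono2 z (\<phi> x)) \<le> K * (1 + norm (dlog1 A (\<psi> z)) + norm (dlog2 A (\<psi> z)))"
    unfolding mono[OF z] by (rule K[OF torus[OF z] x])
   also have "\<dots> \<le> \<bar>K\<bar> * (1 + norm (dlog1 A (\<psi> z)) + norm (dlog2 A (\<psi> z)))" by (intro mult_right_mono) auto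
   also have "\<dots> \<le> \<bar>K\<bar> * (C * (1 + ?d1 + ?d2))" by (intro mult_left_mono le) auto
   finally show ?thesis by (simp add: mult.assoc)
  qed
  then show ?thesis unfolding coercive_def by blast
 qed
 moreover have "\<exists>t. v \<in> sumset t (\<phi> ` A)" for v
 proof -
  obtain t where "lin (\<delta> * d) (- \<delta> * b) (- \<delta> * c) (\<delta> * a) v \<in> sumset t A" using A(3) by blast
  then have "\<phi> (lin (\<delta> * d) (- \<delta> * b) (- \<delta> * c) (\<delta> * a) v) \<in> sumset t (\<phi> ` A)"
   unfolding sumset by (rule imageI)
  then show ?thesis unfolding inv(2) by blast
 qed
 moreover have "2 * card (sumset t (\<phi> ` A)) = 2 + n * (t * (t + 1))" for t
  unfolding sumset card_image[OF injS] by (rule A(4))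
 moreover have "0 \<in> \<phi> ` A" using A(2) by (intro image_eqI[of _ _ 0]) (simp_all add: \<phi>_def lin_def zero_prod_def)
 ultimately show ?thesis using A(1,5) unfolding tame_def \<phi>_def by simp
qed

subsection \<open>Coercivity\<close>

definition pairing :: "int \<times> int \<Rightarrow> int \<times> int \<Rightarrow> int" where
 "pairing w x = fst w * fst x + snd w * snd x"

lemma pairing_add: "pairing w (x + y) = pairing w x + pairing w y"
 by (simp add: pairing_def algebra_simps)

lemma pairing_0 [simp]: "pairing w 0 = 0" "pairing w (0, 0) = 0"
 by (simp_all add: pairing_def)

lemma pairing_sum: "pairing w (\<Sum>i\<in>I. f i) = (\<Sum>i\<in>I. pairing w (f i))"
 by (induction I rule: infinite_finite_induct) (simp_all add: pairing_add)

text \<open>\<open>A\<close> is the set of lattice points of a polygon with all edges at lattice distance \<open>1\<close> from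
  the origin, and every lattice point of a dilate is a sum of lattice points of the polygon.\<close>

definition normal_polygon :: "(int \<times> int) set \<Rightarrow> (int \<times> int) set \<Rightarrow> bool" where
 "normal_polygon A W \<longleftrightarrow> finite A & finite W & 0 \<in> A &
   (\<forall>t x. x \<in> sumset t A \<longleftrightarrow> (\<forall>w\<in>W. pairing w x \<le> int t))"

lemma normal_polygon_generates:
 assumes "normal_polygon A W" shows "\<exists>t. v \<in> sumset t A"
proof -
 have fin: "finite W" using assms by (simp add: normal_polygon_def)
 have "\<bar>pairing w v\<bar> \<le> (\<Sum>w\<in>W. \<bar>pairing w v\<bar>)" if "w \<in> W" for w
  using member_le_sum[OF that, of "\<lambda>w. \<bar>pairing w v\<bar>"] fin by simp
 then have "\<forall>w\<in>W. pairing w v \<le> int (nat (\<Sum>w\<in>W. \<bar>pairing w v\<bar>))" by (auto simp: abs_le_iff)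
 then show ?thesis using assms unfolding normal_polygon_def by blast
qed

lemma finite_convergent_subsequence:
 fixes p :: "nat \<Rightarrow> 'a \<Rightarrow> complex"
 assumes "finite A" "\<And>n a. a \<in> A \<Longrightarrow> norm (p n a) \<le> 1"
 shows "\<exists>r q. strict_mono r & (\<forall>a\<in>A. (\<lambda>n. p (r n) a) \<longlonglongrightarrow> q a)"
 using assms
proof (induction A rule: finite_induct)
 case empty
 show ?case using strict_mono_id by blast
next
 case (insert a A)
 then obtain r q where r: "strict_mono r" "\<forall>a\<in>A. (\<lambda>n. p (r n) a) \<longlonglongrightarrow> q a" by auto
 have "\<forall>n. p (r n) a \<in> cball 0 1" using insert.prems by simp
 then obtain l s where s: "strict_mono s" "((\<lambda>n. p (r n) a) \<circ> s) \<longlonglongrightarrow> l"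
  using compact_imp_seq_compact[OF compact_cball[of "0::complex" 1]] unfolding seq_compact_def by metis
 have "(\<lambda>n. p ((r \<circ> s) n) b) \<longlonglongrightarrow> (q(a := l)) b" if "b \<in> insert a A" for b
 proof (cases "b = a")
  case True then show ?thesis using s(2) by (simp add: o_def)
 next
  case False
  then have "(\<lambda>n. p (r n) b) \<longlonglongrightarrow> q b" using r(2) that by blast
  from LIMSEQ_subseq_LIMSEQ[OF this s(1)] show ?thesis using False by (simp add: o_def)
 qed
 then show ?case using strict_mono_o[OF r(1) s(1)] by blast
qed

lemma geometric_no_double_root:
 fixes t :: complex
 assumes "(\<Sum>k\<le>l. t ^ k) = 0" "(\<Sum>k\<le>l. of_nat k * t ^ k) = 0"
 shows False
proof -
 have "(t - 1) * (\<Sum>k\<le>l. of_nat k * t ^ k) = of_nat l * t ^ Suc l + 1 - (\<Sum>k\<le>l. t ^ k)"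
  by (induction l) (simp_all add: algebra_simps)
 moreover have "(t - 1) * (\<Sum>k\<le>l. t ^ k) = t ^ Suc l - 1"
  by (induction l) (simp_all add: algebra_simps)
 ultimately have "of_nat l * t ^ Suc l + 1 = 0" "t ^ Suc l = 1" using assms by simp_all
 then have "of_nat (Suc l) = (0 :: complex)" by (simp add: add.commute)
 then show False unfolding of_nat_eq_0_iff by simp
qed

lemma geometric_relations:
 fixes q :: "nat \<Rightarrow> complex"
 assumes rel: "\<And>i j i' j'. i \<le> l \<Longrightarrow> j \<le> l \<Longrightarrow> i' \<le> l \<Longrightarrow> j' \<le> l \<Longrightarrow> i + j = i' + j' \<Longrightarrow> q i * q j = q i' * q j'"
  and sums: "(\<Sum>k\<le>l. q k) = 0" "(\<Sum>k\<le>l. of_nat k * q k) = 0"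
  and "k \<le> l"
 shows "q k = 0"
proof -
 have q0: "q 0 = 0"
 proof (rule ccontr)
  assume nz: "q 0 ~= 0"
  define t where "t = q 1 / q 0"
  have geo: "q i = q 0 * t ^ i" if "i \<le> l" for i
   using that
  proof (induction i)
   case (Suc i)
   then have "q (Suc i) * q 0 = q i * q 1" by (intro rel) auto
   then have "q (Suc i) = q i * t" using nz by (simp add: t_def field_simps)
   then show ?case using Suc by simp
  qed simp
  have "(\<Sum>k\<le>l. q k) = (\<Sum>k\<le>l. q 0 * t ^ k)" by (intro sum.cong refl geo) simp
  then have "q 0 * (\<Sum>k\<le>l. t ^ k) = 0" using sums(1) by (simp add: sum_distrib_left)
  moreover have "(\<Sum>k\<le>l. of_nat k * q k) = (\<Sum>k\<le>l. of_nat k * (q 0 * t ^ k))"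
   by (intro sum.cong refl arg_cong2[of _ _ _ _ "(*)"] geo) simp
  then have "q 0 * (\<Sum>k\<le>l. of_nat k * t ^ k) = 0"
   using sums(2) by (simp add: sum_distrib_left mult.left_commute)
  ultimately show False using geometric_no_double_root[of t l] nz by simp
 qed
 have small: "q i = 0" if "i < l" for i
  using that
 proof (induction i)
  case (Suc i)
  then have "q (Suc i) * q (Suc i) = q i * q (Suc (Suc i))" by (intro rel) auto
  then show ?case using Suc by simp
 qed (use q0 in simp)
 have "(\<Sum>k\<le>l. q k) = q l" using small by (simp add: sum.remove[of "{..l}" l])
 then show ?thesis using sums(1) small \<open>k \<le> l\<close> by (cases "k = l") auto
qed

lemma norm_mono2_sumset:
 assumes "z \<in> torus2" "\<And>a. a \<in> A \<Longrightarrow> norm (mono2 z a) \<le> \<mu>" "x \<in> sumset t A" "0 \<le> \<mu>"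
 shows "norm (mono2 z x) \<le> \<mu> ^ t"
 using assms(3)
proof (induction t arbitrary: x)
 case (Suc t)
 then obtain a b where x: "x = a + b" "a \<in> A" "b \<in> sumset t A" by auto
 then show ?case using Suc.IH[of b] assms(2)[of a] assms(1,4)
  by (simp add: mono2_add norm_mult) (intro mult_mono; simp)
qed simp

theorem normal_polygon_coercive:
 assumes N: "normal_polygon A W"
 shows "coercive A"
proof (rule ccontr)
 assume "\<not> coercive A"
 have A: "finite A" "finite W" "0 \<in> A" "\<And>t x. x \<in> sumset t A \<longleftrightarrow> (\<forall>w\<in>W. pairing w x \<le> int t)"
  using N by (auto simp: normal_polygon_def)
 have A1: "x \<in> A \<longleftrightarrow> (\<forall>w\<in>W. pairing w x \<le> 1)" for x
  using A(4)[of x 1] unfolding sumset_1 by simp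
 have "\<exists>z\<in>torus2. \<exists>a\<in>A. norm (mono2 z a) > real n * (1 + norm (dlog1 A z) + norm (dlog2 A z))" for n
  using \<open>\<not> coercive A\<close> unfolding coercive_def by (meson not_le)
 then obtain Z where Z: "\<And>n. Z n \<in> torus2"
  "\<And>n. \<exists>a\<in>A. norm (mono2 (Z n) a) > real n * (1 + norm (dlog1 A (Z n)) + norm (dlog2 A (Z n)))" by metis
 define \<mu> where "\<mu> = (\<lambda>n. Max ((\<lambda>a. norm (mono2 (Z n) a)) ` A))"
 have \<mu>: "norm (mono2 (Z n) a) \<le> \<mu> n" if "a \<in> A" for n a
  unfolding \<mu>_def using A(1) that by (intro Max_ge) auto
 have \<mu>1: "\<mu> n \<ge> 1" for n using \<mu>[OF A(3), of n] by simp
 have \<mu>att: "\<exists>a\<in>A. norm (mono2 (Z n) a) = \<mu> n" for n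
 proof -
  have "\<mu> n \<in> (\<lambda>a. norm (mono2 (Z n) a)) ` A" unfolding \<mu>_def using A(1,3) by (intro Max_in) auto
  then show ?thesis by auto
 qed
 have \<mu>big: "real n * (1 + norm (dlog1 A (Z n)) + norm (dlog2 A (Z n))) \<le> \<mu> n" for n
  using Z(2)[of n] \<mu> by (meson less_le_trans less_imp_le)
 define p where "p = (\<lambda>n a. mono2 (Z n) a / of_real (\<mu> n))"
 have \<mu>pos: "\<mu> n > 0" for n using \<mu>1[of n] by linarith
 have np: "norm (p n a) = norm (mono2 (Z n) a) / \<mu> n" for n a using \<mu>pos[of n] by (simp add: p_def norm_divide)
 have p1: "norm (p n a) \<le> 1" if "a \<in> A" for n a
  using \<mu>[OF that, of n] \<mu>pos[of n] by (simp add: np)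
 obtain r q where r: "strict_mono r" and q: "\<And>a. a \<in> A \<Longrightarrow> (\<lambda>n. p (r n) a) \<longlonglongrightarrow> q a"
  using finite_convergent_subsequence[of A p] A(1) p1 by metis
 have rn: "real n \<le> real (r n)" for n using strict_mono_imp_increasing[OF r] by simp
 have big: "\<mu> (r n) \<ge> real n" for n
 proof -
  have "real n * 1 \<le> real (r n) * (1 + norm (dlog1 A (Z (r n))) + norm (dlog2 A (Z (r n))))"
   using rn[of n] by (intro mult_mono) auto
  then show ?thesis using \<mu>big[of "r n"] by simp
 qed
 have inv0: "(\<lambda>n. inverse (\<mu> (r n))) \<longlonglongrightarrow> 0"
 proof (rule tendsto_sandwich[OF _ _ tendsto_const lim_inverse_n])
  show "\<forall>\<^sub>F n in sequentially. inverse (\<mu> (r n)) \<le> inverse (real n)"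
   using eventually_gt_at_top[of 0] by eventually_elim (use big in \<open>auto intro!: le_imp_inverse_le\<close>)
 qed (use \<mu>pos in \<open>simp add: less_imp_le\<close>)
 have small: "(\<lambda>n. d (Z (r n)) / of_real (\<mu> (r n))) \<longlonglongrightarrow> 0"
  if d: "\<And>z. norm (d z) \<le> norm (dlog1 A z) + norm (dlog2 A z)" for d :: "complex \<times> complex \<Rightarrow> complex"
 proof (rule Lim_null_comparison[OF _ lim_inverse_n])
  show "\<forall>\<^sub>F n in sequentially. norm (d (Z (r n)) / of_real (\<mu> (r n))) \<le> inverse (real n)"
   using eventually_gt_at_top[of 0]
  proof eventually_elim
   case (elim n)
   have "real n * norm (d (Z (r n))) \<le> real (r n) * (1 + norm (dlog1 A (Z (r n))) + norm (dlog2 A (Z (r n))))"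
    using rn[of n] d[of "Z (r n)"] by (intro mult_mono) auto
   also have "\<dots> \<le> \<mu> (r n)" by (rule \<mu>big)
   finally show ?case using elim \<mu>pos[of "r n"] by (simp add: norm_divide field_simps)
  qed
 qed
 have lim: "(\<lambda>n. \<Sum>a\<in>A. of_int (c a) * p (r n) a) \<longlonglongrightarrow> (\<Sum>a\<in>A. of_int (c a) * q a)" for c :: "int \<times> int \<Rightarrow> int"
  using q by (intro tendsto_sum tendsto_mult tendsto_const)
 have sum_p: "(\<Sum>a\<in>A. of_int (c a) * p n a) = (\<Sum>a\<in>A. of_int (c a) * mono2 (Z n) a) / of_real (\<mu> n)" for c :: "int \<times> int \<Rightarrow> int" and n
  by (simp add: p_def sum_divide_distrib)
 have s1: "(\<Sum>a\<in>A. of_int (fst a) * q a) = 0"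
  using LIMSEQ_unique[OF lim[of fst]] small[of "dlog1 A"] by (simp add: sum_p dlog1_def)
 have s2: "(\<Sum>a\<in>A. of_int (snd a) * q a) = 0"
  using LIMSEQ_unique[OF lim[of snd]] small[of "dlog2 A"] by (simp add: sum_p dlog2_def)
 define S where "S = {a \<in> A. q a ~= 0}"
 have finS: "finite S" "S \<subseteq> A" using A(1) by (auto simp: S_def)
 have "S ~= {}"
 proof
  assume "S = {}"
  then have "(\<lambda>n. \<Sum>a\<in>A. norm (p (r n) a)) \<longlonglongrightarrow> (\<Sum>a\<in>A. norm (0::complex))"
   using q by (intro tendsto_sum tendsto_norm) (auto simp: S_def)
  moreover have "(\<Sum>a\<in>A. norm (p (r n) a)) \<ge> 1" for n
  proof -
   obtain a where "a \<in> A" "norm (p (r n) a) = 1" using \<mu>att[of "r n"] \<mu>pos[of "r n"] by (auto simp: np)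
   then show ?thesis using member_le_sum[of a A "\<lambda>a. norm (p (r n) a)"] A(1) by simp
  qed
  ultimately have "1 \<le> (\<Sum>a\<in>A. norm (0::complex))" by (intro LIMSEQ_le_const) auto
  then show False by simp
 qed
 \<comment> \<open>If no edge contained the whole support of the limit, the sum of the support would be a sum of
  fewer lattice points, so the product of the limits would vanish.\<close>
 have "\<exists>w\<in>W. \<forall>a\<in>S. pairing w a = 1"
 proof (rule ccontr)
  assume no: "\<not> ?thesis"
  define s where "s = (\<Sum>a\<in>S. a)"
  define t where "t = card S - 1"
  have cS: "card S = Suc t" using \<open>S ~= {}\<close> finS by (simp add: t_def card_gt_0_iff)
  have "pairing w s \<le> int t" if w: "w \<in> W" for w
  proof -
   obtain a where a: "a \<in> S" "pairing w a ~= 1" using no w by blast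
   have le: "pairing w b \<le> 1" if "b \<in> S" for b using that finS A1 w by blast
   have "pairing w s = pairing w a + (\<Sum>b\<in>S - {a}. pairing w b)"
    unfolding s_def pairing_sum using finS a by (simp add: sum.remove)
   also have "pairing w a \<le> 0" using le[OF a(1)] a(2) by linarith
   also have "(\<Sum>b\<in>S - {a}. pairing w b) \<le> (\<Sum>b\<in>S - {a}. 1)" using le by (intro sum_mono) blast
   also have "0 + (\<Sum>b\<in>S - {a}. 1) = int t" using finS a cS by simp
   finally show ?thesis by simp
  qed
  then have "s \<in> sumset t A" using A(4) by blast
  then have bound: "norm (mono2 (Z n) s) \<le> \<mu> n ^ t" for n
   using \<mu> by (intro norm_mono2_sumset[OF Z(1)]) (use \<mu>pos[of n] in auto)
  have ms: "(\<Prod>a\<in>S. mono2 z a) = mono2 z s" if "z \<in> torus2" for z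
   unfolding s_def using finS(1) that by (induction S rule: finite_induct) (simp_all add: mono2_add)
  have "norm (\<Prod>a\<in>S. p n a) \<le> inverse (\<mu> n)" for n
  proof -
   have "(\<Prod>a\<in>S. p n a) = mono2 (Z n) s / of_real (\<mu> n) ^ Suc t"
    using ms[OF Z(1)] finS cS by (simp add: p_def prod_dividef)
   then have "norm (\<Prod>a\<in>S. p n a) = norm (mono2 (Z n) s) / \<mu> n ^ Suc t"
    using \<mu>pos[of n] by (simp add: norm_divide norm_mult norm_power)
   also have "\<dots> \<le> \<mu> n ^ t / \<mu> n ^ Suc t" using bound \<mu>pos[of n] by (intro divide_right_mono) auto
   finally show ?thesis using \<mu>pos[of n] by (simp add: inverse_eq_divide)
  qed
  then have "(\<lambda>n. \<Prod>a\<in>S. p (r n) a) \<longlonglongrightarrow> 0"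
   by (intro Lim_null_comparison[OF _ inv0] always_eventually) auto
  moreover have "(\<lambda>n. \<Prod>a\<in>S. p (r n) a) \<longlonglongrightarrow> (\<Prod>a\<in>S. q a)"
   using q finS by (intro tendsto_prod) auto
  ultimately have "(\<Prod>a\<in>S. q a) = 0" using LIMSEQ_unique by blast
  then show False using finS by (auto simp: S_def)
 qed
 then obtain w where w: "w \<in> W" "\<And>a. a \<in> S \<Longrightarrow> pairing w a = 1" by blast
 define E where "E = {a \<in> A. pairing w a = 1}"
 have finE: "finite E" using A(1) by (simp add: E_def)
 have SE: "S \<subseteq> E" using w finS by (auto simp: E_def)
 obtain e where e: "e \<in> E" using SE \<open>S ~= {}\<close> by blast
 define pt where "pt = (\<lambda>k. e + (- snd w * k, fst w * k))"
 have pw: "pairing w (pt k) = 1" for k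
  using e by (simp add: pt_def E_def pairing_def plus_prod_def algebra_simps)
 have on_line: "\<exists>k. a = pt k" if "a \<in> E" for a
 proof -
  define k where "k = fst e * (snd a - snd e) - snd e * (fst a - fst e)"
  have we: "fst w * fst e + snd w * snd e = 1" using e by (simp add: E_def pairing_def)
  have "fst w * fst a + snd w * snd a = 1" using that by (simp add: E_def pairing_def)
  then have wd: "fst w * (fst a - fst e) + snd w * (snd a - snd e) = 0" using we by (simp add: algebra_simps)
  have "fst a - fst e = (fst w * fst e + snd w * snd e) * (fst a - fst e)" using we by simp
  also have "\<dots> = fst e * (fst w * (fst a - fst e)) + snd w * snd e * (fst a - fst e)" by (simp add: algebra_simps)
  also have "fst w * (fst a - fst e) = - (snd w * (snd a - snd e))" using wd by linarith
  finally have 1: "fst a = fst e + - snd w * k" by (simp add: k_def algebra_simps)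
  have "snd a - snd e = (fst w * fst e + snd w * snd e) * (snd a - snd e)" using we by simp
  also have "\<dots> = snd e * (snd w * (snd a - snd e)) + fst w * fst e * (snd a - snd e)" by (simp add: algebra_simps)
  also have "snd w * (snd a - snd e) = - (fst w * (fst a - fst e))" using wd by linarith
  finally have 2: "snd a = snd e + fst w * k" by (simp add: k_def algebra_simps)
  show ?thesis using 1 2 by (intro exI[of _ k]) (simp add: pt_def prod_eq_iff)
 qed
 have pt_inj: "inj pt"
 proof (rule injI)
  fix i j assume "pt i = pt j"
  then have "snd w * i = snd w * j" "fst w * i = fst w * j" by (auto simp: pt_def)
  moreover have "w ~= (0, 0)" using e by (auto simp: E_def pairing_def)
  ultimately show "i = j" by (cases w) auto
 qed
 define K where "K = {k. pt k \<in> E}"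
 have "E = pt ` K"
 proof (intro set_eqI iffI)
  fix a assume "a \<in> E"
  then show "a \<in> pt ` K" using on_line[of a] unfolding K_def by blast
 qed (auto simp: K_def)
 then have finK: "finite K" using finE finite_imageD[of pt K] pt_inj inj_on_subset[of pt UNIV K] by auto
 have "0 \<in> K" using e by (simp add: K_def pt_def zero_prod_def[symmetric])
 have convK: "k \<in> K" if "i \<in> K" "j \<in> K" "i \<le> k" "k \<le> j" for i j k
 proof -
  have "pairing v (pt k) \<le> 1" if v: "v \<in> W" for v
  proof -
   have lin: "pairing v (pt k) = pairing v e + (snd v * fst w - fst v * snd w) * k" for k
    by (simp add: pt_def pairing_def plus_prod_def algebra_simps)
   have "pairing v (pt i) \<le> 1" "pairing v (pt j) \<le> 1"
    using \<open>i \<in> K\<close> \<open>j \<in> K\<close> v A1 by (auto simp: K_def E_def)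
   moreover have "(snd v * fst w - fst v * snd w) * k \<le> (snd v * fst w - fst v * snd w) * j \<or>
     (snd v * fst w - fst v * snd w) * k \<le> (snd v * fst w - fst v * snd w) * i"
    using \<open>i \<le> k\<close> \<open>k \<le> j\<close> by (cases "0 \<le> snd v * fst w - fst v * snd w")
     (auto intro: mult_left_mono mult_left_mono_neg)
   ultimately show ?thesis unfolding lin by linarith
  qed
  then show ?thesis using A1 pw by (simp add: K_def E_def)
 qed
 define k0 l where "k0 = Min K" and "l = nat (Max K - Min K)"
 have K0: "Min K \<in> K" "Max K \<in> K" "\<And>k. k \<in> K \<Longrightarrow> Min K \<le> k & k \<le> Max K"
  using finK \<open>0 \<in> K\<close> by (auto intro: Min_in Max_in)
 have "Min K \<le> Max K" using K0 by blast
 then have K_eq: "K = (\<lambda>i. k0 + int i) ` {..l}"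
 proof (intro set_eqI iffI)
  fix k assume "k \<in> K"
  then have "k = k0 + int (nat (k - k0))" "nat (k - k0) \<le> l"
   using K0(3)[of k] \<open>Min K \<le> Max K\<close> by (auto simp: k0_def l_def)
  then show "k \<in> (\<lambda>i. k0 + int i) ` {..l}" by blast
 next
  fix k assume "k \<in> (\<lambda>i. k0 + int i) ` {..l}"
  then show "k \<in> K" using convK[OF K0(1,2)] \<open>Min K \<le> Max K\<close> by (auto simp: k0_def l_def)
 qed
 define Q where "Q = (\<lambda>i. q (pt (k0 + int i)))"
 have ptE: "pt (k0 + int i) \<in> E" if "i \<le> l" for i
  using that K_eq by (auto simp: K_def)
 then have ptA: "pt (k0 + int i) \<in> A" if "i \<le> l" for i
  using that by (auto simp: E_def)
 have E_eq: "E = (\<lambda>i. pt (k0 + int i)) ` {..l}" using \<open>E = pt ` K\<close> K_eq by (auto simp: image_image)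
 have inj_i: "inj_on (\<lambda>i. pt (k0 + int i)) {..l}"
  using pt_inj by (auto intro!: inj_onI dest: injD)
 have sumE: "(\<Sum>a\<in>A. c a * q a) = (\<Sum>i\<le>l. c (pt (k0 + int i)) * Q i)" for c
 proof -
  have "(\<Sum>a\<in>A. c a * q a) = (\<Sum>a\<in>E. c a * q a)"
   using A(1) SE by (intro sum.mono_neutral_right) (auto simp: E_def S_def)
  then show ?thesis unfolding E_eq sum.reindex[OF inj_i] by (simp add: Q_def o_def)
 qed
 have fstpt: "fst (pt k) = fst e - snd w * k" and sndpt: "snd (pt k) = snd e + fst w * k" for k
  by (simp_all add: pt_def)
 have rel: "Q i * Q j = Q i' * Q j'" if "i \<le> l" "j \<le> l" "i' \<le> l" "j' \<le> l" "i + j = i' + j'" for i j i' j'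
 proof -
  have eq: "pt (k0 + int i) + pt (k0 + int j) = pt (k0 + int i') + pt (k0 + int j')"
  proof -
   have "int i + int j = int i' + int j'" using that(5) by linarith
   then have "(k0 + int i) + (k0 + int j) = (k0 + int i') + (k0 + int j')" by linarith
   then have "x * (k0 + int i) + x * (k0 + int j) = x * (k0 + int i') + x * (k0 + int j')" for x
    by (metis distrib_left)
   from this[of "fst w"] this[of "snd w"] show ?thesis by (simp add: prod_eq_iff fstpt sndpt algebra_simps)
  qed
  have "p n (pt (k0 + int i)) * p n (pt (k0 + int j)) = p n (pt (k0 + int i')) * p n (pt (k0 + int j'))" for n
   using mono2_add[OF Z(1)[of n], of "pt (k0 + int i)" "pt (k0 + int j)"]
    mono2_add[OF Z(1)[of n], of "pt (k0 + int i')" "pt (k0 + int j')"] eq by (simp add: p_def)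
  moreover have "(\<lambda>n. p (r n) (pt (k0 + int i)) * p (r n) (pt (k0 + int j))) \<longlonglongrightarrow> Q i * Q j"
   unfolding Q_def using q ptA that by (intro tendsto_mult) auto
  moreover have "(\<lambda>n. p (r n) (pt (k0 + int i')) * p (r n) (pt (k0 + int j'))) \<longlonglongrightarrow> Q i' * Q j'"
   unfolding Q_def using q ptA that by (intro tendsto_mult) auto
  ultimately show ?thesis using LIMSEQ_unique by auto
 qed
 have f1: "(\<Sum>i\<le>l. of_int (fst e - snd w * (k0 + int i)) * Q i) = 0"
  using s1 sumE[of "\<lambda>a. of_int (fst a)"] by (simp only: fstpt)
 have f2: "(\<Sum>i\<le>l. of_int (snd e + fst w * (k0 + int i)) * Q i) = 0"
  using s2 sumE[of "\<lambda>a. of_int (snd a)"] by (simp only: sndpt)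
 have we: "fst w * fst e + snd w * snd e = 1" using e by (simp add: E_def pairing_def)
 have comb: "(\<Sum>i\<le>l. of_int (\<alpha> * (fst e - snd w * (k0 + int i)) + \<beta> * (snd e + fst w * (k0 + int i))) * Q i) = 0" for \<alpha> \<beta>
 proof -
  have "(\<Sum>i\<le>l. of_int (\<alpha> * (fst e - snd w * (k0 + int i)) + \<beta> * (snd e + fst w * (k0 + int i))) * Q i)
   = of_int \<alpha> * (\<Sum>i\<le>l. of_int (fst e - snd w * (k0 + int i)) * Q i) + of_int \<beta> * (\<Sum>i\<le>l. of_int (snd e + fst w * (k0 + int i)) * Q i)"
   by (simp add: sum_distrib_left sum.distrib[symmetric] distrib_right mult.assoc del: of_int_diff)
  then show ?thesis unfolding f1 f2 by simp
 qed
 have "fst w * (fst e - snd w * k) + snd w * (snd e + fst w * k) = 1" for k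
  using we by (simp add: algebra_simps)
 then have sum0: "(\<Sum>i\<le>l. Q i) = 0" using comb[of "fst w" "snd w"] by simp
 have "- snd e * (fst e - snd w * k) + fst e * (snd e + fst w * k) = (fst w * fst e + snd w * snd e) * k" for k
  by (simp add: algebra_simps)
 then have "(\<Sum>i\<le>l. of_int (k0 + int i) * Q i) = 0" using comb[of "- snd e" "fst e"] we by simp
 then have "of_int k0 * (\<Sum>i\<le>l. Q i) + (\<Sum>i\<le>l. of_nat i * Q i) = 0"
  by (simp add: sum_distrib_left sum.distrib[symmetric] distrib_right)
 then have sum1: "(\<Sum>i\<le>l. of_nat i * Q i) = 0" using sum0 by simp
 have "Q i = 0" if "i \<le> l" for i by (rule geometric_relations[OF rel sum0 sum1 that])
 then have "q a = 0" if "a \<in> E" for a using that E_eq by (auto simp: Q_def)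
 then show False using \<open>S ~= {}\<close> SE by (auto simp: S_def)
qed

subsection \<open>The normal forms\<close>

text \<open>A point of the dilate by \<open>T + 1\<close> is moved into the dilate by \<open>T\<close> by subtracting a
  suitable element of \<open>A\<close>. So integral decomposition is decided by a finite check.\<close>

lemma normal_polygonI:
 assumes "finite A" "finite W" "0 \<in> A" "\<And>a w. a \<in> A \<Longrightarrow> w \<in> W \<Longrightarrow> pairing w a \<le> 1"
  and zero: "\<And>x y. (\<And>w. w \<in> W \<Longrightarrow> pairing w (x, y) \<le> 0) \<Longrightarrow> x = 0 & y = 0"
  and step: "\<And>T x y. 0 \<le> T \<Longrightarrow> (\<And>w. w \<in> W \<Longrightarrow> pairing w (x, y) \<le> T + 1) \<Longrightarrow>
   \<exists>u v. (u, v) \<in> A & (\<forall>w\<in>W. pairing w (x - u, y - v) \<le> T)"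
 shows "normal_polygon A W"
proof -
 have "x \<in> sumset t A \<longleftrightarrow> (\<forall>w\<in>W. pairing w x \<le> int t)" for t x
 proof (induction t arbitrary: x)
  case 0
  show ?case using zero[of "fst x" "snd x"] by (cases x) (auto simp: zero_prod_def)
 next
  case (Suc t)
  show ?case
  proof
   assume "x \<in> sumset (Suc t) A"
   then obtain a b where "x = a + b" "a \<in> A" "b \<in> sumset t A" by auto
   then show "\<forall>w\<in>W. pairing w x \<le> int (Suc t)"
    using Suc.IH[of b] assms(4)[of a] by (fastforce simp: pairing_add)
  next
   assume "\<forall>w\<in>W. pairing w x \<le> int (Suc t)"
   then obtain u v where uv: "(u, v) \<in> A" "\<forall>w\<in>W. pairing w (fst x - u, snd x - v) \<le> int t"
    using step[of "int t" "fst x" "snd x"] by (auto simp: add.commute)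
   then have "(fst x - u, snd x - v) \<in> sumset t A" using Suc.IH by blast
   from sumset_SucI[OF uv(1) this] show "x \<in> sumset (Suc t) A" by (simp del: sumset.simps)
  qed
 qed
 then show ?thesis using assms(1-3) by (simp add: normal_polygon_def)
qed

lemma tameI:
 assumes "normal_polygon A W" "\<And>t. 2 * card (sumset t A) = 2 + b * (t * (t + 1))" "0 < b" "morse A b"
 shows "tame A b"
 using assms normal_polygon_generates[OF assms(1)] normal_polygon_coercive[OF assms(1)]
 by (simp add: tame_def normal_polygon_def)

lemma card_rows:
 fixes L R :: "int \<Rightarrow> int"
 assumes "\<And>y. a \<le> y \<Longrightarrow> y \<le> b \<Longrightarrow> L y \<le> R y + 1"
 shows "int (card {(x, y). a \<le> y & y \<le> b & L y \<le> x & x \<le> R y}) = (\<Sum>y\<in>{a..b}. R y - L y + 1)"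
proof -
 have "{(x, y). a \<le> y & y \<le> b & L y \<le> x & x \<le> R y} = prod.swap ` (SIGMA y:{a..b}. {L y..R y})" by auto
 then have "card {(x, y). a \<le> y & y \<le> b & L y \<le> x & x \<le> R y} = card (SIGMA y:{a..b}. {L y..R y})"
  by (simp add: card_image)
 also have "\<dots> = (\<Sum>y\<in>{a..b}. nat (R y - L y + 1))" by (simp add: card_SigmaI add.commute)
 finally have "int (card {(x, y). a \<le> y & y \<le> b & L y \<le> x & x \<le> R y}) = (\<Sum>y\<in>{a..b}. int (nat (R y - L y + 1)))"
  by (simp only: of_nat_sum)
 also have "\<dots> = (\<Sum>y\<in>{a..b}. R y - L y + 1)" using assms by (intro sum.cong) fastforce+
 finally show ?thesis .
qed

lemma sum_linear: "2 * (\<Sum>y\<in>{1..int n}. c + e * y) = int n * (2 * c + e * (int n + 1))"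
proof (induction n)
 case (Suc n)
 have "{1..int (Suc n)} = insert (int (Suc n)) {1..int n}" by auto
 then show ?case using Suc by (simp add: algebra_simps)
qed simp

lemma sum_split_sign:
 "(\<Sum>y\<in>{- int m..int n}. f y) = f 0 + (\<Sum>y\<in>{1..int n}. f y) + (\<Sum>y\<in>{1..int m}. f (- y) :: int)"
proof -
 have "{- int m..int n} = ({0} \<union> {1..int n}) \<union> uminus ` {1..int m}"
  by (auto simp: image_iff)
 moreover have "sum f (({0} \<union> {1..int n}) \<union> uminus ` {1..int m}) = sum f ({0} \<union> {1..int n}) + sum f (uminus ` {1..int m})"
  by (intro sum.union_disjoint) auto
 moreover have "sum f (uminus ` {1..int m}) = (\<Sum>y\<in>{1..int m}. f (- y))"
  by (subst sum.reindex) (auto simp: inj_on_def)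
 ultimately show ?thesis by simp
qed

text \<open>The triangle whose face fan is the fan of the projective plane.\<close>

definition tri3 :: "(int \<times> int) set" where
 "tri3 = {(0, 0), (1, 0), (0, 1), (-1, -1)}"

lemma tri3_normal: "normal_polygon tri3 {(1, 1), (1, -2), (-2, 1)}"
proof (rule normal_polygonI)
 fix T x y :: int
 assume T: "0 \<le> T" and w: "\<And>w. w \<in> {(1, 1), (1, -2), (-2, 1)} \<Longrightarrow> pairing w (x, y) \<le> T + 1"
 have "x + y \<le> T + 1" "x - 2 * y \<le> T + 1" "- 2 * x + y \<le> T + 1"
  using w[of "(1, 1)"] w[of "(1, -2)"] w[of "(-2, 1)"] by (auto simp: pairing_def)
 then have "(x + y \<le> T & x - 2 * y \<le> T & - 2 * x + y \<le> T)
  \<or> (x + y - 1 \<le> T & x - 2 * y - 1 \<le> T & - 2 * x + y + 2 \<le> T)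
  \<or> (x + y - 1 \<le> T & x - 2 * y + 2 \<le> T & - 2 * x + y - 1 \<le> T)
  \<or> (x + y + 2 \<le> T & x - 2 * y - 1 \<le> T & - 2 * x + y - 1 \<le> T)"
  using T by presburger
 then consider "x + y \<le> T" "x - 2 * y \<le> T" "- 2 * x + y \<le> T"
  | "x + y - 1 \<le> T" "x - 2 * y - 1 \<le> T" "- 2 * x + y + 2 \<le> T"
  | "x + y - 1 \<le> T" "x - 2 * y + 2 \<le> T" "- 2 * x + y - 1 \<le> T"
  | "x + y + 2 \<le> T" "x - 2 * y - 1 \<le> T" "- 2 * x + y - 1 \<le> T"
  by blast
 then show "\<exists>u v. (u, v) \<in> tri3 & (\<forall>w\<in>{(1, 1), (1, -2), (-2, 1)}. pairing w (x - u, y - v) \<le> T)"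
 proof cases
  case 1 then show ?thesis by (intro exI[of _ 0]) (simp add: tri3_def pairing_def)
 next
  case 2 then show ?thesis by (intro exI[of _ 1] exI[of _ 0]) (simp add: tri3_def pairing_def)
 next
  case 3 then show ?thesis by (intro exI[of _ 0] exI[of _ 1]) (simp add: tri3_def pairing_def)
 next
  case 4 then show ?thesis by (intro exI[of _ "- 1"] exI[of _ "- 1"]) (simp add: tri3_def pairing_def)
 qed
next
 fix x y :: int
 assume w: "\<And>w. w \<in> {(1, 1), (1, -2), (-2, 1)} \<Longrightarrow> pairing w (x, y) \<le> 0"
 show "x = 0 & y = 0"
  using w[of "(1, 1)"] w[of "(1, -2)"] w[of "(-2, 1)"] by (auto simp: pairing_def)
qed (auto simp: tri3_def pairing_def zero_prod_def)

lemma tri3_card: "2 * card (sumset t tri3) = 2 + 3 * (t * (t + 1))"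
proof -
 let ?T = "int t"
 let ?C1 = "{(x, y). 0 \<le> y & y \<le> ?T & 0 \<le> x & x \<le> ?T - y}"
 let ?C2 = "{(y, x). 1 \<le> x & x \<le> ?T & - x \<le> y & y \<le> ?T - 2 * x}"
 let ?C3 = "{(x, y). 1 \<le> y & y \<le> ?T & 1 - y \<le> x & x \<le> ?T - 2 * y}"
 have S: "sumset t tri3 = ?C1 \<union> ((\<lambda>(a, b). (- b, a)) ` ?C2 \<union> (\<lambda>(a, b). (a, - b)) ` ?C3)" (is "_ = ?R")
 proof (intro set_eqI iffI)
  fix z assume "z \<in> sumset t tri3"
  then have w: "fst z + snd z \<le> ?T" "fst z - 2 * snd z \<le> ?T" "- 2 * fst z + snd z \<le> ?T"
   using tri3_normal by (cases z; auto simp: normal_polygon_def pairing_def)+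
  consider "0 \<le> fst z" "0 \<le> snd z" | "fst z < 0" "fst z \<le> snd z" | "snd z < 0" "snd z < fst z" by linarith
  then show "z \<in> ?R"
  proof cases
   case 1 then show ?thesis using w by (cases z) auto
  next
   case 2 then have "(snd z, - fst z) \<in> ?C2" using w by auto
   then show ?thesis by (intro UnI2 UnI1 image_eqI[of _ _ "(snd z, - fst z)"]) auto
  next
   case 3 then have "(fst z, - snd z) \<in> ?C3" using w by auto
   then show ?thesis by (intro UnI2 image_eqI[of _ _ "(fst z, - snd z)"]) auto
  qed
 next
  fix z assume "z \<in> ?R"
  then show "z \<in> sumset t tri3"
   using tri3_normal by (auto simp: normal_polygon_def pairing_def)
 qed
 have fin: "finite ?R" unfolding S[symmetric] by (intro finite_sumset) (simp add: tri3_def)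
 have sw: "?C2 = prod.swap ` {(x, y). 1 \<le> x & x \<le> ?T & - x \<le> y & y \<le> ?T - 2 * x}" by auto
 have "card ?R = card ?C1 + (card ((\<lambda>(a, b). (- b, a)) ` ?C2) + card ((\<lambda>(a, b). (a, - b)) ` ?C3))"
  using fin by (subst card_Un_disjoint; (subst card_Un_disjoint)?) auto
 also have "card ((\<lambda>(a, b). (- b, a)) ` ?C2) = card ?C2" by (intro card_image) (auto simp: inj_on_def)
 also have "card ((\<lambda>(a, b). (a, - b)) ` ?C3) = card ?C3" by (intro card_image) (auto simp: inj_on_def)
 finally have "int (card (sumset t tri3)) = int (card ?C1) + (int (card ?C2) + int (card ?C3))"
  unfolding S by simp
 also have "int (card ?C1) = (\<Sum>y\<in>{0..?T}. ?T - y - 0 + 1)" by (intro card_rows) auto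
 also have "int (card ?C2) = (\<Sum>y\<in>{1..?T}. ?T - 2 * y - (- y) + 1)" by (intro card_rows) auto
 also have "int (card ?C3) = (\<Sum>y\<in>{1..?T}. ?T - 2 * y - (1 - y) + 1)" by (intro card_rows) auto
 also have "{0..?T} = insert 0 {1..?T}" by auto
 finally have "2 * int (card (sumset t tri3)) = 2 * (?T + 1) + 2 * (\<Sum>y\<in>{1..?T}. (?T + 1) + (- 1) * y)
   + 2 * (\<Sum>y\<in>{1..?T}. (?T + 1) + (- 1) * y) + 2 * (\<Sum>y\<in>{1..?T}. ?T + (- 1) * y)"
  by (simp add: algebra_simps)
 then have "int (2 * card (sumset t tri3)) = int (2 + 3 * (t * (t + 1)))"
  unfolding sum_linear by (simp add: algebra_simps)
 then show ?thesis by (simp only: of_nat_eq_iff)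
qed

text \<open>The polar dual of the triangle of the projective plane.\<close>

definition tri9 :: "(int \<times> int) set" where
 "tri9 = {(0, 0), (1, 0), (0, 1), (-1, 0), (0, -1), (1, -1), (-1, 1), (-1, -1), (2, -1), (-1, 2)}"

lemma tri9_normal: "normal_polygon tri9 {(-1, 0), (0, -1), (1, 1)}"
proof (rule normal_polygonI)
 fix T x y :: int
 assume T: "0 \<le> T" and w: "\<And>w. w \<in> {(-1, 0), (0, -1), (1, 1)} \<Longrightarrow> pairing w (x, y) \<le> T + 1"
 have xy: "- x \<le> T + 1" "- y \<le> T + 1" "x + y \<le> T + 1"
  using w[of "(-1, 0)"] w[of "(0, -1)"] w[of "(1, 1)"] by (auto simp: pairing_def)
 have "\<exists>(u, v)\<in>tri9. u - x \<le> T & v - y \<le> T & (x - u) + (y - v) \<le> T"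
  using xy T unfolding tri9_def by simp presburger
 then show "\<exists>u v. (u, v) \<in> tri9 & (\<forall>w\<in>{(-1, 0), (0, -1), (1, 1)}. pairing w (x - u, y - v) \<le> T)"
  by (fastforce simp: pairing_def)
next
 fix x y :: int
 assume w: "\<And>w. w \<in> {(-1, 0), (0, -1), (1, 1)} \<Longrightarrow> pairing w (x, y) \<le> 0"
 show "x = 0 & y = 0"
  using w[of "(-1, 0)"] w[of "(0, -1)"] w[of "(1, 1)"] by (auto simp: pairing_def)
qed (auto simp: tri9_def pairing_def zero_prod_def)

lemma tri9_card: "2 * card (sumset t tri9) = 2 + 9 * (t * (t + 1))"
proof -
 let ?T = "int t"
 have "sumset t tri9 = {(x, y). - int t \<le> y & y \<le> int (2 * t) & - ?T \<le> x & x \<le> ?T - y}"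
  using tri9_normal by (auto simp: normal_polygon_def pairing_def set_eq_iff)
 then have "int (card (sumset t tri9)) = (\<Sum>y\<in>{- int t..int (2 * t)}. ?T - y - (- ?T) + 1)"
  by (simp only:) (intro card_rows, auto)
 also have "\<dots> = (2 * ?T + 1) + (\<Sum>y\<in>{1..int (2 * t)}. (2 * ?T + 1) + (- 1) * y) + (\<Sum>y\<in>{1..int t}. (2 * ?T + 1) + 1 * y)"
  unfolding sum_split_sign by (simp add: algebra_simps)
 finally have "2 * int (card (sumset t tri9)) = 2 * (2 * ?T + 1) + 2 * (\<Sum>y\<in>{1..int (2 * t)}. (2 * ?T + 1) + (- 1) * y)
   + 2 * (\<Sum>y\<in>{1..int t}. (2 * ?T + 1) + 1 * y)" by (simp only: distrib_left)
 then have "int (2 * card (sumset t tri9)) = int (2 + 9 * (t * (t + 1)))"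
  unfolding sum_linear by (simp add: algebra_simps)
 then show ?thesis by (simp only: of_nat_eq_iff)
qed

text \<open>The triangle whose face fan is that of the weighted projective plane with weights \<open>1, 2, 3\<close>.\<close>

definition tri6 :: "(int \<times> int) set" where
 "tri6 = {(0, 0), (1, 0), (-1, 0), (0, 1), (1, 1), (1, 2), (-2, -1)}"

lemma tri6_normal: "normal_polygon tri6 {(-1, 1), (1, 0), (1, -3)}"
proof (rule normal_polygonI)
 fix T x y :: int
 assume T: "0 \<le> T" and w: "\<And>w. w \<in> {(-1, 1), (1, 0), (1, -3)} \<Longrightarrow> pairing w (x, y) \<le> T + 1"
 have xy: "y - x \<le> T + 1" "x \<le> T + 1" "x - 3 * y \<le> T + 1"
  using w[of "(-1, 1)"] w[of "(1, 0)"] w[of "(1, -3)"] by (auto simp: pairing_def)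
 have "\<exists>(u, v)\<in>tri6. (y - v) - (x - u) \<le> T & x - u \<le> T & (x - u) - 3 * (y - v) \<le> T"
 proof -
  have witness: ?thesis if "(u, v) \<in> tri6" "(y - v) - (x - u) \<le> T" "x - u \<le> T" "(x - u) - 3 * (y - v) \<le> T" for u v
   using that by blast
  show ?thesis
  proof (cases "x = T + 1")
   case x: True
   show ?thesis
   proof (cases "y = x + T + 1")
    case True
    show ?thesis by (rule witness[of 1 2]) (use x True T in \<open>auto simp: tri6_def\<close>)
   next
    case False
    show ?thesis
    proof (cases "y = x + T")
     case True
     show ?thesis by (rule witness[of 1 1]) (use x True T in \<open>auto simp: tri6_def\<close>)
    next
     case F: False
     show ?thesis by (rule witness[of 1 0]) (use x xy False F T in \<open>auto simp: tri6_def\<close>)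
    qed
   qed
  next
   case nx: False
   show ?thesis
   proof (cases "y = x + T + 1")
    case y: True
    show ?thesis
    proof (cases "x - 3 * y \<le> T - 3")
     case True
     show ?thesis by (rule witness[of 0 1]) (use xy nx y True in \<open>auto simp: tri6_def\<close>)
    next
     case g: False
     show ?thesis
     proof (cases "x - 3 * y \<le> T - 1")
      case True
      show ?thesis by (rule witness[of "- 1" 0]) (use xy nx y True g T in \<open>auto simp: tri6_def\<close>)
     next
      case False
      have "x - 3 * y ~= T" unfolding y by presburger
      then show ?thesis using witness[of "- 2" "- 1"] xy nx y False T by (auto simp: tri6_def)
     qed
    qed
   next
    case ny: False
    show ?thesis
    proof (cases "x = 3 * y + T + 1")
     case g: True
     have "y ~= x + T" unfolding g by presburger
     then show ?thesis using witness[of 1 0] xy nx ny g T by (auto simp: tri6_def)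
    next
     case False
     show ?thesis by (rule witness[of 0 0]) (use xy nx ny False in \<open>auto simp: tri6_def\<close>)
    qed
   qed
  qed
 qed
 then show "\<exists>u v. (u, v) \<in> tri6 & (\<forall>w\<in>{(-1, 1), (1, 0), (1, -3)}. pairing w (x - u, y - v) \<le> T)"
  by (fastforce simp: pairing_def)
next
 fix x y :: int
 assume w: "\<And>w. w \<in> {(-1, 1), (1, 0), (1, -3)} \<Longrightarrow> pairing w (x, y) \<le> 0"
 show "x = 0 & y = 0"
  using w[of "(-1, 1)"] w[of "(1, 0)"] w[of "(1, -3)"] by (auto simp: pairing_def)
qed (auto simp: tri6_def pairing_def zero_prod_def)

lemma tri6_card: "2 * card (sumset t tri6) = 2 + 6 * (t * (t + 1))"
proof -
 let ?T = "int t"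
 let ?L = "\<lambda>y. y - ?T" and ?R = "\<lambda>y. if 0 \<le> y then ?T else ?T + 3 * y"
 have "sumset t tri6 = {(x, y). - int t \<le> y & y \<le> int (2 * t) & ?L y \<le> x & x \<le> ?R y}"
  using tri6_normal by (auto simp: normal_polygon_def pairing_def set_eq_iff)
 then have "int (card (sumset t tri6)) = (\<Sum>y\<in>{- int t..int (2 * t)}. ?R y - ?L y + 1)"
  by (simp only:) (intro card_rows, auto)
 also have "\<dots> = (2 * ?T + 1) + (\<Sum>y\<in>{1..int (2 * t)}. (2 * ?T + 1) + (- 1) * y) + (\<Sum>y\<in>{1..int t}. (2 * ?T + 1) + (- 2) * y)"
 proof -
  have "(\<Sum>y\<in>{1..int (2 * t)}. ?R y - ?L y + 1) = (\<Sum>y\<in>{1..int (2 * t)}. (2 * ?T + 1) + (- 1) * y)"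
   by (intro sum.cong) auto
  moreover have "(\<Sum>y\<in>{1..int t}. ?R (- y) - ?L (- y) + 1) = (\<Sum>y\<in>{1..int t}. (2 * ?T + 1) + (- 2) * y)"
   by (intro sum.cong) auto
  ultimately show ?thesis unfolding sum_split_sign by simp
 qed
 finally have "2 * int (card (sumset t tri6)) = 2 * (2 * ?T + 1) + 2 * (\<Sum>y\<in>{1..int (2 * t)}. (2 * ?T + 1) + (- 1) * y)
   + 2 * (\<Sum>y\<in>{1..int t}. (2 * ?T + 1) + (- 2) * y)" by (simp only: distrib_left)
 then have "int (2 * card (sumset t tri6)) = int (2 + 6 * (t * (t + 1)))"
  unfolding sum_linear by (simp add: algebra_simps)
 then show ?thesis by (simp only: of_nat_eq_iff)
qed

text \<open>The polygons of lattice width two. The lengths of the upper and lower row are \<open>l\<close> and \<open>r\<close>. A shear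
  puts the upper row at \<open>0\<close>, and \<open>p\<close> is then the position of the lower one.\<close>

definition flat :: "int \<Rightarrow> int \<Rightarrow> int \<Rightarrow> (int \<times> int) set" where
 "flat l r p = {(x, y). y = 0 & - 1 \<le> x & x \<le> 1 \<or> y = 1 & 0 \<le> x & x \<le> l \<or> y = - 1 & p \<le> x & x \<le> p + r}"

definition flat_edges :: "int \<Rightarrow> int \<Rightarrow> int \<Rightarrow> (int \<times> int) set" where
 "flat_edges l r p = {(0, 1), (0, -1), (-1, 1), (-1, - p - 1), (1, 1 - l), (1, p + r - 1)}"

lemma flat_eq: "flat l r p = {(-1, 0), (0, 0), (1, 0)} \<union> (\<lambda>i. (i, 1)) ` {0..l} \<union> (\<lambda>i. (i, - 1)) ` {p..p + r}"
 by (auto simp: flat_def)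

lemma finite_flat: "finite (flat l r p)"
 by (simp add: flat_eq)

lemma flat_normal:
 assumes lr: "0 \<le> l" "0 \<le> r" "- 2 \<le> p" "l + r + p \<le> 2"
 shows "normal_polygon (flat l r p) (flat_edges l r p)"
proof (rule normal_polygonI)
 fix T x y :: int
 assume T: "0 \<le> T" and w: "\<And>w. w \<in> flat_edges l r p \<Longrightarrow> pairing w (x, y) \<le> T + 1"
 have xy: "y \<le> T + 1" "- y \<le> T + 1" "- x + y \<le> T + 1" "- x - (p + 1) * y \<le> T + 1"
   "x + (1 - l) * y \<le> T + 1" "x + (p + r - 1) * y \<le> T + 1"
  using w[of "(0, 1)"] w[of "(0, -1)"] w[of "(-1, 1)"] w[of "(-1, - p - 1)"] w[of "(1, 1 - l)"] w[of "(1, p + r - 1)"]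
  by (auto simp: flat_edges_def pairing_def algebra_simps)
 have pair: "(\<forall>w\<in>flat_edges l r p. pairing w (a, b) \<le> T) \<longleftrightarrow> b \<le> T & - b \<le> T & - a + b \<le> T &
   - a - (p + 1) * b \<le> T & a + (1 - l) * b \<le> T & a + (p + r - 1) * b \<le> T" for a b
  by (auto simp: flat_edges_def pairing_def algebra_simps)
 consider (up) "1 \<le> y" | (down) "y \<le> - 1" | (mid) "y = 0" by linarith
 then show "\<exists>u v. (u, v) \<in> flat l r p & (\<forall>w\<in>flat_edges l r p. pairing w (x - u, y - v) \<le> T)"
 proof cases
  case up
  define Y where "Y = y - 1"
  have Y: "0 \<le> Y" "y = Y + 1" using up by (auto simp: Y_def)
  have nn: "0 \<le> l * Y" "0 \<le> (p + 2) * Y" "0 \<le> (2 - l - r - p) * Y" using lr Y by auto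
  define i where "i = (if x \<le> l * Y + T - Y then 0 else x - (l * Y + T - Y))"
  have "(i, 1) \<in> flat l r p" using xy lr nn Y(1) unfolding Y(2) by (auto simp: flat_def i_def algebra_simps)
  moreover have "\<forall>w\<in>flat_edges l r p. pairing w (x - i, y - 1) \<le> T"
   unfolding pair using xy nn Y(1) T unfolding Y(2) by (auto simp: i_def algebra_simps)
  ultimately show ?thesis by blast
 next
  case down
  define Y where "Y = - y - 1"
  have Y: "0 \<le> Y" "y = - Y - 1" using down by (auto simp: Y_def)
  have nn: "0 \<le> r * Y" "0 \<le> (p + 2) * Y" "0 \<le> (2 - l - r - p) * Y" using lr Y by auto
  define m where "m = T + (p + r - 1) * Y + p"
  define i where "i = (if x \<le> m then 0 else x - m)"
  have "(p + i, - 1) \<in> flat l r p" using xy lr nn Y(1) unfolding Y(2) by (auto simp: flat_def i_def m_def algebra_simps)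
  moreover have "\<forall>w\<in>flat_edges l r p. pairing w (x - (p + i), y - (- 1)) \<le> T"
   unfolding pair using xy nn Y(1) T unfolding Y(2) by (auto simp: i_def m_def algebra_simps)
  ultimately show ?thesis by blast
 next
  case mid
  define u :: int where "u = (if x = T + 1 then 1 else if x = - T - 1 then - 1 else 0)"
  have "(u, 0) \<in> flat l r p" by (auto simp: flat_def u_def)
  moreover have "\<forall>w\<in>flat_edges l r p. pairing w (x - u, y - 0) \<le> T"
   unfolding pair using xy T mid by (auto simp: u_def)
  ultimately show ?thesis by blast
 qed
next
 fix x y :: int
 assume w: "\<And>w. w \<in> flat_edges l r p \<Longrightarrow> pairing w (x, y) \<le> 0"
 show "x = 0 & y = 0"
  using w[of "(0, 1)"] w[of "(0, -1)"] w[of "(-1, 1)"] w[of "(1, 1 - l)"] by (auto simp: flat_edges_def pairing_def)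
next
 fix a w assume "a \<in> flat l r p" "w \<in> flat_edges l r p"
 then show "pairing w a \<le> 1" using lr by (auto simp: flat_def flat_edges_def pairing_def)
qed (auto simp: finite_flat, auto simp: flat_def flat_edges_def zero_prod_def)

lemma flat_card:
 assumes lr: "0 \<le> l" "0 \<le> r" "- 2 \<le> p" "l + r + p \<le> 2"
 shows "2 * card (sumset t (flat l r p)) = 2 + nat (4 + l + r) * (t * (t + 1))"
proof -
 let ?T = "int t"
 let ?L = "\<lambda>y. if 0 \<le> y then y - ?T else - p * y - ?T - y"
 let ?R = "\<lambda>y. if 0 \<le> y then l * y + ?T - y else - (p + r) * y + ?T + y"
 have "(\<forall>w\<in>flat_edges l r p. pairing w (x, y) \<le> ?T) \<longleftrightarrow> - int t \<le> y & y \<le> int t & ?L y \<le> x & x \<le> ?R y" for x y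
 proof -
  have pair: "(\<forall>w\<in>flat_edges l r p. pairing w (x, y) \<le> ?T) \<longleftrightarrow> y \<le> ?T & - y \<le> ?T & - x + y \<le> ?T &
    - x - (p + 1) * y \<le> ?T & x + (1 - l) * y \<le> ?T & x + (p + r - 1) * y \<le> ?T"
   by (auto simp: flat_edges_def pairing_def algebra_simps)
  show ?thesis
  proof (cases "0 \<le> y")
   case True
   then have "0 \<le> (p + 2) * y" "0 \<le> (2 - l - r - p) * y" using lr by auto
   then show ?thesis unfolding pair using True by (auto simp: algebra_simps)
  next
   case False
   then have "(p + 2) * y \<le> 0" "(2 - l - r - p) * y \<le> 0" using lr by (auto simp: mult_le_0_iff)
   then show ?thesis unfolding pair using False by (auto simp: algebra_simps)
  qed
 qed
 then have "sumset t (flat l r p) = {(x, y). - int t \<le> y & y \<le> int t & ?L y \<le> x & x \<le> ?R y}"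
  using flat_normal[OF lr] unfolding normal_polygon_def by auto
 moreover have "?L y \<le> ?R y + 1" if "- int t \<le> y" "y \<le> int t" for y
 proof (cases "0 \<le> y")
  case True
  then have "0 \<le> l * y" using lr by simp
  then show ?thesis using that True by simp
 next
  case False
  then have "r * y \<le> 0" using lr by (simp add: mult_nonneg_nonpos)
  then show ?thesis using that False by (simp add: algebra_simps)
 qed
 ultimately have "int (card (sumset t (flat l r p))) = (\<Sum>y\<in>{- int t..int t}. ?R y - ?L y + 1)"
  by (simp only:) (intro card_rows, blast)
 also have "\<dots> = (2 * ?T + 1) + (\<Sum>y\<in>{1..int t}. (2 * ?T + 1) + (l - 2) * y) + (\<Sum>y\<in>{1..int t}. (2 * ?T + 1) + (r - 2) * y)"
 proof -
  have "(\<Sum>y\<in>{1..int t}. ?R y - ?L y + 1) = (\<Sum>y\<in>{1..int t}. (2 * ?T + 1) + (l - 2) * y)"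
   by (intro sum.cong) (auto simp: algebra_simps)
  moreover have "(\<Sum>y\<in>{1..int t}. ?R (- y) - ?L (- y) + 1) = (\<Sum>y\<in>{1..int t}. (2 * ?T + 1) + (r - 2) * y)"
   by (intro sum.cong) (auto simp: algebra_simps)
  ultimately show ?thesis unfolding sum_split_sign by simp
 qed
 finally have "2 * int (card (sumset t (flat l r p))) = 2 * (2 * ?T + 1) + 2 * (\<Sum>y\<in>{1..int t}. (2 * ?T + 1) + (l - 2) * y)
   + 2 * (\<Sum>y\<in>{1..int t}. (2 * ?T + 1) + (r - 2) * y)" by (simp only: distrib_left)
 then have "int (2 * card (sumset t (flat l r p))) = int (2 + nat (4 + l + r) * (t * (t + 1)))"
  unfolding sum_linear using lr by (simp add: algebra_simps)
 then show ?thesis by (simp only: of_nat_eq_iff)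
qed

lemma flat_reflect_x: "lin (- 1) l 0 1 ` flat l r p = flat l r (- p - l - r)"
proof (intro set_eqI iffI)
 fix z assume z: "z \<in> flat l r (- p - l - r)"
 have eq: "z = lin (- 1) l 0 1 (l * snd z - fst z, snd z)" by (simp add: lin_def)
 have "(l * snd z - fst z, snd z) \<in> flat l r p" using z by (auto simp: flat_def)
 then show "z \<in> lin (- 1) l 0 1 ` flat l r p" by (subst eq) (rule imageI)
qed (auto simp: flat_def lin_def)

lemma flat_reflect_y: "lin 1 p 0 (- 1) ` flat l r p = flat r l p"
proof (intro set_eqI iffI)
 fix z assume z: "z \<in> flat r l p"
 have eq: "z = lin 1 p 0 (- 1) (fst z + p * snd z, - snd z)" by (simp add: lin_def)
 have "(fst z + p * snd z, - snd z) \<in> flat l r p" using z by (auto simp: flat_def)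
 then show "z \<in> lin 1 p 0 (- 1) ` flat l r p" by (subst eq) (rule imageI)
qed (auto simp: flat_def lin_def)

subsection \<open>Critical points of the normal forms\<close>

lemma squarefree_roots:
 fixes G :: "complex poly"
 assumes bez: "\<And>x. poly U x * poly G x + poly V x * poly (pderiv G) x = c" and "c ~= 0"
 shows "finite {x. poly G x = 0}" "card {x. poly G x = 0} = degree G" "poly G x = 0 \<Longrightarrow> poly (pderiv G) x ~= 0"
proof -
 have *: "poly (pderiv G) x ~= 0" if "poly G x = 0" for x using bez[of x] that assms(2) by auto
 then show "poly G x = 0 \<Longrightarrow> poly (pderiv G) x ~= 0" .
 have "G ~= 0" using bez[of 0] assms(2) by auto
 then show "finite {x. poly G x = 0}" by (rule poly_roots_finite)
 have "rsquarefree G" using * by (auto simp: rsquarefree_roots)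
 then have "degree G = degree (smult (lead_coeff G) (\<Prod>z | poly G z = 0. [:- z, 1:]))"
  by (simp only: complex_poly_decompose_rsquarefree)
 also have "\<dots> = card {x. poly G x = 0}" using \<open>G ~= 0\<close> by (simp add: degree_prod_eq_sum_degree)
 finally show "card {x. poly G x = 0} = degree G" by simp
qed

lemma quadratic_roots:
 fixes a b c :: complex
 assumes "a ~= 0" "b\<^sup>2 ~= 4 * a * c"
 shows "finite {y. a * y\<^sup>2 + b * y + c = 0}" "card {y. a * y\<^sup>2 + b * y + c = 0} = 2"
proof -
 have bez: "poly [:4 * a:] x * poly [:c, b, a:] x + poly [:- b, - 2 * a:] x * poly (pderiv [:c, b, a:]) x = 4 * a * c - b\<^sup>2" for x
  by (simp add: pderiv_pCons algebra_simps power2_eq_square)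
 have "{x. poly [:c, b, a:] x = 0} = {y. a * y\<^sup>2 + b * y + c = 0}"
  by (simp add: algebra_simps power2_eq_square)
 then show "finite {y. a * y\<^sup>2 + b * y + c = 0}" "card {y. a * y\<^sup>2 + b * y + c = 0} = 2"
  using squarefree_roots(1,2)[OF bez] assms by auto
qed

lemma square_roots:
 fixes c :: complex
 assumes "c ~= 0" shows "finite {y. y\<^sup>2 = c}" "card {y. y\<^sup>2 = c} = 2"
proof -
 have "{y. 1 * y\<^sup>2 + 0 * y + (- c) = 0} = {y. y\<^sup>2 = c}" by (auto simp: algebra_simps)
 then show "finite {y. y\<^sup>2 = c}" "card {y. y\<^sup>2 = c} = 2" using quadratic_roots[of 1 0 "- c"] assms by simp_all
qed

lemma card_disjoint_Un:
 "finite S & card S = m \<Longrightarrow> finite T & card T = n \<Longrightarrow> S \<inter> T = {} \<Longrightarrow> finite (S \<union> T) & card (S \<union> T) = m + n"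
 by (simp add: card_Un_disjoint)

lemma card_fibre: "finite Y & card Y = n \<Longrightarrow> finite ({x} \<times> Y) & card ({x} \<times> Y) = n"
 by (simp add: card_cartesian_product)

lemma card_graph: "finite X & card X = n \<Longrightarrow> finite ((\<lambda>x. (x, r x)) ` X) & card ((\<lambda>x. (x, r x)) ` X) = n"
 by (simp add: card_image inj_on_def)

text \<open>Sets of the form \<open>1 + x + 1/x + y B(x) + C(x)/y\<close>; the functions with indices \<open>1\<close> and \<open>2\<close> are the
  logarithmic derivatives.\<close>

definition conic where
 "conic A B B1 B2 C C1 C2 \<longleftrightarrow> (\<forall>x y. x ~= 0 \<longrightarrow> y ~= 0 \<longrightarrow>
   dlog1 A (x, y) = (x - 1 / x) + y * B1 x + C1 x / y & dlog2 A (x, y) = y * B x - C x / y &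
   hess11 A (x, y) = (x + 1 / x) + y * B2 x + C2 x / y & hess12 A (x, y) = y * B1 x - C1 x / y &
   hess22 A (x, y) = y * B x + C x / y)"

lemma conic_flat:
 assumes "\<And>x. x ~= 0 \<Longrightarrow> (\<Sum>i\<in>{0..l}. x powi i) = B x" "\<And>x. x ~= 0 \<Longrightarrow> (\<Sum>i\<in>{0..l}. of_int i * x powi i) = B1 x"
  "\<And>x. x ~= 0 \<Longrightarrow> (\<Sum>i\<in>{0..l}. of_int (i * i) * x powi i) = B2 x"
  "\<And>x. x ~= 0 \<Longrightarrow> (\<Sum>i\<in>{p..p + r}. x powi i) = C x" "\<And>x. x ~= 0 \<Longrightarrow> (\<Sum>i\<in>{p..p + r}. of_int i * x powi i) = C1 x"
  "\<And>x. x ~= 0 \<Longrightarrow> (\<Sum>i\<in>{p..p + r}. of_int (i * i) * x powi i) = C2 x"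
 shows "conic (flat l r p) B B1 B2 C C1 C2"
proof -
 have split: "(\<Sum>a\<in>flat l r p. f a) = f (- 1, 0) + f (0, 0) + f (1, 0) + (\<Sum>i\<in>{0..l}. f (i, 1)) + (\<Sum>i\<in>{p..p + r}. f (i, - 1))"
  for f :: "int \<times> int \<Rightarrow> complex"
 proof -
  have "(\<Sum>a\<in>flat l r p. f a) = (\<Sum>a\<in>{(-1, 0), (0, 0), (1, 0)}. f a) + (\<Sum>a\<in>(\<lambda>i. (i, 1)) ` {0..l}. f a) + (\<Sum>a\<in>(\<lambda>i. (i, - 1)) ` {p..p + r}. f a)"
   unfolding flat_eq by (subst sum.union_disjoint; (subst sum.union_disjoint)?) auto
  then show ?thesis by (simp add: sum.reindex inj_on_def add.assoc)
 qed
 show ?thesis unfolding conic_def dlog1_def dlog2_def hess11_def hess12_def hess22_def split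
 proof (intro allI impI)
  fix x y :: complex assume "x ~= 0" "y ~= 0"
  note B = assms[OF \<open>x ~= 0\<close>]
  have m: "mono2 (x, y) (- 1, 0) = 1 / x" "mono2 (x, y) (1, 0) = x" "mono2 (x, y) (i, 1) = y * x powi i"
   "mono2 (x, y) (i, - 1) = x powi i / y" for i
   by (simp_all add: mono2_def power_int_minus divide_inverse)
  show "complex_of_int (fst (- 1, 0)) * mono2 (x, y) (- 1, 0) + complex_of_int (fst (0, 0)) * mono2 (x, y) (0, 0) +
    complex_of_int (fst (1, 0)) * mono2 (x, y) (1, 0) + (\<Sum>i = 0..l. complex_of_int (fst (i, 1)) * mono2 (x, y) (i, 1)) +
    (\<Sum>i = p..p + r. complex_of_int (fst (i, - 1)) * mono2 (x, y) (i, - 1)) = x - 1 / x + y * B1 x + C1 x / y &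
    complex_of_int (snd (- 1, 0)) * mono2 (x, y) (- 1, 0) + complex_of_int (snd (0, 0)) * mono2 (x, y) (0, 0) +
    complex_of_int (snd (1, 0)) * mono2 (x, y) (1, 0) + (\<Sum>i = 0..l. complex_of_int (snd (i, 1)) * mono2 (x, y) (i, 1)) +
    (\<Sum>i = p..p + r. complex_of_int (snd (i, - 1)) * mono2 (x, y) (i, - 1)) = y * B x - C x / y &
    complex_of_int (fst (- 1, 0) * fst (- 1, 0)) * mono2 (x, y) (- 1, 0) + complex_of_int (fst (0, 0) * fst (0, 0)) * mono2 (x, y) (0, 0) +
    complex_of_int (fst (1, 0) * fst (1, 0)) * mono2 (x, y) (1, 0) + (\<Sum>i = 0..l. complex_of_int (fst (i, 1) * fst (i, 1)) * mono2 (x, y) (i, 1)) +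
    (\<Sum>i = p..p + r. complex_of_int (fst (i, - 1) * fst (i, - 1)) * mono2 (x, y) (i, - 1)) = x + 1 / x + y * B2 x + C2 x / y &
    complex_of_int (fst (- 1, 0) * snd (- 1, 0)) * mono2 (x, y) (- 1, 0) + complex_of_int (fst (0, 0) * snd (0, 0)) * mono2 (x, y) (0, 0) +
    complex_of_int (fst (1, 0) * snd (1, 0)) * mono2 (x, y) (1, 0) + (\<Sum>i = 0..l. complex_of_int (fst (i, 1) * snd (i, 1)) * mono2 (x, y) (i, 1)) +
    (\<Sum>i = p..p + r. complex_of_int (fst (i, - 1) * snd (i, - 1)) * mono2 (x, y) (i, - 1)) = y * B1 x - C1 x / y &
    complex_of_int (snd (- 1, 0) * snd (- 1, 0)) * mono2 (x, y) (- 1, 0) + complex_of_int (snd (0, 0) * snd (0, 0)) * mono2 (x, y) (0, 0) +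
    complex_of_int (snd (1, 0) * snd (1, 0)) * mono2 (x, y) (1, 0) + (\<Sum>i = 0..l. complex_of_int (snd (i, 1) * snd (i, 1)) * mono2 (x, y) (i, 1)) +
    (\<Sum>i = p..p + r. complex_of_int (snd (i, - 1) * snd (i, - 1)) * mono2 (x, y) (i, - 1)) = y * B x + C x / y"
   by (simp add: m B[symmetric] sum_distrib_left sum_divide_distrib mult.left_commute sum_negf algebra_simps)
 qed
qed

lemma conic_crit_iff:
 assumes "conic A B B1 B2 C C1 C2"
 shows "(x, y) \<in> crit A \<longleftrightarrow> x ~= 0 & y ~= 0 & (x - 1 / x) + y * B1 x + C1 x / y = 0 & y\<^sup>2 * B x = C x"
proof -
 have "y * B x - C x / y = 0 \<longleftrightarrow> y\<^sup>2 * B x = C x" if "y ~= 0"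
  using that by (simp add: field_simps power2_eq_square)
 then show ?thesis using assms by (auto simp: crit_def torus2_def conic_def)
qed

lemma conic_crit_facts:
 assumes "conic A B B1 B2 C C1 C2" "(x, y) \<in> crit A"
 shows "(x - 1 / x) * (y * B x) = - (B1 x * C x + B x * C1 x)" "(y * B x)\<^sup>2 = B x * C x"
  "hess A (x, y) = 2 * (x + 1 / x) * (y * B x) - (x - 1 / x)\<^sup>2 + 2 * (B2 x * C x + 2 * B1 x * C1 x + B x * C2 x)"
proof -
 have xy: "x ~= 0" "y ~= 0" "(x - 1 / x) + y * B1 x + C1 x / y = 0" "y\<^sup>2 * B x = C x"
  using assms(2) unfolding conic_crit_iff[OF assms(1)] by auto
 define v where "v = 1 / y"
 have v: "y * v = 1" using xy by (simp add: v_def)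
 have C: "C x = y * y * B x" using xy(4) by (simp add: power2_eq_square)
 have a: "x - 1 / x = - (y * B1 x) - v * C1 x" using xy(3) by (simp add: v_def algebra_simps eq_neg_iff_add_eq_0)
 show "(x - 1 / x) * (y * B x) = - (B1 x * C x + B x * C1 x)" unfolding a C using v by algebra
 show "(y * B x)\<^sup>2 = B x * C x" unfolding C by (simp add: power2_eq_square mult_ac)
 have h: "hess A (x, y) = ((x + 1 / x) + y * B2 x + v * C2 x) * (y * B x + v * C x) - (y * B1 x - v * C1 x)\<^sup>2"
  using assms(1) xy(1,2) by (simp add: conic_def hess_def v_def)
 show "hess A (x, y) = 2 * (x + 1 / x) * (y * B x) - (x - 1 / x)\<^sup>2 + 2 * (B2 x * C x + 2 * B1 x * C1 x + B x * C2 x)"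
  unfolding h a C using v by algebra
qed

theorem conic_regular:
 assumes con: "conic A B B1 B2 C C1 C2"
  and G: "\<And>x. x ~= 0 \<Longrightarrow> poly G x = x ^ m * ((x - 1 / x)\<^sup>2 * (B x * C x) - (B1 x * C x + B x * C1 x)\<^sup>2)"
  and dG: "\<And>x. x ~= 0 \<Longrightarrow> x * poly (pderiv G) x = of_nat m * poly G x + x ^ m * (2 * (x - 1 / x) * (x + 1 / x) * (B x * C x)
    + (x - 1 / x)\<^sup>2 * (B1 x * C x + B x * C1 x) - 2 * (B1 x * C x + B x * C1 x) * (B2 x * C x + 2 * B1 x * C1 x + B x * C2 x))"
  and bez: "\<And>x. poly U x * poly G x + poly V x * poly (pderiv G) x = c" and "c ~= 0"
  and G0: "poly G 0 ~= 0" and nc: "\<And>x. x ~= 0 \<Longrightarrow> B x = 0 \<Longrightarrow> C x ~= 0"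
  and pm1: "B1 1 * C 1 + B 1 * C1 1 ~= 0" "B1 (- 1) * C (- 1) + B (- 1) * C1 (- 1) ~= 0"
 shows "morse A (degree G)"
proof -
 let ?\<delta> = "\<lambda>x. B x * C x" and ?\<delta>1 = "\<lambda>x. B1 x * C x + B x * C1 x" and ?\<delta>2 = "\<lambda>x. B2 x * C x + 2 * B1 x * C1 x + B x * C2 x"
 note sf = squarefree_roots[OF bez \<open>c ~= 0\<close>]
 have pm: "?\<delta>1 x ~= 0" if "x\<^sup>2 = 1" for x using that pm1 unfolding power2_eq_1_iff by blast
 have simple: "2 * (x - 1 / x) * (x + 1 / x) * ?\<delta> x + (x - 1 / x)\<^sup>2 * ?\<delta>1 x - 2 * ?\<delta>1 x * ?\<delta>2 x ~= 0"
  if "poly G x = 0" for x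
 proof -
  have "x ~= 0" using that G0 by auto
  then have "x * poly (pderiv G) x ~= 0" using sf(3)[OF that] by simp
  then show ?thesis using dG[OF \<open>x ~= 0\<close>] that by auto
 qed
 define R where "R = (\<lambda>x. - ?\<delta>1 x / ((x - 1 / x) * B x))"
 have a0: "x - 1 / x = 0 \<longleftrightarrow> x\<^sup>2 = 1" if "x ~= 0" for x :: complex
  using that by (simp add: field_simps power2_eq_square)
 have fwd: "poly G x = 0 & y = R x & hess A (x, y) ~= 0" if z: "(x, y) \<in> crit A" for x y
 proof -
  have xy: "x ~= 0" "y ~= 0" "y\<^sup>2 * B x = C x" using z unfolding conic_crit_iff[OF con] by auto
  note f = conic_crit_facts[OF con z]
  have "B x ~= 0" using nc[OF xy(1)] xy(3) by auto
  have "x - 1 / x ~= 0"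
  proof
   assume a: "x - 1 / x = 0"
   have "- ?\<delta>1 x = 0" using f(1) unfolding a mult_zero_left by (rule sym)
   moreover have "x\<^sup>2 = 1" using a0[OF xy(1)] a by blast
   ultimately show False using pm[of x] by (simp only: neg_equal_0_iff_equal simp_thms)
  qed
  have "(x - 1 / x)\<^sup>2 * ?\<delta> x = (?\<delta>1 x)\<^sup>2" using f(1,2) by (metis power2_minus power_mult_distrib)
  then have 1: "poly G x = 0" using G[OF xy(1)] by simp
  have "y * ((x - 1 / x) * B x) = - ?\<delta>1 x" using f(1) by (simp add: mult_ac)
  then have 2: "y = R x" using \<open>B x ~= 0\<close> \<open>x - 1 / x ~= 0\<close> unfolding R_def by (metis mult_eq_0_iff nonzero_mult_div_cancel_right)
  have "(x - 1 / x) * (y * B x) * hess A (x, y)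
   = 2 * (x - 1 / x) * (x + 1 / x) * ?\<delta> x + (x - 1 / x)\<^sup>2 * ?\<delta>1 x - 2 * ?\<delta>1 x * ?\<delta>2 x"
   unfolding f(3) using f(1,2) by algebra
  then have 3: "hess A (x, y) ~= 0" using simple[OF 1] by auto
  show ?thesis using 1 2 3 by blast
 qed
 have bwd: "(x, R x) \<in> crit A" if "poly G x = 0" for x
 proof -
  have x0: "x ~= 0" using that G0 by auto
  have Gx: "(x - 1 / x)\<^sup>2 * ?\<delta> x = (?\<delta>1 x)\<^sup>2" using G[OF x0] that x0 by simp
  have a: "x - 1 / x ~= 0"
  proof
   assume a: "x - 1 / x = 0"
   then have "?\<delta>1 x = 0" using Gx by simp
   then show False using pm[of x] a0[OF x0] a by blast
  qed
  have \<delta>: "?\<delta> x ~= 0"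
  proof
   assume d: "?\<delta> x = 0"
   then have "?\<delta>1 x = 0" using Gx by (simp only: mult_zero_right) simp
   then show False using simple[OF that] d by (simp only: mult_zero_right mult_zero_left) simp
  qed
  then have \<delta>1: "?\<delta>1 x ~= 0" using Gx a by (metis mult_eq_0_iff power2_eq_square)
  have B: "B x ~= 0" using \<delta> by auto
  have R0: "R x ~= 0"
   unfolding R_def divide_eq_0_iff neg_equal_0_iff_equal mult_eq_0_iff using \<delta>1 a B by blast
  have Rw: "(x - 1 / x) * (R x * B x) = - ?\<delta>1 x" using a B by (simp add: R_def)
  have "(x - 1 / x)\<^sup>2 * (R x * B x)\<^sup>2 = (x - 1 / x)\<^sup>2 * ?\<delta> x" unfolding Gx using Rw by (metis power2_minus power_mult_distrib)
  then have w2: "(R x * B x)\<^sup>2 = ?\<delta> x" using a by simp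
  then have "B x * ((R x)\<^sup>2 * B x) = B x * C x" by (simp only: power2_eq_square mult_ac)
  then have C: "(R x)\<^sup>2 * B x = C x" using B by (simp only: mult_cancel_left simp_thms)
  have "((x - 1 / x) + R x * B1 x + C1 x / R x) * (R x * B x) = 0"
  proof -
   have "((x - 1 / x) + R x * B1 x + C1 x / R x) * (R x * B x) = (x - 1 / x) * (R x * B x) + B1 x * ((R x)\<^sup>2 * B x) + B x * C1 x"
    using R0 by (simp add: field_simps power2_eq_square)
   also have "\<dots> = 0" unfolding Rw C by simp
   finally show ?thesis .
  qed
  then have "(x - 1 / x) + R x * B1 x + C1 x / R x = 0" using R0 B by simp
  then show ?thesis unfolding conic_crit_iff[OF con] using x0 R0 C by blast
 qed
 have eq: "crit A = (\<lambda>x. (x, R x)) ` {x. poly G x = 0}"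
 proof (intro set_eqI iffI)
  fix z assume z: "z \<in> crit A"
  obtain x y where "z = (x, y)" by (cases z)
  then show "z \<in> (\<lambda>x. (x, R x)) ` {x. poly G x = 0}" using fwd[of x y] z by auto
 qed (use bwd in auto)
 have "finite (crit A) & card (crit A) = degree G" unfolding eq using card_graph sf(1,2) by blast
 then show ?thesis using fwd unfolding morse_def by fast
qed

lemmas flat_simps = simp_from_to power_int_minus power2_eq_square power3_eq_cube power4_eq_xxxx

text \<open>The resultant certificates below are Bezout identities between a polynomial and its derivative.\<close>

lemma conic_0_0_m2: "conic (flat 0 0 (- 2)) (\<lambda>_. 1) (\<lambda>_. 0) (\<lambda>_. 0) (\<lambda>x. 1 / x ^ 2) (\<lambda>x. - 2 / x ^ 2) (\<lambda>x. 4 / x ^ 2)"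
 by (rule conic_flat) (simp_all add: flat_simps field_simps)

lemma morse_0_0_m2: "morse (flat 0 0 (- 2)) 4"
proof -
 have "morse (flat 0 0 (- 2)) (degree [:- 3, 0, - 2, 0, 1 :: complex:])"
  by (rule conic_regular[OF conic_0_0_m2, where m = 4 and U = "[:- 16, 0, 4:]" and V = "[:0, 5, 0, - 1:]" and c = 48])
   (auto simp: pderiv_pCons field_simps eval_nat_numeral)
 then show ?thesis by (simp add: eval_nat_numeral)
qed

lemma conic_0_0_m1: "conic (flat 0 0 (- 1)) (\<lambda>_. 1) (\<lambda>_. 0) (\<lambda>_. 0) (\<lambda>x. 1 / x) (\<lambda>x. - 1 / x) (\<lambda>x. 1 / x)"
 by (rule conic_flat) (simp_all add: flat_simps field_simps)

lemma morse_0_0_m1: "morse (flat 0 0 (- 1)) 4"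
proof -
 have "morse (flat 0 0 (- 1)) (degree [:1, - 1, - 2, 0, 1 :: complex:])"
  by (rule conic_regular[OF conic_0_0_m1, where m = 3 and U = "[:192, - 256, - 144:]" and V = "[:- 91, - 84, 64, 36:]" and c = 283])
   (auto simp: pderiv_pCons field_simps eval_nat_numeral)
 then show ?thesis by (simp add: eval_nat_numeral)
qed

lemma conic_1_0_m2: "conic (flat 1 0 (- 2)) (\<lambda>x. 1 + x) (\<lambda>x. x) (\<lambda>x. x) (\<lambda>x. 1 / x ^ 2) (\<lambda>x. - 2 / x ^ 2) (\<lambda>x. 4 / x ^ 2)"
 by (rule conic_flat) (simp_all add: flat_simps field_simps)

lemma morse_1_0_m2: "morse (flat 1 0 (- 2)) 5"
proof -
 have "morse (flat 1 0 (- 2)) (degree [:- 3, - 3, - 3, - 2, 1, 1 :: complex:])"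
  by (rule conic_regular[OF conic_1_0_m2, where m = 4 and U = "[:- 198, 14, - 71, 130:]" and V = "[:69, 46, 25, 9, - 26:]" and c = 387])
   (auto simp: pderiv_pCons field_simps eval_nat_numeral)
 then show ?thesis by (simp add: eval_nat_numeral)
qed

lemma conic_1_0_m1: "conic (flat 1 0 (- 1)) (\<lambda>x. 1 + x) (\<lambda>x. x) (\<lambda>x. x) (\<lambda>x. 1 / x) (\<lambda>x. - 1 / x) (\<lambda>x. 1 / x)"
 by (rule conic_flat) (simp_all add: flat_simps field_simps)

lemma morse_1_0_m1: "morse (flat 1 0 (- 1)) 5"
proof -
 have "morse (flat 1 0 (- 1)) (degree [:1, 0, - 2, - 2, 1, 1 :: complex:])"
  by (rule conic_regular[OF conic_1_0_m1, where m = 3 and U = "[:575, - 604, - 488, 40:]" and V = "[:- 151, - 183, 148, 96, - 8:]" and c = 575])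
   (auto simp: pderiv_pCons field_simps eval_nat_numeral)
 then show ?thesis by (simp add: eval_nat_numeral)
qed

lemma conic_2_0_m2: "conic (flat 2 0 (- 2)) (\<lambda>x. 1 + x + x ^ 2) (\<lambda>x. x + 2 * x ^ 2) (\<lambda>x. x + 4 * x ^ 2) (\<lambda>x. 1 / x ^ 2) (\<lambda>x. - 2 / x ^ 2) (\<lambda>x. 4 / x ^ 2)"
 by (rule conic_flat) (simp_all add: flat_simps field_simps)

lemma morse_2_0_m2: "morse (flat 2 0 (- 2)) 6"
proof -
 have "morse (flat 2 0 (- 2)) (degree [:- 3, - 3, - 2, - 2, - 1, 1, 1 :: complex:])"
  by (rule conic_regular[OF conic_2_0_m2, where m = 4 and U = "[:- 656634, 482618, - 227491, 129172, 6708:]" and V = "[:63021, 89988, - 63397, 34855, - 21715, - 1118:]" and c = 1780839])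
   (auto simp: pderiv_pCons field_simps eval_nat_numeral)
 then show ?thesis by (simp add: eval_nat_numeral)
qed

lemma conic_3_0_m2: "conic (flat 3 0 (- 2)) (\<lambda>x. 1 + x + x ^ 2 + x ^ 3) (\<lambda>x. x + 2 * x ^ 2 + 3 * x ^ 3) (\<lambda>x. x + 4 * x ^ 2 + 9 * x ^ 3) (\<lambda>x. 1 / x ^ 2) (\<lambda>x. - 2 / x ^ 2) (\<lambda>x. 4 / x ^ 2)"
 by (rule conic_flat) (simp_all add: flat_simps field_simps)

lemma morse_3_0_m2: "morse (flat 3 0 (- 2)) 7"
proof -
 have "morse (flat 3 0 (- 2)) (degree [:- 3, - 3, - 2, 3, 1, - 1, 0, 1 :: complex:])"
  by (rule conic_regular[OF conic_3_0_m2, where m = 4 and U = "[:- 1065791, 554346, 531302, - 580726, - 31311, 369488:]" and V = "[:183423, 266881, - 180693, - 99800, 98042, 4473, - 52784:]" and c = 2647104])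
   (auto simp: pderiv_pCons field_simps eval_nat_numeral)
 then show ?thesis by (simp add: eval_nat_numeral)
qed

lemma conic_2_1_m2: "conic (flat 2 1 (- 2)) (\<lambda>x. 1 + x + x ^ 2) (\<lambda>x. x + 2 * x ^ 2) (\<lambda>x. x + 4 * x ^ 2) (\<lambda>x. (1 + x) / x ^ 2) (\<lambda>x. - (2 + x) / x ^ 2) (\<lambda>x. (4 + x) / x ^ 2)"
 by (rule conic_flat) (simp_all add: flat_simps field_simps)

lemma morse_2_1_m2: "morse (flat 2 1 (- 2)) 7"
proof -
 have nc: "x + (1 + x * x) ~= 0" if "x + 1 = 0" for x :: complex
 proof -
  have "x = - 1" using that by (simp add: eq_neg_iff_add_eq_0)
  then show ?thesis by simp
 qed
 have "morse (flat 2 1 (- 2)) (degree [:- 3, - 6, - 4, 1, 1, 0, 1, 1 :: complex:])"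
  by (rule conic_regular[OF conic_2_1_m2, where m = 4 and U = "[:- 643197, 843884, - 276913, - 283256, 566827, - 261380:]" and V = "[:179907, - 18621, - 161848, 75177, 24325, - 75641, 37340:]" and c = 850149])
   (auto simp: pderiv_pCons field_simps eval_nat_numeral dest: nc)
 then show ?thesis by (simp add: eval_nat_numeral)
qed

lemma conic_0_0_0: "conic (flat 0 0 0) (\<lambda>_. 1) (\<lambda>_. 0) (\<lambda>_. 0) (\<lambda>_. 1) (\<lambda>_. 0) (\<lambda>_. 0)"
 by (rule conic_flat) (simp_all add: flat_simps field_simps)

lemma conic_2_0_m1: "conic (flat 2 0 (- 1)) (\<lambda>x. 1 + x + x ^ 2) (\<lambda>x. x + 2 * x ^ 2) (\<lambda>x. x + 4 * x ^ 2) (\<lambda>x. 1 / x) (\<lambda>x. - 1 / x) (\<lambda>x. 1 / x)"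
 by (rule conic_flat) (simp_all add: flat_simps field_simps)

lemma conic_1_1_m2: "conic (flat 1 1 (- 2)) (\<lambda>x. 1 + x) (\<lambda>x. x) (\<lambda>x. x) (\<lambda>x. (1 + x) / x ^ 2) (\<lambda>x. - (2 + x) / x ^ 2) (\<lambda>x. (4 + x) / x ^ 2)"
 by (rule conic_flat) (simp_all add: flat_simps field_simps)

lemma conic_1_1_m1: "conic (flat 1 1 (- 1)) (\<lambda>x. 1 + x) (\<lambda>x. x) (\<lambda>x. x) (\<lambda>x. (1 + x) / x) (\<lambda>x. - 1 / x) (\<lambda>x. 1 / x)"
 by (rule conic_flat) (simp_all add: flat_simps field_simps)

lemma conic_4_0_m2: "conic (flat 4 0 (- 2)) (\<lambda>x. 1 + x + x ^ 2 + x ^ 3 + x ^ 4) (\<lambda>x. x + 2 * x ^ 2 + 3 * x ^ 3 + 4 * x ^ 4) (\<lambda>x. x + 4 * x ^ 2 + 9 * x ^ 3 + 16 * x ^ 4) (\<lambda>x. 1 / x ^ 2) (\<lambda>x. - 2 / x ^ 2) (\<lambda>x. 4 / x ^ 2)"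
 by (rule conic_flat) (simp_all add: flat_simps field_simps)

lemma conic_3_1_m2: "conic (flat 3 1 (- 2)) (\<lambda>x. 1 + x + x ^ 2 + x ^ 3) (\<lambda>x. x + 2 * x ^ 2 + 3 * x ^ 3) (\<lambda>x. x + 4 * x ^ 2 + 9 * x ^ 3) (\<lambda>x. (1 + x) / x ^ 2) (\<lambda>x. - (2 + x) / x ^ 2) (\<lambda>x. (4 + x) / x ^ 2)"
 by (rule conic_flat) (simp_all add: flat_simps field_simps)

lemma conic_2_2_m2: "conic (flat 2 2 (- 2)) (\<lambda>x. 1 + x + x ^ 2) (\<lambda>x. x + 2 * x ^ 2) (\<lambda>x. x + 4 * x ^ 2) (\<lambda>x. (1 + x + x ^ 2) / x ^ 2) (\<lambda>x. - (2 + x) / x ^ 2) (\<lambda>x. (4 + x) / x ^ 2)"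
 by (rule conic_flat) (simp_all add: flat_simps field_simps)

lemma conic_crit_hess:
 assumes "conic A B B1 B2 C C1 C2" "(x, y) \<in> crit A"
 shows "(x - 1 / x) * (y * B x) * hess A (x, y)
   = 2 * (x - 1 / x) * (x + 1 / x) * (B x * C x) + (x - 1 / x)\<^sup>2 * (B1 x * C x + B x * C1 x)
    - 2 * (B1 x * C x + B x * C1 x) * (B2 x * C x + 2 * B1 x * C1 x + B x * C2 x)"
 unfolding conic_crit_facts(3)[OF assms] using conic_crit_facts(1,2)[OF assms] by algebra

lemma morse_0_0_0: "morse (flat 0 0 0) 4"
proof -
 note con = conic_0_0_0
 have "(x, y) \<in> crit (flat 0 0 0) \<longleftrightarrow> x\<^sup>2 = 1 & y\<^sup>2 = 1" for x y
 proof -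
  have "x - 1 / x + y * 0 + 0 / y = 0 \<longleftrightarrow> x\<^sup>2 = 1" if "x ~= 0"
   using that by (simp add: field_simps power2_eq_square)
  moreover have "x ~= 0" if "x\<^sup>2 = 1" using that by auto
  moreover have "y ~= 0" if "y\<^sup>2 = 1" using that by auto
  ultimately show ?thesis unfolding conic_crit_iff[OF con] by auto
 qed
 then have eq: "crit (flat 0 0 0) = {x. x\<^sup>2 = 1} \<times> {y. y\<^sup>2 = 1}" by auto
 have "hess (flat 0 0 0) z ~= 0" if z: "z \<in> crit (flat 0 0 0)" for z
 proof -
  obtain x y where xy: "z = (x, y)" by (cases z)
  then have "x = 1 \<or> x = - 1" "y = 1 \<or> y = - 1" using z unfolding eq by (auto simp: power2_eq_1_iff)
  then show ?thesis using conic_crit_facts(3)[OF con z[unfolded xy]] unfolding xy by auto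
 qed
 then show ?thesis unfolding morse_def eq using square_roots[of 1] by (auto simp: card_cartesian_product)
qed

lemma morse_2_0_m1: "morse (flat 2 0 (- 1)) 6"
proof -
 note con = conic_2_0_m1
 have iff: "(x, y) \<in> crit (flat 2 0 (- 1)) \<longleftrightarrow> x ~= 0 & y ~= 0 & y\<^sup>2 * (1 + x + x\<^sup>2) * x = 1 & (x\<^sup>2 - 1) * (1 + x * y) = 0" for x y
 proof -
  have "(x - 1 / x) + y * (x + 2 * x\<^sup>2) + (- 1 / x) / y = 0 \<longleftrightarrow> (x\<^sup>2 - 1) * (1 + x * y) = 0"
   if "x ~= 0" "y ~= 0" and B: "y\<^sup>2 * (1 + x + x\<^sup>2) * x = 1"
  proof -
   have "1 / (x * y) = 1 / (x * y) * (y\<^sup>2 * (1 + x + x\<^sup>2) * x)" unfolding B by simp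
   also have "\<dots> = y * (1 + x + x\<^sup>2)" using that(1,2) by (simp add: power2_eq_square)
   finally have v: "1 / (x * y) = y * (1 + x + x\<^sup>2)" .
   have w: "(- 1 / x) / y = - (y * (1 + x + x\<^sup>2))" unfolding v[symmetric] by simp
   have "(x - 1 / x) + y * (x + 2 * x\<^sup>2) + (- 1 / x) / y = (x\<^sup>2 - 1) * (1 + x * y) / x"
    unfolding w using that(1) by (simp add: field_simps power2_eq_square)
   then show ?thesis using that by simp
  qed
  moreover have "y\<^sup>2 * (1 + x + x\<^sup>2) = 1 / x \<longleftrightarrow> y\<^sup>2 * (1 + x + x\<^sup>2) * x = 1" if "x ~= 0"
   using that by (simp add: eq_divide_eq)
  ultimately show ?thesis unfolding conic_crit_iff[OF con] by blast
 qed
 have crit1: "(x, y) \<in> crit (flat 2 0 (- 1)) \<longleftrightarrow> (x = 1 & y\<^sup>2 = 1 / 3) \<or> (x = - 1 & y\<^sup>2 = - 1) \<or> (x\<^sup>2 = - 1 & y = x)" for x y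
 proof
  assume "(x, y) \<in> crit (flat 2 0 (- 1))"
  then have h: "x ~= 0" "y ~= 0" "y\<^sup>2 * (1 + x + x\<^sup>2) * x = 1" "(x\<^sup>2 - 1) * (1 + x * y) = 0" unfolding iff by auto
  from h(4) consider "x = 1" | "x = - 1" | "1 + x * y = 0" by (auto simp: power2_eq_1_iff)
  then show "(x = 1 & y\<^sup>2 = 1 / 3) \<or> (x = - 1 & y\<^sup>2 = - 1) \<or> (x\<^sup>2 = - 1 & y = x)"
  proof cases
   case 1 then show ?thesis using h(3) by (simp add: field_simps)
  next
   case 2
   have "y\<^sup>2 = - 1" using h(3) 2 by algebra
   then show ?thesis using 2 by blast
  next
   case 3
   have "x * (1 + x\<^sup>2) = 0" using h(3) 3 by algebra
   then have "x\<^sup>2 = - 1" using h(1) by (simp add: eq_neg_iff_add_eq_0 add.commute)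
   moreover have "x * (y - x) = 0" using 3 calculation by algebra
   ultimately show ?thesis using h(1) by simp
  qed
 next
  assume "(x = 1 & y\<^sup>2 = 1 / 3) \<or> (x = - 1 & y\<^sup>2 = - 1) \<or> (x\<^sup>2 = - 1 & y = x)"
  then show "(x, y) \<in> crit (flat 2 0 (- 1))"
  proof (elim disjE conjE)
   assume e: "x = 1" "y\<^sup>2 = 1 / 3"
   then have "y ~= 0" by auto
   then show ?thesis unfolding iff e by simp
  next
   assume e: "x = - 1" "y\<^sup>2 = - 1"
   then have "y ~= 0" by auto
   then show ?thesis unfolding iff e by simp
  next
   assume e: "x\<^sup>2 = - 1" "y = x"
   then have "x ~= 0" by auto
   moreover have "x * x = - 1" using e(1) by (simp add: power2_eq_square)
   ultimately show ?thesis unfolding iff e by simp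
  qed
 qed
 have eq: "crit (flat 2 0 (- 1)) = ({1} \<times> {y. y\<^sup>2 = 1 / 3} \<union> {- 1} \<times> {y. y\<^sup>2 = - 1}) \<union> (\<lambda>x. (x, x)) ` {x. x\<^sup>2 = - 1}"
  using crit1 by auto
 have "finite (crit (flat 2 0 (- 1))) & card (crit (flat 2 0 (- 1))) = 2 + 2 + 2"
  unfolding eq by (intro card_disjoint_Un card_fibre card_graph conjI square_roots) auto
 moreover have "hess (flat 2 0 (- 1)) z ~= 0" if z: "z \<in> crit (flat 2 0 (- 1))" for z
 proof -
  obtain x y where xy: "z = (x, y)" by (cases z)
  note H = conic_crit_facts(3)[OF con z[unfolded xy]]
  from z consider "x = 1" "y\<^sup>2 = 1 / 3" | "x = - 1" "y\<^sup>2 = - 1" | "x\<^sup>2 = - 1" "y = x" unfolding xy crit1 by blast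
  then show ?thesis
  proof cases
   case 1
   have "hess (flat 2 0 (- 1)) (x, y) = 12 * y + 4" unfolding H unfolding 1 by simp
   moreover have "12 * y + 4 ~= 0"
   proof
    assume "12 * y + 4 = 0"
    then have "y = - 1 / 3" by algebra
    then show False using 1 by (simp add: power2_eq_square)
   qed
   ultimately show ?thesis unfolding xy by argo
  next
   case 2
   have "hess (flat 2 0 (- 1)) (x, y) = - 4 * y - 4" unfolding H unfolding 2 by simp
   moreover have "- 4 * y - 4 ~= 0"
   proof
    assume "- 4 * y - 4 = 0"
    then have "y = - 1" by algebra
    then show False using 2 by simp
   qed
   ultimately show ?thesis unfolding xy by argo
  next
   case 3
   have x0: "x ~= 0" using 3 by auto
   have "1 / x = - x" using 3 x0 by (simp add: field_simps power2_eq_square)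
   then have u: "- 1 / x = x" "1 / x = - x" by simp_all
   have "hess (flat 2 0 (- 1)) (x, y) = 4" unfolding H unfolding u 3(2) using 3(1) by algebra
   then show ?thesis using xy by simp
  qed
 qed
 ultimately show ?thesis by (simp add: morse_def)
qed

lemma morse_1_1_m2: "morse (flat 1 1 (- 2)) 6"
proof -
 note con = conic_1_1_m2
 have iff: "(x, y) \<in> crit (flat 1 1 (- 2)) \<longleftrightarrow> x ~= 0 & y ~= 0 & (1 + x) * ((x * y)\<^sup>2 - 1) = 0 &
   x * y * (x\<^sup>2 - 1) + (x * y)\<^sup>2 * x - (2 + x) = 0" for x y
 proof -
  have "(x - 1 / x) + y * x + (- (2 + x) / x\<^sup>2) / y = (x * y * (x\<^sup>2 - 1) + (x * y)\<^sup>2 * x - (2 + x)) / (x\<^sup>2 * y)"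
   if "x ~= 0" "y ~= 0"
   using that by (simp add: field_simps power2_eq_square)
  moreover have "y\<^sup>2 * (1 + x) = (1 + x) / x\<^sup>2 \<longleftrightarrow> (1 + x) * ((x * y)\<^sup>2 - 1) = 0" if "x ~= 0"
  proof -
   have "y\<^sup>2 * (1 + x) = (1 + x) / x\<^sup>2 \<longleftrightarrow> y\<^sup>2 * (1 + x) * x\<^sup>2 = 1 + x" using that by (simp add: eq_divide_eq)
   also have "\<dots> \<longleftrightarrow> (1 + x) * ((x * y)\<^sup>2 - 1) = 0" by algebra
   finally show ?thesis .
  qed
  ultimately show ?thesis unfolding conic_crit_iff[OF con] by auto
 qed
 have crit1: "(x, y) \<in> crit (flat 1 1 (- 2)) \<longleftrightarrow> (x = - 1 & y\<^sup>2 = - 1) \<or> (x\<^sup>2 = 3 & y = x / 3) \<or> (x\<^sup>2 = - 1 & y = x)" for x y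
 proof
  assume "(x, y) \<in> crit (flat 1 1 (- 2))"
  then have h: "x ~= 0" "y ~= 0" "(1 + x) * ((x * y)\<^sup>2 - 1) = 0" "x * y * (x\<^sup>2 - 1) + (x * y)\<^sup>2 * x - (2 + x) = 0"
   unfolding iff by auto
  from h(3) consider "1 + x = 0" | "x * y = 1" | "x * y = - 1" by (auto simp: power2_eq_1_iff)
  then show "(x = - 1 & y\<^sup>2 = - 1) \<or> (x\<^sup>2 = 3 & y = x / 3) \<or> (x\<^sup>2 = - 1 & y = x)"
  proof cases
   case 1
   then have "x = - 1" "y\<^sup>2 + 1 = 0" using h(4) by algebra+
   then show ?thesis by (simp add: eq_neg_iff_add_eq_0)
  next
   case 2
   then have "x\<^sup>2 = 3" using h(4) by algebra
   moreover have "x * (y - x / 3) = 0" using 2 calculation by (simp add: algebra_simps power2_eq_square)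
   ultimately show ?thesis using h(1) by simp
  next
   case 3
   then have "x\<^sup>2 = - 1" using h(4) by algebra
   moreover have "x * (y - x) = 0" using 3 calculation by (simp add: algebra_simps power2_eq_square)
   ultimately show ?thesis using h(1) by simp
  qed
 next
  assume "(x = - 1 & y\<^sup>2 = - 1) \<or> (x\<^sup>2 = 3 & y = x / 3) \<or> (x\<^sup>2 = - 1 & y = x)"
  then show "(x, y) \<in> crit (flat 1 1 (- 2))"
  proof (elim disjE conjE)
   assume "x = - 1" "y\<^sup>2 = - 1" then show ?thesis unfolding iff by auto
  next
   assume x: "x\<^sup>2 = 3" "y = x / 3"
   have "3 * y = x" unfolding x(2) by simp
   have "x * x = 3" using x(1) by (simp add: power2_eq_square)
   then have xy: "x * y = 1" unfolding x(2) by simp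
   then have "x ~= 0" "y ~= 0" by auto
   then show ?thesis unfolding iff xy x(1) by simp
  next
   assume x: "x\<^sup>2 = - 1" "y = x"
   then have "x * y = - 1" by (simp add: power2_eq_square)
   then show ?thesis unfolding iff using x by auto
  qed
 qed
 have eq: "crit (flat 1 1 (- 2)) = ({- 1} \<times> {y. y\<^sup>2 = - 1} \<union> (\<lambda>x. (x, x / 3)) ` {x. x\<^sup>2 = 3}) \<union> (\<lambda>x. (x, x)) ` {x. x\<^sup>2 = - 1}"
  using crit1 by auto
 have "finite (crit (flat 1 1 (- 2))) & card (crit (flat 1 1 (- 2))) = 2 + 2 + 2"
  unfolding eq by (intro card_disjoint_Un card_fibre card_graph conjI square_roots) auto
 moreover have "hess (flat 1 1 (- 2)) z ~= 0" if z: "z \<in> crit (flat 1 1 (- 2))" for z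
 proof -
  obtain x y where xy: "z = (x, y)" by (cases z)
  note H = conic_crit_facts(3)[OF con z[unfolded xy]]
  from z consider "x = - 1" | "x\<^sup>2 = 3" "y = x / 3" | "x\<^sup>2 = - 1" "y = x" unfolding xy crit1 by blast
  then show ?thesis
  proof cases
   case 1
   show ?thesis unfolding xy H unfolding 1 by simp
  next
   case 2
   define u where "u = 1 / x"
   have xu: "x * u = 1" using 2 by (auto simp: u_def)
   have y: "3 * y = x" using 2 by (simp add: mult.commute)
   have H': "hess (flat 1 1 (- 2)) (x, y) = 2 * (x + u) * (y * (1 + x)) - (x - u)\<^sup>2
     + 2 * (x * ((1 + x) * u\<^sup>2) + 2 * x * (- (2 + x) * u\<^sup>2) + (1 + x) * ((4 + x) * u\<^sup>2))"
    unfolding H by (simp add: u_def power_divide)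
   have "hess (flat 1 1 (- 2)) (x, y) = 4 + 4 * x" unfolding H' using xu y 2(1) by algebra
   moreover have "4 + 4 * x ~= 0"
   proof
    assume "4 + 4 * x = 0"
    then have "x = - 1" by algebra
    then show False using 2 by simp
   qed
   ultimately show ?thesis unfolding xy by argo
  next
   case 3
   define u where "u = 1 / x"
   have xu: "x * u = 1" using 3 by (auto simp: u_def)
   have H': "hess (flat 1 1 (- 2)) (x, y) = 2 * (x + u) * (y * (1 + x)) - (x - u)\<^sup>2
     + 2 * (x * ((1 + x) * u\<^sup>2) + 2 * x * (- (2 + x) * u\<^sup>2) + (1 + x) * ((4 + x) * u\<^sup>2))"
    unfolding H by (simp add: u_def power_divide)
   have "hess (flat 1 1 (- 2)) (x, y) = - 4 - 4 * x" unfolding H' using xu 3 by algebra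
   moreover have "- 4 - 4 * x ~= 0"
   proof
    assume "- 4 - 4 * x = 0"
    then have "x = - 1" by algebra
    then show False using 3 by simp
   qed
   ultimately show ?thesis unfolding xy by argo
  qed
 qed
 ultimately show ?thesis by (simp add: morse_def)
qed

lemma cube_roots: "finite {x :: complex. x ^ 3 = 1} & card {x :: complex. x ^ 3 = 1} = 3"
proof -
 have bez: "poly [:- 3:] x * poly [:- 1, 0, 0, 1:] x + poly [:0, 1:] x * poly (pderiv [:- 1, 0, 0, 1:]) x = (3 :: complex)" for x
  by (simp add: pderiv_pCons algebra_simps)
 have "{x :: complex. poly [:- 1, 0, 0, 1:] x = 0} = {x. x ^ 3 = 1}"
  by (auto simp: power3_eq_cube algebra_simps)
 then show ?thesis using squarefree_roots(1,2)[OF bez] by (simp add: eval_nat_numeral)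
qed

lemma morse_1_1_m1: "morse (flat 1 1 (- 1)) 6"
proof -
 note con = conic_1_1_m1
 have iff: "(x, y) \<in> crit (flat 1 1 (- 1)) \<longleftrightarrow> x ~= 0 & y ~= 0 & (1 + x) * (x * y\<^sup>2 - 1) = 0 &
   y * (x\<^sup>2 - 1) + (x * y)\<^sup>2 - 1 = 0" for x y
 proof -
  have "(x - 1 / x) + y * x + (- 1 / x) / y = (y * (x\<^sup>2 - 1) + (x * y)\<^sup>2 - 1) / (x * y)"
   if "x ~= 0" "y ~= 0"
   using that by (simp add: field_simps power2_eq_square)
  moreover have "y\<^sup>2 * (1 + x) = (1 + x) / x \<longleftrightarrow> (1 + x) * (x * y\<^sup>2 - 1) = 0" if "x ~= 0"
  proof -
   have "y\<^sup>2 * (1 + x) = (1 + x) / x \<longleftrightarrow> y\<^sup>2 * (1 + x) * x = 1 + x" using that by (simp add: eq_divide_eq)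
   also have "\<dots> \<longleftrightarrow> (1 + x) * (x * y\<^sup>2 - 1) = 0" by algebra
   finally show ?thesis .
  qed
  ultimately show ?thesis unfolding conic_crit_iff[OF con] by auto
 qed
 have crit1: "(x, y) \<in> crit (flat 1 1 (- 1)) \<longleftrightarrow> (x = - 1 & y\<^sup>2 = 1) \<or> (x = 1 & y = - 1) \<or> (x ^ 3 = 1 & y = x)" for x y
 proof
  assume "(x, y) \<in> crit (flat 1 1 (- 1))"
  then have h: "x ~= 0" "y ~= 0" "(1 + x) * (x * y\<^sup>2 - 1) = 0" "y * (x\<^sup>2 - 1) + (x * y)\<^sup>2 - 1 = 0"
   unfolding iff by auto
  from h(3) consider "1 + x = 0" | "x * y\<^sup>2 = 1" by auto
  then show "(x = - 1 & y\<^sup>2 = 1) \<or> (x = 1 & y = - 1) \<or> (x ^ 3 = 1 & y = x)"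
  proof cases
   case 1
   then have "x = - 1" "y\<^sup>2 = 1" using h(4) by algebra+
   then show ?thesis by simp
  next
   case 2
   then have "(1 + y) * (1 - y ^ 3) = 0" using h(4) by algebra
   then consider "1 + y = 0" | "y ^ 3 = 1" by auto
   then show ?thesis
   proof cases
    case 1
    then have "y = - 1" "x = 1" using 2 by algebra+
    then show ?thesis by simp
   next
    case c: 2
    then have "x = y" using 2 by algebra
    then show ?thesis using c by simp
   qed
  qed
 next
  assume "(x = - 1 & y\<^sup>2 = 1) \<or> (x = 1 & y = - 1) \<or> (x ^ 3 = 1 & y = x)"
  then show "(x, y) \<in> crit (flat 1 1 (- 1))"
  proof (elim disjE conjE)
   assume x: "x ^ 3 = 1" "y = x"
   then have "x ~= 0" by auto
   moreover have "(1 + x) * (x * x\<^sup>2 - 1) = 0" "x * (x\<^sup>2 - 1) + (x * x)\<^sup>2 - 1 = 0" using x(1) by algebra+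
   ultimately show ?thesis unfolding iff using x(2) by simp
  qed (unfold iff, auto)
 qed
 have eq: "crit (flat 1 1 (- 1)) = ({- 1} \<times> {y. y\<^sup>2 = 1} \<union> {1} \<times> {- 1}) \<union> (\<lambda>x. (x, x)) ` {x. x ^ 3 = 1}"
  using crit1 by auto
 have "finite (crit (flat 1 1 (- 1))) & card (crit (flat 1 1 (- 1))) = 2 + 1 + 3"
  unfolding eq by (intro card_disjoint_Un card_fibre card_graph cube_roots conjI square_roots) auto
 moreover have "hess (flat 1 1 (- 1)) z ~= 0" if z: "z \<in> crit (flat 1 1 (- 1))" for z
 proof -
  obtain x y where xy: "z = (x, y)" by (cases z)
  note H = conic_crit_facts(3)[OF con z[unfolded xy]]
  from z consider "x = - 1" | "x = 1" "y = - 1" | "x ^ 3 = 1" "y = x" unfolding xy crit1 by blast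
  then show ?thesis
  proof cases
   case 1
   show ?thesis unfolding xy H unfolding 1 by simp
  next
   case 2
   show ?thesis unfolding xy H unfolding 2 by simp
  next
   case 3
   define u where "u = 1 / x"
   have xu: "x * u = 1" using 3 by (auto simp: u_def)
   have H': "hess (flat 1 1 (- 1)) (x, y) = 2 * (x + u) * (y * (1 + x)) - (x - u)\<^sup>2
     + 2 * (x * ((1 + x) * u) + 2 * x * (- u) + (1 + x) * u)"
    unfolding H by (simp add: u_def)
   have "hess (flat 1 1 (- 1)) (x, y) = 3 * (x\<^sup>2 + x + 2)" unfolding H' using xu 3 by algebra
   moreover have "3 * (x\<^sup>2 + x + 2) ~= 0"
   proof
    assume *: "3 * (x\<^sup>2 + x + 2) = 0"
    then have "x = 1" using 3(1) by algebra
    then show False using * by simp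
   qed
   ultimately show ?thesis unfolding xy by argo
  qed
 qed
 ultimately show ?thesis by (simp add: morse_def)
qed

lemma morse_4_0_m2: "morse (flat 4 0 (- 2)) 8"
proof -
 note con = conic_4_0_m2
 let ?B = "\<lambda>x::complex. 1 + x + x\<^sup>2 + x ^ 3 + x ^ 4" and ?E = "\<lambda>x::complex. 2 * x\<^sup>2 + x + 2"
 let ?q = "[:3, 3, 8, 3, 3 :: complex:]"
 have bez: "poly [:119, 189, 204:] x * poly ?q x + poly [:- 39, - 100, - 60, - 51:] x * poly (pderiv ?q) x = 240" for x
  by (simp add: pderiv_pCons algebra_simps)
 note sf = squarefree_roots[OF bez, simplified]
 have q: "poly ?q x = ?E x ^ 2 - ?B x" for x by (simp add: algebra_simps eval_nat_numeral)
 have iff: "(x, y) \<in> crit (flat 4 0 (- 2)) \<longleftrightarrow> x ~= 0 & y ~= 0 & (x * y)\<^sup>2 * ?B x = 1 & (x\<^sup>2 - 1) * (1 + x * y * ?E x) = 0" for x y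
 proof -
  have "(x - 1 / x) + y * (x + 2 * x\<^sup>2 + 3 * x ^ 3 + 4 * x ^ 4) + (- 2 / x\<^sup>2) / y = (x\<^sup>2 - 1) * (1 + x * y * ?E x) / x"
   if "x ~= 0" "y ~= 0" and B: "(x * y)\<^sup>2 * ?B x = 1"
  proof -
   have v: "(- 2 / x\<^sup>2) / y = - 2 * (y * ?B x)"
   proof -
    have "(- 2 / x\<^sup>2) / y = (- 2 / x\<^sup>2) / y * ((x * y)\<^sup>2 * ?B x)" unfolding B by simp
    also have "\<dots> = - 2 * (y * ?B x)" using that(1,2) by (simp add: power2_eq_square)
    finally show ?thesis .
   qed
   show ?thesis unfolding v using that(1) by (simp add: field_simps eval_nat_numeral)
  qed
  moreover have "y\<^sup>2 * ?B x = 1 / x\<^sup>2 \<longleftrightarrow> (x * y)\<^sup>2 * ?B x = 1" if "x ~= 0"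
   using that by (simp add: eq_divide_eq power_mult_distrib mult_ac)
  ultimately show ?thesis unfolding conic_crit_iff[OF con] by auto
 qed
 have E0: "?E x ~= 0" if "poly ?q x = 0" for x
 proof
  assume E: "?E x = 0"
  have B: "?B x = ?E x ^ 2 - poly ?q x" unfolding q by simp
  have "?B x = 0" by (simp only: B E that) simp
  then have "5 * x + 10 = 0" using E by algebra
  then have "x = - 2" by algebra
  then show False using E by simp
 qed
 define r where "r = (\<lambda>x. - 1 / (x * ?E x))"
 have crit1: "(x, y) \<in> crit (flat 4 0 (- 2)) \<longleftrightarrow> (x = 1 & y\<^sup>2 = 1 / 5) \<or> (x = - 1 & y\<^sup>2 = 1) \<or> (poly ?q x = 0 & y = r x)" for x y
 proof
  assume "(x, y) \<in> crit (flat 4 0 (- 2))"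
  then have h: "x ~= 0" "y ~= 0" "(x * y)\<^sup>2 * ?B x = 1" "(x\<^sup>2 - 1) * (1 + x * y * ?E x) = 0" unfolding iff by auto
  from h(4) consider "x = 1" | "x = - 1" | "1 + x * y * ?E x = 0" by (auto simp: power2_eq_1_iff)
  then show "(x = 1 & y\<^sup>2 = 1 / 5) \<or> (x = - 1 & y\<^sup>2 = 1) \<or> (poly ?q x = 0 & y = r x)"
  proof cases
   case 1 then show ?thesis using h(3) by (simp add: field_simps)
  next
   case 2 then show ?thesis using h(3) by simp
  next
   case 3
   have "(x * y)\<^sup>2 * (?E x ^ 2 - ?B x) = 0" using h(3) 3 by algebra
   then have *: "poly ?q x = 0" using h(1,2) unfolding q by simp
   have "y * (x * ?E x) = - 1" using 3 by algebra
   then have "y = r x" unfolding r_def using h(1) E0[OF *] by (simp only: eq_divide_eq) simp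
   with * show ?thesis by blast
  qed
 next
  assume "(x = 1 & y\<^sup>2 = 1 / 5) \<or> (x = - 1 & y\<^sup>2 = 1) \<or> (poly ?q x = 0 & y = r x)"
  then show "(x, y) \<in> crit (flat 4 0 (- 2))"
  proof (elim disjE conjE)
   assume x: "poly ?q x = 0" "y = r x"
   have x0: "x ~= 0" using x(1) by auto
   have e: "x * y * ?E x = - 1" unfolding x(2) r_def using x0 E0[OF x(1)] by simp
   then have "y ~= 0" by auto
   moreover have "?B x = ?E x ^ 2" using x(1) q[of x] by simp
   then have "(x * y)\<^sup>2 * ?B x = 1" using e by algebra
   ultimately show ?thesis unfolding iff using x0 e by simp
  qed (unfold iff, auto)
 qed
 have eq: "crit (flat 4 0 (- 2)) = ({1} \<times> {y. y\<^sup>2 = 1 / 5} \<union> {- 1} \<times> {y. y\<^sup>2 = 1}) \<union> (\<lambda>x. (x, r x)) ` {x. poly ?q x = 0}"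
  using crit1 by auto
 have "card {x. poly ?q x = 0} = 4" using sf(2) by (simp add: eval_nat_numeral)
 then have "finite (crit (flat 4 0 (- 2))) & card (crit (flat 4 0 (- 2))) = 2 + 2 + 4"
  unfolding eq by (intro card_disjoint_Un card_fibre card_graph conjI square_roots poly_roots_finite) auto
 moreover have "hess (flat 4 0 (- 2)) z ~= 0" if z: "z \<in> crit (flat 4 0 (- 2))" for z
 proof -
  obtain x y where xy: "z = (x, y)" by (cases z)
  note H = conic_crit_facts(3)[OF con z[unfolded xy]]
  from z consider "x = 1" "y\<^sup>2 = 1 / 5" | "x = - 1" "y\<^sup>2 = 1" | "poly ?q x = 0" unfolding xy crit1 by blast
  then show ?thesis
  proof cases
   case 1
   have "hess (flat 4 0 (- 2)) (x, y) = 20 * (y + 1)" unfolding H unfolding 1(1) by simp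
   moreover have "20 * (y + 1) ~= 0"
   proof
    assume "20 * (y + 1) = 0" then have "y = - 1" by algebra
    then show False using 1 by simp
   qed
   ultimately show ?thesis unfolding xy by argo
  next
   case 2
   then show ?thesis unfolding xy H unfolding 2(1) by (auto simp: power2_eq_1_iff)
  next
   case 3
   have x0: "x ~= 0" using 3 by auto
   have "x\<^sup>2 ~= 1" using 3 by (auto simp: power2_eq_1_iff)
   have "x ^ 4 * ((x - 1 / x) * (y * ?B x) * hess (flat 4 0 (- 2)) (x, y))
    = - (x\<^sup>2 - 1)\<^sup>2 * (x * poly (pderiv ?q) x) - 4 * x\<^sup>2 * (x\<^sup>2 - 1) * poly ?q x + 4 * (x\<^sup>2 - 1)\<^sup>2 * poly ?q x"
    unfolding conic_crit_hess[OF con z[unfolded xy]] using x0 by (simp add: pderiv_pCons field_simps eval_nat_numeral)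
   also have "\<dots> ~= 0" using 3 sf(3)[of x] x0 \<open>x\<^sup>2 ~= 1\<close> by auto
   finally show ?thesis using xy by auto
  qed
 qed
 ultimately show ?thesis by (simp add: morse_def)
qed

lemma morse_3_1_m2: "morse (flat 3 1 (- 2)) 8"
proof -
 note con = conic_3_1_m2
 let ?T = "\<lambda>x::complex. x\<^sup>2 + x + 1"
 let ?q = "[:3, 6, 10, 6, 3 :: complex:]"
 have bez: "poly [:188, 306, 156:] x * poly ?q x + poly [:- 66, - 121, - 96, - 39:] x * poly (pderiv ?q) x = 168" for x
  by (simp add: pderiv_pCons algebra_simps)
 note sf = squarefree_roots[OF bez, simplified]
 have q: "poly ?q x = 4 * ?T x ^ 2 - (x + 1)\<^sup>2 * (1 + x\<^sup>2)" for x by (simp add: algebra_simps eval_nat_numeral)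
 have iff: "(x, y) \<in> crit (flat 3 1 (- 2)) \<longleftrightarrow> x ~= 0 & y ~= 0 & (1 + x) * ((x * y)\<^sup>2 * (1 + x\<^sup>2) - 1) = 0 &
   x * y * (x\<^sup>2 - 1) + (x * y)\<^sup>2 * (x + 2 * x\<^sup>2 + 3 * x ^ 3) - (2 + x) = 0" for x y
 proof -
  have "(x - 1 / x) + y * (x + 2 * x\<^sup>2 + 3 * x ^ 3) + (- (2 + x) / x\<^sup>2) / y
    = (x * y * (x\<^sup>2 - 1) + (x * y)\<^sup>2 * (x + 2 * x\<^sup>2 + 3 * x ^ 3) - (2 + x)) / (x\<^sup>2 * y)"
   if "x ~= 0" "y ~= 0"
   using that by (simp add: field_simps eval_nat_numeral)
  moreover have "y\<^sup>2 * (1 + x + x\<^sup>2 + x ^ 3) = (1 + x) / x\<^sup>2 \<longleftrightarrow> (1 + x) * ((x * y)\<^sup>2 * (1 + x\<^sup>2) - 1) = 0" if "x ~= 0"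
  proof -
   have "y\<^sup>2 * (1 + x + x\<^sup>2 + x ^ 3) = (1 + x) / x\<^sup>2 \<longleftrightarrow> y\<^sup>2 * (1 + x + x\<^sup>2 + x ^ 3) * x\<^sup>2 = 1 + x"
    using that by (simp add: eq_divide_eq)
   also have "\<dots> \<longleftrightarrow> (1 + x) * ((x * y)\<^sup>2 * (1 + x\<^sup>2) - 1) = 0" by algebra
   finally show ?thesis .
  qed
  ultimately show ?thesis unfolding conic_crit_iff[OF con] by auto
 qed
 have T0: "?T x ~= 0" if "poly ?q x = 0" for x
 proof
  assume T: "?T x = 0"
  have "(x + 1)\<^sup>2 * (1 + x\<^sup>2) = 4 * ?T x ^ 2 - poly ?q x" unfolding q by simp
  then have "(x + 1)\<^sup>2 * (1 + x\<^sup>2) = 0" unfolding T that by simp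
  then have "x = 0" using T by algebra
  then show False using T by simp
 qed
 define r where "r = (\<lambda>x. - (x + 1) / (2 * x * ?T x))"
 have crit1: "(x, y) \<in> crit (flat 3 1 (- 2)) \<longleftrightarrow> (x = - 1 & y\<^sup>2 = - 1 / 2) \<or> (x = 1 & y\<^sup>2 = 1 / 2) \<or> (poly ?q x = 0 & y = r x)" for x y
 proof
  assume "(x, y) \<in> crit (flat 3 1 (- 2))"
  then have h: "x ~= 0" "y ~= 0" "(1 + x) * ((x * y)\<^sup>2 * (1 + x\<^sup>2) - 1) = 0"
   "x * y * (x\<^sup>2 - 1) + (x * y)\<^sup>2 * (x + 2 * x\<^sup>2 + 3 * x ^ 3) - (2 + x) = 0" unfolding iff by auto
  from h(3) consider "1 + x = 0" | "(x * y)\<^sup>2 * (1 + x\<^sup>2) = 1" by auto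
  then show "(x = - 1 & y\<^sup>2 = - 1 / 2) \<or> (x = 1 & y\<^sup>2 = 1 / 2) \<or> (poly ?q x = 0 & y = r x)"
  proof cases
   case 1
   then have "x = - 1" "2 * y\<^sup>2 + 1 = 0" using h(4) by algebra+
   then show ?thesis by (simp add: field_simps eq_neg_iff_add_eq_0)
  next
   case 2
   have "x * y * ((x - 1) * (x + 1 + 2 * (x * y) * ?T x)) = 0" using 2 h(4) by algebra
   then consider "x = 1" | "x + 1 + 2 * (x * y) * ?T x = 0" using h(1,2) by auto
   then show ?thesis
   proof cases
    case 1
    then show ?thesis using 2 by (simp add: field_simps)
   next
    case c: 2
    have "(x * y)\<^sup>2 * (4 * ?T x ^ 2 - (x + 1)\<^sup>2 * (1 + x\<^sup>2)) = 0" using 2 c by algebra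
    then have *: "poly ?q x = 0" using h(1,2) unfolding q by simp
    have "y * (2 * x * ?T x) = - (x + 1)" using c by algebra
    then have "y = r x" unfolding r_def using h(1) T0[OF *] by (simp only: eq_divide_eq) simp
    with * show ?thesis by blast
   qed
  qed
 next
  assume "(x = - 1 & y\<^sup>2 = - 1 / 2) \<or> (x = 1 & y\<^sup>2 = 1 / 2) \<or> (poly ?q x = 0 & y = r x)"
  then show "(x, y) \<in> crit (flat 3 1 (- 2))"
  proof (elim disjE conjE)
   assume x: "poly ?q x = 0" "y = r x"
   have x0: "x ~= 0" using x(1) by auto
   have x1: "x + 1 ~= 0"
   proof
    assume "x + 1 = 0" then have "x = - 1" by algebra
    then show False using x(1) by simp
   qed
   have "2 * x * ?T x ~= 0" using x0 T0[OF x(1)] by (simp only: mult_eq_0_iff) simp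
   from nonzero_eq_divide_eq[OF this, of y "- (x + 1)"]
   have "y * (2 * x * ?T x) = - (x + 1)" using x(2) unfolding r_def by blast
   then have e: "2 * (x * y) * ?T x = - (x + 1)" by algebra
   have "y ~= 0"
   proof
    assume "y = 0"
    then have "x + 1 = 0" using e by algebra
    then show False using x1 by blast
   qed
   moreover have "(x + 1)\<^sup>2 * (1 + x\<^sup>2) = 4 * ?T x ^ 2 - poly ?q x" unfolding q by simp
   then have 4: "(x + 1)\<^sup>2 * (1 + x\<^sup>2) = 4 * ?T x ^ 2" unfolding x(1) by simp
   have "?T x ^ 2 * ((x * y)\<^sup>2 * (1 + x\<^sup>2) - 1) = 0" using e 4 by algebra
   then have 5: "(x * y)\<^sup>2 * (1 + x\<^sup>2) = 1" using T0[OF x(1)] by simp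
   moreover have "x * y * (x\<^sup>2 - 1) + (x * y)\<^sup>2 * (x + 2 * x\<^sup>2 + 3 * x ^ 3) - (2 + x) = 0"
    using 5 e by algebra
   ultimately show ?thesis unfolding iff using x0 by simp
  next
   assume "x = - 1" "y\<^sup>2 = - 1 / 2"
   then show ?thesis unfolding iff by auto
  next
   assume x: "x = 1" "y\<^sup>2 = 1 / 2"
   have 6: "2 * y\<^sup>2 = 1" unfolding x(2) by simp
   then have "y ~= 0" by auto
   then show ?thesis unfolding iff using x(1) 6 by simp
  qed
 qed
 have eq: "crit (flat 3 1 (- 2)) = ({- 1} \<times> {y. y\<^sup>2 = - 1 / 2} \<union> {1} \<times> {y. y\<^sup>2 = 1 / 2}) \<union> (\<lambda>x. (x, r x)) ` {x. poly ?q x = 0}"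
  using crit1 by auto
 have "card {x. poly ?q x = 0} = 4" using sf(2) by (simp add: eval_nat_numeral)
 then have "finite (crit (flat 3 1 (- 2))) & card (crit (flat 3 1 (- 2))) = 2 + 2 + 4"
  unfolding eq by (intro card_disjoint_Un card_fibre card_graph conjI square_roots poly_roots_finite) auto
 moreover have "hess (flat 3 1 (- 2)) z ~= 0" if z: "z \<in> crit (flat 3 1 (- 2))" for z
 proof -
  obtain x y where xy: "z = (x, y)" by (cases z)
  note H = conic_crit_facts(3)[OF con z[unfolded xy]]
  from z consider "x = - 1" "y\<^sup>2 = - 1 / 2" | "x = 1" "y\<^sup>2 = 1 / 2" | "poly ?q x = 0" unfolding xy crit1 by blast
  then show ?thesis
  proof cases
   case 1
   show ?thesis unfolding xy H unfolding 1(1) by simp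
  next
   case 2
   have "hess (flat 3 1 (- 2)) (x, y) = 16 * y + 24" unfolding H unfolding 2(1) by simp
   moreover have "16 * y + 24 ~= 0"
   proof
    assume "16 * y + 24 = 0" then have "y = - 3 / 2" by algebra
    then show False using 2 by (simp add: power2_eq_square)
   qed
   ultimately show ?thesis unfolding xy by argo
  next
   case 3
   have x0: "x ~= 0" using 3 by auto
   have "x\<^sup>2 ~= 1" using 3 by (auto simp: power2_eq_1_iff)
   have "x ^ 4 * ((x - 1 / x) * (y * (1 + x + x\<^sup>2 + x ^ 3)) * hess (flat 3 1 (- 2)) (x, y))
    = - (x\<^sup>2 - 1)\<^sup>2 * (x * poly (pderiv ?q) x) - 4 * x\<^sup>2 * (x\<^sup>2 - 1) * poly ?q x + 4 * (x\<^sup>2 - 1)\<^sup>2 * poly ?q x"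
    unfolding conic_crit_hess[OF con z[unfolded xy]] using x0 by (simp add: pderiv_pCons field_simps eval_nat_numeral)
   also have "\<dots> ~= 0" using 3 sf(3)[of x] x0 \<open>x\<^sup>2 ~= 1\<close> by auto
   finally show ?thesis using xy by auto
  qed
 qed
 ultimately show ?thesis by (simp add: morse_def)
qed

lemma morse_2_2_m2: "morse (flat 2 2 (- 2)) 8"
proof -
 note con = conic_2_2_m2
 let ?B = "\<lambda>x::complex. 1 + x + x\<^sup>2"
 let ?\<Omega> = "{x::complex. 1 * x\<^sup>2 + 1 * x + 1 = 0}"
 have iff: "(x, y) \<in> crit (flat 2 2 (- 2)) \<longleftrightarrow> x ~= 0 & y ~= 0 & ?B x * ((x * y)\<^sup>2 - 1) = 0 &
   x * y * (x\<^sup>2 - 1) + (x * y)\<^sup>2 * (x + 2 * x\<^sup>2) - (2 + x) = 0" for x y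
 proof -
  have e: "(x - 1 / x) + y * (x + 2 * x\<^sup>2) + (- (2 + x) / x\<^sup>2) / y
    = (x * y * (x\<^sup>2 - 1) + (x * y)\<^sup>2 * (x + 2 * x\<^sup>2) - (2 + x)) / (x\<^sup>2 * y)"
   if "x ~= 0" "y ~= 0"
   using that by (simp add: field_simps eval_nat_numeral)
  have "(x - 1 / x) + y * (x + 2 * x\<^sup>2) + (- (2 + x) / x\<^sup>2) / y = 0
    \<longleftrightarrow> x * y * (x\<^sup>2 - 1) + (x * y)\<^sup>2 * (x + 2 * x\<^sup>2) - (2 + x) = 0"
   if "x ~= 0" "y ~= 0"
   unfolding e[OF that] divide_eq_0_iff using that by simp
  moreover have "y\<^sup>2 * ?B x = ?B x / x\<^sup>2 \<longleftrightarrow> ?B x * ((x * y)\<^sup>2 - 1) = 0" if "x ~= 0"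
  proof -
   have "y\<^sup>2 * ?B x = ?B x / x\<^sup>2 \<longleftrightarrow> y\<^sup>2 * ?B x * x\<^sup>2 = ?B x" using that by (simp add: eq_divide_eq)
   also have "\<dots> \<longleftrightarrow> ?B x * ((x * y)\<^sup>2 - 1) = 0" by algebra
   finally show ?thesis .
  qed
  ultimately show ?thesis unfolding conic_crit_iff[OF con] by blast
 qed
 have crit1: "(x, y) \<in> crit (flat 2 2 (- 2)) \<longleftrightarrow> (x\<^sup>2 = 1 & y\<^sup>2 = 1) \<or> (x \<in> ?\<Omega> & x * y \<in> ?\<Omega>)" for x y
 proof
  assume "(x, y) \<in> crit (flat 2 2 (- 2))"
  then have h: "x ~= 0" "y ~= 0" "?B x * ((x * y)\<^sup>2 - 1) = 0"
   "x * y * (x\<^sup>2 - 1) + (x * y)\<^sup>2 * (x + 2 * x\<^sup>2) - (2 + x) = 0" unfolding iff by auto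
  from h(3) consider "?B x = 0" | "x * y = 1" | "x * y = - 1" by (auto simp: power2_eq_1_iff)
  then show "(x\<^sup>2 = 1 & y\<^sup>2 = 1) \<or> (x \<in> ?\<Omega> & x * y \<in> ?\<Omega>)"
  proof cases
   case 1
   have "x * (2 * x + 1) * ((x * y)\<^sup>2 + x * y + 1) = 0" using 1 h(4) by algebra
   moreover have "2 * x + 1 ~= 0"
   proof
    assume "2 * x + 1 = 0" then have "x = - 1 / 2" by algebra
    then show False using 1 by (simp add: power2_eq_square)
   qed
   ultimately have "(x * y)\<^sup>2 + x * y + 1 = 0" using h(1) by simp
   then show ?thesis using 1 by (simp add: algebra_simps)
  next
   case 2
   then have "x\<^sup>2 = 1" "y\<^sup>2 = 1" using h(4) by algebra+
   then show ?thesis by simp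
  next
   case 3
   then have "x\<^sup>2 = 1" using h(4) by algebra
   moreover have "y\<^sup>2 = 1" using 3 calculation by algebra
   ultimately show ?thesis by simp
  qed
 next
  assume "(x\<^sup>2 = 1 & y\<^sup>2 = 1) \<or> (x \<in> ?\<Omega> & x * y \<in> ?\<Omega>)"
  then show "(x, y) \<in> crit (flat 2 2 (- 2))"
  proof (elim disjE conjE)
   assume "x\<^sup>2 = 1" "y\<^sup>2 = 1"
   then show ?thesis unfolding iff by (auto simp: power2_eq_1_iff)
  next
   assume "x \<in> ?\<Omega>" "x * y \<in> ?\<Omega>"
   then have w: "x\<^sup>2 + x + 1 = 0" "(x * y)\<^sup>2 + x * y + 1 = 0" by simp_all
   have "x ~= 0" "y ~= 0" using w by auto
   moreover have "?B x = 0" using w(1) by algebra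
   moreover have "x * y * (x\<^sup>2 - 1) + (x * y)\<^sup>2 * (x + 2 * x\<^sup>2) - (2 + x) = 0" using w by algebra
   ultimately show ?thesis unfolding iff by simp
  qed
 qed
 have eq: "crit (flat 2 2 (- 2)) = {x. x\<^sup>2 = 1} \<times> {y. y\<^sup>2 = 1} \<union> (\<lambda>(x, s). (x, s / x)) ` (?\<Omega> \<times> ?\<Omega>)"
 proof (intro set_eqI iffI)
  fix z assume z: "z \<in> crit (flat 2 2 (- 2))"
  obtain x y where xy: "z = (x, y)" by (cases z)
  have "x ~= 0" using z unfolding xy iff by blast
  then have "(x, y) = (\<lambda>(x, s). (x, s / x)) (x, x * y)" by simp
  then show "z \<in> {x. x\<^sup>2 = 1} \<times> {y. y\<^sup>2 = 1} \<union> (\<lambda>(x, s). (x, s / x)) ` (?\<Omega> \<times> ?\<Omega>)"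
   using z unfolding xy crit1 by blast
 next
  fix z assume "z \<in> {x. x\<^sup>2 = 1} \<times> {y. y\<^sup>2 = 1} \<union> (\<lambda>(x, s). (x, s / x)) ` (?\<Omega> \<times> ?\<Omega>)"
  then show "z \<in> crit (flat 2 2 (- 2))"
  proof
   assume "z \<in> (\<lambda>(x, s). (x, s / x)) ` (?\<Omega> \<times> ?\<Omega>)"
   then obtain p where p: "p \<in> ?\<Omega> \<times> ?\<Omega>" "z = (\<lambda>(x, s). (x, s / x)) p" by (elim imageE)
   obtain x s where "p = (x, s)" by (cases p)
   then have xs: "z = (x, s / x)" "x \<in> ?\<Omega>" "s \<in> ?\<Omega>" using p by simp_all
   then have "x ~= 0" by auto
   then have "x * (s / x) = s" by simp
   then show ?thesis unfolding xs(1) crit1 using xs by simp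
  qed (auto simp: crit1)
 qed
 have \<Omega>: "finite ?\<Omega>" "card ?\<Omega> = 2" by (rule quadratic_roots; simp)+
 have "inj_on (\<lambda>(x, s). (x, s / x)) (?\<Omega> \<times> ?\<Omega>)" by (auto simp: inj_on_def)
 then have "card ((\<lambda>(x, s). (x, s / x)) ` (?\<Omega> \<times> ?\<Omega>)) = 4" using \<Omega> by (simp only: card_image card_cartesian_product)
 then have "finite (crit (flat 2 2 (- 2))) & card (crit (flat 2 2 (- 2))) = 4 + 4"
  unfolding eq
 proof (intro card_disjoint_Un conjI)
  show "card ({x :: complex. x\<^sup>2 = 1} \<times> {y :: complex. y\<^sup>2 = 1}) = 4" using square_roots[of 1] by (simp add: card_cartesian_product)
  show "{x. x\<^sup>2 = 1} \<times> {y. y\<^sup>2 = 1} \<inter> (\<lambda>(x, s). (x, s / x)) ` (?\<Omega> \<times> ?\<Omega>) = {}"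
   by (auto simp: power2_eq_1_iff)
 qed (use \<Omega> square_roots[of 1] in \<open>auto intro!: finite_imageI finite_cartesian_product\<close>)
 moreover have "hess (flat 2 2 (- 2)) z ~= 0" if z: "z \<in> crit (flat 2 2 (- 2))" for z
 proof -
  obtain x y where xy: "z = (x, y)" by (cases z)
  note H = conic_crit_facts(3)[OF con z[unfolded xy]]
  from z consider "x = 1" "y = 1 \<or> y = - 1" | "x = - 1" "y = 1 \<or> y = - 1" | "x \<in> ?\<Omega>"
   unfolding xy crit1 by (auto simp: power2_eq_1_iff)
  then show ?thesis
  proof cases
   case 1
   then show ?thesis unfolding xy H unfolding 1(1) by auto
  next
   case 2
   then show ?thesis unfolding xy H unfolding 2(1) by auto
  next
   case 3
   define u where "u = 1 / x"
   have w: "x\<^sup>2 + x + 1 = 0" using 3 by simp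
   then have xu: "x * u = 1" by (auto simp: u_def)
   have H': "hess (flat 2 2 (- 2)) (x, y) = 2 * (x + u) * (y * ?B x) - (x - u)\<^sup>2
     + 2 * ((x + 4 * x\<^sup>2) * (?B x * u\<^sup>2) + 2 * (x + 2 * x\<^sup>2) * (- (2 + x) * u\<^sup>2) + ?B x * ((4 + x) * u\<^sup>2))"
    unfolding H by (simp add: u_def power_divide)
   have "hess (flat 2 2 (- 2)) (x, y) = - 9" unfolding H' using xu w by algebra
   then show ?thesis using xy by simp
  qed
 qed
 ultimately show ?thesis by (simp add: morse_def)
qed

lemma morse_tri3: "morse tri3 3"
proof -
 have d: "dlog1 tri3 (x, y) = x - 1 / (x * y)" "dlog2 tri3 (x, y) = y - 1 / (x * y)" 
  "hess tri3 (x, y) = (x + 1 / (x * y)) * (y + 1 / (x * y)) - (1 / (x * y))\<^sup>2" for x y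
  by (simp_all add: dlog1_def dlog2_def hess_def hess11_def hess12_def hess22_def tri3_def mono2_def power_int_minus divide_inverse)
 have crit1: "(x, y) \<in> crit tri3 \<longleftrightarrow> x ^ 3 = 1 & y = x" for x y
 proof
  assume "(x, y) \<in> crit tri3"
  then have h: "x ~= 0" "y ~= 0" "x = 1 / (x * y)" "y = 1 / (x * y)" by (auto simp: crit_def torus2_def d)
  then have "y = x" by simp
  moreover have "x * (x * y) = 1" using h by (metis mult_eq_0_iff nonzero_eq_divide_eq)
  ultimately show "x ^ 3 = 1 & y = x" by (simp add: power3_eq_cube mult.assoc)
 next
  assume x: "x ^ 3 = 1 & y = x"
  then have "x ~= 0" by auto
  then show "(x, y) \<in> crit tri3" using x by (auto simp: crit_def torus2_def d field_simps power3_eq_cube)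
 qed
 then have eq: "crit tri3 = (\<lambda>x. (x, x)) ` {x. x ^ 3 = 1}" by auto
 have "hess tri3 z ~= 0" if z: "z \<in> crit tri3" for z
 proof -
  obtain x y where xy: "z = (x, y)" by (cases z)
  have x: "x ^ 3 = 1" "y = x" using z unfolding xy crit1 by auto
  then have "x ~= 0" by auto
  then have "1 / (x * y) = x" using x by (simp add: field_simps power3_eq_cube)
  then have "hess tri3 (x, y) = 3 * x\<^sup>2" unfolding d x(2) by (simp add: power2_eq_square algebra_simps)
  then show ?thesis using xy \<open>x ~= 0\<close> by simp
 qed
 moreover have "finite (crit tri3) & card (crit tri3) = 3" unfolding eq by (intro card_graph cube_roots)
 ultimately show ?thesis by (simp add: morse_def)
qed

lemma morse_tri9: "morse tri9 9"
proof -
 define P1 where "P1 = (\<lambda>x y::complex. x\<^sup>2 * y - y + x\<^sup>2 - y\<^sup>2 - 1 + 2 * x ^ 3 - y ^ 3)"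
 define P2 where "P2 = (\<lambda>x y::complex. x * y\<^sup>2 - x - x\<^sup>2 + y\<^sup>2 - 1 - x ^ 3 + 2 * y ^ 3)"
 have d: "x * y * dlog1 tri9 (x, y) = P1 x y" "x * y * dlog2 tri9 (x, y) = P2 x y" if "x ~= 0" "y ~= 0" for x y
  using that by (simp_all add: dlog1_def dlog2_def tri9_def mono2_def power_int_minus P1_def P2_def field_simps eval_nat_numeral)
 have iff: "(x, y) \<in> crit tri9 \<longleftrightarrow> x ~= 0 & y ~= 0 & P1 x y = 0 & P2 x y = 0" for x y
 proof (cases "x ~= 0 & y ~= 0")
  case True
  then show ?thesis using d[of x y, symmetric] by (simp add: crit_def torus2_def)
 qed (auto simp: crit_def torus2_def)
 have h: "hess11 tri9 (x, y) = x + u + x * v + u * y + u * v + 4 * x\<^sup>2 * v + u * y\<^sup>2"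
  "hess12 tri9 (x, y) = - x * v - u * y + u * v - 2 * x\<^sup>2 * v - 2 * u * y\<^sup>2"
  "hess22 tri9 (x, y) = y + v + x * v + u * y + u * v + x\<^sup>2 * v + 4 * u * y\<^sup>2"
  if "u = inverse x" "v = inverse y" for x y u v
  by (simp_all add: that hess11_def hess12_def hess22_def tri9_def mono2_def power_int_minus)
 define Q where "Q = (\<lambda>x y. (x = 1 & y = 1) \<or> (2 * x\<^sup>2 + 2 * x + 1 = 0 & y = x) \<or> (x = 1 & 1 * y\<^sup>2 + 2 * y + 2 = 0)
  \<or> (y = 1 & 1 * x\<^sup>2 + 2 * x + 2 = 0) \<or> (1 * x\<^sup>2 + 1 * x + 1 = (0::complex) & y = - 1 - x))"
 have crit1: "(x, y) \<in> crit tri9 \<longleftrightarrow> Q x y" for x y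
 proof
  assume "(x, y) \<in> crit tri9"
  then have P: "P1 x y = 0" "P2 x y = 0" unfolding iff by auto
  have 1: "(x - y) * (3 * x\<^sup>2 + 4 * x * y + 3 * y\<^sup>2 + 2 * x + 2 * y + 1) = 0" using P unfolding P1_def P2_def by algebra
  have 2: "(x - 1) * (3 * x\<^sup>2 + 4 * x + 3 + 2 * x * y + 2 * y + y\<^sup>2) = 0" using P unfolding P1_def P2_def by algebra
  have 3: "(y - 1) * (3 * y\<^sup>2 + 4 * y + 3 + 2 * x * y + 2 * x + x\<^sup>2) = 0" using P unfolding P1_def P2_def by algebra
  show "Q x y"
  proof (cases "x = y")
   case xy: True
   show ?thesis
   proof (cases "x = 1")
    case True then show ?thesis using xy by (simp add: Q_def)
   next
    case False
    have "3 * ((x - 1) * (2 * x\<^sup>2 + 2 * x + 1)) = 0" using 2 xy by algebra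
    then have "2 * x\<^sup>2 + 2 * x + 1 = 0" using False by simp
    then show ?thesis using xy by (simp add: Q_def)
   qed
  next
   case nxy: False
   then have q1: "3 * x\<^sup>2 + 4 * x * y + 3 * y\<^sup>2 + 2 * x + 2 * y + 1 = 0" using 1 by simp
   show ?thesis
   proof (cases "x = 1")
    case x: True
    then have "1 * y\<^sup>2 + 2 * y + 2 = 0" using q1 by algebra
    then show ?thesis using x by (simp add: Q_def)
   next
    case nx: False
    then have q2: "3 * x\<^sup>2 + 4 * x + 3 + 2 * x * y + 2 * y + y\<^sup>2 = 0" using 2 by simp
    show ?thesis
    proof (cases "y = 1")
     case y: True
     then have "1 * x\<^sup>2 + 2 * x + 2 = 0" using q1 by algebra
     then show ?thesis using y by (simp add: Q_def)
    next
     case False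
     have "(y - 1) * (x + y + 1) = 0" using q1 q2 by algebra
     then have s: "x + y + 1 = 0" using False by simp
     then have "y = - 1 - x" "1 * x\<^sup>2 + 1 * x + 1 = 0" using q1 by algebra+
     then show ?thesis by (simp add: Q_def)
    qed
   qed
  qed
 next
  assume "Q x y"
  then show "(x, y) \<in> crit tri9" unfolding Q_def
  proof (elim disjE conjE)
   assume "x = 1" "y = 1" then show ?thesis unfolding iff by (simp add: P1_def P2_def)
  next
   assume x: "2 * x\<^sup>2 + 2 * x + 1 = 0" "y = x"
   then have "x ~= 0" by auto
   moreover have "P1 x y = 0" "P2 x y = 0" using x unfolding P1_def P2_def by algebra+
   ultimately show ?thesis unfolding iff using x by simp
  next
   assume x: "x = 1" "1 * y\<^sup>2 + 2 * y + 2 = 0"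
   then have "y ~= 0" by auto
   moreover have "P1 x y = 0" "P2 x y = 0" using x unfolding P1_def P2_def by algebra+
   ultimately show ?thesis unfolding iff using x by simp
  next
   assume x: "y = 1" "1 * x\<^sup>2 + 2 * x + 2 = 0"
   then have "x ~= 0" by auto
   moreover have "P1 x y = 0" "P2 x y = 0" using x unfolding P1_def P2_def by algebra+
   ultimately show ?thesis unfolding iff using x by simp
  next
   assume x: "1 * x\<^sup>2 + 1 * x + 1 = 0" "y = - 1 - x"
   then have "x ~= 0" by auto
   moreover have "y ~= 0"
   proof
    assume "y = 0" then have "x = - 1" using x(2) by algebra
    then show False using x(1) by simp
   qed
   moreover have "P1 x y = 0" "P2 x y = 0" using x unfolding P1_def P2_def by algebra+
   ultimately show ?thesis unfolding iff by simp
  qed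
 qed
 let ?R1 = "{x::complex. 2 * x\<^sup>2 + 2 * x + 1 = 0}" and ?R2 = "{x::complex. 1 * x\<^sup>2 + 2 * x + 2 = 0}"
  and ?R3 = "{x::complex. 1 * x\<^sup>2 + 1 * x + 1 = 0}"
 have R: "finite ?R1 & card ?R1 = 2" "finite ?R2 & card ?R2 = 2" "finite ?R3 & card ?R3 = 2"
  using quadratic_roots[of 2 2 1] quadratic_roots[of 1 2 2] quadratic_roots[of 1 1 1] by simp_all
 have swap: "finite (?R2 \<times> {1::complex}) & card (?R2 \<times> {1::complex}) = 2"
  using R(2) by (simp add: card_cartesian_product)
 have eq: "crit tri9 = ((({1} \<times> {1} \<union> (\<lambda>x. (x, x)) ` ?R1) \<union> {1} \<times> ?R2) \<union> ?R2 \<times> {1}) \<union> (\<lambda>x. (x, - 1 - x)) ` ?R3"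
  using crit1 by (auto simp: Q_def)
 have "finite (crit tri9) & card (crit tri9) = (((1 + 2) + 2) + 2) + 2"
  unfolding eq
 proof (intro card_disjoint_Un card_fibre card_graph R swap)
  show "({1} \<times> {1} \<union> (\<lambda>x. (x, x)) ` ?R1 \<union> {1} \<times> ?R2 \<union> ?R2 \<times> {1}) \<inter> (\<lambda>x. (x, - 1 - x)) ` ?R3 = {}"
  proof -
   have "- 1 ~= 2 * x" if "2 * x\<^sup>2 + 2 * x + 1 = 0" for x :: complex
   proof
    assume "- 1 = 2 * x"
    then have "(1 :: complex) = 0" using that by algebra
    then show False by simp
   qed
   moreover have "- 1 - x ~= 1" if "x \<in> ?R3" for x :: complex
   proof
    assume "- 1 - x = 1" then have "x = - 2" by algebra
    then show False using that by simp
   qed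
   ultimately show ?thesis by auto
  qed
 qed auto
 moreover have "hess tri9 z ~= 0" if z: "z \<in> crit tri9" for z
 proof -
  obtain x y where xy: "z = (x, y)" by (cases z)
  define u v where "u = inverse x" and "v = inverse y"
  have nz: "x ~= 0" "y ~= 0" using z unfolding xy iff by auto
  have uv: "x * u = 1" "y * v = 1" using nz by (simp_all add: u_def v_def)
  note H = h[OF u_def v_def]
  have "Q x y" using z unfolding xy crit1 .
  then consider "x = 1" "y = 1" | "2 * x\<^sup>2 + 2 * x + 1 = 0" "y = x" | "x = 1" "y\<^sup>2 + 2 * y + 2 = 0"
   | "y = 1" "x\<^sup>2 + 2 * x + 2 = 0" | "x\<^sup>2 + x + 1 = 0" "y = - 1 - x" unfolding Q_def by auto
  then show ?thesis
  proof cases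
   case 1
   then show ?thesis unfolding xy hess_def H u_def v_def by simp
  next
   case 2
   have "hess tri9 (x, y) = (8 * x + 2)\<^sup>2" unfolding hess_def H using uv 2 by algebra
   moreover have "8 * x + 2 ~= 0"
   proof
    assume "8 * x + 2 = 0" then have "x = - 1 / 4" by algebra
    then show False using 2 by (simp add: power2_eq_square)
   qed
   ultimately show ?thesis unfolding xy by simp
  next
   case 3
   have "hess tri9 (x, y) = (6 + 4 * y)\<^sup>2" unfolding hess_def H using uv 3 by algebra
   moreover have "6 + 4 * y ~= 0"
   proof
    assume "6 + 4 * y = 0" then have "y = - 3 / 2" by algebra
    then show False using 3 by (simp add: power2_eq_square)
   qed
   ultimately show ?thesis unfolding xy by simp
  next
   case 4
   have "hess tri9 (x, y) = (6 + 4 * x)\<^sup>2" unfolding hess_def H using uv 4 by algebra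
   moreover have "6 + 4 * x ~= 0"
   proof
    assume "6 + 4 * x = 0" then have "x = - 3 / 2" by algebra
    then show False using 4 by (simp add: power2_eq_square)
   qed
   ultimately show ?thesis unfolding xy by simp
  next
   case 5
   have "hess tri9 (x, y) = 12" unfolding hess_def H using uv 5 by algebra
   then show ?thesis using xy by simp
  qed
 qed
 ultimately show ?thesis by (simp add: morse_def)
qed

lemma morse_tri6: "morse tri6 6"
proof -
 let ?G = "[:1, 0, - 2, - 5, 0, 3, 3 :: complex:]"
 let ?N = "\<lambda>s::complex. 1 - s\<^sup>2 - 2 * s ^ 3"
 have bez: "poly [:7252, - 5112, - 16302, - 7503, 11646:] x * poly ?G x + poly [:- 1278, - 2909, 2524, 3195, 927, - 1941:] x * poly (pderiv ?G) x = 7252" for x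
  by (simp add: pderiv_pCons algebra_simps)
 have "(7252 :: complex) ~= 0" by simp
 note sf = squarefree_roots[OF bez this]
 have G: "poly ?G s = 1 - 2 * s\<^sup>2 - 5 * s ^ 3 + 3 * s ^ 5 + 3 * s ^ 6" for s by (simp add: algebra_simps eval_nat_numeral)
 have dG: "poly (pderiv ?G) s = - 4 * s - 15 * s\<^sup>2 + 15 * s ^ 4 + 18 * s ^ 5" for s
  by (simp add: pderiv_pCons algebra_simps eval_nat_numeral)
 have d: "dlog1 tri6 (x, y) = x - u + x * y + x * y\<^sup>2 - 2 * u\<^sup>2 * v" "dlog2 tri6 (x, y) = y + x * y + 2 * x * y\<^sup>2 - u\<^sup>2 * v"
  "hess11 tri6 (x, y) = x + u + x * y + x * y\<^sup>2 + 4 * u\<^sup>2 * v" "hess12 tri6 (x, y) = x * y + 2 * x * y\<^sup>2 + 2 * u\<^sup>2 * v"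
  "hess22 tri6 (x, y) = y + x * y + 4 * x * y\<^sup>2 + u\<^sup>2 * v" if "u = inverse x" "v = inverse y" for x y u v
  by (simp_all add: that dlog1_def dlog2_def hess11_def hess12_def hess22_def tri6_def mono2_def power_int_minus power_inverse)
 have iff: "(x, y) \<in> crit tri6 \<longleftrightarrow> x ~= 0 & y ~= 0 & (x * y)\<^sup>2 * x = ?N (x * y) & x\<^sup>2 - 1 - 2 * (x * y) - x * (x * y) - 3 * (x * y)\<^sup>2 = 0" for x y
 proof (cases "x ~= 0 & y ~= 0")
  case True
  define u v where "u = inverse x" and "v = inverse y"
  have uv: "x * u = 1" "y * v = 1" using True by (simp_all add: u_def v_def)
  have "dlog1 tri6 (x, y) = 0 & dlog2 tri6 (x, y) = 0 \<longleftrightarrow>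
   (x * y)\<^sup>2 * x = ?N (x * y) & x\<^sup>2 - 1 - 2 * (x * y) - x * (x * y) - 3 * (x * y)\<^sup>2 = 0"
  proof
   assume a: "dlog1 tri6 (x, y) = 0 & dlog2 tri6 (x, y) = 0"
   then have e: "x - u + x * y + x * y\<^sup>2 - 2 * u\<^sup>2 * v = 0" "y + x * y + 2 * x * y\<^sup>2 - u\<^sup>2 * v = 0"
    unfolding d[OF u_def v_def] by auto
   show "(x * y)\<^sup>2 * x = ?N (x * y) & x\<^sup>2 - 1 - 2 * (x * y) - x * (x * y) - 3 * (x * y)\<^sup>2 = 0"
    using e uv by algebra
  next
   assume a: "(x * y)\<^sup>2 * x = ?N (x * y) & x\<^sup>2 - 1 - 2 * (x * y) - x * (x * y) - 3 * (x * y)\<^sup>2 = 0"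
   then have e: "(x * y)\<^sup>2 * x = ?N (x * y)" "x\<^sup>2 - 1 - 2 * (x * y) - x * (x * y) - 3 * (x * y)\<^sup>2 = 0" by auto
   have 2: "y + x * y + 2 * x * y\<^sup>2 - u\<^sup>2 * v = 0" using e(1) uv by algebra
   have "x - u + x * y + x * y\<^sup>2 - 2 * u\<^sup>2 * v = 0" using e(2) 2 uv by algebra
   then show "dlog1 tri6 (x, y) = 0 & dlog2 tri6 (x, y) = 0" using 2 unfolding d[OF u_def v_def] by blast
  qed
  then show ?thesis using True by (simp add: crit_def torus2_def)
 qed (auto simp: crit_def torus2_def)
 have N0: "?N s ~= 0" if "poly ?G s = 0" for s
 proof
  assume N: "?N s = 0"
  have "s ~= 0" using N by auto
  moreover have "s ^ 4 * (1 + 2 * s + 3 * s\<^sup>2) = 0" using that N unfolding G by algebra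
  ultimately have q: "1 + 2 * s + 3 * s\<^sup>2 = 0" by simp
  then have "4 * (s + 2) = 0" using N by algebra
  then have "s = - 2" by algebra
  then show False using q by simp
 qed
 define X where "X = (\<lambda>s. ?N s / s\<^sup>2)"
 define F where "F = (\<lambda>s. (X s, s / X s))"
 have fwd: "poly ?G (x * y) = 0 & (x, y) = F (x * y)" if "(x, y) \<in> crit tri6" for x y
 proof -
  have h: "x ~= 0" "y ~= 0" "(x * y)\<^sup>2 * x = ?N (x * y)" "x\<^sup>2 - 1 - 2 * (x * y) - x * (x * y) - 3 * (x * y)\<^sup>2 = 0"
   using that unfolding iff by auto
  define s where "s = x * y"
  have hs: "s\<^sup>2 * x = ?N s" "x\<^sup>2 - 1 - 2 * s - x * s - 3 * s\<^sup>2 = 0" using h unfolding s_def by auto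
  have 1: "poly ?G s = 0" unfolding G using hs by algebra
  have "s ~= 0" using h by (simp add: s_def)
  then have X: "X s = x" using hs(1) unfolding X_def by (metis nonzero_mult_div_cancel_left power_not_zero)
  moreover have "s / x = y" using h by (simp add: s_def)
  ultimately have "F s = (x, y)" unfolding F_def X by blast
  then show ?thesis using 1 unfolding s_def by metis
 qed
 have bwd: "F s \<in> crit tri6 & fst (F s) * snd (F s) = s" if "poly ?G s = 0" for s
 proof -
  have s0: "s ~= 0" using that by auto
  have x0: "X s ~= 0" using N0[OF that] s0 by (simp add: X_def)
  define x where "x = X s"
  have xs: "x * (s / x) = s" using x0 by (simp add: x_def)
  have x0': "x ~= 0" using x0 by (simp add: x_def)
  have e: "s\<^sup>2 * x = ?N s" using s0 by (simp add: x_def X_def)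
  have "s ^ 4 * (x\<^sup>2 - 1 - 2 * s - x * s - 3 * s\<^sup>2) = (s\<^sup>2 * x)\<^sup>2 - s ^ 3 * (s\<^sup>2 * x) - s ^ 4 - 2 * s ^ 5 - 3 * s ^ 6"
   by algebra
  also have "\<dots> = poly ?G s" unfolding e G by algebra
  also have "\<dots> = 0" by fact
  finally have "x\<^sup>2 - 1 - 2 * s - x * s - 3 * s\<^sup>2 = 0" using s0 by simp
  then show ?thesis unfolding F_def x_def[symmetric] iff fst_conv snd_conv xs using e x0' s0 by simp
 qed
 have "bij_betw F {s. poly ?G s = 0} (crit tri6)"
 proof (rule bij_betw_byWitness[where f' = "\<lambda>z. fst z * snd z"])
  show "\<forall>s\<in>{s. poly ?G s = 0}. fst (F s) * snd (F s) = s" using bwd by blast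
  show "\<forall>z\<in>crit tri6. F (fst z * snd z) = z"
  proof
   fix z assume z: "z \<in> crit tri6"
   have "(fst z, snd z) \<in> crit tri6" using z by simp
   from fwd[OF this] show "F (fst z * snd z) = z" by simp
  qed
  show "F ` {s. poly ?G s = 0} \<subseteq> crit tri6" using bwd by blast
  show "(\<lambda>z. fst z * snd z) ` crit tri6 \<subseteq> {s. poly ?G s = 0}"
  proof
   fix s assume "s \<in> (\<lambda>z. fst z * snd z) ` crit tri6"
   then obtain x y where "(x, y) \<in> crit tri6" "s = x * y" by auto
   then show "s \<in> {s. poly ?G s = 0}" using fwd[of x y] by simp
  qed
 qed
 then have "finite (crit tri6) & card (crit tri6) = 6"
  using sf(1,2) bij_betw_finite[of F] bij_betw_same_card[of F] by simp
 moreover have "hess tri6 z ~= 0" if z: "z \<in> crit tri6" for z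
 proof -
  obtain x y where xy: "z = (x, y)" by (cases z)
  define u v where "u = inverse x" and "v = inverse y"
  have h: "x ~= 0" "y ~= 0" "(x * y)\<^sup>2 * x = ?N (x * y)" "x\<^sup>2 - 1 - 2 * (x * y) - x * (x * y) - 3 * (x * y)\<^sup>2 = 0"
   using z unfolding xy iff by auto
  have uv: "x * u = 1" "y * v = 1" using h by (simp_all add: u_def v_def)
  have D: "dlog1 tri6 (x, y) = 0" "dlog2 tri6 (x, y) = 0" using z unfolding xy crit_def by auto
  define s where "s = x * y"
  have G0: "poly ?G s = 0" using fwd z unfolding xy s_def by blast
  define q where "q = u\<^sup>2 * v"
  have h11: "hess11 tri6 (x, y) = 2 * (x + x * y + x * y\<^sup>2 + q)" and h22: "hess22 tri6 (x, y) = 2 * (q + x * y\<^sup>2)"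
   using D unfolding d[OF u_def v_def] q_def by algebra+
  have h12: "hess12 tri6 (x, y) = x * y + 2 * x * y\<^sup>2 + 2 * q" unfolding d[OF u_def v_def] q_def by simp
  have "x * q = u * v" using uv unfolding q_def by algebra
  moreover have "hess tri6 (x, y) = 4 * (x * q) + 3 * (x * y)\<^sup>2" unfolding hess_def h11 h12 h22 by algebra
  ultimately have H: "hess tri6 (x, y) = 4 * (u * v) + 3 * s\<^sup>2" unfolding s_def by simp
  have t: "s * (u * v) = 1" unfolding s_def using uv by algebra
  have hs: "s\<^sup>2 * x = ?N s" using h unfolding s_def by auto
  have "s\<^sup>2 * (x * s * hess tri6 (x, y)) = 4 * (s\<^sup>2 * x) * (s * (u * v)) + 3 * s ^ 3 * (s\<^sup>2 * x)"
   unfolding H by algebra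
  also have "\<dots> = 4 * poly ?G s - s * poly (pderiv ?G) s" unfolding hs t G dG by algebra
  finally have "s\<^sup>2 * (x * s * hess tri6 (x, y)) = - (s * poly (pderiv ?G) s)" unfolding G0 by simp
  moreover have "poly (pderiv ?G) s ~= 0" using sf(3) G0 by blast
  moreover have "s ~= 0" using h by (simp add: s_def)
  ultimately show ?thesis unfolding xy by (metis mult_eq_0_iff neg_equal_0_iff_equal)
 qed
 ultimately show ?thesis by (simp add: morse_def)
qed

text \<open>Two reflections reduce the parameters to \<open>r \<le> l\<close> and \<open>2 p + l + r \<le> 0\<close>, which leaves fourteen
  polygons.\<close>

lemma tame_flat:
 assumes "0 \<le> l" "0 \<le> r" "- 2 \<le> p" "l + r + p \<le> 2"
 shows "tame (flat l r p) (nat (4 + l + r))"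
proof -
 have canonical: "tame (flat l r p) (nat (4 + l + r))"
  if lr: "0 \<le> l" "0 \<le> r" "- 2 \<le> p" "r \<le> l" "2 * p + l + r \<le> 0" for l r p
 proof (rule tameI[OF flat_normal flat_card])
  have l: "l = 0 \<or> l = 1 \<or> l = 2 \<or> l = 3 \<or> l = 4" using lr by presburger
  have r: "r = 0 \<or> r = 1 \<or> r = 2" using lr by presburger
  have p: "p = - 2 \<or> p = - 1 \<or> p = 0" using lr by presburger
  show "morse (flat l r p) (nat (4 + l + r))"
   using l
  proof (elim disjE)
   assume l: "l = 0"
   then have "r = 0" using lr by linarith
   then show ?thesis using p l by (elim disjE) (simp_all add: morse_0_0_m2 morse_0_0_m1 morse_0_0_0)
  next
   assume l: "l = 1"
   have "p = - 2 \<or> p = - 1" "r = 0 \<or> r = 1" using lr l p r by auto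
   then show ?thesis using l by (elim disjE) (simp_all add: morse_1_0_m2 morse_1_0_m1 morse_1_1_m2 morse_1_1_m1)
  next
   assume l: "l = 2"
   have "p = - 2 & r = 0 \<or> p = - 1 & r = 0 \<or> p = - 2 & r = 1 \<or> p = - 2 & r = 2" using lr l p r by auto
   then show ?thesis using l by (elim disjE) (simp_all add: morse_2_0_m2 morse_2_0_m1 morse_2_1_m2 morse_2_2_m2)
  next
   assume l: "l = 3"
   have "p = - 2 & r = 0 \<or> p = - 2 & r = 1" using lr l p r by auto
   then show ?thesis using l by (elim disjE) (simp_all add: morse_3_0_m2 morse_3_1_m2)
  next
   assume l: "l = 4"
   have "p = - 2 & r = 0" using lr l p r by auto
   then show ?thesis using l by (simp add: morse_4_0_m2)
  qed
 qed (use lr in auto)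
 have ordered: "tame (flat l r p) (nat (4 + l + r))"
  if lr: "0 \<le> l" "0 \<le> r" "- 2 \<le> p" "l + r + p \<le> 2" "r \<le> l" for l r p
 proof (cases "2 * p + l + r \<le> 0")
  case False
  have "tame (flat l r (- p - l - r)) (nat (4 + l + r))" by (rule canonical) (use lr False in auto)
  then have "tame (lin (- 1) l 0 1 ` flat l r (- p - l - r)) (nat (4 + l + r))" by (rule tame_lin) simp
  then show ?thesis unfolding flat_reflect_x by simp
 qed (use lr canonical in auto)
 show ?thesis
 proof (cases "r \<le> l")
  case False
  have "tame (flat r l p) (nat (4 + r + l))" by (rule ordered) (use assms False in auto)
  then have "tame (lin 1 p 0 (- 1) ` flat r l p) (nat (4 + r + l))" by (rule tame_lin) simp
  then show ?thesis unfolding flat_reflect_y by (simp add: add_ac)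
 qed (use assms ordered in auto)
qed

lemma tame_tri3: "tame tri3 3"
 by (rule tameI[OF tri3_normal tri3_card]) (simp_all add: morse_tri3)

lemma tame_tri6: "tame tri6 6"
 by (rule tameI[OF tri6_normal tri6_card]) (simp_all add: morse_tri6)

lemma tame_tri9: "tame tri9 9"
 by (rule tameI[OF tri9_normal tri9_card]) (simp_all add: morse_tri9)

section \<open>Classification of reflexive polygons\<close>

text \<open>What reflexivity means for the set \<open>A\<close> of lattice points: if \<open>n x\<close> is a nonnegative integral combination
  of lattice points with coefficient sum at most \<open>n\<close>, then \<open>x\<close> lies in the polygon, and if the sum is
  less than \<open>n\<close>, then \<open>x\<close> is an interior lattice point and hence the origin. Multiplication by an
  integer is written as a linear map. Three summands suffice for the classification. The
  condition on \<open>pairing\<close> says that the origin is in the interior.\<close>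

definition fano :: "(int \<times> int) set \<Rightarrow> bool" where
 "fano A \<longleftrightarrow> finite A & 0 \<in> A & (\<forall>w. w ~= 0 \<longrightarrow> (\<exists>a\<in>A. 0 < pairing w a)) &
   (\<forall>n i j k a b c x. 0 < n \<longrightarrow> 0 \<le> i \<longrightarrow> 0 \<le> j \<longrightarrow> 0 \<le> k \<longrightarrow> a \<in> A \<longrightarrow> b \<in> A \<longrightarrow> c \<in> A \<longrightarrow>
    lin n 0 0 n x = lin i 0 0 i a + lin j 0 0 j b + lin k 0 0 k c \<longrightarrow>
    (i + j + k \<le> n \<longrightarrow> x \<in> A) & (i + j + k < n \<longrightarrow> x = 0))"

lemma fanoI:
 assumes "finite A" "0 \<in> A" "\<And>w. w ~= 0 \<Longrightarrow> \<exists>a\<in>A. 0 < pairing w a"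
  "\<And>n i j k a b c x. \<lbrakk>0 < n; 0 \<le> i; 0 \<le> j; 0 \<le> k; a \<in> A; b \<in> A; c \<in> A;
   lin n 0 0 n x = lin i 0 0 i a + lin j 0 0 j b + lin k 0 0 k c\<rbrakk>
   \<Longrightarrow> (i + j + k \<le> n \<longrightarrow> x \<in> A) & (i + j + k < n \<longrightarrow> x = 0)"
 shows "fano A"
 unfolding fano_def
 apply (intro conjI)
   apply (rule assms(1))
  apply (rule assms(2))
  apply (intro allI impI, rule assms(3), assumption)
 apply (intro allI impI, rule assms(4); assumption)
 done

lemma fanoD:
 assumes "fano A" "0 < n" "0 \<le> i" "0 \<le> j" "0 \<le> k" "a \<in> A" "b \<in> A" "c \<in> A"
  "lin n 0 0 n x = lin i 0 0 i a + lin j 0 0 j b + lin k 0 0 k c"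
 shows "i + j + k \<le> n \<Longrightarrow> x \<in> A" "i + j + k < n \<Longrightarrow> x = 0"
 using assms(1)[unfolded fano_def, THEN conjunct2, THEN conjunct2, THEN conjunct2,
  THEN spec[of _ n], THEN spec[of _ i], THEN spec[of _ j], THEN spec[of _ k], THEN spec[of _ a], THEN spec[of _ b],
  THEN spec[of _ c], THEN spec[of _ x], rule_format, OF assms(2-)] by auto

lemma fano_pairing:
 assumes "fano A" "w ~= 0"
 shows "\<exists>a\<in>A. 0 < pairing w a"
 by (rule assms(1)[unfolded fano_def, THEN conjunct2, THEN conjunct2, THEN conjunct1, THEN spec, THEN mp, OF assms(2)])

lemma fano_finite: "fano A \<Longrightarrow> finite A" "fano A \<Longrightarrow> 0 \<in> A"
 by (erule fano_def[THEN iffD1, THEN conjunct1] fano_def[THEN iffD1, THEN conjunct2, THEN conjunct1])+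

lemma fano_combination:
 assumes "fano A" "0 < n" "0 \<le> i" "0 \<le> j" "0 \<le> k" "(a, a') \<in> A" "(b, b') \<in> A" "(c, c') \<in> A"
  "n * x = i * a + j * b + k * c" "n * x' = i * a' + j * b' + k * c'"
 shows "i + j + k \<le> n \<Longrightarrow> (x, x') \<in> A" "i + j + k < n \<Longrightarrow> x = 0 & x' = 0"
proof -
 have "lin n 0 0 n (x, x') = lin i 0 0 i (a, a') + lin j 0 0 j (b, b') + lin k 0 0 k (c, c')"
  using assms(9,10) by (simp add: lin_def)
 note D = fanoD[OF assms(1-8) this]
 show "i + j + k \<le> n \<Longrightarrow> (x, x') \<in> A" "i + j + k < n \<Longrightarrow> x = 0 & x' = 0" using D by (auto simp: zero_prod_def)
qed

lemma fano_0: "fano A \<Longrightarrow> (0, 0) \<in> A" using fano_finite(2)[of A] by (simp add: zero_prod_def)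

lemma fano_combination2:
 assumes "fano A" "0 < n" "0 \<le> i" "0 \<le> j" "(a, a') \<in> A" "(b, b') \<in> A"
  "n * x = i * a + j * b" "n * x' = i * a' + j * b'"
 shows "i + j \<le> n \<Longrightarrow> (x, x') \<in> A" "i + j < n \<Longrightarrow> x = 0 & x' = 0"
 using fano_combination[OF assms(1-4) _ assms(5,6) fano_0[OF assms(1)], of 0] assms(7,8) by auto

lemma fano_positive:
 assumes "fano A" "w ~= 0 \<or> w' ~= 0"
 obtains a a' where "(a, a') \<in> A" "0 < w * a + w' * a'"
proof -
 have "(w, w') ~= 0" using assms(2) by (auto simp: zero_prod_def)
 then obtain z where "z \<in> A" "0 < pairing (w, w') z" using fano_pairing[OF assms(1)] by blast
 then show ?thesis using that[of "fst z" "snd z"] by (simp add: pairing_def)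
qed

lemma fano_lin:
 assumes A: "fano A" and d: "\<bar>a * d - b * c\<bar> = 1"
 shows "fano (lin a b c d ` A)"
proof -
 let ?L = "lin a b c d"
 define \<delta> where "\<delta> = a * d - b * c"
 let ?M = "lin (\<delta> * d) (- \<delta> * b) (- \<delta> * c) (\<delta> * a)"
 note inv = lin_inverse[OF d, folded \<delta>_def]
 have mem: "z \<in> ?L ` A \<longleftrightarrow> ?M z \<in> A" for z
 proof
  assume "?M z \<in> A"
  then have "?L (?M z) \<in> ?L ` A" by (rule imageI)
  then show "z \<in> ?L ` A" unfolding inv(2) .
 next
  assume "z \<in> ?L ` A"
  then obtain y where "z = ?L y" "y \<in> A" by blast
  then show "?M z \<in> A" using inv(1)[of y] by simp
 qed
 have smult: "?M (lin n 0 0 n z) = lin n 0 0 n (?M z)" for n z by (simp add: lin_def algebra_simps)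
 have L0: "?L 0 = 0" "?M 0 = 0" by (simp_all add: lin_def zero_prod_def)
 have pos: "\<exists>z\<in>?L ` A. 0 < pairing w z" if "w ~= 0" for w
 proof -
  let ?w = "lin a c b d w"
  have "?w ~= 0"
  proof
   assume "?w = 0"
   moreover have "\<bar>a * d - c * b\<bar> = 1" using d by (simp add: mult.commute)
   note lin_inverse(1)[OF this, of w]
   ultimately show False using that by (simp add: lin_def zero_prod_def)
  qed
  then obtain z where "z \<in> A" "0 < pairing ?w z" using fano_pairing[OF A] by blast
  moreover have "pairing ?w z = pairing w (?L z)" by (simp add: pairing_def lin_def algebra_simps)
  ultimately show ?thesis by auto
 qed
 have comb: "(i + j + k \<le> n \<longrightarrow> x \<in> ?L ` A) & (i + j + k < n \<longrightarrow> x = 0)"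
  if h: "0 < n" "0 \<le> i" "0 \<le> j" "0 \<le> k" "u \<in> ?L ` A" "v \<in> ?L ` A" "w \<in> ?L ` A"
   "lin n 0 0 n x = lin i 0 0 i u + lin j 0 0 j v + lin k 0 0 k w" for n i j k u v w x
 proof -
  have "?M (lin n 0 0 n x) = ?M (lin i 0 0 i u + lin j 0 0 j v + lin k 0 0 k w)" unfolding h(8) ..
  then have "lin n 0 0 n (?M x) = lin i 0 0 i (?M u) + lin j 0 0 j (?M v) + lin k 0 0 k (?M w)"
   unfolding lin_add smult .
  moreover have "?M u \<in> A" "?M v \<in> A" "?M w \<in> A" using h mem by blast+
  ultimately have "i + j + k \<le> n \<Longrightarrow> ?M x \<in> A" "i + j + k < n \<Longrightarrow> ?M x = 0"
   using fanoD[OF A h(1-4), of "?M u" "?M v" "?M w" "?M x"] by simp_all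
  moreover have "x = 0" if "?M x = 0" using inv(2)[of x] that L0(1) by simp
  ultimately show ?thesis using mem[of x] by simp
 qed
 have fin: "finite (?L ` A)" using fano_finite(1)[OF A] by simp
 have zero: "0 \<in> ?L ` A" by (rule image_eqI[of _ _ 0]) (use fano_finite(2)[OF A] L0 in simp_all)
 show ?thesis by (rule fanoI[OF fin zero pos comb])
qed

lemma tame_lin_iff:
 assumes "tame (lin a b c d ` A) n" "\<bar>a * d - b * c\<bar> = 1"
 shows "tame A n"
proof -
 define \<delta> where "\<delta> = a * d - b * c"
 let ?M = "lin (\<delta> * d) (- \<delta> * b) (- \<delta> * c) (\<delta> * a)"
 have "\<delta> = 1 \<or> \<delta> = - 1" using assms(2) by (auto simp: \<delta>_def)
 then have "\<bar>\<delta> * d * (\<delta> * a) - - \<delta> * b * (- \<delta> * c)\<bar> = 1" using assms(2) by (elim disjE) (simp_all add: mult.commute)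
 from tame_lin[OF assms(1) this] show ?thesis
  unfolding image_image lin_inverse(1)[OF assms(2), folded \<delta>_def] by simp
qed

lemma fano_row0:
 assumes A: "fano A" and e: "(x, 0) \<in> A"
 shows "- 1 \<le> x & x \<le> 1"
proof -
 have "\<bar>x\<bar> \<le> 1"
 proof (rule ccontr)
  assume "\<not> \<bar>x\<bar> \<le> 1"
  then have x: "1 < \<bar>x\<bar>" by simp
  have "sgn x = 0 & (0::int) = 0"
   by (rule fano_combination2(2)[OF A _ _ _ e e, of "\<bar>x\<bar>" 1 0]) (use x in \<open>auto simp: sgn_if\<close>)
  then show False using x by (simp add: sgn_if split: if_splits)
 qed
 then show ?thesis by linarith
qed

lemma fano_primitive:
 assumes A: "fano A" and e: "(m * x, m * y) \<in> A" and "1 < m"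
 shows "x = 0 & y = 0"
 using fano_combination2(2)[OF A _ _ _ e e, of m 1 0 x y] assms(3) by simp

locale flat_direction =
 fixes A assumes A: "fano A" and right: "(1, 0) \<in> A" and left: "(- 1, 0) \<in> A"
begin

text \<open>The vectors \<open>y (k, 1)\<close> and \<open>(x, y)\<close> differ by a horizontal vector of length at most \<open>y - 1\<close>, which is a multiple of \<open>(1, 0)\<close> or \<open>(-1, 0)\<close>.\<close>

lemma near:
 assumes "(x, y) \<in> A" "0 < y" "1 + \<bar>y * k - x\<bar> \<le> y"
 shows "(k, 1) \<in> A" "1 + \<bar>y * k - x\<bar> = y"
proof -
 have e: "(sgn (y * k - x), 0) \<in> A" using right left fano_0[OF A] by (simp add: sgn_if)
 have c: "y * k = 1 * x + \<bar>y * k - x\<bar> * sgn (y * k - x)" "y * 1 = 1 * y + \<bar>y * k - x\<bar> * 0"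
  by (simp_all add: abs_mult_sgn)
 show "(k, 1) \<in> A"
  by (rule fano_combination2(1)[OF A assms(2) _ _ assms(1) e c]) (use assms in auto)
 have "\<not> 1 + \<bar>y * k - x\<bar> < y"
  using fano_combination2(2)[OF A assms(2) _ _ assms(1) e c] by auto
 then show "1 + \<bar>y * k - x\<bar> = y" using assms by simp
qed

lemma row_le_2:
 assumes "(x, y) \<in> A" "0 < y" shows "y \<le> 2"
proof (rule ccontr)
 assume y: "\<not> y \<le> 2"
 define q s where "q = x div y" and "s = x mod y"
 have x: "x = y * q + s" "0 \<le> s" "s < y" using assms(2) by (auto simp: q_def s_def)
 have 1: "y * (q + 1) - x = y - s" "y * q - x = - s" using x by (simp_all add: algebra_simps)
 show False
 proof (cases "s \<le> y - 2")
  case True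
  then have "1 + \<bar>y * q - x\<bar> = y" by (intro near(2)[OF assms]) (use x 1 True in simp)
  then show False using True 1 x by simp
 next
  case False
  then have "1 + \<bar>y * (q + 1) - x\<bar> = y" by (intro near(2)[OF assms]) (use x y 1 False in simp)
  then show False using False 1 x y by simp
 qed
qed

text \<open>A point at height \<open>2\<close> leaves room for only two points at height \<open>1\<close>. Its abscissa is odd, as
  otherwise its half would be an interior lattice point. With a third point at height \<open>1\<close>, one of
  the two would be in the interior.\<close>

lemma row2:
 assumes "(x, 2) \<in> A"
 obtains k where "x = 2 * k + 1" "(k, 1) \<in> A" "(k + 1, 1) \<in> A" "\<And>j. (j, 1) \<in> A \<Longrightarrow> j = k \<or> j = k + 1"
proof -
 have odd: "odd x"
 proof
  assume "even x" then obtain k where x: "x = 2 * k" by blast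
  have "1 + \<bar>2 * k - x\<bar> = 2" by (rule near(2)[OF assms]) (use x in auto)
  then show False using x by simp
 qed
 then obtain k where x: "x = 2 * k + 1" by (metis oddE)
 have "(k, 1) \<in> A" by (rule near(1)[OF assms]) (use x in auto)
 moreover have "(k + 1, 1) \<in> A" by (rule near(1)[OF assms]) (use x in auto)
 moreover have "j = k \<or> j = k + 1" if j: "(j, 1) \<in> A" for j
 proof (rule ccontr)
  assume "\<not> (j = k \<or> j = k + 1)"
  then consider "k + 2 \<le> j" | "j \<le> k - 1" by linarith
  then show False
  proof cases
   case 1
   define s where "s = j - (k + 1)"
   have "k + 1 = 0 & (1 :: int) = 0"
    by (rule fano_combination2(2)[OF A _ _ _ assms j, of "2 * s + 1" s 1]) (use 1 x in \<open>auto simp: s_def algebra_simps\<close>)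
   then show False by simp
  next
   case 2
   define s where "s = k - j"
   have "k = 0 & (1 :: int) = 0"
    by (rule fano_combination2(2)[OF A _ _ _ assms j, of "2 * s + 1" s 1]) (use 2 x in \<open>auto simp: s_def algebra_simps\<close>)
   then show False by simp
  qed
 qed
 ultimately show ?thesis using x that by blast
qed

lemma row1:
 obtains l m where "l \<le> m" "\<And>x. (x, 1) \<in> A \<longleftrightarrow> l \<le> x & x \<le> m"
proof -
 let ?R = "{x. (x, 1) \<in> A}"
 obtain x y where xy: "(x, y) \<in> A" "0 < 0 * x + 1 * y" using fano_positive[OF A, of 0 1] by auto
 define q s where "q = x div y" and "s = x mod y"
 have x: "x = y * q + s" "0 \<le> s" "s < y" using xy(2) by (auto simp: q_def s_def)
 have q: "(q, 1) \<in> A"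
  by (rule near(1)[OF xy(1)]) (use x xy(2) in \<open>auto simp: algebra_simps\<close>)
 have "?R \<subseteq> fst ` A" by force
 then have fin: "finite ?R" using fano_finite(1)[OF A] finite_subset by blast
 define l m where "l = Min ?R" and "m = Max ?R"
 have lm: "l \<in> ?R" "m \<in> ?R" using Min_in[OF fin] Max_in[OF fin] q unfolding l_def m_def by blast+
 have le: "l \<le> x & x \<le> m" if "(x, 1) \<in> A" for x using fin that unfolding l_def m_def by auto
 have "(x, 1) \<in> A" if "l \<le> x" "x \<le> m" for x
 proof (cases "l = m")
  case False
  show ?thesis
   by (rule fano_combination2(1)[OF A, of "m - l" "m - x" "x - l" l 1 m 1]) (use False that lm in \<open>auto simp: algebra_simps\<close>)
 qed (use that lm in auto)
 then show ?thesis using that[of l m] le lm by blast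
qed

lemma reflect: "flat_direction (lin 1 0 0 (- 1) ` A)"
proof
 show "fano (lin 1 0 0 (- 1) ` A)" by (rule fano_lin[OF A]) simp
 show "(1, 0) \<in> lin 1 0 0 (- 1) ` A" "(- 1, 0) \<in> lin 1 0 0 (- 1) ` A"
  by (rule image_eqI[OF _ right], simp add: lin_def, rule image_eqI[OF _ left], simp add: lin_def)
qed

lemma reflect_mem: "(x, y) \<in> lin 1 0 0 (- 1) ` A \<longleftrightarrow> (x, - y) \<in> A"
proof
 assume "(x, - y) \<in> A" then have "lin 1 0 0 (- 1) (x, - y) \<in> lin 1 0 0 (- 1) ` A" by blast
 then show "(x, y) \<in> lin 1 0 0 (- 1) ` A" by (simp add: lin_def)
qed (auto simp: lin_def)

lemma shear: "flat_direction (lin 1 k 0 1 ` A)"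
proof
 show "fano (lin 1 k 0 1 ` A)" by (rule fano_lin[OF A]) simp
 show "(1, 0) \<in> lin 1 k 0 1 ` A" "(- 1, 0) \<in> lin 1 k 0 1 ` A"
  by (rule image_eqI[OF _ right], simp add: lin_def, rule image_eqI[OF _ left], simp add: lin_def)
qed

lemma shear_mem: "(x, y) \<in> lin 1 k 0 1 ` A \<longleftrightarrow> (x - k * y, y) \<in> A"
proof
 assume "(x - k * y, y) \<in> A" then have "lin 1 k 0 1 (x - k * y, y) \<in> lin 1 k 0 1 ` A" by blast
 then show "(x, y) \<in> lin 1 k 0 1 ` A" by (simp add: lin_def)
qed (auto simp: lin_def)

lemma rows:
 "\<exists>l m p q. l \<le> m & p \<le> q & (\<forall>x. (x, 1) \<in> A \<longleftrightarrow> l \<le> x & x \<le> m) &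
   (\<forall>x. (x, - 1) \<in> A \<longleftrightarrow> p \<le> x & x \<le> q) & (\<forall>x. (x, 0) \<in> A \<longleftrightarrow> - 1 \<le> x & x \<le> 1) &
   - 2 \<le> l + p & m + q \<le> 2 & (\<forall>x y. (x, y) \<in> A \<longrightarrow> - 2 \<le> y & y \<le> 2)"
proof -
 obtain l m where lm: "l \<le> m" "\<And>x. (x, 1) \<in> A \<longleftrightarrow> l \<le> x & x \<le> m" using row1 by blast
 obtain p q where pq: "p \<le> q" "\<And>x. (x, 1) \<in> lin 1 0 0 (- 1) ` A \<longleftrightarrow> p \<le> x & x \<le> q"
  using flat_direction.row1[OF reflect] by blast
 note pq' = pq[unfolded reflect_mem]
 have lp: "- 2 \<le> l + p"
 proof (rule ccontr)
  assume "\<not> - 2 \<le> l + p"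
  moreover have "(l, 1) \<in> A" "(p, - 1) \<in> A" using lm pq unfolding reflect_mem by auto
  ultimately have "(- 1 :: int) = 0 & (0 :: int) = 0"
   by (intro fano_combination2(2)[OF A, of "- (l + p)" 1 1]) auto
  then show False by simp
 qed
 have mq: "m + q \<le> 2"
 proof (rule ccontr)
  assume "\<not> m + q \<le> 2"
  moreover have "(m, 1) \<in> A" "(q, - 1) \<in> A" using lm pq unfolding reflect_mem by auto
  ultimately have "(1 :: int) = 0 & (0 :: int) = 0"
   by (intro fano_combination2(2)[OF A, of "m + q" 1 1]) auto
  then show False by simp
 qed
 have row0: "(x, 0) \<in> A \<longleftrightarrow> - 1 \<le> x & x \<le> 1" for x
 proof
  assume "- 1 \<le> x & x \<le> 1"
  then have "x = - 1 \<or> x = 0 \<or> x = 1" by linarith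
  then show "(x, 0) \<in> A" using right left fano_0[OF A] by auto
 qed (use fano_row0[OF A] in blast)
 have height: "- 2 \<le> y & y \<le> 2" if "(x, y) \<in> A" for x y
 proof -
  have "y \<le> 2" using row_le_2[OF that] by linarith
  moreover have "- y \<le> 2" using flat_direction.row_le_2[OF reflect, of x "- y"] that unfolding reflect_mem by fastforce
  ultimately show ?thesis by simp
 qed
 show ?thesis
  by (rule exI[of _ l], rule exI[of _ m], rule exI[of _ p], rule exI[of _ q])
   (intro conjI allI impI lm pq' row0 lp mq, use height in auto)
qed

lemma flat_tame:
 assumes flat: "\<And>x y. (x, y) \<in> A \<Longrightarrow> \<bar>y\<bar> \<le> 1"
 shows "\<exists>b. tame A b"
proof -
 obtain l m p q where H: "l \<le> m" "p \<le> q" "\<forall>x. (x, 1) \<in> A \<longleftrightarrow> l \<le> x & x \<le> m"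
  "\<forall>x. (x, - 1) \<in> A \<longleftrightarrow> p \<le> x & x \<le> q" "\<forall>x. (x, 0) \<in> A \<longleftrightarrow> - 1 \<le> x & x \<le> 1"
  "- 2 \<le> l + p" "m + q \<le> 2" "\<forall>x y. (x, y) \<in> A \<longrightarrow> - 2 \<le> y & y \<le> 2" using rows by blast
 note h = H[rule_format]
 have "lin 1 (- l) 0 1 ` A = flat (m - l) (q - p) (p + l)"
 proof (intro set_eqI)
  fix z :: "int \<times> int"
  obtain x y where z: "z = (x, y)" by (cases z)
  show "z \<in> lin 1 (- l) 0 1 ` A \<longleftrightarrow> z \<in> flat (m - l) (q - p) (p + l)"
  proof (cases "y = 1 \<or> y = - 1 \<or> y = 0")
   case True
   then show ?thesis unfolding z shear_mem by (elim disjE) (auto simp: h flat_def)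
  next
   case False
   then have "\<not> \<bar>y\<bar> \<le> 1" by linarith
   then have "(x - - l * y, y) \<notin> A" using flat by blast
   then show ?thesis using False unfolding z shear_mem by (simp add: flat_def)
  qed
 qed
 moreover have "tame (flat (m - l) (q - p) (p + l)) (nat (4 + (m - l) + (q - p)))"
  by (rule tame_flat) (use h in auto)
 ultimately have "tame A (nat (4 + (m - l) + (q - p)))" using tame_lin_iff[of 1 "- l" 0 1 A] by simp
 then show ?thesis by blast
qed

end

text \<open>Used with several directions: after a change of basis that maps the given antipodal pair to
  \<open>(1, 0)\<close> and \<open>(-1, 0)\<close>, the functional \<open>(c, d)\<close> becomes the height.\<close>

lemma flat_in_direction:
 assumes A: "fano A" and d: "\<bar>a * d - b * c\<bar> = 1"
  and "(x, y) \<in> A" "(- x, - y) \<in> A" "a * x + b * y = 1" "c * x + d * y = 0"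
  and flat: "\<And>x y. (x, y) \<in> A \<Longrightarrow> \<bar>c * x + d * y\<bar> \<le> 1"
 shows "\<exists>n. tame A n"
proof -
 interpret flat_direction "lin a b c d ` A"
 proof
  show "fano (lin a b c d ` A)" by (rule fano_lin[OF A d])
  show "(1, 0) \<in> lin a b c d ` A" by (rule image_eqI[OF _ assms(3)]) (use assms in \<open>simp add: lin_def\<close>)
  show "(- 1, 0) \<in> lin a b c d ` A"
   by (rule image_eqI[OF _ assms(4)]) (use assms(5,6) in \<open>simp add: lin_def algebra_simps\<close>)
 qed
 have "\<exists>n. tame (lin a b c d ` A) n" by (rule flat_tame) (use flat in \<open>auto simp: lin_def\<close>)
 then show ?thesis using tame_lin_iff[OF _ d] by blast
qed

context flat_direction
begin

text \<open>The lower row is one of ten intervals \<open>{p..q}\<close>. In seven cases the polygon has width two in another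
  direction. The other three are the exceptional triangles.\<close>

lemma tame_row2_normalised:
 assumes "(1, 2) \<in> A" shows "\<exists>n. tame A n"
proof -
 obtain k where k: "(1::int) = 2 * k + 1" "(k, 1) \<in> A" "(k + 1, 1) \<in> A" "\<And>j. (j, 1) \<in> A \<Longrightarrow> j = k \<or> j = k + 1"
  using row2[OF assms] by blast
 have r1: "(x, 1) \<in> A \<longleftrightarrow> x = 0 \<or> x = 1" for x using k by auto
 obtain l m p q where H: "l \<le> m" "p \<le> q" "\<forall>x. (x, 1) \<in> A \<longleftrightarrow> l \<le> x & x \<le> m"
  "\<forall>x. (x, - 1) \<in> A \<longleftrightarrow> p \<le> x & x \<le> q" "\<forall>x. (x, 0) \<in> A \<longleftrightarrow> - 1 \<le> x & x \<le> 1"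
  "- 2 \<le> l + p" "m + q \<le> 2" "\<forall>x y. (x, y) \<in> A \<longrightarrow> - 2 \<le> y & y \<le> 2" using rows by blast
 note h = H[rule_format]
 have "(l, 1) \<in> A" "(m, 1) \<in> A" "(0, 1) \<in> A" "(1, 1) \<in> A" using h(1,3) r1 by auto
 then have lm: "l = 0" "m = 1" using h(3)[of 0] h(3)[of 1] r1[of l] r1[of m] by auto
 have r2: "x = 1" if x: "(x, 2) \<in> A" for x
 proof -
  obtain j where "x = 2 * j + 1" "(j, 1) \<in> A" "(j + 1, 1) \<in> A" using row2[OF x] by blast
  then show ?thesis unfolding r1 by auto
 qed
 have r3: "x = 2 * p + 1 & q = p + 1" if x: "(x, - 2) \<in> A" for x
 proof -
  have x2: "(x, 2) \<in> lin 1 0 0 (- 1) ` A" using x unfolding reflect_mem .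
  obtain j where j: "x = 2 * j + 1" "(j, - 1) \<in> A" "(j + 1, - 1) \<in> A" "\<And>i. (i, - 1) \<in> A \<Longrightarrow> i = j \<or> i = j + 1"
   using flat_direction.row2[OF reflect x2] unfolding reflect_mem by blast
  have "p = j \<or> p = j + 1" "q = j \<or> q = j + 1" using j(4) h(2,4) by auto
  then show ?thesis using j(1,2,3) h(4) by auto
 qed
 have mem: "y = 0 & - 1 \<le> x & x \<le> 1 \<or> y = 1 & (x = 0 \<or> x = 1) \<or> y = 2 & x = 1 \<or> y = - 1 & p \<le> x & x \<le> q
   \<or> y = - 2 & x = 2 * p + 1 & q = p + 1" if "(x, y) \<in> A" for x y
 proof -
  have "- 2 \<le> y & y \<le> 2" using h(8) that by blast
  then consider "y = 0" | "y = 1" | "y = 2" | "y = - 1" | "y = - 2" by linarith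
  then show ?thesis
  proof cases
   case 1 then show ?thesis using that h(5)[of x] by simp
  next
   case 2 then show ?thesis using that r1[of x] by simp
  next
   case 3 then show ?thesis using that r2[of x] by simp
  next
   case 4 then show ?thesis using that h(4)[of x] by simp
  next
   case 5 then show ?thesis using that r3[of x] by simp
  qed
 qed
 have in_A: "(0, 1) \<in> A" "(1, 1) \<in> A" "(- 1, 0) \<in> A" "(0, 0) \<in> A" "(1, 0) \<in> A" using r1 h(5) by auto
 have pq: "- 2 \<le> p" "q \<le> 1" using h(6,7) lm by auto
 consider "p = - 1 \<or> p = 0" "0 \<le> q" | "p = - 2" "q = - 1 \<or> q = 0" | "p = - 1" "q = - 1" | "p = - 2" "q = 1"
  | "p = - 2" "q = - 2" | "p = 1" "q = 1" using pq h(2) by (smt (verit))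
 then show ?thesis
 proof cases
  case 1
  show ?thesis
  proof (rule flat_in_direction[OF A, of 0 0 1 1 0 1])
   show "(- 0, - 1) \<in> A" using h(4)[of 0] 1 by auto
   show "\<bar>1 * x + 0 * y\<bar> \<le> 1" if "(x, y) \<in> A" for x y using mem[OF that] 1 pq(2) by auto
  qed (use in_A in auto)
 next
  case 2
  show ?thesis
  proof (rule flat_in_direction[OF A, of 1 "- 1" 0 1 1 1])
   show "(- 1, - 1) \<in> A" using h(4)[of "- 1"] 2 by auto
   show "\<bar>1 * x + - 1 * y\<bar> \<le> 1" if "(x, y) \<in> A" for x y using mem[OF that] 2 by auto
  qed (use in_A in auto)
 next
  case 3
  show ?thesis
  proof (rule flat_in_direction[OF A, of 1 "- 1" 0 1 1 1])
   show "(- 1, - 1) \<in> A" using h(4)[of "- 1"] 3 by auto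
   show "\<bar>1 * x + - 1 * y\<bar> \<le> 1" if "(x, y) \<in> A" for x y using mem[OF that] 3 by auto
  qed (use in_A in auto)
 next
  case 4
  have "A = lin 0 (- 1) 1 0 ` tri9"
  proof (rule subset_antisym)
   have "lin 0 (- 1) 1 0 ` tri9 = {(0, 0), (0, 1), (- 1, 0), (0, - 1), (1, 0), (1, 1), (- 1, - 1), (1, - 1), (1, 2), (- 2, - 1)}"
    by (simp add: tri9_def lin_def)
   moreover have "(x, y) \<in> {(0, 0), (0, 1), (- 1, 0), (0, - 1), (1, 0), (1, 1), (- 1, - 1), (1, - 1), (1, 2), (- 2, - 1)}"
    if "(x, y) \<in> A" for x y
    using mem[OF that] unfolding 4 by (simp only: insert_iff empty_iff prod.inject) (smt (verit))
   ultimately show "A \<subseteq> lin 0 (- 1) 1 0 ` tri9" by (simp only:) (rule subrelI)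
   show "lin 0 (- 1) 1 0 ` tri9 \<subseteq> A" using in_A assms h(4) 4 by (simp add: tri9_def lin_def)
  qed
  then have "tame A 9" using tame_lin[OF tame_tri9, where a = 0 and b = "- 1" and c = 1 and d = 0] by simp
  then show ?thesis by blast
 next
  case 5
  have "A = tri6"
  proof (rule subset_antisym)
   show "A \<subseteq> tri6"
   proof (rule subrelI)
    fix x y assume "(x, y) \<in> A"
    from mem[OF this] show "(x, y) \<in> tri6" unfolding 5 tri6_def by (simp only: insert_iff empty_iff prod.inject) (smt (verit))
   qed
   show "tri6 \<subseteq> A" using in_A assms h(4) 5 by (simp add: tri6_def)
  qed
  then show ?thesis using tame_tri6 by blast
 next
  case 6
  have "A = lin (- 1) 1 0 1 ` tri6"
  proof (rule subset_antisym)
   have "lin (- 1) 1 0 1 ` tri6 = {(0, 0), (- 1, 0), (1, 0), (1, 1), (0, 1), (1, 2), (1, - 1)}"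
    by (simp add: tri6_def lin_def)
   moreover have "(x, y) \<in> {(0, 0), (- 1, 0), (1, 0), (1, 1), (0, 1), (1, 2), (1, - 1)}" if "(x, y) \<in> A" for x y
    using mem[OF that] unfolding 6 by (simp only: insert_iff empty_iff prod.inject) (smt (verit))
   ultimately show "A \<subseteq> lin (- 1) 1 0 1 ` tri6" by (simp only:) (rule subrelI)
   show "lin (- 1) 1 0 1 ` tri6 \<subseteq> A" using in_A assms h(4) 6 by (simp add: tri6_def lin_def)
  qed
  then have "tame A 6" using tame_lin[OF tame_tri6, where a = "- 1" and b = 1 and c = 0 and d = 1] by simp
  then show ?thesis by blast
 qed
qed

lemma tame_row2:
 assumes "(x, 2) \<in> A" shows "\<exists>n. tame A n"
proof -
 obtain k where k: "x = 2 * k + 1" using row2[OF assms] by blast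
 have "(1, 2) \<in> lin 1 (- k) 0 1 ` A" unfolding shear_mem using assms unfolding k by (simp add: add.commute mult.commute)
 then have "\<exists>n. tame (lin 1 (- k) 0 1 ` A) n" by (rule flat_direction.tame_row2_normalised[OF shear])
 then show ?thesis using tame_lin_iff[where a = 1 and b = "- k" and c = 0 and d = 1 and A = A] by auto
qed

lemma tame: "\<exists>n. tame A n"
proof (cases "\<exists>x. (x, 2) \<in> A \<or> (x, - 2) \<in> A")
 case True
 then obtain x where "(x, 2) \<in> A \<or> (x, - 2) \<in> A" by blast
 then show ?thesis
 proof
  assume "(x, - 2) \<in> A"
  then have "(x, 2) \<in> lin 1 0 0 (- 1) ` A" unfolding reflect_mem .
  then have "\<exists>n. tame (lin 1 0 0 (- 1) ` A) n" by (rule flat_direction.tame_row2[OF reflect])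
  then show ?thesis using tame_lin_iff[where a = 1 and b = 0 and c = 0 and d = "- 1" and A = A] by auto
 qed (rule tame_row2)
next
 case False
 have h: "- 2 \<le> y & y \<le> 2" if "(x, y) \<in> A" for x y using rows that by blast
 show ?thesis
 proof (rule flat_tame)
  fix x y assume xy: "(x, y) \<in> A"
  then have "y ~= 2" "y ~= - 2" using False by auto
  then show "\<bar>y\<bar> \<le> 1" using h[OF xy] by linarith
 qed
qed

end

lemma fano_coprime:
 assumes A: "fano A" and xy: "(x, y) \<in> A" "x ~= 0 \<or> y ~= 0"
 obtains u v where "u * x + v * y = 1"
proof -
 have "gcd x y = 1"
 proof (rule ccontr)
  assume g: "gcd x y ~= 1"
  have "gcd x y ~= 0" using xy(2) by simp
  then have g1: "1 < gcd x y" using g gcd_ge_0_int[of x y] by linarith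
  obtain x' y' where e: "x = gcd x y * x'" "y = gcd x y * y'" by (meson dvd_def gcd_dvd1 gcd_dvd2)
  then have "(gcd x y * x', gcd x y * y') \<in> A" using xy(1) by metis
  then have "x' = 0 & y' = 0" by (rule fano_primitive[OF A _ g1])
  then show False using xy(2) e by simp
 qed
 then show ?thesis using bezout_int[of x y] that by auto
qed

text \<open>A primitive vector can be completed to a lattice basis, so the antipodal pair may be assumed horizontal.\<close>

lemma antipodal_tame:
 assumes A: "fano A" and xy: "(x, y) \<in> A" "(- x, - y) \<in> A" "x ~= 0 \<or> y ~= 0"
 shows "\<exists>n. tame A n"
proof -
 obtain u v where uv: "u * x + v * y = 1" using fano_coprime[OF A xy(1,3)] .
 have det: "\<bar>u * x - v * - y\<bar> = 1" using uv by simp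
 interpret flat_direction "lin u v (- y) x ` A"
 proof
  show "fano (lin u v (- y) x ` A)" by (rule fano_lin[OF A det])
  show "(1, 0) \<in> lin u v (- y) x ` A" by (rule image_eqI[OF _ xy(1)]) (use uv in \<open>simp add: lin_def\<close>)
  show "(- 1, 0) \<in> lin u v (- y) x ` A" by (rule image_eqI[OF _ xy(2)]) (use uv in \<open>simp add: lin_def algebra_simps\<close>)
 qed
 show ?thesis using tame tame_lin_iff[OF _ det] by blast
qed

text \<open>A further lattice point lies in a cone spanned by two of the three vertices. If it is not on the boundary
  of the cone, then the sum of these two vertices, which is the negative of the third, belongs
  to \<open>A\<close> as well.\<close>

lemma unit_triangle_tame:
 assumes A: "fano A" and t: "(1, 0) \<in> A" "(0, 1) \<in> A" "(- 1, - 1) \<in> A"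
 shows "\<exists>n. tame A n"
proof (cases "A \<subseteq> tri3")
 case True
 have "tri3 \<subseteq> A" using t fano_0[OF A] by (simp add: tri3_def)
 then show ?thesis using True tame_tri3 by (metis subset_antisym)
next
 case False
 then obtain x y where xy: "(x, y) \<in> A" "(x, y) \<notin> tri3" by auto
 have e1: "\<exists>n. tame A n" if "(- 1, 0) \<in> A" using antipodal_tame[OF A, of 1 0] t that by simp
 have e2: "\<exists>n. tame A n" if "(0, - 1) \<in> A" using antipodal_tame[OF A, of 0 1] t that by simp
 have e3: "\<exists>n. tame A n" if "(1, 1) \<in> A" using antipodal_tame[OF A, of 1 1] t that by simp
 have prim: "m = - 1 \<or> m = 0 \<or> m = 1" if "(m * u, m * v) \<in> A" "u ~= 0 \<or> v ~= 0" for m u v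
 proof (rule ccontr)
  assume "\<not> (m = - 1 \<or> m = 0 \<or> m = 1)"
  then consider "1 < m" | "1 < - m" by linarith
  then show False
  proof cases
   case 1 then show False using fano_primitive[OF A that(1)] that(2) by blast
  next
   case 2 then show False using fano_primitive[OF A _ 2, of "- u" "- v"] that by auto
  qed
 qed
 consider "x = 0" | "y = 0" | "x = y" | "0 < x" "0 < y" "y \<le> x" | "0 < x" "0 < y" "x < y"
  | "y < 0" "y < x" "x \<le> 0" | "y < 0" "y < x" "0 < x" | "x < 0" "x < y" "y \<le> 0" | "x < 0" "x < y" "0 < y" by (smt (verit))
 then show ?thesis
 proof cases
  case 1
  then have "y = - 1" using prim[of y 0 1] xy by (auto simp: tri3_def)
  then show ?thesis using e2 xy 1 by simp
 next
  case 2
  then have "x = - 1" using prim[of x 1 0] xy by (auto simp: tri3_def)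
  then show ?thesis using e1 xy 2 by simp
 next
  case 3
  then have "x = 1" using prim[of x 1 1] xy by (auto simp: tri3_def)
  then show ?thesis using e3 xy 3 by simp
 next
  case 4
  show ?thesis by (rule e3, rule fano_combination2(1)[OF A, of x 1 "x - y" x y 0 1]) (use 4 xy t in auto)
 next
  case 5
  show ?thesis by (rule e3, rule fano_combination2(1)[OF A, of y 1 "y - x" x y 1 0]) (use 5 xy t in auto)
 next
  case 6
  show ?thesis by (rule e2, rule fano_combination2(1)[OF A, of "- y" 1 "- x" x y 1 0]) (use 6 xy t in auto)
 next
  case 7
  show ?thesis by (rule e2, rule fano_combination2(1)[OF A, of "x - y" 1 x x y "- 1" "- 1"]) (use 7 xy t in auto)
 next
  case 8
  show ?thesis by (rule e1, rule fano_combination2(1)[OF A, of "- x" 1 "- y" x y 0 1]) (use 8 xy t in auto)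
 next
  case 9
  show ?thesis by (rule e1, rule fano_combination2(1)[OF A, of "y - x" 1 y x y "- 1" "- 1"]) (use 9 xy t in auto)
 qed
qed

definition area :: "int \<times> int \<Rightarrow> int \<times> int \<Rightarrow> int" where
 "area a b = fst a * snd b - snd a * fst b"

text \<open>If the cone spanned by \<open>a\<close> and \<open>b\<close> is not unimodular, it contains a lattice point \<open>z\<close> with
  \<open>area a z = 1\<close> and \<open>D z = (D - 1) a + b\<close>, where \<open>D = area a b\<close>. The coefficients have sum \<open>D\<close>, so \<open>z\<close> is in \<open>A\<close>. The
  position of \<open>z\<close> relative to \<open>c\<close> decides which vertex it replaces; if it is opposite to \<open>c\<close>, there
  is an antipodal pair.\<close>

lemma shrink_triangle:
 assumes A: "fano A" and abc: "a \<in> A" "b \<in> A" "c \<in> A"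
  and pos: "2 \<le> area a b" "0 < area b c" "0 < area c a"
 shows "(\<exists>n. tame A n) \<or> (\<exists>z\<in>A. 0 < area a z & 0 < area z c & area a z + area z c < area a b + area b c)
  \<or> (\<exists>z\<in>A. 0 < area z b & 0 < area c z & area z b + area c z < area a b + area c a)"
proof -
 obtain a1 a2 b1 b2 c1 c2 where e: "a = (a1, a2)" "b = (b1, b2)" "c = (c1, c2)" by (cases a, cases b, cases c)
 define D where "D = a1 * b2 - a2 * b1"
 have D: "2 \<le> D" "area a b = D" using pos by (simp_all add: D_def area_def e)
 have "a1 ~= 0 \<or> a2 ~= 0" using D by (auto simp: D_def)
 then obtain u v where uv: "u * a1 + v * a2 = 1" using fano_coprime[OF A abc(1)[unfolded e]] by blast
 define E where "E = - v * b2 - u * b1"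
 define z1 z2 i where "z1 = - v - (E div D) * a1" and "z2 = u - (E div D) * a2" and "i = z1 * b2 - z2 * b1"
 have az: "a1 * z2 - a2 * z1 = 1" using uv by (simp add: z1_def z2_def algebra_simps)
 have "i = E - (E div D) * D" by (simp add: i_def z1_def z2_def E_def D_def algebra_simps)
 then have "i = E mod D" by (simp add: minus_div_mult_eq_mod)
 then have i: "0 \<le> i" "i < D" using D by auto
 have c: "D * z1 = i * a1 + 1 * b1" "D * z2 = i * a2 + 1 * b2"
  using az unfolding D_def i_def by algebra+
 have z: "(z1, z2) \<in> A"
  by (rule fano_combination2(1)[OF A _ _ _ abc(1,2)[unfolded e] c]) (use D i in auto)
 have "\<not> i + 1 < D"
 proof
  assume "i + 1 < D"
  then have "z1 = 0 & z2 = 0" by (intro fano_combination2(2)[OF A _ _ _ abc(1,2)[unfolded e] c]) (use D i in auto)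
  then show False using az by simp
 qed
 then have iD: "i = D - 1" using i by simp
 define s where "s = z1 * c2 - z2 * c1"
 have s: "D * s = area b c - (D - 1) * area c a"
  using az iD unfolding s_def D_def i_def area_def e fst_conv snd_conv by algebra
 consider "0 < s" | "s < 0" | "s = 0" by linarith
 then show ?thesis
 proof cases
  case 1
  have "0 < (D - 1) * area c a" using D pos by simp
  moreover have "s \<le> D * s" using 1 D by simp
  ultimately have "s < area b c" using s by linarith
  then have "0 < area a (z1, z2) & 0 < area (z1, z2) c & area a (z1, z2) + area (z1, z2) c < area a b + area b c"
   using az 1 D by (simp add: area_def e s_def)
  then show ?thesis using z by blast
 next
  case 2
  have "D * (- s) < D * area c a" using s pos by (simp add: algebra_simps)
  then have "- s < area c a" using D(1) mult_less_cancel_left_pos[of D "- s" "area c a"] by linarith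
  then have "0 < area (z1, z2) b & 0 < area c (z1, z2) & area (z1, z2) b + area c (z1, z2) < area a b + area c a"
   using iD 2 D by (simp add: area_def e s_def i_def algebra_simps)
  then show ?thesis using z by blast
 next
  case 3
  define m where "m = area c a"
  have cz: "c1 = m * - z1" "c2 = m * - z2"
   using az 3 unfolding m_def s_def area_def e fst_conv snd_conv by algebra+
  have "\<not> 1 < m"
  proof
   assume "1 < m"
   moreover have "(m * - z1, m * - z2) \<in> A" using abc(3) unfolding e cz .
   ultimately have "- z1 = 0 & - z2 = 0" by (intro fano_primitive[OF A])
   then show False using az by simp
  qed
  then have "m = 1" using pos(3) m_def by simp
  then have "(- z1, - z2) \<in> A" using abc(3) unfolding e cz by simp
  then have "\<exists>n. tame A n" by (intro antipodal_tame[OF A z]) (use az in auto)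
  then show ?thesis by blast
 qed
qed

text \<open>A triangle around the origin can be shrunk until it is unimodular, and then its vertices have sum zero.\<close>

lemma triangle_tame:
 assumes A: "fano A" and "a \<in> A" "b \<in> A" "c \<in> A" "0 < area a b" "0 < area b c" "0 < area c a"
 shows "\<exists>n. tame A n"
 using assms(2-)
proof (induction "nat (area a b + area b c + area c a)" arbitrary: a b c rule: less_induct)
 case less
 note mem = less.prems(1-3) and pos = less.prems(4-6)
 have step: "\<exists>n. tame A n" if h: "x \<in> A" "y \<in> A" "z \<in> A" "2 \<le> area x y" "0 < area y z" "0 < area z x"
  "area x y + area y z + area z x = area a b + area b c + area c a" for x y z
  using shrink_triangle[OF A h(1-6)]
 proof (elim disjE bexE conjE)
  fix w assume w: "w \<in> A" "0 < area x w" "0 < area w z" "area x w + area w z < area x y + area y z"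
  show ?thesis by (rule less.hyps[OF _ h(1) w(1) h(3) w(2,3) h(6)]) (use w h in linarith)
 next
  fix w assume w: "w \<in> A" "0 < area w y" "0 < area z w" "area w y + area z w < area x y + area z x"
  show ?thesis by (rule less.hyps[OF _ w(1) h(2,3) w(2) h(5) w(3)]) (use w h in linarith)
 qed
 consider "2 \<le> area a b" | "2 \<le> area b c" | "2 \<le> area c a" | "area a b = 1" "area b c = 1" "area c a = 1"
  using pos by linarith
 then show ?case
 proof cases
  case 1 then show ?thesis using step[OF mem(1,2,3)] pos by simp
 next
  case 2 then show ?thesis using step[OF mem(2,3,1)] pos by simp
 next
  case 3 then show ?thesis using step[OF mem(3,1,2)] pos by simp
 next
  case 4
  obtain a1 a2 b1 b2 c1 c2 where e: "a = (a1, a2)" "b = (b1, b2)" "c = (c1, c2)" by (cases a, cases b, cases c)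
  have d: "a1 * b2 - a2 * b1 = 1" "b1 * c2 - b2 * c1 = 1" "c1 * a2 - c2 * a1 = 1" using 4 by (auto simp: area_def e)
  have c: "c1 = - a1 - b1" "c2 = - a2 - b2" using d by algebra+
  let ?L = "lin b2 (- b1) (- a2) a1"
  have det: "\<bar>b2 * a1 - - b1 * - a2\<bar> = 1" using d(1) by (simp add: mult.commute)
  have "\<exists>n. tame (?L ` A) n"
  proof (rule unit_triangle_tame)
   show "fano (?L ` A)" by (rule fano_lin[OF A det])
   show "(1, 0) \<in> ?L ` A" by (rule image_eqI[OF _ mem(1)]) (use d(1) in \<open>simp add: lin_def e algebra_simps\<close>)
   show "(0, 1) \<in> ?L ` A" by (rule image_eqI[OF _ mem(2)]) (use d(1) in \<open>simp add: lin_def e algebra_simps\<close>)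
   show "(- 1, - 1) \<in> ?L ` A" by (rule image_eqI[OF _ mem(3)]) (use d(1) in \<open>simp add: lin_def e c algebra_simps\<close>)
  qed
  then show ?thesis using tame_lin_iff[OF _ det] by blast
 qed
qed

text \<open>A triangle around the origin, or an antipodal pair: after \<open>(1, 0)\<close> take the point \<open>b\<close> of the upper half plane with
  the largest angle, and then a point on the other side of the line through \<open>b\<close>.\<close>

theorem fano_tame:
 assumes A: "fano A" shows "\<exists>n. tame A n"
proof -
 have normalised: "\<exists>n. tame A n" if A: "fano A" and e1: "(1, 0) \<in> A" for A
 proof -
  let ?U = "{z \<in> A. 0 < snd z}"
  let ?s = "\<lambda>z :: int \<times> int. real_of_int (fst z) / real_of_int (snd z)"
  obtain x y where "(x, y) \<in> A" "0 < 0 * x + 1 * y" using fano_positive[OF A, of 0 1] by auto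
  then have "?U ~= {}" by force
  moreover have "finite ?U" using fano_finite(1)[OF A] by simp
  ultimately have m: "arg_min_on ?s ?U \<in> ?U" "\<not> (\<exists>z\<in>?U. ?s z < ?s (arg_min_on ?s ?U))"
   using arg_min_if_finite[of ?U ?s] by blast+
  define b where "b = arg_min_on ?s ?U"
  have b: "b \<in> ?U" using m(1) unfolding b_def .
  have b2: "?s b \<le> ?s z" if "z \<in> ?U" for z
   using m(2) that unfolding b_def[symmetric] not_less[symmetric] by blast
  have le: "area b z \<le> 0" if "z \<in> ?U" for z
  proof -
   have "real_of_int (fst b) * real_of_int (snd z) \<le> real_of_int (fst z) * real_of_int (snd b)"
    using b2[OF that] b that by (simp add: field_simps)
   then have "fst b * snd z \<le> fst z * snd b" by (metis of_int_mult of_int_le_iff)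
   then show ?thesis by (simp add: area_def mult.commute)
  qed
  have "- snd b ~= 0 \<or> fst b ~= 0" using b by auto
  from fano_positive[OF A this] obtain c1 c2 where c: "(c1, c2) \<in> A" "0 < - snd b * c1 + fst b * c2" by blast
  then have bc: "0 < area b (c1, c2)" by (simp add: area_def)
  consider "0 < c2" | "c2 = 0" | "c2 < 0" by linarith
  then show ?thesis
  proof cases
   case 1 then show ?thesis using le[of "(c1, c2)"] bc c(1) by auto
  next
   case 2
   then have "snd b * c1 < 0" using c(2) by simp
   then have "c1 < 0" using b by (simp add: mult_less_0_iff)
   then have "c1 = - 1" using fano_row0[OF A] c(1) 2 by fastforce
   then show ?thesis using antipodal_tame[OF A e1] c(1) 2 by simp
  next
   case 3 then show ?thesis
    using triangle_tame[OF A e1 _ c(1), of b] b bc by (simp add: area_def)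
  qed
 qed
 obtain x y where xy: "(x, y) \<in> A" "0 < 0 * x + 1 * y" using fano_positive[OF A, of 0 1] by auto
 then obtain u v where uv: "u * x + v * y = 1" using fano_coprime[OF A xy(1)] by auto
 have det: "\<bar>u * x - v * - y\<bar> = 1" using uv by simp
 have "\<exists>n. tame (lin u v (- y) x ` A) n"
 proof (rule normalised[OF fano_lin[OF A det]])
  show "(1, 0) \<in> lin u v (- y) x ` A" by (rule image_eqI[OF _ xy(1)]) (use uv in \<open>simp add: lin_def\<close>)
 qed
 then show ?thesis using tame_lin_iff[OF _ det] by blast
qed

section \<open>Lattice points of reflexive polygons and bipyramids\<close>

lemma lookup_scaleR: "lookup (r *\<^sub>R x) i = r *\<^sub>R lookup (x :: 'a \<Rightarrow>\<^sub>0 'b :: real_vector) i"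
proof -
 have "finite {i. r *\<^sub>R lookup x i ~= 0}"
  by (rule finite_subset[of _ "keys x"]) (auto simp: in_keys_iff)
 then show ?thesis unfolding scaleR_poly_mapping_def by (simp add: Abs_poly_mapping_inverse)
qed

lemma lookup_real_vec: "lookup (real_vec a) i = real_of_int (lookup a i)"
 by (simp add: real_vec_def Poly_Mapping.map.rep_eq when_def)

definition embed2 :: "int \<times> int \<Rightarrow> (nat \<Rightarrow>\<^sub>0 int)" where
 "embed2 a = single 0 (fst a) + single 1 (snd a)"

lemma lookup_embed2: "lookup (embed2 a) i = (if i = 0 then fst a else if i = 1 then snd a else 0)"
 by (simp add: embed2_def lookup_add lookup_single when_def)

lemma embed2_add: "embed2 (a + b) = embed2 a + embed2 b"
 by (rule poly_mapping_eqI) (simp add: lookup_add lookup_embed2)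

lemma embed2_0: "embed2 0 = 0" "embed2 (0, 0) = 0"
 by (simp_all add: embed2_def)

lemma inj_embed2: "inj embed2"
proof (rule injI)
 fix a b assume "embed2 a = embed2 b"
 then have "lookup (embed2 a) i = lookup (embed2 b) i" for i by simp
 from this[of 0] this[of 1] show "a = b" by (simp add: lookup_embed2 prod_eq_iff)
qed

lemma int_lattice_2: "int_lattice 2 = range embed2"
proof (intro equalityI subsetI)
 fix a assume a: "a \<in> int_lattice 2"
 have "a = embed2 (lookup a 0, lookup a 1)"
 proof (rule poly_mapping_eqI)
  fix i
  have "lookup a i = 0" if "i ~= 0" "i ~= 1"
  proof -
   have "i \<notin> {..<2}" using that by auto
   then have "i \<notin> keys a" using a unfolding int_lattice_def by blast
   then show ?thesis by (simp add: in_keys_iff)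
  qed
  then show "lookup a i = lookup (embed2 (lookup a 0, lookup a 1)) i"
   by (simp add: lookup_embed2)
 qed
 then show "a \<in> range embed2" by blast
qed (auto simp: int_lattice_def in_keys_iff lookup_embed2 split: if_splits)

lemma int_lattice_2D: "a \<in> int_lattice 2 \<Longrightarrow> \<exists>z. a = embed2 z"
 unfolding int_lattice_2 by (erule imageE) (rule exI)

lemma embed2_lattice: "embed2 z \<in> int_lattice 2"
 unfolding int_lattice_2 by (rule rangeI)

lemma convex_euclid: "convex (euclid m)"
proof (rule convexI)
 fix x y :: "nat \<Rightarrow>\<^sub>0 real" and u v :: real
 assume "x \<in> euclid m" "y \<in> euclid m"
 then have *: "lookup x i = 0 & lookup y i = 0" if "i \<notin> {..<m}" for i
  using that unfolding euclid_def by (auto simp: in_keys_iff)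
 show "u *\<^sub>R x + v *\<^sub>R y \<in> euclid m"
  unfolding euclid_def
 proof (intro CollectI subsetI, rule ccontr)
  fix i assume "i \<in> keys (u *\<^sub>R x + v *\<^sub>R y)" and i: "i \<notin> {..<m}"
  then show False using *[OF i] by (simp add: in_keys_iff lookup_add lookup_scaleR)
 qed
qed

lemma real_vec_euclid: "a \<in> int_lattice m \<Longrightarrow> real_vec a \<in> euclid m"
 by (auto simp: int_lattice_def euclid_def in_keys_iff lookup_real_vec)

definition dot2 :: "(nat \<Rightarrow>\<^sub>0 real) \<Rightarrow> (nat \<Rightarrow>\<^sub>0 real) \<Rightarrow> real" where
 "dot2 x y = lookup x 0 * lookup y 0 + lookup x 1 * lookup y 1"

lemma dot2_commute: "dot2 x y = dot2 y x"
 by (simp add: dot2_def)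

lemma dot2_scale: "dot2 x (r *\<^sub>R y) = r * dot2 x y" "dot2 (r *\<^sub>R x) y = r * dot2 x y"
 by (simp_all add: dot2_def lookup_scaleR algebra_simps)

lemma dot2_real_vec: "dot2 (real_vec (embed2 a)) (real_vec (embed2 b)) = real_of_int (pairing a b)"
 by (simp add: dot2_def lookup_real_vec lookup_embed2 pairing_def)

lemma dot2_hull:
 assumes "\<And>s. s \<in> S \<Longrightarrow> dot2 w s \<le> c" "x \<in> convex hull S"
 shows "dot2 w x \<le> c"
proof -
 have "convex {x. dot2 w x \<le> c}"
 proof (rule convexI)
  fix x y :: "nat \<Rightarrow>\<^sub>0 real" and u v :: real
  assume xy: "x \<in> {x. dot2 w x \<le> c}" "y \<in> {x. dot2 w x \<le> c}" and uv: "0 \<le> u" "0 \<le> v" "u + v = 1"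
  have "dot2 w (u *\<^sub>R x + v *\<^sub>R y) = u * dot2 w x + v * dot2 w y"
   by (simp add: dot2_def lookup_add lookup_scaleR algebra_simps)
  also have "\<dots> \<le> u * c + v * c" using xy uv by (intro add_mono mult_left_mono) auto
  also have "\<dots> = c" using uv by (metis distrib_right mult_1)
  finally show "u *\<^sub>R x + v *\<^sub>R y \<in> {x. dot2 w x \<le> c}" by simp
 qed
 then have "convex hull S \<subseteq> {x. dot2 w x \<le> c}" using assms(1) by (intro hull_minimal) auto
 then show ?thesis using assms(2) by auto
qed

lemma polar_dual_2: "polar_dual 2 Q = {y \<in> euclid 2. \<forall>x\<in>Q. dot2 x y \<le> 1}"
 by (simp add: polar_dual_def dot2_def numeral_2_eq_2)

lemma real_vec_embed2_sum:
 assumes "lin n 0 0 n x = lin i 0 0 i a + lin j 0 0 j b + lin k 0 0 k c" "0 < n"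
 shows "real_vec (embed2 x) = (of_int i / of_int n) *\<^sub>R real_vec (embed2 a) + (of_int j / of_int n) *\<^sub>R real_vec (embed2 b)
  + (of_int k / of_int n) *\<^sub>R real_vec (embed2 c)"
proof (rule poly_mapping_eqI)
 fix l
 have e: "n * fst x = i * fst a + j * fst b + k * fst c" "n * snd x = i * snd a + j * snd b + k * snd c"
  using assms(1) by (simp_all add: lin_def prod_eq_iff)
 have r: "real_of_int n * of_int (fst x) = of_int i * of_int (fst a) + of_int j * of_int (fst b) + of_int k * of_int (fst c)"
  "real_of_int n * of_int (snd x) = of_int i * of_int (snd a) + of_int j * of_int (snd b) + of_int k * of_int (snd c)"
  using e by (metis of_int_add of_int_mult)+
 have n: "real_of_int n ~= 0" using assms(2) by simp
 have "real_of_int (fst x) = (of_int i / of_int n) * of_int (fst a) + (of_int j / of_int n) * of_int (fst b) + (of_int k / of_int n) * of_int (fst c)"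
  "real_of_int (snd x) = (of_int i / of_int n) * of_int (snd a) + (of_int j / of_int n) * of_int (snd b) + (of_int k / of_int n) * of_int (snd c)"
  using r n by (simp_all add: field_simps)
 then show "lookup (real_vec (embed2 x)) l = lookup ((of_int i / of_int n) *\<^sub>R real_vec (embed2 a)
   + (of_int j / of_int n) *\<^sub>R real_vec (embed2 b) + (of_int k / of_int n) *\<^sub>R real_vec (embed2 c)) l"
  by (simp add: lookup_real_vec lookup_embed2 lookup_add lookup_scaleR)
qed

lemma reflexive_polygon_facts:
 assumes "reflexive_polytope 2 P"
 shows "convex P" "0 \<in> P" "P \<subseteq> euclid 2"
proof -
 obtain S where S: "S \<subseteq> int_lattice 2" "P = convex hull (real_vec ` S)"
  using assms unfolding reflexive_polytope_def lattice_polytope_def by blast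
 then show "convex P" by simp
 have "0 \<in> top_of_set (euclid 2) interior_of P" using assms by (simp add: reflexive_polytope_def)
 then show "0 \<in> P" by (rule subsetD[OF interior_of_subset])
 show "P \<subseteq> euclid 2" unfolding S(2)
 proof (rule hull_minimal)
  show "real_vec ` S \<subseteq> euclid 2" using S(1) by (intro image_subsetI real_vec_euclid) (rule subsetD)
 qed (rule convex_euclid)
qed

definition polygon_points :: "(nat \<Rightarrow>\<^sub>0 real) set \<Rightarrow> (int \<times> int) set" where
 "polygon_points P = {a. real_vec (embed2 a) \<in> P}"

lemma lattice_points_2: "lattice_points 2 P = embed2 ` polygon_points P"
 by (auto simp: lattice_points_def polygon_points_def int_lattice_2)

text \<open>An inequality that holds for all lattice functionals of the polar dual holds on the polygon after
  rounding: a functional that is less than \<open>1\<close> at a lattice point is at most \<open>0\<close> there. If this is so for all of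
  them, also a small positive multiple of the point itself, which lies in the polar dual, is such a
  functional, so the point is zero.\<close>

lemma fano_polygon_points:
 assumes R: "reflexive_polytope 2 P"
 shows "fano (polygon_points P)"
proof -
 let ?A = "polygon_points P" and ?r = "\<lambda>a. real_vec (embed2 a)"
 note P = reflexive_polygon_facts[OF R]
 obtain S where S: "finite S" "S \<subseteq> int_lattice 2" "P = convex hull (real_vec ` S)"
  using R unfolding reflexive_polytope_def lattice_polytope_def by blast
 obtain S' where S': "S' \<subseteq> int_lattice 2" "polar_dual 2 P = convex hull (real_vec ` S')"
  using R unfolding reflexive_polytope_def lattice_polytope_def by blast
 have SA: "\<exists>a\<in>?A. s = embed2 a" if sS: "s \<in> S" for s
 proof -
  obtain a where a: "s = embed2 a" using int_lattice_2D[OF subsetD[OF S(2) sS]] by blast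
  have "real_vec s \<in> P" unfolding S(3) by (intro hull_inc imageI sS)
  then show ?thesis using a unfolding polygon_points_def by blast
 qed
 define M where "M = (\<Sum>s\<in>S. \<bar>lookup s 0\<bar> + \<bar>lookup s 1\<bar>)"
 have M0: "0 \<le> M" unfolding M_def by (intro sum_nonneg) simp
 have bound: "dot2 (?r w) p \<le> of_int (M * (\<bar>fst w\<bar> + \<bar>snd w\<bar>))" if "p \<in> P" for p w
 proof (rule dot2_hull[OF _ that[unfolded S(3)]])
  fix q assume "q \<in> real_vec ` S"
  then obtain s where s: "s \<in> S" "q = real_vec s" by blast
  then obtain a where a: "s = embed2 a" using SA by blast
  have "\<bar>lookup s 0\<bar> + \<bar>lookup s 1\<bar> \<le> M"
   unfolding M_def by (rule member_le_sum[OF s(1)]) (use S(1) in auto)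
  then have "\<bar>fst a\<bar> + \<bar>snd a\<bar> \<le> M" by (simp add: a lookup_embed2)
  then have "\<bar>fst w\<bar> * \<bar>fst a\<bar> \<le> \<bar>fst w\<bar> * M" "\<bar>snd w\<bar> * \<bar>snd a\<bar> \<le> \<bar>snd w\<bar> * M"
   by (intro mult_left_mono; simp)+
  moreover have "fst w * fst a \<le> \<bar>fst w\<bar> * \<bar>fst a\<bar>" "snd w * snd a \<le> \<bar>snd w\<bar> * \<bar>snd a\<bar>"
   by (metis abs_ge_self abs_mult)+
  ultimately have "pairing w a \<le> M * (\<bar>fst w\<bar> + \<bar>snd w\<bar>)" by (simp add: pairing_def algebra_simps)
  then show "dot2 (?r w) q \<le> of_int (M * (\<bar>fst w\<bar> + \<bar>snd w\<bar>))" unfolding s(2) a dot2_real_vec by (rule of_int_le_iff[THEN iffD2])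
 qed
 have fin: "finite ?A"
 proof (rule finite_subset)
  show "?A \<subseteq> {- M..M} \<times> {- M..M}"
  proof
   fix a assume "a \<in> ?A"
   then have "?r a \<in> P" by (simp add: polygon_points_def)
   from bound[OF this] have "pairing w a \<le> M * (\<bar>fst w\<bar> + \<bar>snd w\<bar>)" for w
    unfolding dot2_real_vec of_int_le_iff .
   from this[of "(1, 0)"] this[of "(- 1, 0)"] this[of "(0, 1)"] this[of "(0, - 1)"]
   show "a \<in> {- M..M} \<times> {- M..M}" by (cases a) (simp add: pairing_def)
  qed
 qed simp
 have zero: "0 \<in> ?A"
 proof -
  have "real_vec (embed2 0) = 0" by (rule poly_mapping_eqI) (simp add: lookup_real_vec embed2_0)
  then show ?thesis using P(2) by (simp add: polygon_points_def)
 qed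
 have pos_def: "0 < dot2 (?r w) (?r w)" if "w ~= 0" for w
 proof -
  have "0 < pairing w w" using that
   by (cases w) (auto simp: pairing_def zero_prod_def not_le[symmetric] sum_squares_le_zero_iff)
  then show ?thesis unfolding dot2_real_vec by simp
 qed
 have pos: "\<exists>a\<in>?A. 0 < pairing w a" if w: "w ~= 0" for w
 proof (rule ccontr)
  assume n: "\<not> (\<exists>a\<in>?A. 0 < pairing w a)"
  have "0 \<in> top_of_set (euclid 2) interior_of P" using R by (simp add: reflexive_polytope_def)
  then obtain T where T: "openin (top_of_set (euclid 2)) T" "0 \<in> T" "T \<subseteq> P" unfolding interior_of_def by blast
  then obtain U where U: "open U" "T = euclid 2 \<inter> U" unfolding openin_open by blast
  then obtain e where e: "0 < e" "ball 0 e \<subseteq> U" using T(2) open_contains_ball by blast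
  define \<delta> where "\<delta> = e / (2 * (norm (?r w) + 1))"
  have d: "0 < \<delta>" unfolding \<delta>_def using e(1) by (simp add: add_nonneg_pos)
  have "\<delta> * norm (?r w) \<le> \<delta> * (norm (?r w) + 1)" using d by simp
  also have "\<dots> = e / 2"
  proof -
   have "norm (?r w) + 1 ~= 0" using norm_ge_zero[of "?r w"] by linarith
   then show ?thesis unfolding \<delta>_def by (simp add: field_simps)
  qed
  finally have "norm (\<delta> *\<^sub>R ?r w) < e" using d e(1) by simp
  then have "\<delta> *\<^sub>R ?r w \<in> U" using e(2) by auto
  moreover have "\<delta> *\<^sub>R ?r w \<in> euclid 2"
  proof -
   have "?r w \<in> euclid 2" by (rule real_vec_euclid[OF embed2_lattice])
   then show ?thesis by (auto simp: euclid_def in_keys_iff lookup_scaleR)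
  qed
  ultimately have inP: "\<delta> *\<^sub>R ?r w \<in> P" using T(3) U(2) by blast
  have "dot2 (?r w) (\<delta> *\<^sub>R ?r w) \<le> 0"
  proof (rule dot2_hull[OF _ inP[unfolded S(3)]])
   fix q assume "q \<in> real_vec ` S"
   then obtain s where s: "s \<in> S" "q = real_vec s" by blast
   then obtain a where a: "a \<in> ?A" "s = embed2 a" using SA by blast
   then have "pairing w a \<le> 0" using n by force
   then show "dot2 (?r w) q \<le> 0" unfolding s(2) a(2) dot2_real_vec by simp
  qed
  then show False using pos_def[OF w] d unfolding dot2_scale by (simp add: mult_le_0_iff)
 qed
 have comb: "(i + j + k \<le> n \<longrightarrow> x \<in> ?A) & (i + j + k < n \<longrightarrow> x = 0)"
  if h: "0 < n" "0 \<le> i" "0 \<le> j" "0 \<le> k" "a \<in> ?A" "b \<in> ?A" "c \<in> ?A"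
   "lin n 0 0 n x = lin i 0 0 i a + lin j 0 0 j b + lin k 0 0 k c" for n i j k a b c x
 proof (intro conjI impI)
  note rx = real_vec_embed2_sum[OF h(8,1)]
  have mem: "?r a \<in> P" "?r b \<in> P" "?r c \<in> P" using h by (auto simp: polygon_points_def)
  {
   assume le: "i + j + k \<le> n"
   define t where "t = (\<lambda>l::nat. if l = 0 then of_int i / of_int n else if l = 1 then of_int j / of_int n
    else if l = 2 then of_int k / of_int n else 1 - (of_int i + of_int j + of_int k) / of_int n :: real)"
   define y where "y = (\<lambda>l::nat. if l = 0 then ?r a else if l = 1 then ?r b else if l = 2 then ?r c else 0)"
   have sum4: "(\<Sum>l\<in>{0, 1, 2, 3::nat}. g l) = g 0 + g 1 + g 2 + g 3" for g :: "nat \<Rightarrow> 'c :: comm_monoid_add"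
    by (simp add: add.assoc)
   have "(\<Sum>l\<in>{0, 1, 2, 3}. t l *\<^sub>R y l) \<in> P"
   proof (rule convex_sum)
    show "(\<Sum>l\<in>{0, 1, 2, 3}. t l) = 1" unfolding sum4 by (simp add: t_def add_divide_distrib)
    show "0 \<le> t l" if "l \<in> {0, 1, 2, 3}" for l
    proof -
     have "real_of_int (i + j + k) \<le> of_int n" using le by (rule of_int_le_iff[THEN iffD2])
     then have "(real_of_int i + of_int j + of_int k) / of_int n \<le> 1" using h(1) by simp
     then show ?thesis using h(1-4) by (simp add: t_def)
    qed
    show "y l \<in> P" if "l \<in> {0, 1, 2, 3}" for l using mem P(2) by (simp add: y_def)
   qed (use P in auto)
   moreover have "(\<Sum>l\<in>{0, 1, 2, 3}. t l *\<^sub>R y l) = ?r x" unfolding sum4 rx by (simp add: t_def y_def)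
   ultimately show "x \<in> ?A" by (simp add: polygon_points_def)
  }
  {
   assume less: "i + j + k < n"
   show "x = 0"
   proof (rule ccontr)
    assume x: "x ~= 0"
    define L where "L = real_of_int (M * (\<bar>fst x\<bar> + \<bar>snd x\<bar>))"
    have L: "0 \<le> L" unfolding L_def using M0 by simp
    define \<epsilon> where "\<epsilon> = 1 / (1 + L)"
    have eps: "0 < \<epsilon>" "\<epsilon> * L \<le> 1" using L by (auto simp: \<epsilon>_def field_simps)
    have "\<epsilon> *\<^sub>R ?r x \<in> polar_dual 2 P"
     unfolding polar_dual_2
    proof (intro CollectI conjI ballI)
     have "?r x \<in> euclid 2" by (rule real_vec_euclid[OF embed2_lattice])
     then show "\<epsilon> *\<^sub>R ?r x \<in> euclid 2" by (auto simp: euclid_def in_keys_iff lookup_scaleR)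
     fix p assume "p \<in> P"
     then have "dot2 p (?r x) \<le> L" using bound[of p x] unfolding L_def dot2_commute[of p] by blast
     then have "\<epsilon> * dot2 p (?r x) \<le> \<epsilon> * L" using eps by (intro mult_left_mono) auto
     then show "dot2 p (\<epsilon> *\<^sub>R ?r x) \<le> 1" using eps(2) unfolding dot2_scale by linarith
    qed
    then have "dot2 (?r x) (\<epsilon> *\<^sub>R ?r x) \<le> 0"
     unfolding S'(2)
    proof (rule dot2_hull[rotated])
     fix q assume "q \<in> real_vec ` S'"
     then obtain s where s: "s \<in> S'" "q = real_vec s" by blast
     then obtain w where w: "embed2 w \<in> S'" "q = ?r w" using int_lattice_2D[OF subsetD[OF S'(1) s(1)]] by blast
     have "q \<in> polar_dual 2 P" unfolding S'(2) w(2) by (intro hull_inc imageI w(1))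
     then have le1: "pairing w z \<le> 1" if "?r z \<in> P" for z
      using that unfolding polar_dual_2 w(2) by (auto simp: dot2_real_vec dot2_commute[of _ "?r w"])
     have "n * pairing w x = i * pairing w a + j * pairing w b + k * pairing w c"
     proof -
      have "pairing w (lin n 0 0 n x) = pairing w (lin i 0 0 i a + lin j 0 0 j b + lin k 0 0 k c)" unfolding h(8) ..
      then show ?thesis by (simp add: pairing_def lin_def algebra_simps)
     qed
     also have "\<dots> \<le> i * 1 + j * 1 + k * 1"
      using le1[OF mem(1)] le1[OF mem(2)] le1[OF mem(3)] h(2-4) by (intro add_mono mult_left_mono)
     also have "\<dots> < n * 1" using less by simp
     finally have "pairing w x < 1" using h(1) mult_less_cancel_left_pos by blast
     then have "pairing x w \<le> 0" by (simp add: pairing_def mult.commute)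
     then show "dot2 (?r x) q \<le> 0" unfolding w(2) dot2_real_vec by simp
    qed
    then show False using pos_def[OF x] eps(1) unfolding dot2_scale by (simp add: mult_le_0_iff)
   qed
  }
 qed
 show ?thesis by (rule fanoI[OF fin zero pos comb])
qed

lemma bipyramid_mem:
 assumes Q: "convex Q" "0 \<in> Q" "Q \<subseteq> euclid m"
  and x: "x \<in> bipyramid m Q"
 obtains q s t where "q \<in> Q" "0 \<le> s" "s + \<bar>t\<bar> \<le> 1" "x = s *\<^sub>R q + t *\<^sub>R single m 1"
proof -
 let ?e = "single m 1 :: nat \<Rightarrow>\<^sub>0 real"
 have me: "single m (- 1) = (- 1) *\<^sub>R ?e"
  by (rule poly_mapping_eqI) (simp add: lookup_scaleR lookup_single when_def)
 have "x \<in> convex hull (insert ?e (insert (single m (- 1)) Q))"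
  using x unfolding bipyramid_def by (simp add: Un_commute insert_commute)
 then obtain u v b where 1: "0 \<le> u" "0 \<le> v" "u + v = 1" "b \<in> convex hull (insert (single m (- 1)) Q)"
  "x = u *\<^sub>R ?e + v *\<^sub>R b"
  unfolding convex_hull_insert[OF insert_not_empty] by blast
 have "Q ~= {}" using Q(2) by blast
 from 1(4) obtain u' v' q where 2: "0 \<le> u'" "0 \<le> v'" "u' + v' = 1" "q \<in> convex hull Q"
  "b = u' *\<^sub>R single m (- 1) + v' *\<^sub>R q"
  unfolding convex_hull_insert[OF \<open>Q ~= {}\<close>] by blast
 have "q \<in> Q" using 2(4) Q(1) by (simp add: convex_hull_eq[THEN iffD2])
 moreover have "0 \<le> v * v'" using 1 2 by simp
 moreover have "v * v' + \<bar>u - v * u'\<bar> \<le> 1"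
 proof -
  have "\<bar>u - v * u'\<bar> \<le> u + v * u'" using 1 2 by (simp add: abs_le_iff)
  moreover have "v * v' + v * u' = v" using 2(3) by (metis add.commute distrib_left mult.right_neutral)
  ultimately show ?thesis using 1(3) by linarith
 qed
 moreover have "x = (v * v') *\<^sub>R q + (u - v * u') *\<^sub>R ?e"
  unfolding 1(5) 2(5) me by (simp add: algebra_simps)
 ultimately show ?thesis by (rule that)
qed

lemma bipyramid_facts:
 assumes Q: "convex Q" "0 \<in> Q" "Q \<subseteq> euclid m"
 shows "convex (bipyramid m Q)" "0 \<in> bipyramid m Q" "bipyramid m Q \<subseteq> euclid (Suc m)"
  "lattice_points (Suc m) (bipyramid m Q) = lattice_points m Q \<union> {single m 1, single m (- 1)}"
proof -
 let ?e = "single m 1 :: nat \<Rightarrow>\<^sub>0 real"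
 show "convex (bipyramid m Q)" by (simp add: bipyramid_def)
 have sub: "Q \<union> {?e, single m (- 1)} \<subseteq> bipyramid m Q" unfolding bipyramid_def by (rule hull_subset)
 then show "0 \<in> bipyramid m Q" using Q(2) by blast
 have eu: "euclid m \<subseteq> euclid (Suc m)" by (auto simp: euclid_def)
 show "bipyramid m Q \<subseteq> euclid (Suc m)"
  unfolding bipyramid_def
 proof (rule hull_minimal)
  show "Q \<union> {?e, single m (- 1)} \<subseteq> euclid (Suc m)" using Q(3) eu by (auto simp: euclid_def)
 qed (rule convex_euclid)
 show "lattice_points (Suc m) (bipyramid m Q) = lattice_points m Q \<union> {single m 1, single m (- 1)}"
 proof (intro equalityI subsetI)
  fix a assume "a \<in> lattice_points (Suc m) (bipyramid m Q)"
  then have a: "a \<in> int_lattice (Suc m)" "real_vec a \<in> bipyramid m Q" by (auto simp: lattice_points_def)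
  obtain q s t where q: "q \<in> Q" "0 \<le> s" "s + \<bar>t\<bar> \<le> 1" "real_vec a = s *\<^sub>R q + t *\<^sub>R ?e"
   using bipyramid_mem[OF Q a(2)] by blast
  have qm: "lookup q i = 0" if "m \<le> i" for i
  proof (rule ccontr)
   assume "lookup q i ~= 0"
   then have "i \<in> keys q" by (simp add: in_keys_iff)
   moreover have "keys q \<subseteq> {..<m}" using q(1) Q(3) unfolding euclid_def by blast
   ultimately show False using that by auto
  qed
  have c: "real_of_int (lookup a i) = s * lookup q i + t * (if i = m then 1 else 0)" for i
   unfolding lookup_real_vec[symmetric] q(4) by (simp add: lookup_add lookup_scaleR lookup_single when_def)
  have tm: "t = of_int (lookup a m)" using c[of m] qm[of m] by simp
  then have "\<bar>real_of_int (lookup a m)\<bar> \<le> 1" using q(2,3) by linarith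
  then have "\<bar>lookup a m\<bar> \<le> 1" by linarith
  then consider "lookup a m = 0" | "lookup a m = 1" | "lookup a m = - 1" by linarith
  then show "a \<in> lattice_points m Q \<union> {single m 1, single m (- 1)}"
  proof cases
   case 1
   have "lookup a i = 0" if "m \<le> i" for i using c[of i] qm[OF that] tm 1 by simp
   then have "a \<in> int_lattice m" by (auto simp: int_lattice_def in_keys_iff not_less[symmetric])
   moreover have "real_vec a = s *\<^sub>R q + (1 - s) *\<^sub>R 0" using q(4) tm 1 by simp
   then have "real_vec a \<in> Q" using Q(1,2) q(1,2,3) by (simp add: convexD[OF Q(1) q(1) Q(2), of s "1 - s"] del: scaleR_zero_right)
   ultimately show ?thesis by (simp add: lattice_points_def)
  next
   case 2
   then have "s = 0" using q(2,3) tm by simp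
   then have "real_of_int (lookup a i) = of_int (lookup (single m 1) i)" for i
    using c[of i] tm 2 by (simp add: lookup_single when_def)
   then have "a = single m 1" by (intro poly_mapping_eqI) (simp only: of_int_eq_iff)
   then show ?thesis by simp
  next
   case 3
   then have "s = 0" using q(2,3) tm by simp
   then have "real_of_int (lookup a i) = of_int (lookup (single m (- 1)) i)" for i
    using c[of i] tm 3 by (simp add: lookup_single when_def)
   then have "a = single m (- 1)" by (intro poly_mapping_eqI) (simp only: of_int_eq_iff)
   then show ?thesis by simp
  qed
 next
  fix a assume a: "a \<in> lattice_points m Q \<union> {single m 1, single m (- 1)}"
  have rv: "real_vec (single m z) = single m (of_int z)" for z
   by (rule poly_mapping_eqI) (simp add: lookup_real_vec lookup_single when_def)
  show "a \<in> lattice_points (Suc m) (bipyramid m Q)"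
  proof (cases "a \<in> lattice_points m Q")
   case True
   then show ?thesis using sub by (auto simp: lattice_points_def int_lattice_def)
  next
   case False
   then have "a = single m 1 \<or> a = single m (- 1)" using a by blast
   then have "real_vec a \<in> bipyramid m Q" using sub rv[of 1] rv[of "- 1"] by auto
   moreover have "a \<in> int_lattice (Suc m)" using \<open>a = _ \<or> a = _\<close> by (auto simp: int_lattice_def split: if_splits)
   ultimately show ?thesis by (simp add: lattice_points_def)
  qed
 qed
qed

text \<open>The apices added by \<open>k\<close> bipyramids over a polytope in dimension \<open>m\<close>.\<close>

definition cross_axes :: "nat \<Rightarrow> nat \<Rightarrow> (nat \<Rightarrow>\<^sub>0 int) set" where
 "cross_axes m k = (\<Union>i\<in>{m..<m + k}. {single i 1, single i (- 1)})"

lemma cross_axes_simps: "cross_axes m 0 = {}"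
 "cross_axes m (Suc k) = cross_axes m k \<union> {single (m + k) 1, single (m + k) (- 1)}"
 by (simp_all add: cross_axes_def atLeastLessThanSuc Un_commute)

lemma lattice_points_iter_bipyramid:
 assumes Q: "convex Q" "0 \<in> Q" "Q \<subseteq> euclid m"
 shows "lattice_points (m + k) (iter_bipyramid m k Q) = lattice_points m Q \<union> cross_axes m k"
proof -
 have "convex (iter_bipyramid m k Q) & 0 \<in> iter_bipyramid m k Q & iter_bipyramid m k Q \<subseteq> euclid (m + k) &
  lattice_points (m + k) (iter_bipyramid m k Q) = lattice_points m Q \<union> cross_axes m k"
 proof (induction k)
  case 0 then show ?case using Q by (simp add: cross_axes_simps)
 next
  case (Suc k)
  then have h: "convex (iter_bipyramid m k Q)" "0 \<in> iter_bipyramid m k Q" "iter_bipyramid m k Q \<subseteq> euclid (m + k)" by auto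
  show ?case using bipyramid_facts[OF h] Suc by (simp add: cross_axes_simps Un_assoc)
 qed
 then show ?thesis by blast
qed

section \<open>Inverting the logarithmic gradient in the plane\<close>

text \<open>Inverse function theorem with explicit constants, by the contraction \<open>x \<mapsto> x - S (f x - w)\<close>. The explicit
  form gives a common radius for all critical points and a Lipschitz bound.\<close>

lemma local_inverse:
 fixes f T S :: "'a :: banach \<Rightarrow> 'a"
 assumes T: "linear T" and S: "linear S" "\<And>v. S (T v) = v" "\<And>v. T (S v) = v" "\<And>v. norm (S v) \<le> M * norm v" and M: "0 < M"
  and approx: "\<And>x y. x \<in> cball p r \<Longrightarrow> y \<in> cball p r \<Longrightarrow> norm (f x - f y - T (x - y)) \<le> norm (x - y) / (2 * M)"
  and r: "0 < r" and fp: "f p = 0"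
 shows "norm w \<le> r / (2 * M) \<Longrightarrow> \<exists>x\<in>cball p r. f x = w"
  and "x \<in> cball p r \<Longrightarrow> y \<in> cball p r \<Longrightarrow> norm (x - y) \<le> 2 * M * norm (f x - f y)"
proof -
 show "norm (x - y) \<le> 2 * M * norm (f x - f y)" if "x \<in> cball p r" "y \<in> cball p r" for x y
 proof -
  have "norm (x - y) = norm (S (T (x - y)))" by (simp add: S(2))
  also have "\<dots> \<le> M * norm (T (x - y))" by (rule S(4))
  also have "norm (T (x - y)) \<le> norm (f x - f y) + norm (f x - f y - T (x - y))"
   using norm_triangle_ineq4[of "f x - f y" "f x - f y - T (x - y)"] by simp
  also have "\<dots> \<le> norm (f x - f y) + norm (x - y) / (2 * M)" using approx[OF that] by simp
  finally have "norm (x - y) \<le> M * (norm (f x - f y) + norm (x - y) / (2 * M))" using M by simp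
  also have "\<dots> = M * norm (f x - f y) + norm (x - y) / 2" using M by (simp add: field_simps)
  finally show ?thesis by simp
 qed
 assume w: "norm w \<le> r / (2 * M)"
 define \<phi> where "\<phi> = (\<lambda>x. x - S (f x - w))"
 have diff: "\<phi> x - \<phi> y = - S (f x - f y - T (x - y))" for x y
 proof -
  have "S (f x - f y - T (x - y)) = S (f x - w) - S (f y - w) - S (T (x - y))"
   unfolding linear_diff[OF S(1), symmetric] by simp
  then show ?thesis unfolding \<phi>_def S(2) by simp
 qed
 have contr: "norm (\<phi> x - \<phi> y) \<le> norm (x - y) / 2" if "x \<in> cball p r" "y \<in> cball p r" for x y
 proof -
  have "norm (\<phi> x - \<phi> y) \<le> M * norm (f x - f y - T (x - y))" unfolding diff norm_minus_cancel by (rule S(4))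
  also have "\<dots> \<le> M * (norm (x - y) / (2 * M))" using approx[OF that] M by (intro mult_left_mono) auto
  finally show ?thesis using M by simp
 qed
 have pp: "p \<in> cball p r" using r by simp
 have "\<exists>!x\<in>cball p r. \<phi> x = x"
 proof (rule Banach_fix)
  show "complete (cball p r)" by (simp add: complete_eq_closed)
  show "\<phi> ` cball p r \<subseteq> cball p r"
  proof (rule image_subsetI)
   fix x assume x: "x \<in> cball p r"
   have "norm (\<phi> p - p) = norm (S w)" using linear_neg[OF S(1), of w] unfolding \<phi>_def fp by simp
   also have "\<dots> \<le> M * norm w" by (rule S(4))
   also have "\<dots> \<le> M * (r / (2 * M))" using w M by (intro mult_left_mono) auto
   finally have "norm (\<phi> p - p) \<le> r / 2" using M by simp
   moreover have "norm (\<phi> x - \<phi> p) \<le> r / 2" using contr[OF x pp] x by (simp add: dist_norm norm_minus_commute)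
   moreover have "norm (\<phi> x - p) \<le> norm (\<phi> x - \<phi> p) + norm (\<phi> p - p)"
    using norm_triangle_ineq[of "\<phi> x - \<phi> p" "\<phi> p - p"] by simp
   ultimately show "\<phi> x \<in> cball p r" by (simp add: dist_norm norm_minus_commute)
  qed
  show "dist (\<phi> x) (\<phi> y) \<le> 1 / 2 * dist x y" if "x \<in> cball p r" "y \<in> cball p r" for x y
   using contr[OF that] by (simp add: dist_norm)
 qed (use pp in auto)
 then obtain x where x: "x \<in> cball p r" "\<phi> x = x" by blast
 then have "S (f x - w) = 0" unfolding \<phi>_def by simp
 then have "T (S (f x - w)) = T 0" by simp
 then have "f x = w" unfolding S(3) using linear_0[OF T] by simp
 then show "\<exists>x\<in>cball p r. f x = w" using x by blast
qed

lemma norm_fst_part: "norm (fst v) \<le> norm v" and norm_snd_part: "norm (snd v) \<le> norm v"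
 for v :: "'a :: real_normed_vector \<times> 'b :: real_normed_vector"
 by (metis norm_fst_le prod.collapse, metis norm_snd_le prod.collapse)

lemma norm_le_parts: "norm v \<le> norm (fst v) + norm (snd v)"
 for v :: "'a :: real_normed_vector \<times> 'b :: real_normed_vector"
 using norm_Pair_le[of "fst v" "snd v"] by simp

definition weighted_sum :: "(int \<times> int \<Rightarrow> complex) \<Rightarrow> (int \<times> int) set \<Rightarrow> complex \<times> complex \<Rightarrow> complex" where
 "weighted_sum c A z = (\<Sum>a\<in>A. c a * mono2 z a)"

lemma weighted_sum_deriv1:
 assumes "s ~= 0"
 shows "((\<lambda>s. weighted_sum c A (s, y)) has_field_derivative weighted_sum (\<lambda>a. c a * of_int (fst a)) A (s, y) / s) (at s)"
proof -
 have "((\<lambda>s. c a * mono2 (s, y) a) has_field_derivative c a * of_int (fst a) * mono2 (s, y) a / s) (at s)" for a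
  unfolding mono2_def fst_conv snd_conv using assms
  by (auto intro!: derivative_eq_intros simp: power_int_diff)
 then have "((\<lambda>s. weighted_sum c A (s, y)) has_field_derivative (\<Sum>a\<in>A. c a * of_int (fst a) * mono2 (s, y) a / s)) (at s)"
  unfolding weighted_sum_def by (intro DERIV_sum) auto
 then show ?thesis unfolding weighted_sum_def by (simp add: sum_divide_distrib)
qed

lemma weighted_sum_deriv2:
 assumes "s ~= 0"
 shows "((\<lambda>s. weighted_sum c A (x, s)) has_field_derivative weighted_sum (\<lambda>a. c a * of_int (snd a)) A (x, s) / s) (at s)"
proof -
 have "((\<lambda>s. c a * mono2 (x, s) a) has_field_derivative c a * of_int (snd a) * mono2 (x, s) a / s) (at s)" for a
  unfolding mono2_def fst_conv snd_conv using assms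
  by (auto intro!: derivative_eq_intros simp: power_int_diff)
 then have "((\<lambda>s. weighted_sum c A (x, s)) has_field_derivative (\<Sum>a\<in>A. c a * of_int (snd a) * mono2 (x, s) a / s)) (at s)"
  unfolding weighted_sum_def by (intro DERIV_sum) auto
 then show ?thesis unfolding weighted_sum_def by (simp add: sum_divide_distrib)
qed

lemma continuous_weighted_sum:
 "continuous_on torus2 (weighted_sum c A)"
 unfolding weighted_sum_def mono2_def
 by (intro continuous_intros) (auto simp: torus2_def)

lemma open_torus2: "open torus2"
proof -
 have "torus2 = (- {0}) \<times> (- {0})" by (auto simp: torus2_def)
 moreover have "open ((- {0::complex}) \<times> (- {0::complex}))" by (intro open_Times) auto
 ultimately show ?thesis by simp
qed

text \<open>The difference of two values is split into a horizontal and a vertical step, and on each the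
  mean value inequality for functions of one complex variable applies.\<close>

lemma weighted_sum_strict_derivative:
 fixes c :: "int \<times> int \<Rightarrow> complex" and A :: "(int \<times> int) set"
 assumes p: "p \<in> torus2" and e: "0 < e"
 defines "t1 \<equiv> weighted_sum (\<lambda>a. c a * of_int (fst a)) A p / fst p"
  and "t2 \<equiv> weighted_sum (\<lambda>a. c a * of_int (snd a)) A p / snd p"
 shows "eventually (\<lambda>r. \<forall>x\<in>cball p r. \<forall>y\<in>cball p r.
  norm (weighted_sum c A x - weighted_sum c A y - (t1 * fst (x - y) + t2 * snd (x - y))) \<le> e * norm (x - y)) (at_right 0)"
proof -
 let ?d1 = "\<lambda>z. weighted_sum (\<lambda>a. c a * of_int (fst a)) A z / fst z"
 let ?d2 = "\<lambda>z. weighted_sum (\<lambda>a. c a * of_int (snd a)) A z / snd z"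
 have c1: "continuous_on torus2 ?d1" "continuous_on torus2 ?d2"
  by (intro continuous_intros continuous_weighted_sum; auto simp: torus2_def)+
 have ic: "isCont ?d1 p" "isCont ?d2 p"
  using c1[unfolded continuous_on_eq_continuous_at[OF open_torus2]] p by blast+
 obtain e1 where e1: "0 < e1" "\<forall>z. dist z p < e1 \<longrightarrow> dist (?d1 z) (?d1 p) < e / 2"
  using ic(1)[unfolded continuous_at_eps_delta, THEN spec, THEN mp, OF half_gt_zero[OF e]] by blast
 obtain e2 where e2: "0 < e2" "\<forall>z. dist z p < e2 \<longrightarrow> dist (?d2 z) (?d2 p) < e / 2"
  using ic(2)[unfolded continuous_at_eps_delta, THEN spec, THEN mp, OF half_gt_zero[OF e]] by blast
 note ee = e1(1) e1(2)[rule_format, folded t1_def] e2(1) e2(2)[rule_format, folded t2_def]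
 obtain e3 where e3: "0 < e3" "ball p e3 \<subseteq> torus2" using open_torus2 p open_contains_ball by blast
 define R where "R = min e1 (min e2 e3) / 3"
 have R: "0 < R" using ee e3 by (simp add: R_def)
 have "\<forall>x\<in>cball p r. \<forall>y\<in>cball p r.
  norm (weighted_sum c A x - weighted_sum c A y - (t1 * fst (x - y) + t2 * snd (x - y))) \<le> e * norm (x - y)"
  if r: "0 < r" "r < R" for r
 proof (intro ballI)
  fix x y assume xy: "x \<in> cball p r" "y \<in> cball p r"
  obtain x1 x2 y1 y2 p1 p2 where xe: "x = (x1, x2)" "y = (y1, y2)" "p = (p1, p2)" by (cases x, cases y, cases p)
  have n: "norm (x - p) \<le> r" "norm (y - p) \<le> r" using xy by (simp_all add: dist_norm norm_minus_commute)
  have comp: "norm (x1 - p1) \<le> r" "norm (x2 - p2) \<le> r" "norm (y1 - p1) \<le> r" "norm (y2 - p2) \<le> r"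
   using order_trans[OF norm_fst_part n(1)] order_trans[OF norm_snd_part n(1)]
    order_trans[OF norm_fst_part n(2)] order_trans[OF norm_snd_part n(2)] unfolding xe by simp_all
  have near: "dist (s, t) p < min e1 (min e2 e3)" if "norm (s - p1) \<le> r" "norm (t - p2) \<le> r" for s t
  proof -
   have "dist (s, t) p \<le> norm (s - p1) + norm (t - p2)"
    unfolding xe dist_norm by (simp add: norm_Pair_le)
   then show ?thesis using that r unfolding R_def by linarith
  qed
  have T: "(s, t) \<in> torus2" if "norm (s - p1) \<le> r" "norm (t - p2) \<le> r" for s t
   using near[OF that] e3(2) by (auto simp: dist_commute)
  have b1: "norm ((weighted_sum c A (x1, x2) - t1 * x1) - (weighted_sum c A (y1, x2) - t1 * y1)) \<le> e / 2 * norm (x1 - y1)"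
  proof (rule field_differentiable_bound[of "cball p1 r" "\<lambda>s. weighted_sum c A (s, x2) - t1 * s" "\<lambda>s. ?d1 (s, x2) - t1"])
   fix s assume "s \<in> cball p1 r"
   then have s: "norm (s - p1) \<le> r" by (simp add: dist_norm norm_minus_commute)
   have "s ~= 0" using T[OF s comp(2)] by (simp add: torus2_def)
   have "((\<lambda>s. weighted_sum c A (s, x2) - t1 * s) has_field_derivative ?d1 (s, x2) - t1) (at s)"
    unfolding fst_conv by (rule DERIV_diff[OF weighted_sum_deriv1[OF \<open>s ~= 0\<close>] DERIV_cmult_Id])
   then show "((\<lambda>s. weighted_sum c A (s, x2) - t1 * s) has_field_derivative ?d1 (s, x2) - t1) (at s within cball p1 r)"
    by (rule has_field_derivative_at_within)
   show "norm (?d1 (s, x2) - t1) \<le> e / 2" using ee(2)[of "(s, x2)"] near[OF s comp(2)] by (simp add: dist_norm)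
  qed (use comp in \<open>auto simp: dist_norm norm_minus_commute\<close>)
  have b2: "norm ((weighted_sum c A (y1, x2) - t2 * x2) - (weighted_sum c A (y1, y2) - t2 * y2)) \<le> e / 2 * norm (x2 - y2)"
  proof (rule field_differentiable_bound[of "cball p2 r" "\<lambda>s. weighted_sum c A (y1, s) - t2 * s" "\<lambda>s. ?d2 (y1, s) - t2"])
   fix s assume "s \<in> cball p2 r"
   then have s: "norm (s - p2) \<le> r" by (simp add: dist_norm norm_minus_commute)
   have "s ~= 0" using T[OF comp(3) s] by (simp add: torus2_def)
   have "((\<lambda>s. weighted_sum c A (y1, s) - t2 * s) has_field_derivative ?d2 (y1, s) - t2) (at s)"
    unfolding snd_conv by (rule DERIV_diff[OF weighted_sum_deriv2[OF \<open>s ~= 0\<close>] DERIV_cmult_Id])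
   then show "((\<lambda>s. weighted_sum c A (y1, s) - t2 * s) has_field_derivative ?d2 (y1, s) - t2) (at s within cball p2 r)"
    by (rule has_field_derivative_at_within)
   show "norm (?d2 (y1, s) - t2) \<le> e / 2" using ee(4)[of "(y1, s)"] near[OF comp(3) s] by (simp add: dist_norm)
  qed (use comp in \<open>auto simp: dist_norm norm_minus_commute\<close>)
  have "weighted_sum c A x - weighted_sum c A y - (t1 * fst (x - y) + t2 * snd (x - y)) =
   ((weighted_sum c A (x1, x2) - t1 * x1) - (weighted_sum c A (y1, x2) - t1 * y1)) +
   ((weighted_sum c A (y1, x2) - t2 * x2) - (weighted_sum c A (y1, y2) - t2 * y2))"
   unfolding xe by (simp add: algebra_simps)
  also have "norm \<dots> \<le> e / 2 * norm (x1 - y1) + e / 2 * norm (x2 - y2)" by (rule norm_triangle_mono[OF b1 b2])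
  also have "\<dots> \<le> e / 2 * norm (x - y) + e / 2 * norm (x - y)"
   using norm_fst_part[of "x - y"] norm_snd_part[of "x - y"] e unfolding xe by (intro add_mono mult_left_mono) auto
  finally show "norm (weighted_sum c A x - weighted_sum c A y - (t1 * fst (x - y) + t2 * snd (x - y))) \<le> e * norm (x - y)"
   by simp
 qed
 then show ?thesis unfolding eventually_at_right_field using R by blast
qed

definition dlog :: "(int \<times> int) set \<Rightarrow> complex \<times> complex \<Rightarrow> complex \<times> complex" where
 "dlog A z = (dlog1 A z, dlog2 A z)"

lemma as_weighted_sum:
 "plane_sum A = weighted_sum (\<lambda>_. 1) A" "dlog1 A = weighted_sum (\<lambda>a. of_int (fst a)) A" "dlog2 A = weighted_sum (\<lambda>a. of_int (snd a)) A"
 by (simp_all add: fun_eq_iff plane_sum_def dlog1_def dlog2_def weighted_sum_def)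

lemma as_hess:
 "weighted_sum (\<lambda>a. of_int (fst a) * of_int (fst a)) A = hess11 A" "weighted_sum (\<lambda>a. of_int (fst a) * of_int (snd a)) A = hess12 A"
 "weighted_sum (\<lambda>a. of_int (snd a) * of_int (fst a)) A = hess12 A" "weighted_sum (\<lambda>a. of_int (snd a) * of_int (snd a)) A = hess22 A"
 by (simp_all add: fun_eq_iff hess11_def hess12_def hess22_def weighted_sum_def mult.commute)

text \<open>In the coordinates of the torus, the derivative of the logarithmic gradient is the Hessian matrix with
  columns divided by the coordinates, so its determinant is the Hessian up to a nonzero factor.\<close>

lemma dlog_local_inverse:
 assumes p: "p \<in> crit A" and h: "hess A p ~= 0"
 shows "\<exists>M>0. eventually (\<lambda>r. (\<forall>w. norm w \<le> r / (2 * M) \<longrightarrow> (\<exists>x\<in>cball p r. dlog A x = w)) &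
  (\<forall>x\<in>cball p r. \<forall>y\<in>cball p r. norm (x - y) \<le> 2 * M * norm (dlog A x - dlog A y))) (at_right 0)"
proof -
 have pt: "p \<in> torus2" "dlog A p = 0" using p by (auto simp: crit_def dlog_def zero_prod_def)
 have nz: "fst p ~= 0" "snd p ~= 0" using pt by (auto simp: torus2_def)
 define t11 t12 t21 t22 where "t11 = hess11 A p / fst p" and "t12 = hess12 A p / snd p"
  and "t21 = hess12 A p / fst p" and "t22 = hess22 A p / snd p"
 define d where "d = t11 * t22 - t12 * t21"
 have "d * (fst p * snd p) = hess A p"
  using nz unfolding d_def hess_def t11_def t12_def t21_def t22_def by (simp add: field_simps power2_eq_square)
 then have d0: "d ~= 0" using h by auto
 define T where "T = (\<lambda>v. (t11 * fst v + t12 * snd v, t21 * fst v + t22 * snd v))"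
 define S where "S = (\<lambda>v. ((t22 * fst v - t12 * snd v) / d, (t11 * snd v - t21 * fst v) / d))"
 define M where "M = (norm t11 + norm t12 + norm t21 + norm t22) / norm d + 1"
 have M: "0 < M" unfolding M_def by (intro add_nonneg_pos divide_nonneg_nonneg) auto
 have linT: "linear T" unfolding T_def by (intro linearI) (simp_all add: algebra_simps scaleR_conv_of_real)
 have linS: "linear S" unfolding S_def by (intro linearI) (simp_all add: diff_divide_distrib[symmetric] add_divide_distrib[symmetric] algebra_simps scaleR_conv_of_real)
 have ST: "S (T v) = v" for v
 proof -
  have "t22 * (t11 * fst v + t12 * snd v) - t12 * (t21 * fst v + t22 * snd v) = d * fst v"
   "t11 * (t21 * fst v + t22 * snd v) - t21 * (t11 * fst v + t12 * snd v) = d * snd v"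
   unfolding d_def by algebra+
  then show ?thesis using d0 unfolding S_def T_def fst_conv snd_conv by (simp add: prod_eq_iff)
 qed
 have TS: "T (S v) = v" for v
 proof -
  have "t11 * (t22 * fst v - t12 * snd v) + t12 * (t11 * snd v - t21 * fst v) = d * fst v"
   "t21 * (t22 * fst v - t12 * snd v) + t22 * (t11 * snd v - t21 * fst v) = d * snd v"
   unfolding d_def by algebra+
  then have "(t11 * (t22 * fst v - t12 * snd v) + t12 * (t11 * snd v - t21 * fst v)) / d = fst v"
   "(t21 * (t22 * fst v - t12 * snd v) + t22 * (t11 * snd v - t21 * fst v)) / d = snd v"
   using d0 by simp_all
  then show ?thesis unfolding S_def T_def fst_conv snd_conv by (simp add: prod_eq_iff add_divide_distrib)
 qed
 have bS: "norm (S v) \<le> M * norm v" for v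
 proof -
  have comp: "norm (fst v) \<le> norm v" "norm (snd v) \<le> norm v" using norm_fst_part[of v] norm_snd_part[of v] by auto
  have b: "norm ((x * s - y * t) / d) \<le> (norm x + norm y) / norm d * norm v" if "norm s \<le> norm v" "norm t \<le> norm v" for x y s t
  proof -
   have "norm (x * s - y * t) \<le> norm x * norm s + norm y * norm t"
    using norm_triangle_ineq4[of "x * s" "y * t"] by (simp add: norm_mult)
   also have "\<dots> \<le> norm x * norm v + norm y * norm v" using that by (intro add_mono mult_left_mono) auto
   finally have "norm (x * s - y * t) / norm d \<le> ((norm x + norm y) * norm v) / norm d"
    by (intro divide_right_mono) (auto simp: distrib_right)
   then show ?thesis by (simp add: norm_divide)
  qed
  have "norm (S v) \<le> norm (fst (S v)) + norm (snd (S v))" by (rule norm_le_parts)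
  also have "\<dots> \<le> (norm t22 + norm t12) / norm d * norm v + (norm t11 + norm t21) / norm d * norm v"
   unfolding S_def fst_conv snd_conv using comp by (intro add_mono b)
  also have "\<dots> = (M - 1) * norm v" unfolding M_def by (simp add: add_divide_distrib algebra_simps)
  also have "\<dots> \<le> M * norm v" by (simp add: algebra_simps)
  finally show ?thesis .
 qed
 have "0 < 1 / (4 * M)" using M by simp
 note ev = weighted_sum_strict_derivative[OF pt(1) this]
 have "eventually (\<lambda>r. 0 < r & (\<forall>x\<in>cball p r. \<forall>y\<in>cball p r. norm (dlog A x - dlog A y - T (x - y)) \<le> norm (x - y) / (2 * M))) (at_right 0)"
  using ev[of "\<lambda>a. of_int (fst a)" A] ev[of "\<lambda>a. of_int (snd a)" A] eventually_at_right_less[of "0::real"]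
  unfolding as_hess as_weighted_sum(2,3)[symmetric]
 proof eventually_elim
  case (elim r)
  show ?case
  proof (intro conjI ballI)
   show "0 < r" using elim(3) .
   fix x y assume xy: "x \<in> cball p r" "y \<in> cball p r"
   have "norm (dlog A x - dlog A y - T (x - y)) \<le> norm (fst (dlog A x - dlog A y - T (x - y))) + norm (snd (dlog A x - dlog A y - T (x - y)))"
    by (rule norm_le_parts)
   also have "\<dots> \<le> 1 / (4 * M) * norm (x - y) + 1 / (4 * M) * norm (x - y)"
    using elim(1)[rule_format, OF xy] elim(2)[rule_format, OF xy]
    unfolding dlog_def T_def t11_def t12_def t21_def t22_def by (intro add_mono) simp_all
   finally show "norm (dlog A x - dlog A y - T (x - y)) \<le> norm (x - y) / (2 * M)" by (simp add: field_simps)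
  qed
 qed
 then have "eventually (\<lambda>r. (\<forall>w. norm w \<le> r / (2 * M) \<longrightarrow> (\<exists>x\<in>cball p r. dlog A x = w)) &
  (\<forall>x\<in>cball p r. \<forall>y\<in>cball p r. norm (x - y) \<le> 2 * M * norm (dlog A x - dlog A y))) (at_right 0)"
 proof eventually_elim
  case (elim r)
  have a: "norm (dlog A x - dlog A y - T (x - y)) \<le> norm (x - y) / (2 * M)" if "x \<in> cball p r" "y \<in> cball p r" for x y
   using elim that by blast
  note L = local_inverse[OF linT linS ST TS bS M a conjunct1[OF elim] pt(2)]
  show ?case
  proof (intro conjI allI impI ballI)
   show "\<exists>x\<in>cball p r. dlog A x = w" if "norm w \<le> r / (2 * M)" for w by (rule L(1)) (use that in simp_all)
   show "norm (x - y) \<le> 2 * M * norm (dlog A x - dlog A y)" if "x \<in> cball p r" "y \<in> cball p r" for x y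
    by (rule L(2)) (use that in simp_all)
  qed
 qed
 then show ?thesis using M by blast
qed

lemma sumset_monomial_bound:
 assumes z: "z \<in> torus2" and C: "\<And>a. a \<in> A \<Longrightarrow> norm (mono2 z a) \<le> C" "0 \<le> C"
 shows "v \<in> sumset t A \<Longrightarrow> norm (mono2 z v) \<le> C ^ t"
proof (induction t arbitrary: v)
 case 0 then show ?case by (simp add: mono2_def)
next
 case (Suc t)
 then obtain a b where v: "v = a + b" "a \<in> A" "b \<in> sumset t A" by auto
 have "norm (mono2 z a) * norm (mono2 z b) \<le> C * C ^ t" using Suc.IH[OF v(3)] C(1)[OF v(2)] C(2) by (intro mult_mono) auto
 then show ?case unfolding v(1) mono2_add[OF z] by (simp add: norm_mult)
qed

lemma dlog_bounded_preimage:
 assumes A: "tame A b"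
 obtains C where "0 < C" "\<And>z. z \<in> torus2 \<Longrightarrow> norm (dlog A z) \<le> 1 \<Longrightarrow>
  norm (fst z) \<le> C & norm (snd z) \<le> C & 1 \<le> C * norm (fst z) & 1 \<le> C * norm (snd z)"
proof -
 have gen: "\<forall>v. \<exists>t. v \<in> sumset t A" and "coercive A" using A unfolding tame_def by blast+
 then obtain K where K: "\<And>z a. z \<in> torus2 \<Longrightarrow> a \<in> A \<Longrightarrow> norm (mono2 z a) \<le> K * (1 + norm (dlog1 A z) + norm (dlog2 A z))"
  unfolding coercive_def by blast
 obtain t1 t2 t3 t4 where t: "(1, 0) \<in> sumset t1 A" "(- 1, 0) \<in> sumset t2 A" "(0, 1) \<in> sumset t3 A" "(0, - 1) \<in> sumset t4 A"
  using gen by metis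
 define C where "C = \<bar>K\<bar> * 3"
 define C0 where "C0 = C ^ t1 + C ^ t2 + C ^ t3 + C ^ t4 + 1"
 have C: "0 \<le> C" by (simp add: C_def)
 have pw: "0 \<le> C ^ t1" "0 \<le> C ^ t2" "0 \<le> C ^ t3" "0 \<le> C ^ t4" using C by auto
 have "norm (fst z) \<le> C0 & norm (snd z) \<le> C0 & 1 \<le> C0 * norm (fst z) & 1 \<le> C0 * norm (snd z)"
  if z: "z \<in> torus2" and d: "norm (dlog A z) \<le> 1" for z
 proof -
  have d12: "norm (dlog1 A z) \<le> 1" "norm (dlog2 A z) \<le> 1"
   using order_trans[OF norm_fst_part d] order_trans[OF norm_snd_part d] by (simp_all add: dlog_def)
  have b: "norm (mono2 z a) \<le> C" if "a \<in> A" for a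
  proof -
   have "K * (1 + norm (dlog1 A z) + norm (dlog2 A z)) \<le> \<bar>K\<bar> * 3" using d12 by (intro mult_mono) auto
   then show ?thesis using K[OF z that] by (simp add: C_def)
  qed
  note s = sumset_monomial_bound[OF z b C]
  have "norm (fst z) \<le> C ^ t1" "norm (inverse (fst z)) \<le> C ^ t2" "norm (snd z) \<le> C ^ t3" "norm (inverse (snd z)) \<le> C ^ t4"
   using s[OF _ t(1)] s[OF _ t(2)] s[OF _ t(3)] s[OF _ t(4)] by (simp_all add: mono2_def power_int_minus)
  then have bb: "norm (fst z) \<le> C0" "norm (inverse (fst z)) \<le> C0" "norm (snd z) \<le> C0" "norm (inverse (snd z)) \<le> C0"
   using pw unfolding C0_def by linarith+
  have nz: "0 < norm (fst z)" "0 < norm (snd z)" using z by (auto simp: torus2_def)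
  have "norm (inverse (fst z)) * norm (fst z) \<le> C0 * norm (fst z)" "norm (inverse (snd z)) * norm (snd z) \<le> C0 * norm (snd z)"
   using bb by (intro mult_right_mono; simp)+
  then show ?thesis using bb nz by (simp add: norm_inverse)
 qed
 moreover have "0 < C0" using pw unfolding C0_def by linarith
 ultimately show ?thesis by (rule that[rotated])
qed

definition annulus :: "real \<Rightarrow> (complex \<times> complex) set" where
 "annulus C = {z. norm (fst z) \<le> C & norm (snd z) \<le> C & 1 \<le> C * norm (fst z) & 1 \<le> C * norm (snd z)}"

lemma annulus_facts: "compact (annulus C)" "annulus C \<subseteq> torus2"
proof -
 have "annulus C = (cball 0 C \<times> cball 0 C) \<inter> ({z. 1 \<le> C * norm (fst z)} \<inter> {z. 1 \<le> C * norm (snd z)})"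
  by (auto simp: annulus_def)
 moreover have "compact (cball (0::complex) C \<times> cball (0::complex) C)" by (intro compact_Times compact_cball)
 moreover have "closed ({z :: complex \<times> complex. 1 \<le> C * norm (fst z)} \<inter> {z. 1 \<le> C * norm (snd z)})"
  by (intro closed_Int closed_Collect_le continuous_intros)
 ultimately show "compact (annulus C)" by (simp only: compact_Int_closed)
 show "annulus C \<subseteq> torus2" by (auto simp: torus2_def annulus_def)
qed

text \<open>For small \<open>w\<close> the fibre of the logarithmic gradient over \<open>w\<close> has one point \<open>\<zeta> p w\<close> near each critical point \<open>p\<close>, and
  no other. On the compact part of the torus that contains the fibre, the gradient is bounded away from zero outside the balls
  around the critical points.\<close>

lemma dlog_inverse:
 assumes A: "tame A b"
 obtains \<delta> L \<zeta> where "0 < \<delta>" "\<delta> \<le> 1" "0 \<le> L"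
  "\<And>w. norm w < \<delta> \<Longrightarrow> inj_on (\<lambda>p. \<zeta> p w) (crit A)"
  "\<And>w. norm w < \<delta> \<Longrightarrow> (\<lambda>p. \<zeta> p w) ` crit A = {z \<in> torus2. dlog A z = w}"
  "\<And>p w w'. p \<in> crit A \<Longrightarrow> norm w < \<delta> \<Longrightarrow> norm w' < \<delta> \<Longrightarrow>
    norm (plane_sum A (\<zeta> p w) - plane_sum A (\<zeta> p w')) \<le> L * norm (w - w')"
proof -
 let ?Z = "crit A"
 have m: "finite ?Z" "\<And>p. p \<in> ?Z \<Longrightarrow> hess A p ~= 0" using A unfolding tame_def morse_def by blast+
 have "\<forall>p\<in>?Z. \<exists>M>0. eventually (\<lambda>r. (\<forall>w. norm w \<le> r / (2 * M) \<longrightarrow> (\<exists>x\<in>cball p r. dlog A x = w)) &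
  (\<forall>x\<in>cball p r. \<forall>y\<in>cball p r. norm (x - y) \<le> 2 * M * norm (dlog A x - dlog A y))) (at_right 0)"
  using dlog_local_inverse m(2) by blast
 from bchoice[OF this] obtain M where M: "\<forall>p\<in>?Z. 0 < M p & eventually (\<lambda>r. (\<forall>w. norm w \<le> r / (2 * M p) \<longrightarrow> (\<exists>x\<in>cball p r. dlog A x = w)) &
  (\<forall>x\<in>cball p r. \<forall>y\<in>cball p r. norm (x - y) \<le> 2 * M p * norm (dlog A x - dlog A y))) (at_right 0)"
  by blast
 define Q where "Q = (\<lambda>p. 1 + norm (weighted_sum (\<lambda>a. 1 * of_int (fst a)) A p / fst p) + norm (weighted_sum (\<lambda>a. 1 * of_int (snd a)) A p / snd p))"
 have Q: "eventually (\<lambda>r. \<forall>x\<in>cball p r. \<forall>y\<in>cball p r. norm (plane_sum A x - plane_sum A y) \<le> Q p * norm (x - y)) (at_right 0)"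
  if p: "p \<in> ?Z" for p
 proof -
  have "p \<in> torus2" using p by (simp add: crit_def)
  from weighted_sum_strict_derivative[OF this zero_less_one, of "\<lambda>_. 1" A]
  show ?thesis
  proof eventually_elim
   case (elim r)
   show ?case
   proof (intro ballI)
    fix x y assume xy: "x \<in> cball p r" "y \<in> cball p r"
    let ?t = "weighted_sum (\<lambda>a. 1 * of_int (fst a)) A p / fst p" and ?s = "weighted_sum (\<lambda>a. 1 * of_int (snd a)) A p / snd p"
    have 1: "norm (plane_sum A x - plane_sum A y - (?t * fst (x - y) + ?s * snd (x - y))) \<le> 1 * norm (x - y)"
     using elim[rule_format, OF xy] unfolding as_weighted_sum(1) .
    have 2: "norm (?t * fst (x - y)) \<le> norm ?t * norm (x - y)" "norm (?s * snd (x - y)) \<le> norm ?s * norm (x - y)"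
     unfolding norm_mult using norm_fst_part[of "x - y"] norm_snd_part[of "x - y"] by (intro mult_left_mono; simp)+
    have "norm (plane_sum A x - plane_sum A y) \<le> norm (plane_sum A x - plane_sum A y - (?t * fst (x - y) + ?s * snd (x - y)))
      + norm (?t * fst (x - y) + ?s * snd (x - y))"
     using norm_triangle_ineq[of "plane_sum A x - plane_sum A y - (?t * fst (x - y) + ?s * snd (x - y))"
       "?t * fst (x - y) + ?s * snd (x - y)"] unfolding diff_add_cancel .
    also have "norm (?t * fst (x - y) + ?s * snd (x - y)) \<le> norm (?t * fst (x - y)) + norm (?s * snd (x - y))" by (rule norm_triangle_ineq)
    finally have "norm (plane_sum A x - plane_sum A y) \<le> 1 * norm (x - y) + (norm ?t * norm (x - y) + norm ?s * norm (x - y))"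
     using 1 2 by linarith
    also have "\<dots> = Q p * norm (x - y)" unfolding Q_def by (simp add: distrib_right)
    finally show "norm (plane_sum A x - plane_sum A y) \<le> Q p * norm (x - y)" .
   qed
  qed
 qed
 have T: "eventually (\<lambda>r. cball p r \<subseteq> torus2) (at_right 0)" if p: "p \<in> ?Z" for p
 proof -
  have "p \<in> torus2" using p by (simp add: crit_def)
  then obtain e where e: "0 < e" "ball p e \<subseteq> torus2" using open_torus2 open_contains_ball by blast
  have "cball p r \<subseteq> torus2" if "r < e" for r using e(2) that by (intro subset_trans[OF _ e(2)]) auto
  then show ?thesis using e(1) eventually_at_right_field by blast
 qed
 have D: "eventually (\<lambda>r. \<forall>q\<in>?Z. q ~= p \<longrightarrow> cball p r \<inter> cball q r = {}) (at_right 0)" for p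
 proof (rule eventually_ball_finite[OF m(1)], rule ballI)
  fix q assume "q \<in> ?Z"
  show "eventually (\<lambda>r. q ~= p \<longrightarrow> cball p r \<inter> cball q r = {}) (at_right 0)"
  proof (cases "q = p")
   case False
   then have d: "0 < dist p q / 2" by simp
   have "cball p r \<inter> cball q r = {}" if "r < dist p q / 2" for r
   proof (rule ccontr)
    assume "cball p r \<inter> cball q r ~= {}"
    then obtain x where "dist p x \<le> r" "dist q x \<le> r" by auto
    then have "dist p q \<le> 2 * r" using dist_triangle2[of p q x] by linarith
    then show False using that by simp
   qed
   then show ?thesis using d eventually_at_right_field by blast
  qed simp
 qed
 define good where "good = (\<lambda>p r. (\<forall>w. norm w \<le> r / (2 * M p) \<longrightarrow> (\<exists>x\<in>cball p r. dlog A x = w)) &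
   (\<forall>x\<in>cball p r. \<forall>y\<in>cball p r. norm (x - y) \<le> 2 * M p * norm (dlog A x - dlog A y)) &
   (\<forall>x\<in>cball p r. \<forall>y\<in>cball p r. norm (plane_sum A x - plane_sum A y) \<le> Q p * norm (x - y)) &
   cball p r \<subseteq> torus2 & (\<forall>q\<in>?Z. q ~= p \<longrightarrow> cball p r \<inter> cball q r = {}))"
 have "eventually (\<lambda>r. good p r) (at_right 0)" if p: "p \<in> ?Z" for p
  using M[THEN bspec, OF p, THEN conjunct2] Q[OF p] T[OF p] D[of p] unfolding good_def by eventually_elim blast
 then have "eventually (\<lambda>r. \<forall>p\<in>?Z. good p r) (at_right 0)"
  by (intro eventually_ball_finite m(1)) blast
 then have "eventually (\<lambda>r. 0 < r & (\<forall>p\<in>?Z. good p r)) (at_right 0)"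
  using eventually_at_right_less[of "0::real"] by eventually_elim blast
 then obtain r where r: "0 < r" "\<And>p. p \<in> ?Z \<Longrightarrow> good p r"
  using eventually_happens'[OF trivial_limit_at_right_real] by blast
 have G: "norm w \<le> r / (2 * M p) \<Longrightarrow> \<exists>x\<in>cball p r. dlog A x = w"
   "x \<in> cball p r \<Longrightarrow> y \<in> cball p r \<Longrightarrow> norm (x - y) \<le> 2 * M p * norm (dlog A x - dlog A y)"
   "x \<in> cball p r \<Longrightarrow> y \<in> cball p r \<Longrightarrow> norm (plane_sum A x - plane_sum A y) \<le> Q p * norm (x - y)"
   "cball p r \<subseteq> torus2" "q \<in> ?Z \<Longrightarrow> q ~= p \<Longrightarrow> cball p r \<inter> cball q r = {}"
  if "p \<in> ?Z" for p q w x y using r(2)[OF that] unfolding good_def by blast+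
 obtain C where C: "0 < C" "\<And>z. z \<in> torus2 \<Longrightarrow> norm (dlog A z) \<le> 1 \<Longrightarrow>
  norm (fst z) \<le> C & norm (snd z) \<le> C & 1 \<le> C * norm (fst z) & 1 \<le> C * norm (snd z)"
  using dlog_bounded_preimage[OF A] by blast
 define K where "K = annulus C"
 have K: "compact K" "K \<subseteq> torus2" unfolding K_def by (rule annulus_facts)+
 define X where "X = K - (\<Union>p\<in>?Z. ball p r)"
 have X: "compact X" unfolding X_def by (intro compact_diff K(1) open_UN ballI open_ball)
 have "\<exists>d>0. \<forall>z\<in>X. d \<le> norm (dlog A z)"
 proof (cases "X = {}")
  case False
  have "continuous_on X (\<lambda>z. norm (dlog A z))"
  proof -
   have "X \<subseteq> torus2" using K(2) by (auto simp: X_def)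
   note c = continuous_on_subset[OF continuous_weighted_sum this]
   show ?thesis unfolding dlog_def as_weighted_sum by (intro continuous_on_norm continuous_on_Pair c)
  qed
  from continuous_attains_inf[OF X False this] obtain z0 where z0: "z0 \<in> X" "\<And>z. z \<in> X \<Longrightarrow> norm (dlog A z0) \<le> norm (dlog A z)" by blast
  have "dlog A z0 ~= 0"
  proof
   assume "dlog A z0 = 0"
   then have "z0 \<in> ?Z" using z0(1) K(2) by (auto simp: crit_def dlog_def zero_prod_def X_def)
   then show False using z0(1) r(1) unfolding X_def by auto
  qed
  then show ?thesis using z0(2) by (intro exI[of _ "norm (dlog A z0)"]) simp
 qed (auto intro: zero_less_one)
 then obtain d where d: "0 < d" "\<And>z. z \<in> X \<Longrightarrow> d \<le> norm (dlog A z)" by blast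
 define Ms where "Ms = 1 + (\<Sum>p\<in>?Z. M p)"
 have M0: "0 < M p" if "p \<in> ?Z" for p using M that by blast
 have Q0: "0 < Q p" for p unfolding Q_def by (intro add_pos_nonneg) auto
 have Ms: "M p \<le> Ms" if "p \<in> ?Z" for p
 proof -
  have "M p \<le> (\<Sum>p\<in>?Z. M p)" using M0 by (intro member_le_sum[OF that]) (auto intro: less_imp_le m(1))
  then show ?thesis unfolding Ms_def by simp
 qed
 have Ms0: "0 < Ms" unfolding Ms_def using M0 by (intro add_pos_nonneg sum_nonneg) (auto intro: less_imp_le)
 define \<delta> where "\<delta> = min 1 (min d (r / (2 * Ms)))"
 define \<zeta> where "\<zeta> = (\<lambda>p w. SOME x. x \<in> cball p r & dlog A x = w)"
 define L where "L = (\<Sum>p\<in>?Z. Q p * (2 * M p))"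
 have zeta: "\<zeta> p w \<in> cball p r & dlog A (\<zeta> p w) = w" if p: "p \<in> ?Z" and w: "norm w < \<delta>" for p w
 proof -
  have "r / (2 * Ms) \<le> r / (2 * M p)" using Ms[OF p] M0[OF p] r(1) by (intro divide_left_mono) auto
  then have "norm w \<le> r / (2 * M p)" using w unfolding \<delta>_def by linarith
  from G(1)[OF p this] have "\<exists>x. x \<in> cball p r & dlog A x = w" by blast
  then show ?thesis unfolding \<zeta>_def by (rule someI_ex)
 qed
 have unique: "x = y" if "p \<in> ?Z" "x \<in> cball p r" "y \<in> cball p r" "dlog A x = dlog A y" for p x y
  using G(2)[OF that(1-3)] that(4) by simp
 show ?thesis
 proof (rule that)
  show "0 < \<delta>" unfolding \<delta>_def using d(1) r(1) Ms0 by simp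
  show "\<delta> \<le> 1" unfolding \<delta>_def by simp
  show "0 \<le> L" unfolding L_def using Q0 M0 by (intro sum_nonneg mult_nonneg_nonneg) (auto intro: less_imp_le)
  fix w :: "complex \<times> complex" assume w: "norm w < \<delta>"
  show "inj_on (\<lambda>p. \<zeta> p w) ?Z"
  proof (rule inj_onI, rule ccontr)
   fix p q assume pq: "p \<in> ?Z" "q \<in> ?Z" "\<zeta> p w = \<zeta> q w" "p ~= q"
   then show False using G(5)[OF pq(1,2)] zeta[OF pq(1) w] zeta[OF pq(2) w] by auto
  qed
  show "(\<lambda>p. \<zeta> p w) ` ?Z = {z \<in> torus2. dlog A z = w}"
  proof (intro equalityI subsetI)
   fix z assume "z \<in> (\<lambda>p. \<zeta> p w) ` ?Z"
   then obtain p where "p \<in> ?Z" "z = \<zeta> p w" by blast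
   then show "z \<in> {z \<in> torus2. dlog A z = w}" using zeta[of p w] w G(4)[of p] by blast
  next
   fix z assume "z \<in> {z \<in> torus2. dlog A z = w}"
   then have z: "z \<in> torus2" "dlog A z = w" by auto
   have "norm (dlog A z) \<le> 1" using w unfolding z(2) \<delta>_def by simp
   from C(2)[OF z(1) this] have "z \<in> K" unfolding K_def annulus_def by blast
   have "z \<notin> X" using d(2)[of z] w z(2) unfolding \<delta>_def by auto
   then obtain p where p: "p \<in> ?Z" "z \<in> ball p r" using \<open>z \<in> K\<close> unfolding X_def by blast
   have "z \<in> cball p r" using p(2) by simp
   then have "z = \<zeta> p w"
    by (rule unique[OF p(1) _ conjunct1[OF zeta[OF p(1) w]]]) (simp only: z(2) conjunct2[OF zeta[OF p(1) w]])
   then show "z \<in> (\<lambda>p. \<zeta> p w) ` ?Z" using p(1) by blast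
  qed
 next
  fix p w w' :: "complex \<times> complex" assume p: "p \<in> ?Z" and w: "norm w < \<delta>" "norm w' < \<delta>"
  note z = zeta[OF p w(1)] zeta[OF p w(2)]
  have "norm (\<zeta> p w - \<zeta> p w') \<le> 2 * M p * norm (w - w')"
   using G(2)[OF p conjunct1[OF z(1)] conjunct1[OF z(2)]] unfolding conjunct2[OF z(1)] conjunct2[OF z(2)] .
  then have "Q p * norm (\<zeta> p w - \<zeta> p w') \<le> Q p * (2 * M p * norm (w - w'))"
   using Q0[of p] by (intro mult_left_mono) auto
  moreover have "Q p * (2 * M p) \<le> L"
   unfolding L_def by (rule member_le_sum[OF p]) (use Q0 M0 m(1) in \<open>auto intro!: mult_nonneg_nonneg less_imp_le\<close>)
  then have "Q p * (2 * M p) * norm (w - w') \<le> L * norm (w - w')" by (rule mult_right_mono) simp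
  moreover have "norm (plane_sum A (\<zeta> p w) - plane_sum A (\<zeta> p w')) \<le> Q p * norm (\<zeta> p w - \<zeta> p w')"
   by (rule G(3)[OF p conjunct1[OF z(1)] conjunct1[OF z(2)]])
  ultimately show "norm (plane_sum A (\<zeta> p w) - plane_sum A (\<zeta> p w')) \<le> L * norm (w - w')" by (simp add: mult.assoc)
 qed
qed

text \<open>The solutions of \<open>y - 1 / y = w\<close> are \<open>(w + s \<rho>) / 2\<close> with \<open>s = 1\<close> or \<open>s = -1\<close> and \<open>\<rho>\<^sup>2 = 4 + w\<^sup>2\<close>, and there
  \<open>y + 1 / y = s \<rho>\<close>. For small \<open>w\<close> the principal root has real part at least \<open>1\<close>, which keeps the two apart.\<close>

definition rho :: "complex \<Rightarrow> complex" where "rho w = csqrt (4 + w\<^sup>2)"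

definition branch :: "complex \<Rightarrow> complex \<Rightarrow> complex" where "branch s w = (w + s * rho w) / 2"

lemma rho_square: "(rho w)\<^sup>2 = 4 + w\<^sup>2"
 by (simp add: rho_def)

lemma Re_rho: "norm w < 1 \<Longrightarrow> 1 \<le> Re (rho w)"
proof -
 assume w: "norm w < 1"
 have "norm (w\<^sup>2) \<le> 1" using w by (simp add: norm_power power_le_one)
 then have "- 1 \<le> Re (w\<^sup>2)" using abs_Re_le_cmod[of "w\<^sup>2"] by linarith
 then have "3 \<le> Re ((rho w)\<^sup>2)" unfolding rho_square by simp
 then have "3 \<le> (Re (rho w))\<^sup>2 - (Im (rho w))\<^sup>2" by (simp add: power2_eq_square)
 moreover have "0 \<le> (Im (rho w))\<^sup>2" by simp
 ultimately have "1 \<le> (Re (rho w))\<^sup>2" by linarith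
 then have "1\<^sup>2 \<le> (Re (rho w))\<^sup>2" by simp
 moreover have "0 \<le> Re (rho w)" unfolding rho_def using csqrt_principal[of "4 + w\<^sup>2"] by auto
 ultimately show ?thesis using power2_le_imp_le by blast
qed

lemma rho_lipschitz:
 assumes "norm w < 1" "norm v < 1"
 shows "norm (rho w - rho v) \<le> norm (w - v)"
proof -
 have "2 \<le> Re (rho w + rho v)" using Re_rho[OF assms(1)] Re_rho[OF assms(2)] by simp
 then have 2: "2 \<le> norm (rho w + rho v)" using complex_Re_le_cmod[of "rho w + rho v"] by linarith
 have "(rho w + rho v) * (rho w - rho v) = (w + v) * (w - v)"
  using rho_square[of w] rho_square[of v] by algebra
 then have e: "norm (rho w + rho v) * norm (rho w - rho v) = norm (w + v) * norm (w - v)" by (metis norm_mult)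
 have "norm (w + v) \<le> 2" using norm_triangle_ineq[of w v] assms by linarith
 then have "norm (w + v) * norm (w - v) \<le> 2 * norm (w - v)" by (intro mult_right_mono) auto
 moreover have "2 * norm (rho w - rho v) \<le> norm (rho w + rho v) * norm (rho w - rho v)" using 2 by (intro mult_right_mono) auto
 ultimately show ?thesis using e by linarith
qed

lemma norm_rho: "norm (rho w) \<le> 2 + norm w"
proof -
 have "(norm (rho w))\<^sup>2 = norm (4 + w\<^sup>2)" by (metis norm_power rho_square)
 also have "\<dots> \<le> norm (4::complex) + norm (w\<^sup>2)" by (rule norm_triangle_ineq)
 also have "\<dots> = 4 + (norm w)\<^sup>2" by (simp add: norm_power)
 also have "\<dots> \<le> (2 + norm w)\<^sup>2" by (simp add: power2_sum)
 finally show ?thesis by (rule power2_le_imp_le) simp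
qed

lemma branch_facts:
 assumes "s = 1 \<or> s = - 1"
 shows "branch s w ~= 0" "branch s w - inverse (branch s w) = w" "branch s w + inverse (branch s w) = s * rho w"
proof -
 have s: "s\<^sup>2 = 1" using assms by auto
 have "branch s w * (branch s w - w) = ((s * rho w)\<^sup>2 - w\<^sup>2) / 4" unfolding branch_def by (simp add: field_simps power2_eq_square)
 also have "\<dots> = 1" using s rho_square[of w] by (simp add: power_mult_distrib)
 finally have 1: "branch s w * (branch s w - w) = 1" .
 then show "branch s w ~= 0" by auto
 have i: "inverse (branch s w) = branch s w - w" using 1 by (rule inverse_unique)
 show "branch s w - inverse (branch s w) = w" unfolding i by simp
 show "branch s w + inverse (branch s w) = s * rho w" unfolding i by (simp add: branch_def)
qed

lemma branch_cases:
 assumes "y ~= 0" "y - inverse y = w"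
 shows "\<exists>s\<in>{1, - 1}. y = branch s w"
proof -
 have "y * y - 1 = w * y" using assms by (simp add: field_simps)
 then have "(2 * y - w)\<^sup>2 = (rho w)\<^sup>2" unfolding rho_square by algebra
 then have "2 * y - w = rho w \<or> 2 * y - w = - rho w" by (simp add: power2_eq_iff)
 then have "2 * y = w + 1 * rho w \<or> 2 * y = w + (- 1) * rho w" by (auto simp: algebra_simps)
 then have "y = branch 1 w \<or> y = branch (- 1) w" unfolding branch_def by (metis nonzero_mult_div_cancel_left zero_neq_numeral)
 then show ?thesis by blast
qed

lemma branch_inj:
 assumes "norm w < 1" "branch s w = branch t w" shows "s = t"
proof -
 have "rho w ~= 0" using Re_rho[OF assms(1)] by auto
 then show ?thesis using assms(2) by (simp add: branch_def)
qed

section \<open>Counting solutions near the origin\<close>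

definition bipyramid_points :: "nat \<Rightarrow> (int \<times> int) set \<Rightarrow> (nat \<Rightarrow>\<^sub>0 int) set" where
 "bipyramid_points k A = embed2 ` A \<union> cross_axes 2 k"

lemma bipyramid_points_lattice: "bipyramid_points k A \<subseteq> int_lattice (2 + k)"
proof -
 have "embed2 a \<in> int_lattice (2 + k)" for a
  unfolding embed2_def by (intro int_lattice_add int_lattice_single) auto
 then show ?thesis unfolding bipyramid_points_def cross_axes_def by auto
qed

lemma finite_bipyramid_points: "finite A \<Longrightarrow> finite (bipyramid_points k A)"
 unfolding bipyramid_points_def cross_axes_def by simp

lemma sum_bipyramid_points:
 fixes g :: "(nat \<Rightarrow>\<^sub>0 int) \<Rightarrow> complex"
 assumes "finite A"
 shows "(\<Sum>a\<in>bipyramid_points k A. g a) = (\<Sum>a\<in>A. g (embed2 a)) +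
  (\<Sum>i\<in>{2..<2 + k}. g (single i 1) + g (single i (- 1)))"
proof -
 have ne: "single i (c::int) ~= embed2 a" if "2 \<le> i" "c ~= 0" for i c a
 proof
  assume "single i c = embed2 a"
  then have "lookup (single i c) i = lookup (embed2 a) i" by simp
  then show False using that by (simp add: lookup_embed2)
 qed
 have disj: "embed2 ` A \<inter> cross_axes 2 k = {}"
 proof (rule equals0I)
  fix x assume x: "x \<in> embed2 ` A \<inter> cross_axes 2 k"
  then obtain a where a: "x = embed2 a" by blast
  obtain i where i: "i \<in> {2..<2 + k}" "x \<in> {single i 1, single i (- 1)}"
   using x unfolding cross_axes_def by blast
  have "2 \<le> i" using i(1) by simp
  from ne[OF this, of 1 a] ne[OF this, of "- 1" a] i(2) show False unfolding a by auto
 qed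
 have ne2: "single i (c::int) ~= single j d" if "i ~= j" "c ~= 0" for i j :: nat and c d
 proof
  assume "single i c = single j d"
  then have "lookup (single i c) i = lookup (single j d) i" by simp
  then show False using that by (simp add: lookup_single when_def)
 qed
 have pm: "single i (1::int) ~= single i (- 1)" for i :: nat
 proof
  assume "single i (1::int) = single i (- 1)"
  then have "lookup (single i (1::int)) i = lookup (single i (- 1)) i" by simp
  then show False by simp
 qed
 have "(\<Sum>a\<in>bipyramid_points k A. g a) = (\<Sum>a\<in>embed2 ` A. g a) + (\<Sum>a\<in>cross_axes 2 k. g a)"
  unfolding bipyramid_points_def by (rule sum.union_disjoint) (use assms disj in \<open>auto simp: cross_axes_def\<close>)
 also have "(\<Sum>a\<in>embed2 ` A. g a) = (\<Sum>a\<in>A. g (embed2 a))"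
  using inj_embed2 by (simp add: sum.reindex inj_on_subset)
 also have "(\<Sum>a\<in>cross_axes 2 k. g a) = (\<Sum>i\<in>{2..<2 + k}. \<Sum>a\<in>{single i 1, single i (- 1)}. g a)"
  unfolding cross_axes_def
 proof (rule sum.UNION_disjoint)
  show "\<forall>i\<in>{2..<2 + k}. \<forall>j\<in>{2..<2 + k}. i ~= j \<longrightarrow>
   {single i 1, single i (- 1)} \<inter> {single j 1, single j (- 1 :: int)} = {}"
  proof (intro ballI impI)
   fix i j :: nat assume "i ~= j"
   then show "{single i 1, single i (- 1)} \<inter> {single j 1, single j (- 1 :: int)} = {}"
    using ne2[of i j 1] ne2[of i j "- 1"] by simp
  qed
 qed auto
 also have "\<dots> = (\<Sum>i\<in>{2..<2 + k}. g (single i 1) + g (single i (- 1)))"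
  using pm by (intro sum.cong refl) simp
 finally show ?thesis .
qed

lemma laurent_monomial_embed2:
 assumes "\<theta> \<in> torus (2 + k)"
 shows "laurent_monomial \<theta> (embed2 a) = mono2 (\<theta> 0, \<theta> 1) a"
 unfolding embed2_def mono2_def using laurent_monomial_add[OF _ _ assms, of "single 0 (fst a)" "single 1 (snd a)"] by simp

lemma bipyramid_laurent:
 assumes A: "finite A" and \<theta>: "\<theta> \<in> torus (2 + k)"
 shows "laurent_sum (bipyramid_points k A) \<theta> = plane_sum A (\<theta> 0, \<theta> 1) + (\<Sum>i\<in>{2..<2 + k}. \<theta> i + inverse (\<theta> i))"
  "log_deriv (bipyramid_points k A) 0 \<theta> = dlog1 A (\<theta> 0, \<theta> 1)"
  "log_deriv (bipyramid_points k A) 1 \<theta> = dlog2 A (\<theta> 0, \<theta> 1)"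
  "j \<in> {2..<2 + k} \<Longrightarrow> log_deriv (bipyramid_points k A) j \<theta> = \<theta> j - inverse (\<theta> j)"
proof -
 note s = sum_bipyramid_points[OF A] laurent_monomial_embed2[OF \<theta>]
 show "laurent_sum (bipyramid_points k A) \<theta> = plane_sum A (\<theta> 0, \<theta> 1) + (\<Sum>i\<in>{2..<2 + k}. \<theta> i + inverse (\<theta> i))"
  unfolding laurent_sum_def plane_sum_def s(1) s(2) by (simp add: power_int_minus)
 show "log_deriv (bipyramid_points k A) 0 \<theta> = dlog1 A (\<theta> 0, \<theta> 1)"
  unfolding log_deriv_def dlog1_def s(1) s(2) by (simp add: lookup_embed2 lookup_single when_def)
 show "log_deriv (bipyramid_points k A) 1 \<theta> = dlog2 A (\<theta> 0, \<theta> 1)"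
  unfolding log_deriv_def dlog2_def s(1) s(2) by (simp add: lookup_embed2 lookup_single when_def)
 assume j: "j \<in> {2..<2 + k}"
 have z: "lookup (embed2 a) j = 0" for a using j by (simp add: lookup_embed2)
 have c: "of_int (lookup (single i 1) j) * laurent_monomial \<theta> (single i 1) +
   of_int (lookup (single i (- 1)) j) * laurent_monomial \<theta> (single i (- 1)) =
   (if i = j then \<theta> j - inverse (\<theta> j) else 0)" for i
  by (simp add: lookup_single when_def power_int_minus)
 have "log_deriv (bipyramid_points k A) j \<theta> = (\<Sum>a\<in>A. 0) + (\<Sum>i\<in>{2..<2 + k}. if i = j then \<theta> j - inverse (\<theta> j) else 0)"
  unfolding log_deriv_def s(1) z c by (simp only: of_int_0 mult_zero_left)
 also have "\<dots> = \<theta> j - inverse (\<theta> j)"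
  unfolding sum.delta[OF finite_atLeastLessThan] using j by simp
 finally show "log_deriv (bipyramid_points k A) j \<theta> = \<theta> j - inverse (\<theta> j)" .
qed

text \<open>The critical equations without the condition that the Laurent polynomial does not vanish.\<close>

definition log_solutions :: "nat \<Rightarrow> (nat \<Rightarrow>\<^sub>0 int) set \<Rightarrow> (nat \<Rightarrow> complex) \<Rightarrow> (nat \<Rightarrow> complex) set" where
 "log_solutions m B c = {\<theta> \<in> torus m. \<forall>i<m. log_deriv B i \<theta> = c i * laurent_sum B \<theta>}"

lemma below_cases: "i < 2 + k \<longleftrightarrow> i = 0 \<or> i = 1 \<or> i \<in> {2..<2 + k}" for i :: nat
 by auto

lemma all_below: "(\<forall>i<2 + k. P i) \<longleftrightarrow> P 0 & P 1 & (\<forall>i\<in>{2..<2 + k}. P i)" for P :: "nat \<Rightarrow> bool"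
 unfolding below_cases by blast

lemma log_solutions_iff:
 assumes "finite A"
 shows "\<theta> \<in> log_solutions (2 + k) (bipyramid_points k A) c \<longleftrightarrow> \<theta> \<in> torus (2 + k) &
  dlog A (\<theta> 0, \<theta> 1) = (c 0 * laurent_sum (bipyramid_points k A) \<theta>, c 1 * laurent_sum (bipyramid_points k A) \<theta>) &
  (\<forall>i\<in>{2..<2 + k}. \<theta> i - inverse (\<theta> i) = c i * laurent_sum (bipyramid_points k A) \<theta>)"
proof (cases "\<theta> \<in> torus (2 + k)")
 case True
 note b = bipyramid_laurent(2)[OF assms True] bipyramid_laurent(3)[OF assms True]
 have ball: "(\<forall>i\<in>{2..<2 + k}. log_deriv (bipyramid_points k A) i \<theta> = c i * F) \<longleftrightarrow>
  (\<forall>i\<in>{2..<2 + k}. \<theta> i - inverse (\<theta> i) = c i * F)" for F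
  by (intro ball_cong refl) (simp only: bipyramid_laurent(4)[OF assms True])
 show ?thesis unfolding log_solutions_def mem_Collect_eq all_below ball b dlog_def prod.inject using True by blast
qed (simp add: log_solutions_def)

text \<open>The equations for different coordinates are coupled only through the value \<open>F\<close> of the Laurent
  polynomial. Given \<open>F\<close>, a solution is determined by a critical point \<open>p\<close> of the planar part and a sign for
  each other coordinate, and \<open>F\<close> has to be a fixed point of the function \<open>\<Phi>\<close> that computes the value from these
  solutions. For small \<open>c\<close> this function is a contraction of a disc, and all values that occur are
  in the disc by coercivity. So there is exactly one solution for each choice of \<open>p\<close> and of
  the signs.\<close>

theorem card_log_solutions:
 assumes A: "tame A b"
 shows "\<exists>\<eta>>0. \<forall>c. (\<forall>i<2 + k. norm (c i) < \<eta>) \<longrightarrow>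
  finite (log_solutions (2 + k) (bipyramid_points k A) c) & card (log_solutions (2 + k) (bipyramid_points k A) c) = b * 2 ^ k"
proof -
 let ?I = "{2..<2 + k}" and ?B = "bipyramid_points k A"
 have fA: "finite A" and mo: "morse A b" and "coercive A" using A unfolding tame_def by blast+
 then obtain K where K: "\<And>z a. z \<in> torus2 \<Longrightarrow> a \<in> A \<Longrightarrow> norm (mono2 z a) \<le> K * (1 + norm (dlog1 A z) + norm (dlog2 A z))"
  unfolding coercive_def by blast
 obtain \<delta> L \<zeta> where dl: "0 < \<delta>" "\<delta> \<le> 1" "0 \<le> L"
  and z_inj: "\<And>w. norm w < \<delta> \<Longrightarrow> inj_on (\<lambda>p. \<zeta> p w) (crit A)"
  and z_im: "\<And>w. norm w < \<delta> \<Longrightarrow> (\<lambda>p. \<zeta> p w) ` crit A = {z \<in> torus2. dlog A z = w}"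
  and z_lip: "\<And>p w w'. p \<in> crit A \<Longrightarrow> norm w < \<delta> \<Longrightarrow> norm w' < \<delta> \<Longrightarrow>
    norm (plane_sum A (\<zeta> p w) - plane_sum A (\<zeta> p w')) \<le> L * norm (w - w')"
  using dlog_inverse[OF A] by blast
 define C where "C = 2 * (real (card A) * \<bar>K\<bar>) + 2 * real k + 1"
 have C: "1 \<le> C" unfolding C_def by simp
 define R where "R = 2 * C"
 define \<eta> where "\<eta> = min (\<delta> / (2 * R)) (min (1 / (2 * C)) (1 / (2 * (2 * L + real k + 1))))"
 have eta: "0 < \<eta>" "2 * R * \<eta> \<le> \<delta>" "C * \<eta> \<le> 1 / 2" "(2 * L + real k) * \<eta> \<le> 1 / 2"
 proof -
  show e0: "0 < \<eta>" unfolding \<eta>_def R_def using dl C by simp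
  have R0: "0 < R" using C unfolding R_def by simp
  have "\<eta> \<le> \<delta> / (2 * R)" "\<eta> \<le> 1 / (2 * C)" "\<eta> \<le> 1 / (2 * (2 * L + real k + 1))" unfolding \<eta>_def by auto
  then have "\<eta> * (2 * R) \<le> \<delta>" "\<eta> * (2 * C) \<le> 1" "\<eta> * (2 * (2 * L + real k + 1)) \<le> 1"
   using R0 C dl(3) by (simp_all add: pos_le_divide_eq)
  then show "2 * R * \<eta> \<le> \<delta>" "C * \<eta> \<le> 1 / 2" "(2 * L + real k) * \<eta> \<le> 1 / 2" using e0 by (simp_all add: algebra_simps)
 qed
 have R0: "0 < R" using C by (simp add: R_def)
 have plane_bound: "norm (plane_sum A z) \<le> real (card A) * \<bar>K\<bar> * (1 + 2 * s)"
  if z: "z \<in> torus2" and d: "norm (dlog1 A z) \<le> s" "norm (dlog2 A z) \<le> s" for z s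
 proof -
  have "norm (plane_sum A z) \<le> (\<Sum>a\<in>A. norm (mono2 z a))" unfolding plane_sum_def by (rule norm_sum)
  also have "\<dots> \<le> (\<Sum>a\<in>A. \<bar>K\<bar> * (1 + 2 * s))"
  proof (rule sum_mono)
   fix a assume a: "a \<in> A"
   have "norm (mono2 z a) \<le> K * (1 + norm (dlog1 A z) + norm (dlog2 A z))" by (rule K[OF z a])
   also have "\<dots> \<le> \<bar>K\<bar> * (1 + 2 * s)" using d by (intro mult_mono) auto
   finally show "norm (mono2 z a) \<le> \<bar>K\<bar> * (1 + 2 * s)" .
  qed
  finally show ?thesis by (simp add: mult.assoc)
 qed
 have total: "norm (x + y) \<le> C * (1 + s)"
  if "norm x \<le> real (card A) * \<bar>K\<bar> * (1 + 2 * s)" "norm y \<le> real k * (2 + s)" "0 \<le> s" for x y :: complex and s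
 proof -
  have "norm (x + y) \<le> real (card A) * \<bar>K\<bar> * (1 + 2 * s) + real k * (2 + s)" using norm_triangle_ineq[of x y] that by linarith
  moreover have "0 \<le> real (card A) * \<bar>K\<bar>" "0 \<le> real k * s" using that by auto
  moreover have "C * (1 + s) = (E * (1 + 2 * s) + real k * (2 + s)) + (E + real k * s + 1 + s)" if "E = real (card A) * \<bar>K\<bar>" for E
   unfolding C_def that by algebra
  ultimately show ?thesis using that(3) by (smt (verit))
 qed
 have sums: "norm (\<Sum>i\<in>?I. y i) \<le> real k * t" if "\<And>i. i \<in> ?I \<Longrightarrow> norm (y i) \<le> t" for y :: "nat \<Rightarrow> complex" and t
  using sum_norm_le[of ?I y "\<lambda>_. t"] that by simp
 have "finite (log_solutions (2 + k) ?B c) & card (log_solutions (2 + k) ?B c) = b * 2 ^ k" if c: "\<forall>i<2 + k. norm (c i) < \<eta>" for c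
 proof -
  let ?S = "log_solutions (2 + k) ?B c"
  let ?w = "\<lambda>F. (c 0 * F, c 1 * F)"
  define J where "J = crit A \<times> (?I \<rightarrow>\<^sub>E {1, - 1 :: complex})"
  define \<Phi> where "\<Phi> = (\<lambda>(p, s) F. plane_sum A (\<zeta> p (?w F)) + (\<Sum>i\<in>?I. s i * rho (c i * F)))"
  define \<Theta> where "\<Theta> = (\<lambda>(p, s) F. \<lambda>i\<in>{..<2 + k}. if i = 0 then fst (\<zeta> p (?w F)) else if i = 1 then snd (\<zeta> p (?w F)) else branch (s i) (c i * F))"
  have cF: "norm (c i * F) \<le> \<eta> * norm F" if "i < 2 + k" for i F
   unfolding norm_mult using c that by (intro mult_right_mono) (auto intro: less_imp_le)
  have wF: "norm (?w F - ?w G) \<le> 2 * \<eta> * norm (F - G)" for F G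
  proof -
   have "norm (?w F - ?w G) \<le> norm (c 0 * (F - G)) + norm (c 1 * (F - G))"
    using norm_Pair_le[of "c 0 * (F - G)" "c 1 * (F - G)"] by (simp add: algebra_simps)
   then show ?thesis using cF[of 0 "F - G"] cF[of 1 "F - G"] by simp
  qed
  have wR: "norm (?w F) < \<delta>" if F: "norm F \<le> R" for F
  proof (cases "F = 0")
   case False
   have "norm (?w F) \<le> norm (c 0 * F) + norm (c 1 * F)" by (rule norm_Pair_le)
   also have "\<dots> < \<eta> * norm F + \<eta> * norm F"
    unfolding norm_mult using c False by (intro add_strict_mono mult_strict_right_mono) auto
   also have "\<dots> \<le> 2 * R * \<eta>" using mult_left_mono[OF F, of \<eta>] eta(1) by (simp add: algebra_simps)
   finally show ?thesis using eta(2) by linarith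
  qed (use dl in \<open>simp add: zero_prod_def[symmetric]\<close>)
  have cR: "norm (c i * F) < 1" if F: "norm F \<le> R" and i: "i < 2 + k" for i F
  proof -
   have "\<eta> * norm F \<le> R * \<eta>" using mult_left_mono[OF F, of \<eta>] eta(1) by (simp add: algebra_simps)
   then show ?thesis using cF[OF i, of F] eta(2) dl mult_pos_pos[OF R0 eta(1)] by linarith
  qed
  have zF: "\<zeta> p (?w F) \<in> torus2" "dlog A (\<zeta> p (?w F)) = ?w F" if "p \<in> crit A" "norm F \<le> R" for p F
   using z_im[OF wR[OF that(2)]] that(1) by blast+
  have sJ: "s i = 1 \<or> s i = - 1" if "(p, s) \<in> J" "i \<in> ?I" for p s i
   using that unfolding J_def by (auto simp: PiE_iff)
  have pJ: "p \<in> crit A" if "(p, s) \<in> J" for p s using that unfolding J_def by blast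
  have CR: "C * (1 + \<eta> * norm F) \<le> R" if "norm F \<le> R" for F :: complex
  proof -
   have "C * \<eta> * norm F \<le> 1 / 2 * R" using eta C that by (intro mult_mono) auto
   then show ?thesis unfolding R_def by (simp add: algebra_simps)
  qed
  have self: "norm (\<Phi> j F) \<le> R" if j: "j \<in> J" and F: "norm F \<le> R" for j F
  proof -
   obtain p s where ps: "j = (p, s)" by (cases j)
   have J: "(p, s) \<in> J" using j unfolding ps .
   have 1: "norm (plane_sum A (\<zeta> p (?w F))) \<le> real (card A) * \<bar>K\<bar> * (1 + 2 * (\<eta> * norm F))"
    using zF[OF pJ[OF J] F] cF[of 0 F] cF[of 1 F] by (intro plane_bound) (auto simp: dlog_def)
   have 2: "norm (\<Sum>i\<in>?I. s i * rho (c i * F)) \<le> real k * (2 + \<eta> * norm F)"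
   proof (rule sums)
    fix i assume i: "i \<in> ?I"
    have "norm (s i * rho (c i * F)) = norm (rho (c i * F))" using sJ[OF J i] by (auto simp: norm_mult)
    then show "norm (s i * rho (c i * F)) \<le> 2 + \<eta> * norm F" using norm_rho[of "c i * F"] cF[of i F] i by simp
   qed
   have "norm (\<Phi> j F) \<le> C * (1 + \<eta> * norm F)"
    unfolding \<Phi>_def ps prod.case by (rule total[OF 1 2]) (use eta in simp)
   then show ?thesis using CR[OF F] by linarith
  qed
  have contraction: "norm (\<Phi> j F - \<Phi> j G) \<le> 1 / 2 * norm (F - G)" if j: "j \<in> J" and FG: "norm F \<le> R" "norm G \<le> R" for j F G
  proof -
   obtain p s where ps: "j = (p, s)" by (cases j)
   have J: "(p, s) \<in> J" using j unfolding ps .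
   have "norm (plane_sum A (\<zeta> p (?w F)) - plane_sum A (\<zeta> p (?w G))) \<le> L * norm (?w F - ?w G)"
    by (rule z_lip[OF pJ[OF J] wR[OF FG(1)] wR[OF FG(2)]])
   also have "\<dots> \<le> L * (2 * \<eta> * norm (F - G))" by (rule mult_left_mono[OF wF dl(3)])
   finally have 1: "norm (plane_sum A (\<zeta> p (?w F)) - plane_sum A (\<zeta> p (?w G))) \<le> 2 * L * \<eta> * norm (F - G)" by (simp add: algebra_simps)
   have 2: "norm (\<Sum>i\<in>?I. s i * rho (c i * F) - s i * rho (c i * G)) \<le> real k * (\<eta> * norm (F - G))"
   proof (rule sums)
    fix i assume i: "i \<in> ?I"
    then have i': "i < 2 + k" by simp
    have "norm (s i * rho (c i * F) - s i * rho (c i * G)) = norm (s i) * norm (rho (c i * F) - rho (c i * G))"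
     unfolding right_diff_distrib[symmetric] by (rule norm_mult)
    also have "\<dots> = norm (rho (c i * F) - rho (c i * G))" using sJ[OF J i] by auto
    also have "\<dots> \<le> norm (c i * F - c i * G)" by (rule rho_lipschitz[OF cR[OF FG(1) i'] cR[OF FG(2) i']])
    also have "\<dots> = norm (c i * (F - G))" by (simp add: algebra_simps)
    also have "\<dots> \<le> \<eta> * norm (F - G)" by (rule cF[OF i'])
    finally show "norm (s i * rho (c i * F) - s i * rho (c i * G)) \<le> \<eta> * norm (F - G)" .
   qed
   have "\<Phi> j F - \<Phi> j G = (plane_sum A (\<zeta> p (?w F)) - plane_sum A (\<zeta> p (?w G))) + (\<Sum>i\<in>?I. s i * rho (c i * F) - s i * rho (c i * G))"
    unfolding \<Phi>_def ps prod.case sum_subtractf by simp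
   also have "norm \<dots> \<le> 2 * L * \<eta> * norm (F - G) + real k * (\<eta> * norm (F - G))" by (rule norm_triangle_mono[OF 1 2])
   also have "\<dots> = (2 * L + real k) * \<eta> * norm (F - G)" by (simp add: algebra_simps)
   also have "\<dots> \<le> 1 / 2 * norm (F - G)" by (rule mult_right_mono[OF eta(4)]) simp
   finally show ?thesis .
  qed
  have fix_unique: "F = G" if "j \<in> J" "norm F \<le> R" "norm G \<le> R" "\<Phi> j F = F" "\<Phi> j G = G" for j F G
   using contraction[OF that(1-3)] unfolding that(4,5) by simp
  have "\<exists>F. norm F \<le> R & \<Phi> j F = F" if j: "j \<in> J" for j
  proof -
   have "\<exists>!F\<in>cball 0 R. \<Phi> j F = F"
   proof (rule Banach_fix)
    show "complete (cball (0::complex) R)" by (simp add: complete_eq_closed)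
    show "\<Phi> j ` cball 0 R \<subseteq> cball 0 R" using self[OF j] by (intro image_subsetI) (simp add: dist_norm)
    show "dist (\<Phi> j x) (\<Phi> j y) \<le> 1 / 2 * dist x y" if "x \<in> cball 0 R" "y \<in> cball 0 R" for x y
     using contraction[OF j, of x y] that by (simp add: dist_norm)
   qed (use R0 in auto)
   then obtain F where "F \<in> cball 0 R" "\<Phi> j F = F" by blast
   then show ?thesis by (intro exI[of _ F]) (simp add: dist_norm)
  qed
  then have "\<forall>j\<in>J. \<exists>F. norm F \<le> R & \<Phi> j F = F" by blast
  from bchoice[OF this] obtain F0 where F0: "\<And>j. j \<in> J \<Longrightarrow> norm (F0 j) \<le> R" "\<And>j. j \<in> J \<Longrightarrow> \<Phi> j (F0 j) = F0 j" by blast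
  have \<Theta>_facts: "\<Theta> j F \<in> torus (2 + k)" "(\<Theta> j F 0, \<Theta> j F 1) = \<zeta> (fst j) (?w F)"
   "\<And>i. i \<in> ?I \<Longrightarrow> \<Theta> j F i = branch (snd j i) (c i * F)" "laurent_sum ?B (\<Theta> j F) = \<Phi> j F"
   if j: "j \<in> J" and F: "norm F \<le> R" for j F
  proof -
   obtain p s where ps: "j = (p, s)" by (cases j)
   have J: "(p, s) \<in> J" using j unfolding ps .
   have t2: "fst (\<zeta> p (?w F)) ~= 0" "snd (\<zeta> p (?w F)) ~= 0" using zF(1)[OF pJ[OF J] F] by (auto simp: torus2_def)
   show b: "\<Theta> j F i = branch (snd j i) (c i * F)" if "i \<in> ?I" for i using that unfolding \<Theta>_def ps by auto
   show z: "(\<Theta> j F 0, \<Theta> j F 1) = \<zeta> (fst j) (?w F)" unfolding \<Theta>_def ps by simp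
   show T: "\<Theta> j F \<in> torus (2 + k)"
    unfolding torus_def
   proof (rule PiE_I)
    fix i assume "i \<in> {..<2 + k}"
    then consider "i = 0" | "i = 1" | "i \<in> ?I" using below_cases[of i k] by blast
    then show "\<Theta> j F i \<in> UNIV - {0}"
    proof cases
     case 3
     have "branch (s i) (c i * F) ~= 0" by (rule branch_facts(1)[OF sJ[OF J 3]])
     then show ?thesis using b[OF 3] unfolding ps by simp
    qed (use t2 in \<open>simp_all add: \<Theta>_def ps\<close>)
   qed (simp add: \<Theta>_def ps)
   have "(\<Sum>i\<in>?I. \<Theta> j F i + inverse (\<Theta> j F i)) = (\<Sum>i\<in>?I. s i * rho (c i * F))"
    using branch_facts(3)[OF sJ[OF J]] b unfolding ps by (intro sum.cong refl) simp
   then show "laurent_sum ?B (\<Theta> j F) = \<Phi> j F"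
    unfolding bipyramid_laurent(1)[OF fA T] z unfolding \<Phi>_def ps by simp
  qed
  have sol: "\<Theta> j (F0 j) \<in> ?S" "laurent_sum ?B (\<Theta> j (F0 j)) = F0 j" if j: "j \<in> J" for j
  proof -
   note F = F0(1)[OF j]
   show e: "laurent_sum ?B (\<Theta> j (F0 j)) = F0 j" using \<Theta>_facts(4)[OF j F] F0(2)[OF j] by simp
   have J: "(fst j, snd j) \<in> J" using j by simp
   show "\<Theta> j (F0 j) \<in> ?S"
    unfolding log_solutions_iff[OF fA] e \<Theta>_facts(2)[OF j F]
    using \<Theta>_facts(1)[OF j F] zF(2)[OF pJ[OF J] F] \<Theta>_facts(3)[OF j F] branch_facts(2)[OF sJ[OF J]] by simp
  qed
  have inj: "inj_on (\<lambda>j. \<Theta> j (F0 j)) J"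
  proof (rule inj_onI)
   fix j j' assume j: "j \<in> J" "j' \<in> J" and eq: "\<Theta> j (F0 j) = \<Theta> j' (F0 j')"
   have F: "F0 j = F0 j'" using sol(2)[OF j(1)] sol(2)[OF j(2)] eq by simp
   note t = \<Theta>_facts[OF j(1) F0(1)[OF j(1)]] and t' = \<Theta>_facts[OF j(2) F0(1)[OF j(2)]]
   have J: "(fst j, snd j) \<in> J" "(fst j', snd j') \<in> J" using j by simp_all
   have zeq: "\<zeta> (fst j) (?w (F0 j)) = \<zeta> (fst j') (?w (F0 j))" using t(2) t'(2) eq F by simp
   have "fst j = fst j'"
    by (rule inj_onD[OF z_inj[OF wR[OF F0(1)[OF j(1)]]] zeq pJ[OF J(1)] pJ[OF J(2)]])
   moreover have "snd j = snd j'"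
   proof (rule PiE_ext)
    show "snd j \<in> ?I \<rightarrow>\<^sub>E {1, - 1}" "snd j' \<in> ?I \<rightarrow>\<^sub>E {1, - 1}" using j unfolding J_def by auto
    fix i assume i: "i \<in> ?I"
    have i': "i < 2 + k" using i by simp
    have "branch (snd j i) (c i * F0 j) = \<Theta> j (F0 j) i" by (rule t(3)[OF i, symmetric])
    also have "\<dots> = \<Theta> j' (F0 j') i" unfolding eq ..
    also have "\<dots> = branch (snd j' i) (c i * F0 j')" by (rule t'(3)[OF i])
    also have "\<dots> = branch (snd j' i) (c i * F0 j)" unfolding F ..
    finally show "snd j i = snd j' i" by (rule branch_inj[OF cR[OF F0(1)[OF j(1)] i']])
   qed
   ultimately show "j = j'" by (rule prod_eqI)
  qed
  have surj: "\<theta> \<in> (\<lambda>j. \<Theta> j (F0 j)) ` J" if th: "\<theta> \<in> ?S" for \<theta>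
  proof -
   define F where "F = laurent_sum ?B \<theta>"
   have t: "\<theta> \<in> torus (2 + k)" "dlog A (\<theta> 0, \<theta> 1) = ?w F" "\<And>i. i \<in> ?I \<Longrightarrow> \<theta> i - inverse (\<theta> i) = c i * F"
    using th unfolding log_solutions_iff[OF fA] F_def by blast+
   have z: "(\<theta> 0, \<theta> 1) \<in> torus2" using torus_nonzero[OF t(1)] by (simp add: torus2_def)
   have "\<forall>i\<in>?I. \<exists>s. s \<in> {1, - 1} & \<theta> i = branch s (c i * F)"
   proof (rule ballI)
    fix i assume i: "i \<in> ?I"
    have "\<theta> i ~= 0" by (rule torus_nonzero[OF t(1)]) (use i in simp)
    from branch_cases[OF this t(3)[OF i]] show "\<exists>s. s \<in> {1, - 1} & \<theta> i = branch s (c i * F)" by blast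
   qed
   from bchoice[OF this] obtain s0 where s0: "\<And>i. i \<in> ?I \<Longrightarrow> s0 i \<in> {1, - 1} & \<theta> i = branch (s0 i) (c i * F)" by blast
   define s where "s = restrict s0 ?I"
   have FR: "norm F \<le> R"
   proof -
    have 1: "norm (plane_sum A (\<theta> 0, \<theta> 1)) \<le> real (card A) * \<bar>K\<bar> * (1 + 2 * (\<eta> * norm F))"
     using t(2) cF[of 0 F] cF[of 1 F] by (intro plane_bound[OF z]) (auto simp: dlog_def)
    have 2: "norm (\<Sum>i\<in>?I. \<theta> i + inverse (\<theta> i)) \<le> real k * (2 + \<eta> * norm F)"
    proof (rule sums)
     fix i assume i: "i \<in> ?I"
     have "\<theta> i + inverse (\<theta> i) = s0 i * rho (c i * F)" using s0[OF i] branch_facts(3)[of "s0 i" "c i * F"] by auto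
     moreover have "norm (s0 i) = 1" using s0[OF i] by auto
     ultimately have "norm (\<theta> i + inverse (\<theta> i)) = norm (rho (c i * F))" by (simp add: norm_mult)
     then show "norm (\<theta> i + inverse (\<theta> i)) \<le> 2 + \<eta> * norm F" using norm_rho[of "c i * F"] cF[of i F] i by simp
    qed
    have Fe: "F = plane_sum A (\<theta> 0, \<theta> 1) + (\<Sum>i\<in>?I. \<theta> i + inverse (\<theta> i))"
     unfolding F_def by (rule bipyramid_laurent(1)[OF fA t(1)])
    have tot: "norm (plane_sum A (\<theta> 0, \<theta> 1) + (\<Sum>i\<in>?I. \<theta> i + inverse (\<theta> i))) \<le> C * (1 + \<eta> * norm F)"
     by (rule total[OF 1 2]) (use eta in simp)
    have "norm F \<le> C * (1 + \<eta> * norm F)" using tot unfolding Fe[symmetric] .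
    moreover have "C * \<eta> * norm F \<le> 1 / 2 * norm F" by (rule mult_right_mono[OF eta(3)]) simp
    ultimately show ?thesis unfolding R_def by (simp add: algebra_simps)
   qed
   obtain p where p: "p \<in> crit A" "(\<theta> 0, \<theta> 1) = \<zeta> p (?w F)" using z_im[OF wR[OF FR]] z t(2) by blast
   have j: "(p, s) \<in> J" unfolding J_def s_def using p s0 by auto
   have pe: "(\<Theta> (p, s) F 0, \<Theta> (p, s) F 1) = (\<theta> 0, \<theta> 1)"
    by (rule trans[OF \<Theta>_facts(2)[OF j FR, unfolded fst_conv] p(2)[symmetric]])
   have eq: "\<theta> = \<Theta> (p, s) F"
   proof (rule PiE_ext[OF t(1)[unfolded torus_def] \<Theta>_facts(1)[OF j FR, unfolded torus_def]])
    fix i assume "i \<in> {..<2 + k}"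
    then consider "i = 0" | "i = 1" | "i \<in> ?I" using below_cases[of i k] by blast
    then show "\<theta> i = \<Theta> (p, s) F i"
    proof cases
     case 3 then show ?thesis using \<Theta>_facts(3)[OF j FR 3] s0[OF 3] by (simp add: s_def)
    qed (use pe in simp_all)
   qed
   have e1: "laurent_sum ?B (\<Theta> (p, s) F) = laurent_sum ?B \<theta>" by (rule arg_cong[OF eq[symmetric]])
   have phi: "\<Phi> (p, s) F = F" by (rule trans[OF \<Theta>_facts(4)[OF j FR, symmetric] trans[OF e1 F_def[symmetric]]])
   have "F = F0 (p, s)" by (rule fix_unique[OF j FR F0(1)[OF j] phi F0(2)[OF j]])
   then have "\<Theta> (p, s) F = \<Theta> (p, s) (F0 (p, s))" by (rule arg_cong)
   then have "\<theta> = \<Theta> (p, s) (F0 (p, s))" by (rule trans[OF eq])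
   then show ?thesis by (rule image_eqI[OF _ j])
  qed
  have bij: "bij_betw (\<lambda>j. \<Theta> j (F0 j)) J ?S"
   unfolding bij_betw_def
  proof (rule conjI[OF inj], rule equalityI)
   show "(\<lambda>j. \<Theta> j (F0 j)) ` J \<subseteq> ?S" by (intro image_subsetI sol(1))
   show "?S \<subseteq> (\<lambda>j. \<Theta> j (F0 j)) ` J" by (rule subsetI) (rule surj)
  qed
  have fc: "finite (crit A)" "card (crit A) = b" using mo unfolding morse_def by blast+
  have fJ: "finite J" unfolding J_def by (intro finite_cartesian_product fc(1) finite_PiE) auto
  have c2: "card {1, - 1 :: complex} = 2" by simp
  have cJ: "card J = b * 2 ^ k"
   unfolding J_def card_cartesian_product fc(2) card_funcsetE[OF finite_atLeastLessThan] card_atLeastLessThan c2 by simp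
  show ?thesis using fJ cJ bij_betw_finite[OF bij] bij_betw_same_card[OF bij] by simp
 qed
 then show ?thesis using eta(1) by blast
qed

section \<open>The ML degree from the count in a neighbourhood\<close>

definition at_least :: "nat \<Rightarrow> 'a set \<Rightarrow> bool" where
 "at_least d X \<longleftrightarrow> (\<exists>f. inj_on f {..<d} & f ` {..<d} \<subseteq> X)"

lemma at_least_iff: "at_least d X \<longleftrightarrow> infinite X \<or> d \<le> card X"
proof
 assume "at_least d X"
 then obtain f where f: "inj_on f {..<d}" "f ` {..<d} \<subseteq> X" unfolding at_least_def by blast
 have "d \<le> card X" if "finite X" using card_inj_on_le[OF f that] by simp
 then show "infinite X \<or> d \<le> card X" by blast
next
 assume "infinite X \<or> d \<le> card X"
 then obtain T where T: "T \<subseteq> X" "finite T" "card T = d"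
  using infinite_arbitrarily_large[of X d] obtain_subset_with_card_n[of d X] by metis
 obtain h where "bij_betw h {0..<card T} T" using ex_bij_betw_nat_finite[OF T(2)] by blast
 then have "inj_on h {..<d}" "h ` {..<d} \<subseteq> X" using T by (auto simp: bij_betw_def atLeast0LessThan)
 then show "at_least d X" unfolding at_least_def by blast
qed

lemma at_least_exactly: "at_least N X & \<not> at_least (Suc N) X \<longleftrightarrow> finite X & card X = N"
 unfolding at_least_iff by auto

text \<open>Data and, for each of several solutions, its coordinates and their inverses.\<close>

type_synonym likelihood_var = "(nat \<Rightarrow>\<^sub>0 int) + nat \<times> nat"

text \<open>The inverses are variables of their own with index shifted by \<open>m\<close>, so that Laurent monomials become polynomials.\<close>

definition likelihood_monomial :: "nat \<Rightarrow> nat \<Rightarrow> (nat \<Rightarrow>\<^sub>0 int) \<Rightarrow> (likelihood_var \<Rightarrow> complex) \<Rightarrow> complex" where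
 "likelihood_monomial m s a v = (\<Prod>i<m. v (Inr (s, i)) ^ nat (lookup a i) * v (Inr (s, m + i)) ^ nat (- lookup a i))"

lemma polyfun_likelihood_monomial [polyfun_intros]: "polyfun (likelihood_monomial m s a)"
 unfolding likelihood_monomial_def by (intro polyfun_intros)

lemma likelihood_monomial_eq:
 assumes "a \<in> int_lattice m" "\<And>i. i < m \<Longrightarrow> v (Inr (s, i)) = \<theta> i" "\<And>i. i < m \<Longrightarrow> v (Inr (s, i)) * v (Inr (s, m + i)) = 1"
 shows "likelihood_monomial m s a v = laurent_monomial \<theta> a"
 unfolding laurent_monomial_eq[OF assms(1)] likelihood_monomial_def
proof (intro prod.cong refl)
 fix i assume "i \<in> {..<m}"
 then have i: "v (Inr (s, i)) = \<theta> i" "v (Inr (s, i)) * v (Inr (s, m + i)) = 1" using assms by auto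
 then have "v (Inr (s, m + i)) = inverse (\<theta> i)" by (metis inverse_unique)
 then show "v (Inr (s, i)) ^ nat (lookup a i) * v (Inr (s, m + i)) ^ nat (- lookup a i) = \<theta> i powi lookup a i"
  unfolding i(1) power_int_def by auto
qed

definition likelihood_system :: "nat \<Rightarrow> (nat \<Rightarrow>\<^sub>0 int) set \<Rightarrow> nat \<Rightarrow> (likelihood_var \<Rightarrow> complex) \<Rightarrow> bool" where
 "likelihood_system m A d v \<longleftrightarrow> (\<forall>s\<in>{..<d}. (\<forall>i\<in>{..<m}. v (Inr (s, i)) * v (Inr (s, m + i)) = 1) &
   (\<Sum>a\<in>A. likelihood_monomial m s a v) ~= 0 &
   (\<forall>i\<in>{..<m}. (\<Sum>a\<in>A. v (Inl a)) * (\<Sum>a\<in>A. of_int (lookup a i) * likelihood_monomial m s a v) =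
    (\<Sum>a\<in>A. of_int (lookup a i) * v (Inl a)) * (\<Sum>a\<in>A. likelihood_monomial m s a v))) &
   (\<forall>st\<in>{(s, t). s < d & t < d & s ~= t}. \<exists>i\<in>{..<m}. v (Inr (fst st, i)) ~= v (Inr (snd st, i)))"

lemma constr_neq: "polyfun p \<Longrightarrow> polyfun q \<Longrightarrow> constructible {v. p v ~= q v}"
 using constr_compl[OF constr_eq, of p q] by (simp add: Collect_neg_eq)

lemma constructible_likelihood_system: "constructible {v. likelihood_system m A d v}"
proof -
 have fin: "finite {(s, t). s < d & t < d & s ~= t}" by (rule finite_subset[of _ "{..<d} \<times> {..<d}"]) auto
 show ?thesis
  unfolding likelihood_system_def
  by (intro constr_Collect_conj constr_Collect_ball constr_Collect_bex constr_neq constr_eq polyfun_intros finite_lessThan fin)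
qed

lemma likelihood_system_iff:
 assumes A: "A \<subseteq> int_lattice m"
 shows "(\<exists>w\<in>{w. likelihood_system m A d w}. \<forall>j. j \<notin> Inr ` ({..<d} \<times> {..<2 * m}) \<longrightarrow> w j = v j)
  \<longleftrightarrow> at_least d (critical_likelihood m A (\<lambda>a. v (Inl a)))"
proof
 assume "\<exists>w\<in>{w. likelihood_system m A d w}. \<forall>j. j \<notin> Inr ` ({..<d} \<times> {..<2 * m}) \<longrightarrow> w j = v j"
 then obtain w where w: "likelihood_system m A d w" "\<And>j. j \<notin> Inr ` ({..<d} \<times> {..<2 * m}) \<Longrightarrow> w j = v j" by blast
 have wl: "w (Inl a) = v (Inl a)" for a by (rule w(2)) auto
 define f where "f = (\<lambda>s. \<lambda>i\<in>{..<m}. w (Inr (s, i)))"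
 note sys = w(1)[unfolded likelihood_system_def, THEN conjunct1, THEN bspec]
 have "f s \<in> critical_likelihood m A (\<lambda>a. v (Inl a))" if s: "s \<in> {..<d}" for s
 proof -
  note S = sys[OF s]
  have inv: "w (Inr (s, i)) * w (Inr (s, m + i)) = 1" if "i < m" for i using S that by blast
  have mon: "likelihood_monomial m s a w = laurent_monomial (f s) a" if "a \<in> A" for a
   by (rule likelihood_monomial_eq) (use that A inv in \<open>auto simp: f_def\<close>)
  have "f s \<in> torus m" unfolding torus_def f_def restrict_PiE_iff
  proof (rule ballI)
   fix i assume "i \<in> {..<m}"
   then have "w (Inr (s, i)) * w (Inr (s, m + i)) = 1" by (intro inv) simp
   then show "w (Inr (s, i)) \<in> UNIV - {0}" by auto
  qed
  moreover have "(\<Sum>a\<in>A. likelihood_monomial m s a w) = laurent_sum A (f s)"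
   unfolding laurent_sum_def by (intro sum.cong refl mon)
  moreover have "(\<Sum>a\<in>A. of_int (lookup a i) * likelihood_monomial m s a w) = log_deriv A i (f s)" for i
   unfolding log_deriv_def by (intro sum.cong refl) (simp add: mon)
  ultimately show ?thesis using S unfolding critical_likelihood_def wl by simp
 qed
 moreover have "inj_on f {..<d}"
 proof (rule inj_onI, rule ccontr)
  fix s t assume st: "s \<in> {..<d}" "t \<in> {..<d}" "f s = f t" "s ~= t"
  then obtain i where i: "i \<in> {..<m}" "w (Inr (s, i)) ~= w (Inr (t, i))"
   using w(1)[unfolded likelihood_system_def, THEN conjunct2, THEN bspec, of "(s, t)"] by auto
  have "f s i = f t i" using st(3) by simp
  then show False using i by (simp add: f_def)
 qed
 ultimately show "at_least d (critical_likelihood m A (\<lambda>a. v (Inl a)))" unfolding at_least_def by blast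
next
 assume "at_least d (critical_likelihood m A (\<lambda>a. v (Inl a)))"
 then obtain f where f: "inj_on f {..<d}" "f ` {..<d} \<subseteq> critical_likelihood m A (\<lambda>a. v (Inl a))" unfolding at_least_def by blast
 define w where "w = (\<lambda>j. case j of Inl a \<Rightarrow> v (Inl a) | Inr (s, i) \<Rightarrow> if s < d & i < m then f s i
  else if s < d & i < 2 * m then inverse (f s (i - m)) else v (Inr (s, i)))"
 have w1: "w (Inr (s, i)) = f s i" "w (Inr (s, m + i)) = inverse (f s i)" "w (Inl a) = v (Inl a)" if "s < d" "i < m" for s i a
  using that by (auto simp: w_def)
 have wl: "w (Inl a) = v (Inl a)" for a by (simp add: w_def)
 have S: "(\<forall>i\<in>{..<m}. w (Inr (s, i)) * w (Inr (s, m + i)) = 1) & (\<Sum>a\<in>A. likelihood_monomial m s a w) ~= 0 &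
   (\<forall>i\<in>{..<m}. (\<Sum>a\<in>A. w (Inl a)) * (\<Sum>a\<in>A. of_int (lookup a i) * likelihood_monomial m s a w) =
    (\<Sum>a\<in>A. of_int (lookup a i) * w (Inl a)) * (\<Sum>a\<in>A. likelihood_monomial m s a w))" if s: "s \<in> {..<d}" for s
 proof -
  have fs: "f s \<in> critical_likelihood m A (\<lambda>a. v (Inl a))" using f(2) s by blast
  then have ft: "f s \<in> torus m" by (simp add: critical_likelihood_def)
  have inv: "w (Inr (s, i)) * w (Inr (s, m + i)) = 1" if "i < m" for i
   using w1[of s i] torus_nonzero[OF ft that] s that by simp
  have mon: "likelihood_monomial m s a w = laurent_monomial (f s) a" if "a \<in> A" for a
   by (rule likelihood_monomial_eq) (use that A inv w1 s in auto)
  have 1: "(\<Sum>a\<in>A. likelihood_monomial m s a w) = laurent_sum A (f s)"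
   unfolding laurent_sum_def by (intro sum.cong refl mon)
  have 2: "(\<Sum>a\<in>A. of_int (lookup a i) * likelihood_monomial m s a w) = log_deriv A i (f s)" for i
   unfolding log_deriv_def by (intro sum.cong refl) (simp add: mon)
  show ?thesis unfolding 1 2 wl using fs inv by (simp add: critical_likelihood_def)
 qed
 have "\<exists>i\<in>{..<m}. w (Inr (fst st, i)) ~= w (Inr (snd st, i))" if "st \<in> {(s, t). s < d & t < d & s ~= t}" for st
 proof (rule ccontr)
  obtain s t where st: "st = (s, t)" "s < d" "t < d" "s ~= t" using \<open>st \<in> _\<close> by blast
  assume "\<not> (\<exists>i\<in>{..<m}. w (Inr (fst st, i)) ~= w (Inr (snd st, i)))"
  then have "f s i = f t i" if "i \<in> {..<m}" for i using w1(1)[OF st(2)] w1(1)[OF st(3)] that st(1) by auto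
  moreover have "f s \<in> torus m" "f t \<in> torus m" using f(2) st(2,3) by (auto simp: critical_likelihood_def)
  ultimately have "f s = f t" unfolding torus_def by (intro PiE_ext)
  then show False using f(1) st by (auto dest: inj_onD)
 qed
 then have "likelihood_system m A d w" unfolding likelihood_system_def using S by blast
 moreover have "w j = v j" if "j \<notin> Inr ` ({..<d} \<times> {..<2 * m})" for j
 proof (cases j)
  case (Inr si)
  obtain s i where "si = (s, i)" by (cases si)
  then have "\<not> (s < d & i < 2 * m)" using that Inr by auto
  then show ?thesis using Inr \<open>si = (s, i)\<close> by (auto simp: w_def)
 qed (simp add: w_def)
 ultimately show "\<exists>w\<in>{w. likelihood_system m A d w}. \<forall>j. j \<notin> Inr ` ({..<d} \<times> {..<2 * m}) \<longrightarrow> w j = v j" by blast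
qed

lemma constructible_at_least:
 assumes "A \<subseteq> int_lattice m"
 shows "constructible {v :: likelihood_var \<Rightarrow> complex. at_least d (critical_likelihood m A (\<lambda>a. v (Inl a)))}"
proof -
 have "finite (Inr ` ({..<d} \<times> {..<2 * m}) :: likelihood_var set)" by simp
 from constructible_projection_finite[OF constructible_likelihood_system this, of m A d]
 show ?thesis unfolding likelihood_system_iff[OF assms] .
qed

lemma polyfun_translate: "polyfun p \<Longrightarrow> polyfun (\<lambda>v. p (\<lambda>j. v j + c j))"
 by (induction rule: polyfun.induct) (auto intro: polyfun_intros)

text \<open>The polynomial from the theorem on constructible sets may involve variables other than the data. They
  are set to the values they have at one point where the polynomial does not vanish.\<close>

lemma generic_count:
 assumes A: "finite A" "A \<subseteq> int_lattice m" and eta: "0 < \<eta>"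
  and near: "\<And>u :: (nat \<Rightarrow>\<^sub>0 int) \<Rightarrow> complex. \<forall>a\<in>A. norm (u a - u0 a) < \<eta> \<Longrightarrow>
   (\<Sum>a\<in>A. u a) ~= 0 & finite (critical_likelihood m A u) & card (critical_likelihood m A u) = N"
 shows "\<exists>g\<in>polys A. g ~= 0 & (\<forall>u. poly_eval g u ~= 0 \<longrightarrow>
  (\<Sum>a\<in>A. u a) ~= 0 & finite (critical_likelihood m A u) & card (critical_likelihood m A u) = N)"
proof -
 define good where "good = (\<lambda>u. (\<Sum>a\<in>A. u a) ~= 0 & finite (critical_likelihood m A u) & card (critical_likelihood m A u) = N)"
 define S where "S = {v :: likelihood_var \<Rightarrow> complex. good (\<lambda>a. v (Inl a))}"
 have cl_cong: "critical_likelihood m A u = critical_likelihood m A u'" "(\<Sum>a\<in>A. u a) = (\<Sum>a\<in>A. u' a)" if "\<And>a. a \<in> A \<Longrightarrow> u a = u' a" for u u'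
 proof -
  show s: "(\<Sum>a\<in>A. u a) = (\<Sum>a\<in>A. u' a)" using that by (intro sum.cong) auto
  have "(\<Sum>a\<in>A. of_int (lookup a i) * u a) = (\<Sum>a\<in>A. of_int (lookup a i) * u' a)" for i
   using that by (intro sum.cong) auto
  then show "critical_likelihood m A u = critical_likelihood m A u'" unfolding critical_likelihood_def s by simp
 qed
 have Seq: "S = {v. (\<Sum>a\<in>A. v (Inl a)) ~= 0} \<inter> ({v. at_least N (critical_likelihood m A (\<lambda>a. v (Inl a)))}
   - {v. at_least (Suc N) (critical_likelihood m A (\<lambda>a. v (Inl a)))})"
  unfolding S_def good_def at_least_exactly[symmetric] by blast
 have cS: "constructible S"
  unfolding Seq by (intro constr_Int constr_Diff constr_neq constructible_at_least A(2) polyfun_intros)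
 have fin: "finite (Inl ` A :: likelihood_var set)" using A(1) by simp
 have box: "v \<in> S" if "\<forall>j\<in>Inl ` A. norm (v j - (case j of Inl a \<Rightarrow> u0 a | Inr _ \<Rightarrow> 0)) < \<eta>" for v
  unfolding S_def good_def using near[of "\<lambda>a. v (Inl a)"] that by simp
 obtain g where g: "polyfun g" "nonzeros g ~= {}" "nonzeros g \<subseteq> S"
  using constructible_box_generic[OF cS fin eta box] by blast
 obtain v1 where v1: "g v1 ~= 0" using g(2) unfolding nonzeros_def by blast
 define \<tau> where "\<tau> = (\<lambda>j :: likelihood_var. case j of Inl a \<Rightarrow> (if a \<in> A then Some a else None) | Inr _ \<Rightarrow> None)"
 define c where "c = (\<lambda>j. if \<tau> j = None then v1 j else 0)"
 have "\<exists>q\<in>polys A. \<forall>u. poly_eval q u = g (\<lambda>j. (case \<tau> j of Some a \<Rightarrow> u a | None \<Rightarrow> 0) + c j)"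
  by (rule polyfun_imp_polys[OF polyfun_translate[OF g(1), of c]]) (auto simp: \<tau>_def split: sum.splits if_splits)
 then obtain q where q0: "q \<in> polys A" "\<forall>u. poly_eval q u = g (\<lambda>j. (case \<tau> j of Some a \<Rightarrow> u a | None \<Rightarrow> 0) + c j)"
  by (elim bexE)
 note q = q0(1) q0(2)[THEN spec]
 have "(\<lambda>j. (case \<tau> j of Some a \<Rightarrow> v1 (Inl a) | None \<Rightarrow> 0) + c j) = v1"
  by (auto simp: fun_eq_iff c_def \<tau>_def split: sum.splits if_splits)
 then have q1: "poly_eval q (\<lambda>a. v1 (Inl a)) ~= 0" unfolding q(2) using v1 by simp
 show ?thesis
 proof (rule bexI[OF _ q(1)], rule conjI, goal_cases)
  case 1 show "q ~= 0" using q1 by (auto simp: poly_eval_def)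
 next
  case 2 show ?case
  proof (intro allI impI)
  fix u assume "poly_eval q u ~= 0"
  then have "(\<lambda>j. (case \<tau> j of Some a \<Rightarrow> u a | None \<Rightarrow> 0) + c j) \<in> S" using g(3) unfolding q(2) nonzeros_def by blast
  then have "good (\<lambda>a. (case \<tau> (Inl a) of Some a \<Rightarrow> u a | None \<Rightarrow> 0) + c (Inl a))" unfolding S_def by simp
  moreover have "(case \<tau> (Inl a) of Some a \<Rightarrow> u a | None \<Rightarrow> 0) + c (Inl a) = u a" if "a \<in> A" for a
   using that by (simp add: \<tau>_def c_def)
  ultimately show "(\<Sum>a\<in>A. u a) ~= 0 & finite (critical_likelihood m A u) & card (critical_likelihood m A u) = N"
   unfolding good_def using cl_cong[of "\<lambda>a. (case \<tau> (Inl a) of Some a \<Rightarrow> u a | None \<Rightarrow> 0) + c (Inl a)" u] by simp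
  qed
 qed
qed

lemma ml_degree_eqI:
 assumes A: "finite A" "A \<subseteq> int_lattice m" "0 \<in> A" and gen: "\<And>i. i < m \<Longrightarrow> \<exists>t. single i 1 \<in> sumset t A"
  and eta: "0 < \<eta>" and near: "\<And>u :: (nat \<Rightarrow>\<^sub>0 int) \<Rightarrow> complex. \<forall>a\<in>A. norm (u a - u0 a) < \<eta> \<Longrightarrow>
   (\<Sum>a\<in>A. u a) ~= 0 & finite (critical_likelihood m A u) & card (critical_likelihood m A u) = N"
 shows "ml_degree m A = N"
proof -
 have "\<exists>g\<in>polys A. g ~= 0 & (\<forall>u. poly_eval g u ~= 0 \<longrightarrow>
  (\<Sum>a\<in>A. u a) ~= 0 & finite (critical_likelihood m A u) & card (critical_likelihood m A u) = N)"
  by (rule generic_count[OF A(1,2) eta]) (rule near)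
 then obtain g where g0: "g \<in> polys A" "g ~= 0" "\<forall>u. poly_eval g u ~= 0 \<longrightarrow>
  (\<Sum>a\<in>A. u a) ~= 0 & finite (critical_likelihood m A u) & card (critical_likelihood m A u) = N"
  by (elim bexE conjE)
 note g = g0(1,2) g0(3)[THEN spec, THEN mp]
 have score: "finite (score_solutions m A u) & card (score_solutions m A u) = N"
  if u: "poly_eval g (\<lambda>a. of_nat (u a)) ~= 0" for u :: "(nat \<Rightarrow>\<^sub>0 int) \<Rightarrow> nat"
 proof -
  note G = g(3)[OF u]
  have u0: "(\<Sum>a\<in>A. u a) ~= 0"
  proof
   assume z: "(\<Sum>a\<in>A. u a) = 0"
   have "(\<Sum>a\<in>A. of_nat (u a) :: complex) = of_nat (\<Sum>a\<in>A. u a)" by (rule of_nat_sum[symmetric])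
   also have "\<dots> = 0" unfolding z by (rule of_nat_0)
   finally show False using conjunct1[OF G] by blast
  qed
  have bij: "bij_betw (\<lambda>\<theta>. \<lambda>a\<in>A. 1 / laurent_sum A \<theta> * laurent_monomial \<theta> a)
   (critical_likelihood m A (\<lambda>a. of_nat (u a))) (score_solutions m A u)"
   by (rule critical_likelihood_score[OF A(2,3,1) _ u0]) (rule gen)
  show ?thesis using conjunct2[OF G] bij_betw_finite[OF bij] bij_betw_same_card[OF bij] by simp
 qed
 have unique: "d = N" if h: "h \<in> polys A" "h ~= 0"
  "\<forall>u. poly_eval h (\<lambda>a. of_nat (u a)) ~= 0 \<longrightarrow> finite (score_solutions m A u) & card (score_solutions m A u) = d" for h d
 proof -
  obtain u :: "(nat \<Rightarrow>\<^sub>0 int) \<Rightarrow> nat" where "poly_eval g (\<lambda>a. of_nat (u a)) ~= 0" "poly_eval h (\<lambda>a. of_nat (u a)) ~= 0"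
   using polys_common_nonzero_nat[OF A(1) g(1) h(1) g(2) h(2)] by blast
  then show ?thesis using score[of u] h(3) by auto
 qed
 show ?thesis
  unfolding ml_degree_def
 proof (rule the_equality)
  show "\<exists>g\<in>polys A. g ~= 0 & (\<forall>u. poly_eval g (\<lambda>a. of_nat (u a)) ~= 0 \<longrightarrow>
    finite (score_solutions m A u) & card (score_solutions m A u) = N)"
   by (rule bexI[OF _ g(1)]) (intro conjI allI impI g(2) conjunct1[OF score] conjunct2[OF score])
  fix d assume "\<exists>g\<in>polys A. g ~= 0 & (\<forall>u. poly_eval g (\<lambda>a. of_nat (u a)) ~= 0 \<longrightarrow>
    finite (score_solutions m A u) & card (score_solutions m A u) = d)"
  then obtain h where h: "h \<in> polys A" "h ~= 0" "\<forall>u. poly_eval h (\<lambda>a. of_nat (u a)) ~= 0 \<longrightarrow>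
    finite (score_solutions m A u) & card (score_solutions m A u) = d" by (elim bexE conjE)
  show "d = N" by (rule unique[OF h])
 qed
qed

definition singular_points :: "nat \<Rightarrow> (nat \<Rightarrow>\<^sub>0 int) set \<Rightarrow> (nat \<Rightarrow> complex) set" where
 "singular_points m A = {\<theta> \<in> torus m. laurent_sum A \<theta> = 0 & (\<forall>i<m. log_deriv A i \<theta> = 0)}"

text \<open>The equations are divided by the sum of the data. What is removed does not depend on the data.\<close>

lemma critical_likelihood_as_log_solutions:
 assumes "(\<Sum>a\<in>A. u a) ~= (0 :: complex)"
 shows "critical_likelihood m A u =
  log_solutions m A (\<lambda>i. (\<Sum>a\<in>A. of_int (lookup a i) * u a) / (\<Sum>a\<in>A. u a)) - singular_points m A"
proof -
 have e: "(\<Sum>a\<in>A. u a) * x = y * z \<longleftrightarrow> x = y / (\<Sum>a\<in>A. u a) * z" for x y z :: complex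
  using assms by (simp add: field_simps)
 show ?thesis unfolding critical_likelihood_def log_solutions_def singular_points_def e by auto
qed

text \<open>For data near the indicator of the origin, the vector \<open>c\<close> is small because the exponent vector of the constant term is zero.\<close>

lemma count_near_origin:
 assumes A: "finite A" "0 \<in> A" and eta: "0 < \<eta>"
  and counts: "\<forall>c. (\<forall>i<m. norm (c i) < \<eta>) \<longrightarrow> finite (log_solutions m A c) & card (log_solutions m A c) = N"
 shows "finite (singular_points m A)" "card (singular_points m A) \<le> N"
  "\<exists>\<epsilon>>0. \<forall>u :: (nat \<Rightarrow>\<^sub>0 int) \<Rightarrow> complex. (\<forall>a\<in>A. norm (u a - (if a = 0 then 1 else 0)) < \<epsilon>) \<longrightarrow>
   (\<Sum>a\<in>A. u a) ~= 0 & finite (critical_likelihood m A u) & card (critical_likelihood m A u) = N - card (singular_points m A)"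
proof -
 note count = counts[THEN spec, THEN mp]
 have sub: "singular_points m A \<subseteq> log_solutions m A c" for c
  unfolding singular_points_def log_solutions_def by auto
 have c0: "finite (log_solutions m A (\<lambda>_. 0)) & card (log_solutions m A (\<lambda>_. 0)) = N" by (rule count) (use eta in simp)
 show fin: "finite (singular_points m A)" using c0 sub finite_subset by metis
 show "card (singular_points m A) \<le> N" using c0 sub card_mono by metis
 define W where "W = (\<Sum>a\<in>A. \<Sum>i<m. \<bar>of_int (lookup a i)\<bar> :: real)"
 have W: "0 \<le> W" unfolding W_def by (intro sum_nonneg) auto
 define \<epsilon> where "\<epsilon> = min (1 / (2 * (real (card A) + 1))) (\<eta> / (2 * (W + 1)))"
 have eps: "0 < \<epsilon>" "real (card A) * \<epsilon> \<le> 1 / 2" "2 * W * \<epsilon> < \<eta>"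
 proof -
  show e0: "0 < \<epsilon>" unfolding \<epsilon>_def using eta W by simp
  have "\<epsilon> \<le> 1 / (2 * (real (card A) + 1))" "\<epsilon> \<le> \<eta> / (2 * (W + 1))" unfolding \<epsilon>_def by auto
  then have "\<epsilon> * (2 * (real (card A) + 1)) \<le> 1" "\<epsilon> * (2 * (W + 1)) \<le> \<eta>" using W by (simp_all add: pos_le_divide_eq)
  then show "real (card A) * \<epsilon> \<le> 1 / 2" "2 * W * \<epsilon> < \<eta>" using e0 by (simp_all add: algebra_simps)
 qed
 have "(\<Sum>a\<in>A. u a) ~= 0 & finite (critical_likelihood m A u) & card (critical_likelihood m A u) = N - card (singular_points m A)"
  if u: "\<forall>a\<in>A. norm (u a - (if a = 0 then 1 else 0)) < \<epsilon>" for u :: "(nat \<Rightarrow>\<^sub>0 int) \<Rightarrow> complex"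
 proof -
  let ?s = "\<Sum>a\<in>A. u a"
  have "(\<Sum>a\<in>A. u a - (if a = 0 then 1 else 0)) = ?s - 1" using A by (simp add: sum_subtractf)
  then have "norm (?s - 1) \<le> (\<Sum>a\<in>A. \<epsilon>)"
   using sum_norm_le[of A "\<lambda>a. u a - (if a = 0 then 1 else 0)" "\<lambda>_. \<epsilon>"] u by (simp add: less_imp_le)
  then have "norm (1 - ?s) \<le> 1 / 2" using eps(2) by (simp add: norm_minus_commute)
  then have s: "1 / 2 \<le> norm ?s" using norm_triangle_sub[of "1 :: complex" ?s] by simp
  then have s0: "?s ~= 0" by auto
  have "norm ((\<Sum>a\<in>A. of_int (lookup a i) * u a) / ?s) < \<eta>" if i: "i < m" for i
  proof -
   have "norm (\<Sum>a\<in>A. of_int (lookup a i) * u a) \<le> (\<Sum>a\<in>A. (\<Sum>i<m. \<bar>of_int (lookup a i)\<bar>) * \<epsilon>)"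
   proof (rule sum_norm_le)
    fix a assume a: "a \<in> A"
    have "norm (of_int (lookup a i) * u a) = norm (of_int (lookup a i) * (u a - (if a = 0 then 1 else 0)))"
     by simp
    also have "\<dots> = \<bar>of_int (lookup a i)\<bar> * norm (u a - (if a = 0 then 1 else 0))" by (simp only: norm_mult norm_of_int)
    also have "\<dots> \<le> (\<Sum>i<m. \<bar>of_int (lookup a i)\<bar>) * \<epsilon>"
    proof (rule mult_mono)
     show "\<bar>real_of_int (lookup a i)\<bar> \<le> (\<Sum>i<m. \<bar>of_int (lookup a i)\<bar>)"
      by (rule member_le_sum) (use i in auto)
     show "norm (u a - (if a = 0 then 1 else 0)) \<le> \<epsilon>" using u a by (auto intro: less_imp_le)
    qed (auto intro: sum_nonneg)
    finally show "norm (of_int (lookup a i) * u a) \<le> (\<Sum>i<m. \<bar>of_int (lookup a i)\<bar>) * \<epsilon>" .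
   qed
   also have "\<dots> = W * \<epsilon>" unfolding W_def by (simp add: sum_distrib_right)
   finally have n: "norm (\<Sum>a\<in>A. of_int (lookup a i) * u a) \<le> W * \<epsilon>" .
   have "norm ((\<Sum>a\<in>A. of_int (lookup a i) * u a) / ?s) \<le> W * \<epsilon> / (1 / 2)"
    unfolding norm_divide using n s eps(1) W by (intro frac_le) auto
   then show ?thesis using eps(3) by simp
  qed
  then have "finite (log_solutions m A (\<lambda>i. (\<Sum>a\<in>A. of_int (lookup a i) * u a) / ?s)) &
   card (log_solutions m A (\<lambda>i. (\<Sum>a\<in>A. of_int (lookup a i) * u a) / ?s)) = N" by (intro count) blast
  then show ?thesis unfolding critical_likelihood_as_log_solutions[OF s0] using s0 card_Diff_subset[OF fin sub] by simp
 qed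
 then show "\<exists>\<epsilon>>0. \<forall>u :: (nat \<Rightarrow>\<^sub>0 int) \<Rightarrow> complex. (\<forall>a\<in>A. norm (u a - (if a = 0 then 1 else 0)) < \<epsilon>) \<longrightarrow>
   (\<Sum>a\<in>A. u a) ~= 0 & finite (critical_likelihood m A u) & card (critical_likelihood m A u) = N - card (singular_points m A)"
  using eps(1) by blast
qed

section \<open>Degree and conclusion\<close>

lemma sumset_embed2: "sumset t (embed2 ` A) = embed2 ` sumset t A"
proof (induction t)
 case (Suc t)
 show ?case
 proof (intro equalityI subsetI)
  fix x assume "x \<in> sumset (Suc t) (embed2 ` A)"
  then obtain a b where ab: "x = embed2 a + embed2 b" "a \<in> A" "b \<in> sumset t A" using Suc by auto
  show "x \<in> embed2 ` sumset (Suc t) A"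
   unfolding ab(1) embed2_add[symmetric] by (rule imageI) (rule sumset_SucI[OF ab(2,3)])
 next
  fix x assume "x \<in> embed2 ` sumset (Suc t) A"
  then obtain a b where ab: "x = embed2 (a + b)" "a \<in> A" "b \<in> sumset t A" unfolding sumset.simps by blast
  have "embed2 b \<in> sumset t (embed2 ` A)" unfolding Suc by (rule imageI[OF ab(3)])
  then show "x \<in> sumset (Suc t) (embed2 ` A)" unfolding ab(1) embed2_add by (rule sumset_SucI[OF imageI[OF ab(2)]])
 qed
qed (simp add: embed2_0)

lemma hilbert_poly_embed2:
 assumes "\<And>t. 2 * card (sumset t A) = 2 + b * (t * (t + 1))" "0 < b"
 shows "hilbert_poly (embed2 ` A) 2 b"
proof -
 let ?H = "[:1, of_nat b / 2, of_nat b / 2:] :: rat poly"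
 have "poly ?H (of_nat t) = of_nat (card (sumset t (embed2 ` A)))" for t
 proof -
  have "card (sumset t (embed2 ` A)) = card (sumset t A)"
   unfolding sumset_embed2 by (rule card_image[OF inj_on_subset[OF inj_embed2 subset_UNIV]])
  moreover have "2 * (of_nat (card (sumset t A)) :: rat) = 2 + of_nat b * (of_nat t * (of_nat t + 1))"
   using arg_cong[OF assms(1)[of t], of "of_nat :: nat \<Rightarrow> rat"] by (simp add: algebra_simps)
  ultimately show ?thesis by (simp add: field_simps)
 qed
 moreover have "degree ?H = 2" "fact 2 * lead_coeff ?H = of_nat b" "?H ~= 0" using assms(2) by simp_all
 ultimately show ?thesis unfolding hilbert_poly_def by blast
qed

lemma bipyramid_points_Suc:
 "bipyramid_points (Suc k) A = bipyramid_points k A \<union> {single (2 + k) 1, single (2 + k) (- 1)}"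
 by (simp only: bipyramid_points_def cross_axes_simps Un_assoc)

lemma zero_bipyramid_points: "0 \<in> A \<Longrightarrow> 0 \<in> bipyramid_points k A"
 unfolding bipyramid_points_def using embed2_0(1) by (metis UnI1 imageI)

lemma hilbert_poly_bipyramid_points:
 assumes A: "tame A b"
 shows "hilbert_poly (bipyramid_points k A) (2 + k) (b * 2 ^ k)"
proof -
 have h: "finite A" "0 \<in> A" "\<And>t. 2 * card (sumset t A) = 2 + b * (t * (t + 1))" "0 < b" using A unfolding tame_def by blast+
 show ?thesis
 proof (induction k)
  case 0
  show ?case using hilbert_poly_embed2[OF h(3,4)] by (simp add: bipyramid_points_def cross_axes_simps)
 next
  case (Suc k)
  have "hilbert_poly (bipyramid_points k A \<union> {single (2 + k) 1, single (2 + k) (- 1)}) (Suc (2 + k)) (2 * (b * 2 ^ k))"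
   by (rule hilbert_poly_bipyramid[OF zero_bipyramid_points[OF h(2)] bipyramid_points_lattice finite_bipyramid_points[OF h(1)] Suc])
    (use h(4) in simp)
  then show ?case unfolding bipyramid_points_Suc by (simp add: mult_ac)
 qed
qed

lemma bipyramid_points_generate:
 assumes A: "tame A b" and i: "i < 2 + k"
 shows "\<exists>t. single i 1 \<in> sumset t (bipyramid_points k A)"
proof (cases "i < 2")
 case True
 have gen: "\<forall>v. \<exists>t. v \<in> sumset t A" using A unfolding tame_def by blast
 have "single i 1 = embed2 (if i = 0 then (1, 0) else (0, 1))"
 proof (cases "i = 0")
  case False
  then have "i = 1" using True by simp
  then show ?thesis by (simp add: embed2_def)
 qed (simp add: embed2_def)
 moreover obtain t where "(if i = 0 then (1, 0) else (0, 1)) \<in> sumset t A" using gen by blast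
 ultimately have "single i 1 \<in> sumset t (embed2 ` A)" unfolding sumset_embed2 by simp
 then show ?thesis using sumset_mono_set[of "embed2 ` A" "bipyramid_points k A" t] by (auto simp: bipyramid_points_def)
next
 case False
 then have "single i 1 \<in> bipyramid_points k A" using i by (auto simp: bipyramid_points_def cross_axes_def)
 then show ?thesis using sumset_1 by metis
qed

theorem theorem7p8:
  fixes P :: "(nat \<Rightarrow>\<^sub>0 real) set" and k :: nat
  assumes "reflexive_polytope 2 P"
  defines "Q \<equiv> iter_bipyramid 2 k P"
  defines "f \<equiv> lattice_laurent (2 + k) Q"
  shows "finite (singularities (2 + k) f) \<and>
         ml_drop (2 + k) Q = int (card (singularities (2 + k) f))"
proof -
 let ?A = "polygon_points P" and ?m = "2 + k"
 define B where "B = bipyramid_points k ?A"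
 obtain b where b: "tame ?A b" using fano_tame[OF fano_polygon_points[OF assms(1)]] by blast
 have A: "finite ?A" "0 \<in> ?A" using b unfolding tame_def by blast+
 have B: "finite B" "B \<subseteq> int_lattice ?m" "0 \<in> B"
  unfolding B_def by (rule finite_bipyramid_points[OF A(1)], rule bipyramid_points_lattice, rule zero_bipyramid_points[OF A(2)])
 have LB: "lattice_points ?m Q = B"
  unfolding Q_def B_def bipyramid_points_def lattice_points_2[symmetric]
  by (rule lattice_points_iter_bipyramid[OF reflexive_polygon_facts[OF assms(1)]])
 have sing: "singularities ?m f = singular_points ?m B"
  unfolding f_def lattice_laurent_def LB singular_points_def by (rule singularities_indicator[OF B(1,2)])
 obtain \<eta> where eta: "0 < \<eta>" "\<forall>c. (\<forall>i<?m. norm (c i) < \<eta>) \<longrightarrow>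
  finite (log_solutions ?m B c) & card (log_solutions ?m B c) = b * 2 ^ k"
  using card_log_solutions[OF b, of k] unfolding B_def by (elim exE conjE)
 note near = count_near_origin[OF B(1,3) eta]
 obtain \<epsilon> where e: "0 < \<epsilon>" "\<forall>u :: (nat \<Rightarrow>\<^sub>0 int) \<Rightarrow> complex. (\<forall>a\<in>B. norm (u a - (if a = 0 then 1 else 0)) < \<epsilon>) \<longrightarrow>
   (\<Sum>a\<in>B. u a) ~= 0 & finite (critical_likelihood ?m B u) & card (critical_likelihood ?m B u) = b * 2 ^ k - card (singular_points ?m B)"
  using near(3) by (elim exE conjE)
 have ml: "ml_degree ?m B = b * 2 ^ k - card (singular_points ?m B)"
 proof (rule ml_degree_eqI[where ?u0.0 = "\<lambda>a. if a = 0 then 1 else 0", OF B _ e(1)])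
  show "\<exists>t. single i 1 \<in> sumset t B" if "i < ?m" for i
   unfolding B_def by (rule bipyramid_points_generate[OF b that])
  show "(\<Sum>a\<in>B. u a) ~= 0 & finite (critical_likelihood ?m B u) & card (critical_likelihood ?m B u) = b * 2 ^ k - card (singular_points ?m B)"
   if "\<forall>a\<in>B. norm (u a - (if a = 0 then 1 else 0)) < \<epsilon>" for u :: "(nat \<Rightarrow>\<^sub>0 int) \<Rightarrow> complex"
   by (rule e(2)[THEN spec, THEN mp, OF that])
 qed
 have deg: "cone_degree B (toric_variety ?m B) = b * 2 ^ k"
  by (rule cone_degree_toric[OF B(2,1)]) (unfold B_def, rule hilbert_poly_bipyramid_points[OF b])
 have "int (b * 2 ^ k) - int (b * 2 ^ k - card (singular_points ?m B)) = int (card (singular_points ?m B))"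
  unfolding of_nat_diff[OF near(2)] by simp
 then show ?thesis
  unfolding sing ml_drop_def Let_def LB ml deg using near(1) by blast
qed

end
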